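(* Let $F$ be a field, let $A$ be a homogeneous semiassociative $F$-algebra, and let $D$ be the associative $F$-central division algebra which is the common underlying division algebra of the atoms of $A$. Then there is a decomposition $A\cong D\otimes_F A'$ where $A'$ is a skew matrix algebra over $F$.
   Context: Algebras are unital and not necessarily associative. The associator is $(x,y,z)=(xy)z-x(yz)$; the nucleus $\mathfrak{N}(A)$ is the set of $x\in A$ with $(x,A,A)=(A,x,A)=(A,A,x)=0$, an associative subalgebra; the center is $Z(A)=\{x\in\mathfrak{N}(A):xa=ax\text{ for all }a\in A\}$; $A$ is $F$-central if $Z(A)=F$. An étale $F$-algebra is a finite direct product of finite separable field extensions of $F$. A module over an associative ring is minimally faithful if it is faithful and has no faithful proper section (quotient of submodules). A finite dimensional $F$-central algebra $A$ is semiassociative if there is an étale $F$-subalgebra $K\subseteq\mathfrak{N}(A)$ (containing $1_A$) such that $A$ is minimally faithful (equivalently, faithful and cyclic) as a $K\otimes_F K$-module via $(k\otimes k')a=kak'$. For a semiassociative algebra $A$, let $\sigma(A)=\mathfrak{N}(A)/\mathrm{J}(\mathfrak{N}(A))$, where $\mathrm{J}$ is the Jacobson radical. The simple components of the semisimple algebra $\sigma(A)$ are the atoms of $A$. $A$ is homogeneous if all of its atoms have center $F$ and all the atoms are Brauer equivalent to each other over $F$ (so they are matrix algebras over one and the same $F$-central division algebra $D$). A reduced skew set of degree $n$ over $F$ is a family $c=(c_{ijk})_{1\le i,j,k\le n}$ of scalars in $F$ (zeros allowed) with $c_{iij}=c_{ijj}=1$ for all $i,j$. The skew matrix algebra $M_n(F;c)$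 is the $F$-algebra with basis $\{e_{ij}\}_{1\le i,j\le n}$ and multiplication $e_{ij}e_{k\ell}=\delta_{jk}c_{ij\ell}e_{i\ell}$. *)

theory Defs
  imports "HOL-Algebra.Algebra"
begin

text \<open>
  Algebras over a field \<open>F\<close> are \<^type>\<open>module\<close> records, so that they carry a multiplication, a unit
  and a scalar multiplication. No associativity of the multiplication is assumed, hence the
  library's \<^locale>\<open>ring\<close> locale applies only where associativity is known.
\<close>

locale unital_algebra = module F A for F (structure) and A (structure) +
  assumes field_F: "field F"
    and mult_closed: "\<lbrakk>x \<in> carrier A; y \<in> carrier A\<rbrakk> \<Longrightarrow> x \<otimes>\<^bsub>A\<^esub> y \<in> carrier A"
    and unit_closed: "\<one>\<^bsub>A\<^esub> \<in> carrier A"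
    and l_unit: "x \<in> carrier A \<Longrightarrow> \<one>\<^bsub>A\<^esub> \<otimes>\<^bsub>A\<^esub> x = x"
    and r_unit: "x \<in> carrier A \<Longrightarrow> x \<otimes>\<^bsub>A\<^esub> \<one>\<^bsub>A\<^esub> = x"
    and mult_l_distr: "\<lbrakk>x \<in> carrier A; y \<in> carrier A; z \<in> carrier A\<rbrakk> \<Longrightarrow>
      (x \<oplus>\<^bsub>A\<^esub> y) \<otimes>\<^bsub>A\<^esub> z = x \<otimes>\<^bsub>A\<^esub> z \<oplus>\<^bsub>A\<^esub> y \<otimes>\<^bsub>A\<^esub> z"
    and mult_r_distr: "\<lbrakk>x \<in> carrier A; y \<in> carrier A; z \<in> carrier A\<rbrakk> \<Longrightarrow>
      z \<otimes>\<^bsub>A\<^esub> (x \<oplus>\<^bsub>A\<^esub> y) = z \<otimes>\<^bsub>A\<^esub> x \<oplus>\<^bsub>A\<^esub> z \<otimes>\<^bsub>A\<^esub> y"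
    and smult_mult_l: "\<lbrakk>c \<in> carrier F; x \<in> carrier A; y \<in> carrier A\<rbrakk> \<Longrightarrow>
      (c \<odot>\<^bsub>A\<^esub> x) \<otimes>\<^bsub>A\<^esub> y = c \<odot>\<^bsub>A\<^esub> (x \<otimes>\<^bsub>A\<^esub> y)"
    and smult_mult_r: "\<lbrakk>c \<in> carrier F; x \<in> carrier A; y \<in> carrier A\<rbrakk> \<Longrightarrow>
      x \<otimes>\<^bsub>A\<^esub> (c \<odot>\<^bsub>A\<^esub> y) = c \<odot>\<^bsub>A\<^esub> (x \<otimes>\<^bsub>A\<^esub> y)"

definition alg_isomorphic ::
  "('f, 'x) ring_scheme \<Rightarrow> ('f, 'a) module \<Rightarrow> ('f, 'b) module \<Rightarrow> bool" where
  "alg_isomorphic F A B \<longleftrightarrow>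
     (\<exists>h \<in> ring_iso A B. \<forall>c \<in> carrier F. \<forall>x \<in> carrier A. h (c \<odot>\<^bsub>A\<^esub> x) = c \<odot>\<^bsub>B\<^esub> h x)"

definition lin_span :: "('r, 'x) ring_scheme \<Rightarrow> ('r, 'm) module \<Rightarrow> 'm set \<Rightarrow> 'm set" where
  "lin_span R M S = \<Inter>{H. submodule H R M \<and> S \<subseteq> H}"

definition fin_dim :: "('f, 'x) ring_scheme \<Rightarrow> ('f, 'a) module \<Rightarrow> bool" where
  "fin_dim F A \<longleftrightarrow> (\<exists>S. finite S \<and> S \<subseteq> carrier A \<and> lin_span F A S = carrier A)"

text \<open>
  Quotient by a submodule; the multiplication is meaningful only if \<open>I\<close> is a two-sided ideal.
\<close>

definition quot :: "('r, 'm) module \<Rightarrow> 'm set \<Rightarrow> ('r, 'm set) module" where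
  "quot M I =
     \<lparr>carrier = a_rcosets\<^bsub>M\<^esub> I, monoid.mult = rcoset_mult M I, one = I +>\<^bsub>M\<^esub> \<one>\<^bsub>M\<^esub>,
      ring.zero = I, add = set_add M, smult = (\<lambda>r T. \<Union>x\<in>T. I +>\<^bsub>M\<^esub> (r \<odot>\<^bsub>M\<^esub> x))\<rparr>"


section \<open>Nucleus and center\<close>

definition associator :: "('f, 'a) module \<Rightarrow> 'a \<Rightarrow> 'a \<Rightarrow> 'a \<Rightarrow> 'a" where
  "associator A x y z = ((x \<otimes>\<^bsub>A\<^esub> y) \<otimes>\<^bsub>A\<^esub> z) \<ominus>\<^bsub>A\<^esub> (x \<otimes>\<^bsub>A\<^esub> (y \<otimes>\<^bsub>A\<^esub> z))"

definition nucleus :: "('f, 'a) module \<Rightarrow> 'a set" where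
  "nucleus A = {x \<in> carrier A. \<forall>a \<in> carrier A. \<forall>b \<in> carrier A.
     associator A x a b = \<zero>\<^bsub>A\<^esub> \<and> associator A a x b = \<zero>\<^bsub>A\<^esub> \<and> associator A a b x = \<zero>\<^bsub>A\<^esub>}"

definition alg_center :: "('f, 'a) module \<Rightarrow> 'a set" where
  "alg_center A = {x \<in> nucleus A. \<forall>a \<in> carrier A. x \<otimes>\<^bsub>A\<^esub> a = a \<otimes>\<^bsub>A\<^esub> x}"

text \<open>The condition \<open>1 \<noteq> 0\<close> makes \<open>c \<mapsto> c 1\<close> an embedding of \<open>F\<close> into the center.\<close>

definition central :: "('f, 'x) ring_scheme \<Rightarrow> ('f, 'a) module \<Rightarrow> bool" where
  "central F A \<longleftrightarrow> \<one>\<^bsub>A\<^esub> \<noteq> \<zero>\<^bsub>A\<^esub> \<and> alg_center A = (\<lambda>c. c \<odot>\<^bsub>A\<^esub> \<one>\<^bsub>A\<^esub>) ` carrier F"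

definition subalg :: "('f, 'x) ring_scheme \<Rightarrow> ('f, 'a) module \<Rightarrow> 'a set \<Rightarrow> bool" where
  "subalg F A K \<longleftrightarrow> submodule K F A \<and> \<one>\<^bsub>A\<^esub> \<in> K \<and> (\<forall>x \<in> K. \<forall>y \<in> K. x \<otimes>\<^bsub>A\<^esub> y \<in> K)"


section \<open>Etale algebras\<close>

definition poly_deriv :: "('f, 'x) ring_scheme \<Rightarrow> (nat \<Rightarrow> 'f) \<Rightarrow> nat \<Rightarrow> 'f" where
  "poly_deriv F p = (\<lambda>i. [Suc i] \<cdot>\<^bsub>F\<^esub> coeff (UP F) p (Suc i))"

definition separable_poly :: "('f, 'x) ring_scheme \<Rightarrow> (nat \<Rightarrow> 'f) \<Rightarrow> bool" where
  "separable_poly F p \<longleftrightarrow> (\<exists>u \<in> carrier (UP F). \<exists>v \<in> carrier (UP F).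
     u \<otimes>\<^bsub>UP F\<^esub> p \<oplus>\<^bsub>UP F\<^esub> v \<otimes>\<^bsub>UP F\<^esub> poly_deriv F p = \<one>\<^bsub>UP F\<^esub>)"

text \<open>
  The irreducible polynomial below is, up to a scalar, the minimal polynomial of \<open>x\<close>.
\<close>

definition finite_separable_extension ::
  "('f, 'x) ring_scheme \<Rightarrow> ('f, 'a) module \<Rightarrow> bool" where
  "finite_separable_extension F L \<longleftrightarrow> unital_algebra F L \<and> field L \<and> fin_dim F L \<and>
     (\<forall>x \<in> carrier L. \<exists>p \<in> carrier (UP F). ring_irreducible\<^bsub>UP F\<^esub> p \<and> separable_poly F p \<and>
        UnivPoly.eval F L (\<lambda>c. c \<odot>\<^bsub>L\<^esub> \<one>\<^bsub>L\<^esub>) x p = \<zero>\<^bsub>L\<^esub>)"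

definition prod_alg :: "nat \<Rightarrow> (nat \<Rightarrow> ('f, 'a) module) \<Rightarrow> ('f, nat \<Rightarrow> 'a) module" where
  "prod_alg n L =
     \<lparr>carrier = (\<Pi>\<^sub>E i\<in>{..<n}. carrier (L i)),
      monoid.mult = (\<lambda>x y. \<lambda>i\<in>{..<n}. x i \<otimes>\<^bsub>L i\<^esub> y i), one = (\<lambda>i\<in>{..<n}. \<one>\<^bsub>L i\<^esub>),
      ring.zero = (\<lambda>i\<in>{..<n}. \<zero>\<^bsub>L i\<^esub>), add = (\<lambda>x y. \<lambda>i\<in>{..<n}. x i \<oplus>\<^bsub>L i\<^esub> y i),
      smult = (\<lambda>c x. \<lambda>i\<in>{..<n}. c \<odot>\<^bsub>L i\<^esub> x i)\<rparr>"

text \<open>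
  The factors may be taken over the element type of \<open>K\<close> without loss of generality: each factor
  field of a product is in bijection with an ideal of \<open>K\<close>.
\<close>

definition etale :: "('f, 'x) ring_scheme \<Rightarrow> ('f, 'a) module \<Rightarrow> bool" where
  "etale F K \<longleftrightarrow> (\<exists>n. \<exists>L :: nat \<Rightarrow> ('f, 'a) module.
     (\<forall>i<n. finite_separable_extension F (L i)) \<and> alg_isomorphic F K (prod_alg n L))"


section \<open>Tensor products\<close>

text \<open>
  The free vector space on \<open>carrier A \<times> carrier B\<close>, with the multiplication extending bilinearly
  \<open>(a, b) (a', b') = (a a', b b')\<close> on the basis.
\<close>

definition free_alg ::
  "('f, 'x) ring_scheme \<Rightarrow> ('f, 'a) module \<Rightarrow> ('f, 'b) module \<Rightarrow> ('f, 'a \<times> 'b \<Rightarrow> 'f) module" where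
  "free_alg F A B =
     \<lparr>carrier = {f. (\<forall>p \<in> carrier A \<times> carrier B. f p \<in> carrier F) \<and>
        (\<forall>p. p \<notin> carrier A \<times> carrier B \<longrightarrow> f p = \<zero>\<^bsub>F\<^esub>) \<and> finite {p. f p \<noteq> \<zero>\<^bsub>F\<^esub>}},
      monoid.mult = (\<lambda>f g p. \<Oplus>\<^bsub>F\<^esub>q \<in> {((a, b), (a', b')). f (a, b) \<noteq> \<zero>\<^bsub>F\<^esub> \<and> g (a', b') \<noteq> \<zero>\<^bsub>F\<^esub> \<and>
          p = (a \<otimes>\<^bsub>A\<^esub> a', b \<otimes>\<^bsub>B\<^esub> b')}. f (fst q) \<otimes>\<^bsub>F\<^esub> g (snd q)),
      one = (\<lambda>p. if p = (\<one>\<^bsub>A\<^esub>, \<one>\<^bsub>B\<^esub>) then \<one>\<^bsub>F\<^esub> else \<zero>\<^bsub>F\<^esub>),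
      ring.zero = (\<lambda>p. \<zero>\<^bsub>F\<^esub>),
      add = (\<lambda>f g p. f p \<oplus>\<^bsub>F\<^esub> g p),
      smult = (\<lambda>c f p. c \<otimes>\<^bsub>F\<^esub> f p)\<rparr>"

definition free_gen :: "('f, 'x) ring_scheme \<Rightarrow> 'a \<Rightarrow> 'b \<Rightarrow> 'a \<times> 'b \<Rightarrow> 'f" where
  "free_gen F a b = (\<lambda>p. if p = (a, b) then \<one>\<^bsub>F\<^esub> else \<zero>\<^bsub>F\<^esub>)"

definition tensor_relations ::
  "('f, 'x) ring_scheme \<Rightarrow> ('f, 'a) module \<Rightarrow> ('f, 'b) module \<Rightarrow> ('a \<times> 'b \<Rightarrow> 'f) set" where
  "tensor_relations F A B =
     (let T = free_alg F A B in
      {free_gen F (a \<oplus>\<^bsub>A\<^esub> a') b \<ominus>\<^bsub>T\<^esub> (free_gen F a b \<oplus>\<^bsub>T\<^esub> free_gen F a' b) | a a' b.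
         a \<in> carrier A \<and> a' \<in> carrier A \<and> b \<in> carrier B} \<union>
      {free_gen F a (b \<oplus>\<^bsub>B\<^esub> b') \<ominus>\<^bsub>T\<^esub> (free_gen F a b \<oplus>\<^bsub>T\<^esub> free_gen F a b') | a b b'.
         a \<in> carrier A \<and> b \<in> carrier B \<and> b' \<in> carrier B} \<union>
      {free_gen F (c \<odot>\<^bsub>A\<^esub> a) b \<ominus>\<^bsub>T\<^esub> (c \<odot>\<^bsub>T\<^esub> free_gen F a b) | c a b.
         c \<in> carrier F \<and> a \<in> carrier A \<and> b \<in> carrier B} \<union>
      {free_gen F a (c \<odot>\<^bsub>B\<^esub> b) \<ominus>\<^bsub>T\<^esub> (c \<odot>\<^bsub>T\<^esub> free_gen F a b) | c a b.
         c \<in> carrier F \<and> a \<in> carrier A \<and> b \<in> carrier B})"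

definition tensor_ideal ::
  "('f, 'x) ring_scheme \<Rightarrow> ('f, 'a) module \<Rightarrow> ('f, 'b) module \<Rightarrow> ('a \<times> 'b \<Rightarrow> 'f) set" where
  "tensor_ideal F A B = lin_span F (free_alg F A B) (tensor_relations F A B)"

definition tensor_alg ::
  "('f, 'x) ring_scheme \<Rightarrow> ('f, 'a) module \<Rightarrow> ('f, 'b) module \<Rightarrow> ('f, ('a \<times> 'b \<Rightarrow> 'f) set) module" where
  "tensor_alg F A B = quot (free_alg F A B) (tensor_ideal F A B)"

definition tensor ::
  "('f, 'x) ring_scheme \<Rightarrow> ('f, 'a) module \<Rightarrow> ('f, 'b) module \<Rightarrow> 'a \<Rightarrow> 'b \<Rightarrow> ('a \<times> 'b \<Rightarrow> 'f) set" where
  "tensor F A B a b = tensor_ideal F A B +>\<^bsub>free_alg F A B\<^esub> free_gen F a b"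


section \<open>Semiassociative algebras\<close>

definition faithful_module :: "('r, 'x) ring_scheme \<Rightarrow> ('r, 'm) module \<Rightarrow> bool" where
  "faithful_module R M \<longleftrightarrow>
     (\<forall>r \<in> carrier R. (\<forall>x \<in> carrier M. r \<odot>\<^bsub>M\<^esub> x = \<zero>\<^bsub>M\<^esub>) \<longrightarrow> r = \<zero>\<^bsub>R\<^esub>)"

text \<open>The section \<open>N\<^sub>1 / N\<^sub>2\<close> of \<open>M\<close> is proper unless \<open>N\<^sub>1 = M\<close> and \<open>N\<^sub>2 = 0\<close>.\<close>

definition minimally_faithful :: "('r, 'x) ring_scheme \<Rightarrow> ('r, 'm) module \<Rightarrow> bool" where
  "minimally_faithful R M \<longleftrightarrow> faithful_module R M \<and>
     (\<forall>N\<^sub>1 N\<^sub>2. submodule N\<^sub>1 R M \<and> submodule N\<^sub>2 R M \<and> N\<^sub>2 \<subseteq> N\<^sub>1 \<and>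
        faithful_module R (quot (M\<lparr>carrier := N\<^sub>1\<rparr>) N\<^sub>2) \<longrightarrow> N\<^sub>1 = carrier M \<and> N\<^sub>2 = {\<zero>\<^bsub>M\<^esub>})"

text \<open>
  The value at \<open>a\<close> of a tensor \<open>t = \<Sum> f(k, k') k \<otimes> k'\<close> is \<open>\<Sum> f(k, k') (k a) k'\<close>;
  it does not depend on the representative \<open>f \<in> t\<close>, whence \<^const>\<open>the_elem\<close>.
\<close>

definition bimod_act ::
  "('f, 'x) ring_scheme \<Rightarrow> ('f, 'a) module \<Rightarrow> ('a \<times> 'a \<Rightarrow> 'f) set \<Rightarrow> 'a \<Rightarrow> 'a" where
  "bimod_act F A t a = the_elem
     ((\<lambda>f. \<Oplus>\<^bsub>A\<^esub>p \<in> {p. f p \<noteq> \<zero>\<^bsub>F\<^esub>}. f p \<odot>\<^bsub>A\<^esub> ((fst p \<otimes>\<^bsub>A\<^esub> a) \<otimes>\<^bsub>A\<^esub> snd p)) ` t)"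

definition bimod ::
  "('f, 'x) ring_scheme \<Rightarrow> ('f, 'a) module \<Rightarrow> (('a \<times> 'a \<Rightarrow> 'f) set, 'a) module" where
  "bimod F A = \<lparr>carrier = carrier A, monoid.mult = monoid.mult A, one = monoid.one A, ring.zero = ring.zero A, add = ring.add A,
     smult = bimod_act F A\<rparr>"

definition semiassociative :: "('f, 'x) ring_scheme \<Rightarrow> ('f, 'a) module \<Rightarrow> bool" where
  "semiassociative F A \<longleftrightarrow> unital_algebra F A \<and> fin_dim F A \<and> central F A \<and>
     (\<exists>K. subalg F A K \<and> K \<subseteq> nucleus A \<and> etale F (A\<lparr>carrier := K\<rparr>) \<and>
        minimally_faithful (tensor_alg F (A\<lparr>carrier := K\<rparr>) (A\<lparr>carrier := K\<rparr>)) (bimod F A))"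


section \<open>Atoms and homogeneity\<close>

definition left_ideal :: "'a set \<Rightarrow> ('a, 'x) ring_scheme \<Rightarrow> bool" where
  "left_ideal I R \<longleftrightarrow> additive_subgroup I R \<and> (\<forall>r \<in> carrier R. \<forall>x \<in> I. r \<otimes>\<^bsub>R\<^esub> x \<in> I)"

definition maximal_left_ideal :: "'a set \<Rightarrow> ('a, 'x) ring_scheme \<Rightarrow> bool" where
  "maximal_left_ideal I R \<longleftrightarrow> left_ideal I R \<and> I \<noteq> carrier R \<and>
     (\<forall>J. left_ideal J R \<and> I \<subseteq> J \<longrightarrow> J = I \<or> J = carrier R)"

definition jacobson_radical :: "('a, 'x) ring_scheme \<Rightarrow> 'a set" where
  "jacobson_radical R = carrier R \<inter> \<Inter>{I. maximal_left_ideal I R}"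

definition sigma :: "('f, 'a) module \<Rightarrow> ('f, 'a set) module" where
  "sigma A = quot (A\<lparr>carrier := nucleus A\<rparr>) (jacobson_radical (A\<lparr>carrier := nucleus A\<rparr>))"

text \<open>
  The simple components of a semisimple algebra are its minimal nonzero two-sided ideals, each of
  them an algebra with its own unit element.
\<close>

definition simple_component :: "'a set \<Rightarrow> ('f, 'a) module \<Rightarrow> bool" where
  "simple_component I S \<longleftrightarrow> ideal I S \<and> I \<noteq> {\<zero>\<^bsub>S\<^esub>} \<and>
     (\<forall>J. ideal J S \<and> J \<subseteq> I \<longrightarrow> J = {\<zero>\<^bsub>S\<^esub>} \<or> J = I)"

definition component_alg :: "('f, 'a) module \<Rightarrow> 'a set \<Rightarrow> ('f, 'a) module" where
  "component_alg S I = S\<lparr>carrier := I,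
     one := (THE e. e \<in> I \<and> (\<forall>x \<in> I. e \<otimes>\<^bsub>S\<^esub> x = x \<and> x \<otimes>\<^bsub>S\<^esub> e = x))\<rparr>"

definition atoms :: "('f, 'a) module \<Rightarrow> ('f, 'a set) module set" where
  "atoms A = {component_alg (sigma A) I | I. simple_component I (sigma A)}"

definition mat_alg :: "nat \<Rightarrow> ('f, 'd) module \<Rightarrow> ('f, nat \<times> nat \<Rightarrow> 'd) module" where
  "mat_alg m B = (let T = {1..m} \<times> {1..m} in
     \<lparr>carrier = (T \<rightarrow>\<^sub>E carrier B),
      monoid.mult = (\<lambda>x y. \<lambda>(i, j)\<in>T. \<Oplus>\<^bsub>B\<^esub>k \<in> {1..m}. x (i, k) \<otimes>\<^bsub>B\<^esub> y (k, j)),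
      one = (\<lambda>(i, j)\<in>T. if i = j then \<one>\<^bsub>B\<^esub> else \<zero>\<^bsub>B\<^esub>),
      ring.zero = (\<lambda>p\<in>T. \<zero>\<^bsub>B\<^esub>),
      add = (\<lambda>x y. \<lambda>p\<in>T. x p \<oplus>\<^bsub>B\<^esub> y p),
      smult = (\<lambda>c x. \<lambda>p\<in>T. c \<odot>\<^bsub>B\<^esub> x p)\<rparr>)"

definition brauer_equivalent ::
  "('f, 'x) ring_scheme \<Rightarrow> ('f, 'a) module \<Rightarrow> ('f, 'b) module \<Rightarrow> bool" where
  "brauer_equivalent F B C \<longleftrightarrow>
     (\<exists>r s. r \<ge> 1 \<and> s \<ge> 1 \<and> alg_isomorphic F (mat_alg r B) (mat_alg s C))"

definition homogeneous :: "('f, 'x) ring_scheme \<Rightarrow> ('f, 'a) module \<Rightarrow> bool" where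
  "homogeneous F A \<longleftrightarrow> (\<forall>B \<in> atoms A. central F B) \<and>
     (\<forall>B \<in> atoms A. \<forall>C \<in> atoms A. brauer_equivalent F B C)"

definition central_division_algebra :: "('f, 'x) ring_scheme \<Rightarrow> ('f, 'd) module \<Rightarrow> bool" where
  "central_division_algebra F D \<longleftrightarrow> unital_algebra F D \<and> ring D \<and> central F D \<and>
     Units D = carrier D - {\<zero>\<^bsub>D\<^esub>}"

definition common_division_algebra ::
  "('f, 'x) ring_scheme \<Rightarrow> ('f, 'a) module \<Rightarrow> ('f, 'd) module \<Rightarrow> bool" where
  "common_division_algebra F A D \<longleftrightarrow> central_division_algebra F D \<and>
     (\<forall>B \<in> atoms A. \<exists>m \<ge> 1. alg_isomorphic F B (mat_alg m D))"


section \<open>Skew matrix algebras\<close>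

definition reduced_skew_set ::
  "('f, 'x) ring_scheme \<Rightarrow> nat \<Rightarrow> (nat \<Rightarrow> nat \<Rightarrow> nat \<Rightarrow> 'f) \<Rightarrow> bool" where
  "reduced_skew_set F n c \<longleftrightarrow>
     (\<forall>i \<in> {1..n}. \<forall>j \<in> {1..n}. \<forall>k \<in> {1..n}. c i j k \<in> carrier F) \<and>
     (\<forall>i \<in> {1..n}. \<forall>j \<in> {1..n}. c i i j = \<one>\<^bsub>F\<^esub> \<and> c i j j = \<one>\<^bsub>F\<^esub>)"

text \<open>
  Elements are given by their coordinates in the basis \<open>e\<^sub>i\<^sub>j\<close>, where
  \<open>e\<^sub>i\<^sub>k e\<^sub>k\<^sub>j = c\<^sub>i\<^sub>k\<^sub>j e\<^sub>i\<^sub>j\<close>; the unit is \<open>\<Sum>\<^sub>i e\<^sub>i\<^sub>i\<close>.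
\<close>

definition skew_mat_alg ::
  "('f, 'x) ring_scheme \<Rightarrow> nat \<Rightarrow> (nat \<Rightarrow> nat \<Rightarrow> nat \<Rightarrow> 'f) \<Rightarrow> ('f, nat \<times> nat \<Rightarrow> 'f) module" where
  "skew_mat_alg F n c = (let T = {1..n} \<times> {1..n} in
     \<lparr>carrier = (T \<rightarrow>\<^sub>E carrier F),
      monoid.mult = (\<lambda>x y. \<lambda>(i, j)\<in>T. \<Oplus>\<^bsub>F\<^esub>k \<in> {1..n}. c i k j \<otimes>\<^bsub>F\<^esub> (x (i, k) \<otimes>\<^bsub>F\<^esub> y (k, j))),
      one = (\<lambda>(i, j)\<in>T. if i = j then \<one>\<^bsub>F\<^esub> else \<zero>\<^bsub>F\<^esub>),
      ring.zero = (\<lambda>p\<in>T. \<zero>\<^bsub>F\<^esub>),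
      add = (\<lambda>x y. \<lambda>p\<in>T. x p \<oplus>\<^bsub>F\<^esub> y p),
      smult = (\<lambda>a x. \<lambda>p\<in>T. a \<otimes>\<^bsub>F\<^esub> x p)\<rparr>)"

end

theory Submission
  imports Defs
begin

text \<open>
  Let \<open>K\<close> be the etale subalgebra, \<open>N\<close> the nucleus and \<open>J\<close> its radical. By minimal faithfulness a section
  of \<open>A\<close> that is faithful over \<open>K \<otimes> K\<close> is all of \<open>A\<close>. Applied to the preimage of \<open>K\<close> under the
  separability idempotent, this shows that elements of \<open>N\<close> centralizing \<open>K\<close> modulo \<open>J\<close> lie in \<open>K + J\<close>;
  hence the units of the atoms lift to orthogonal idempotents \<open>z \<in> K\<close> with sum 1. A nonzero bimodule
  over two central simple algebras is faithful over their tensor product, so every Peirce component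
  \<open>z A s\<close> is a simple bimodule, killed by \<open>J\<close> on both sides, and \<open>z A z = z N z \<cong> M\<^sub>m(D)\<close>.

  The diagonal copies of \<open>D\<close> add up to an embedding \<open>\<phi> : D \<rightarrow> N\<close>. A Casimir element of
  \<open>D \<otimes> D\<^sup>o\<^sup>p\<close> produces a nonzero element \<open>w\<close> commuting with \<open>\<phi>(D)\<close> in each corner of \<open>z A s\<close> cut out by
  matrix units, and by simplicity this corner is \<open>\<phi>(D) w\<close>. Moving \<open>w\<close> around by matrix units gives a
  \<open>D\<close>-basis \<open>u\<^sub>i\<^sub>j\<close> of \<open>A\<close> commuting with \<open>\<phi>(D)\<close>. The product \<open>u\<^sub>i\<^sub>k u\<^sub>k\<^sub>j\<close> is \<open>\<phi>(d) u\<^sub>i\<^sub>j\<close> with \<open>d\<close> central in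
  \<open>D\<close>, that is a scalar multiple of \<open>u\<^sub>i\<^sub>j\<close>, so the \<open>u\<^sub>i\<^sub>j\<close> span the skew matrix algebra.
\<close>

section \<open>Nonassociative algebras\<close>

text \<open>The obstacle is that minimal faithfulness speaks about \<open>K \<otimes> K\<close>
  only, whereas the decomposition needs simplicity over the much larger corners of the nucleus. The
  bridge is \<open>K_inter_J\<close>: \<open>K\<close> is von Neumann regular and the radical has no
  nonzero idempotent, so independent elements of \<open>K\<close> stay independent modulo
  \<open>J\<close>. A section of \<open>z A s\<close> that is faithful over the two atoms is
  therefore faithful over the part of \<open>K \<otimes> K\<close> at \<open>(z, s)\<close>, and
  adding the other Peirce components makes minimality applicable. For \<open>s = z\<close> the
  section \<open>z N z\<close> modulo its radical part shows that this part is zero, which turns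
  congruences inside a corner into equalities. The idempotents are taken in \<open>K\<close> because
  multiplication by elements of \<open>K\<close> is compatible with every operator over
  \<open>K\<close>.

  Nonassociativity is controlled by letting only nuclear elements act: the operators are sums of
  \<open>a \<mapsto> (b a) c\<close> with \<open>b\<close>, \<open>c\<close> in \<open>N\<close>.
  Tensor products occur at the two ends of the proof; between them such an element is represented by
  its operator or by its coefficients in a basis.\<close>

locale alg = unital_algebra F A
  for A :: "('f, 'a) module" (structure) and F :: "('f, 'x) ring_scheme" (structure)
begin

sublocale F: field F
  by (rule field_F)

abbreviation subspace :: "'a set \<Rightarrow> bool" where
  "subspace H \<equiv> submodule H F A"

declare mult_closed [simp, intro] unit_closed [simp, intro] l_unit [simp] r_unit [simp]

lemma mult_zero_l [simp]: "x \<in> carrier A \<Longrightarrow> \<zero> \<otimes> x = \<zero>"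
  by (metis M.add.l_cancel_one M.zero_closed M.l_zero mult_closed mult_l_distr)

lemma mult_zero_r [simp]: "x \<in> carrier A \<Longrightarrow> x \<otimes> \<zero> = \<zero>"
  by (metis M.add.l_cancel_one M.zero_closed M.l_zero mult_closed mult_r_distr)

lemma mult_neg_l: "x \<in> carrier A \<Longrightarrow> y \<in> carrier A \<Longrightarrow> (\<ominus> x) \<otimes> y = \<ominus> (x \<otimes> y)"
  by (rule M.minus_equality[symmetric]) (simp_all add: mult_l_distr[symmetric] M.l_neg)

lemma mult_neg_r: "x \<in> carrier A \<Longrightarrow> y \<in> carrier A \<Longrightarrow> x \<otimes> (\<ominus> y) = \<ominus> (x \<otimes> y)"
  by (rule M.minus_equality[symmetric]) (simp_all add: mult_r_distr[symmetric] M.l_neg)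

lemma mult_minus_l:
  "\<lbrakk>x \<in> carrier A; y \<in> carrier A; z \<in> carrier A\<rbrakk> \<Longrightarrow> (x \<ominus> y) \<otimes> z = x \<otimes> z \<ominus> y \<otimes> z"
  by (simp add: M.minus_eq mult_l_distr mult_neg_l)

lemma mult_minus_r:
  "\<lbrakk>x \<in> carrier A; y \<in> carrier A; z \<in> carrier A\<rbrakk> \<Longrightarrow> z \<otimes> (x \<ominus> y) = z \<otimes> x \<ominus> z \<otimes> y"
  by (simp add: M.minus_eq mult_r_distr mult_neg_r)

lemma finsum_mult_l:
  "\<lbrakk>f \<in> I \<rightarrow> carrier A; y \<in> carrier A\<rbrakk> \<Longrightarrow> (\<Oplus>i\<in>I. f i) \<otimes> y = (\<Oplus>i\<in>I. f i \<otimes> y)"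
proof (induction I rule: infinite_finite_induct)
  case (insert i I)
  then have "f i \<in> carrier A" "f \<in> I \<rightarrow> carrier A" "(\<lambda>i. f i \<otimes> y) \<in> I \<rightarrow> carrier A"
    by auto
  with insert show ?case
    by (simp add: mult_l_distr)
qed auto

lemma finsum_mult_r:
  "\<lbrakk>f \<in> I \<rightarrow> carrier A; y \<in> carrier A\<rbrakk> \<Longrightarrow> y \<otimes> (\<Oplus>i\<in>I. f i) = (\<Oplus>i\<in>I. y \<otimes> f i)"
proof (induction I rule: infinite_finite_induct)
  case (insert i I)
  then have "f i \<in> carrier A" "f \<in> I \<rightarrow> carrier A" "(\<lambda>i. y \<otimes> f i) \<in> I \<rightarrow> carrier A"
    by auto
  with insert show ?case
    by (simp add: mult_r_distr)
qed auto

lemma minus_self [simp]: "x \<in> carrier A \<Longrightarrow> x \<ominus> x = \<zero>"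
  by (simp add: M.minus_eq M.r_neg)

lemma minus_add_cancel: "\<lbrakk>x \<in> carrier A; y \<in> carrier A\<rbrakk> \<Longrightarrow> (x \<ominus> y) \<oplus> y = x"
  by (simp add: M.minus_eq M.a_assoc M.l_neg)

lemma minus_eq_zero_iff:
  "\<lbrakk>x \<in> carrier A; y \<in> carrier A\<rbrakk> \<Longrightarrow> x \<ominus> y = \<zero> \<longleftrightarrow> x = y"
  by (metis minus_add_cancel M.l_zero minus_self)

lemma smult_minus_r:
  "\<lbrakk>c \<in> carrier F; x \<in> carrier A; y \<in> carrier A\<rbrakk> \<Longrightarrow> c \<odot> (x \<ominus> y) = c \<odot> x \<ominus> c \<odot> y"
  by (simp add: M.minus_eq smult_r_distr smult_r_minus)

lemma add_minus_add:
  "\<lbrakk>x \<in> carrier A; y \<in> carrier A; x' \<in> carrier A; y' \<in> carrier A\<rbrakk>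
    \<Longrightarrow> (x \<oplus> y) \<ominus> (x' \<oplus> y') = (x \<ominus> x') \<oplus> (y \<ominus> y')"
  by (simp add: M.minus_eq M.minus_add M.a_ac)

lemma minus_trans:
  "\<lbrakk>x \<in> carrier A; y \<in> carrier A; z \<in> carrier A\<rbrakk> \<Longrightarrow> (x \<ominus> y) \<oplus> (y \<ominus> z) = x \<ominus> z"
  by (metis M.a_assoc M.minus_closed M.minus_eq M.a_inv_closed minus_add_cancel)

lemma neg_minus:
  "\<lbrakk>x \<in> carrier A; y \<in> carrier A\<rbrakk> \<Longrightarrow> \<ominus> (x \<ominus> y) = y \<ominus> x"
  by (simp add: M.minus_eq M.minus_add M.a_ac)

lemma subspaceD:
  assumes "subspace H"
  shows "H \<subseteq> carrier A" "\<zero> \<in> H" "\<And>x. x \<in> H \<Longrightarrow> \<ominus> x \<in> H"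
    "\<And>x y. x \<in> H \<Longrightarrow> y \<in> H \<Longrightarrow> x \<oplus> y \<in> H" "\<And>x y. x \<in> H \<Longrightarrow> y \<in> H \<Longrightarrow> x \<ominus> y \<in> H"
    "\<And>c x. c \<in> carrier F \<Longrightarrow> x \<in> H \<Longrightarrow> c \<odot> x \<in> H" "\<And>x. x \<in> H \<Longrightarrow> x \<in> carrier A"
proof -
  note E = submoduleE[OF assms]
  show *: "H \<subseteq> carrier A" "\<And>x. x \<in> H \<Longrightarrow> \<ominus> x \<in> H" "\<And>x y. x \<in> H \<Longrightarrow> y \<in> H \<Longrightarrow> x \<oplus> y \<in> H"
    "\<And>c x. c \<in> carrier F \<Longrightarrow> x \<in> H \<Longrightarrow> c \<odot> x \<in> H"
    using E by blast+
  then show "\<And>x y. x \<in> H \<Longrightarrow> y \<in> H \<Longrightarrow> x \<ominus> y \<in> H"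
    by (simp add: M.minus_eq)
  obtain x where "x \<in> H"
    using E(2) by blast
  then show "\<zero> \<in> H"
    using * M.r_neg subsetD by metis
  show "\<And>x. x \<in> H \<Longrightarrow> x \<in> carrier A"
    using *(1) by blast
qed

lemma subspaceI:
  assumes "H \<subseteq> carrier A" "\<zero> \<in> H" "\<And>x y. x \<in> H \<Longrightarrow> y \<in> H \<Longrightarrow> x \<oplus> y \<in> H"
    "\<And>c x. c \<in> carrier F \<Longrightarrow> x \<in> H \<Longrightarrow> c \<odot> x \<in> H"
  shows "subspace H"
proof (rule submoduleI)
  fix a assume "a \<in> H"
  then have "(\<ominus>\<^bsub>F\<^esub> \<one>\<^bsub>F\<^esub>) \<odot> a \<in> H" "a \<in> carrier A"
    using assms by auto
  then show "\<ominus> a \<in> H"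
    by (simp add: smult_l_minus)
qed (use assms in auto)

lemma subspace_finsum:
  assumes "subspace H" "\<And>i. i \<in> I \<Longrightarrow> f i \<in> H"
  shows "(\<Oplus>i\<in>I. f i) \<in> H"
  using assms(2)
proof (induction I rule: infinite_finite_induct)
  case (insert i I)
  then show ?case
    using subspaceD[OF assms(1)] by (subst M.finsum_insert) (auto simp: Pi_def)
qed (use subspaceD[OF assms(1)] in auto)

lemma subspace_trans:
  assumes "subspace H" "x \<ominus> y \<in> H" "y \<ominus> z \<in> H" "x \<in> carrier A" "y \<in> carrier A" "z \<in> carrier A"
  shows "x \<ominus> z \<in> H"
  using assms subspaceD(4)[OF assms(1,2,3)] by (simp add: minus_trans)

lemma subspace_sym:
  assumes "subspace H" "x \<ominus> y \<in> H" "x \<in> carrier A" "y \<in> carrier A"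
  shows "y \<ominus> x \<in> H"
  using assms subspaceD(3)[OF assms(1,2)] by (simp add: neg_minus)

lemma subspace_mem_diff:
  assumes "subspace H" "x \<ominus> y \<in> H" "y \<in> H" "x \<in> carrier A"
  shows "x \<in> H"
  using assms subspaceD(4)[OF assms(1,2,3)] subspaceD(7)[OF assms(1,3)]
  by (simp add: minus_add_cancel)

lemma subspace_mem_diff':
  assumes "subspace H" "x \<ominus> y \<in> H" "x \<in> H" "y \<in> carrier A"
  shows "y \<in> H"
  using assms subspace_mem_diff subspace_sym subspaceD(7) by blast

lemma subspace_zero: "subspace {\<zero>}"
  by (rule subspaceI) auto

lemma subspace_inter: "subspace H \<Longrightarrow> subspace G \<Longrightarrow> subspace (H \<inter> G)"
  by (rule subspaceI) (auto dest: subspaceD)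

subsection \<open>The nucleus\<close>

abbreviation N :: "'a set" where "N \<equiv> nucleus A"

lemma nucleus_iff:
  "x \<in> N \<longleftrightarrow> x \<in> carrier A \<and> (\<forall>a\<in>carrier A. \<forall>b\<in>carrier A. (x \<otimes> a) \<otimes> b = x \<otimes> (a \<otimes> b) \<and>
    (a \<otimes> x) \<otimes> b = a \<otimes> (x \<otimes> b) \<and> (a \<otimes> b) \<otimes> x = a \<otimes> (b \<otimes> x))"
  by (auto simp: nucleus_def associator_def minus_eq_zero_iff)

lemma nuc_carr [simp]: "x \<in> N \<Longrightarrow> x \<in> carrier A"
  unfolding nucleus_iff by blast

lemma nuc1: "\<lbrakk>x \<in> N; a \<in> carrier A; b \<in> carrier A\<rbrakk> \<Longrightarrow> (x \<otimes> a) \<otimes> b = x \<otimes> (a \<otimes> b)"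
  and nuc2: "\<lbrakk>x \<in> N; a \<in> carrier A; b \<in> carrier A\<rbrakk> \<Longrightarrow> (a \<otimes> x) \<otimes> b = a \<otimes> (x \<otimes> b)"
  and nuc3: "\<lbrakk>x \<in> N; a \<in> carrier A; b \<in> carrier A\<rbrakk> \<Longrightarrow> (a \<otimes> b) \<otimes> x = a \<otimes> (b \<otimes> x)"
  unfolding nucleus_iff by blast+

lemma nuc_mult [simp, intro]: "x \<in> N \<Longrightarrow> y \<in> N \<Longrightarrow> x \<otimes> y \<in> N"
proof -
  assume xy: "x \<in> N" "y \<in> N"
  show ?thesis
    unfolding nucleus_iff[of "x \<otimes> y"]
  proof (intro conjI ballI)
    fix a b assume ab: "a \<in> carrier A" "b \<in> carrier A"
    show "x \<otimes> y \<otimes> a \<otimes> b = x \<otimes> y \<otimes> (a \<otimes> b)"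
      using xy ab by (simp add: nuc1)
    have "a \<otimes> (x \<otimes> y) \<otimes> b = ((a \<otimes> x) \<otimes> y) \<otimes> b"
      using xy ab by (simp only: nuc2[OF xy(1) ab(1) nuc_carr[OF xy(2)]])
    also have "\<dots> = a \<otimes> (x \<otimes> (y \<otimes> b))"
      using nuc2[OF xy(2), of "a \<otimes> x" b] nuc2[OF xy(1), of a "y \<otimes> b"] xy ab by simp
    finally show "a \<otimes> (x \<otimes> y) \<otimes> b = a \<otimes> (x \<otimes> y \<otimes> b)"
      using xy ab by (simp add: nuc1)
    have "a \<otimes> b \<otimes> (x \<otimes> y) = (a \<otimes> b \<otimes> x) \<otimes> y"
      using xy ab by (simp add: nuc2)
    then show "a \<otimes> b \<otimes> (x \<otimes> y) = a \<otimes> (b \<otimes> (x \<otimes> y))"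
      using xy ab by (simp add: nuc2 nuc3)
  qed (use xy in simp)
qed

lemma nuc_one [simp, intro]: "\<one> \<in> N"
  unfolding nucleus_iff by simp

lemma nuc_subspace: "subspace N"
proof (rule subspaceI)
  fix x y assume "x \<in> N" "y \<in> N"
  then show "x \<oplus> y \<in> N"
    unfolding nucleus_iff[of "x \<oplus> y"] by (simp add: nuc1 nuc2 nuc3 mult_l_distr mult_r_distr)
next
  fix c x assume "c \<in> carrier F" "x \<in> N"
  then show "c \<odot> x \<in> N"
    unfolding nucleus_iff[of "c \<odot> x"] by (simp add: nuc1 nuc2 nuc3 smult_mult_l smult_mult_r)
next
  show "\<zero> \<in> N"
    unfolding nucleus_iff by simp
qed auto

subsection \<open>Multiplication operators\<close>

text \<open>The image of \<open>B \<otimes> C\<close> in the endomorphisms of \<open>A\<close>,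
  generated without coefficients: scalars and the zero operator are absorbed into \<open>B\<close>
  when it is a subspace. Two operators are only ever compared on \<open>carrier A\<close>.\<close>

inductive_set mop :: "'a set \<Rightarrow> 'a set \<Rightarrow> ('a \<Rightarrow> 'a) set" for B C where
  base: "b \<in> B \<Longrightarrow> c \<in> C \<Longrightarrow> (\<lambda>a. (b \<otimes> a) \<otimes> c) \<in> mop B C"
| sum: "S \<in> mop B C \<Longrightarrow> T \<in> mop B C \<Longrightarrow> (\<lambda>a. S a \<oplus> T a) \<in> mop B C"

text \<open>The closure principle used throughout: what is stable under the coefficients is stable
  under the operators.\<close>

lemma mop_preserves:
  assumes "T \<in> mop B C" "subspace H" "\<And>b x. b \<in> B \<Longrightarrow> x \<in> H \<Longrightarrow> b \<otimes> x \<in> H"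
    "\<And>c x. c \<in> C \<Longrightarrow> x \<in> H \<Longrightarrow> x \<otimes> c \<in> H" "x \<in> H"
  shows "T x \<in> H"
  using assms(1) by induction (use assms subspaceD[OF assms(2)] in auto)

lemma mop_closed:
  assumes "T \<in> mop B C" "B \<subseteq> carrier A" "C \<subseteq> carrier A" "x \<in> carrier A"
  shows "T x \<in> carrier A"
  using mop_preserves[OF assms(1) carrier_is_submodule] assms by blast

lemma mop_add:
  assumes "T \<in> mop B C" "B \<subseteq> carrier A" "C \<subseteq> carrier A" "x \<in> carrier A" "y \<in> carrier A"
  shows "T (x \<oplus> y) = T x \<oplus> T y"
  using assms(1)
proof induction
  case (base b c)
  then have "b \<in> carrier A" "c \<in> carrier A"
    using assms by auto
  then show ?case
    using assms by (simp add: mult_l_distr mult_r_distr)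
next
  case (sum S T)
  have "S x \<in> carrier A" "S y \<in> carrier A" "T x \<in> carrier A" "T y \<in> carrier A"
    using sum assms mop_closed by blast+
  then show ?case
    using sum by (simp add: M.a_ac)
qed

lemma mop_smult:
  assumes "T \<in> mop B C" "B \<subseteq> carrier A" "C \<subseteq> carrier A" "x \<in> carrier A" "c \<in> carrier F"
  shows "T (c \<odot> x) = c \<odot> T x"
  using assms(1)
proof induction
  case (base b d)
  then have "b \<in> carrier A" "d \<in> carrier A"
    using assms by auto
  then show ?case
    using assms by (simp add: smult_mult_r smult_mult_l)
next
  case (sum S T)
  have "S x \<in> carrier A" "T x \<in> carrier A"
    using sum assms mop_closed by blast+
  then show ?case
    using sum assms by (simp add: smult_r_distr)
qed

lemma mop_minus:
  assumes "T \<in> mop B C" "B \<subseteq> carrier A" "C \<subseteq> carrier A" "x \<in> carrier A" "y \<in> carrier A"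
  shows "T (x \<ominus> y) = T x \<ominus> T y"
proof -
  have "T y \<in> carrier A" "\<ominus> y = (\<ominus>\<^bsub>F\<^esub> \<one>\<^bsub>F\<^esub>) \<odot> y"
    using mop_closed[OF assms(1-3)] assms by (auto simp: smult_l_minus)
  then have "T (\<ominus> y) = \<ominus> T y"
    using mop_smult[OF assms(1-3), of y "\<ominus>\<^bsub>F\<^esub> \<one>\<^bsub>F\<^esub>"] assms by (simp add: smult_l_minus)
  then show ?thesis
    using assms by (simp add: M.minus_eq mop_add)
qed

lemma mop_zero:
  assumes "T \<in> mop B C" "B \<subseteq> carrier A" "C \<subseteq> carrier A"
  shows "T \<zero> = \<zero>"
  using mop_minus[OF assms, of \<zero> \<zero>] mop_closed[OF assms, of \<zero>] by simp

text \<open>The rules of \<open>mop\<close> have no empty sum, so the zero operator has to be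
  produced from \<open>\<zero> \<in> B\<close> and some element of \<open>C\<close>.\<close>

lemma mop_finsum:
  assumes "finite I" "\<And>i. i \<in> I \<Longrightarrow> T i \<in> mop B C" "B \<subseteq> carrier A" "C \<subseteq> carrier A" "\<zero> \<in> B" "c \<in> C"
  shows "\<exists>S \<in> mop B C. \<forall>x\<in>carrier A. S x = (\<Oplus>i\<in>I. T i x)"
  using assms(1,2)
proof (induction I)
  case empty
  have "(\<lambda>x. (\<zero> \<otimes> x) \<otimes> c) \<in> mop B C"
    using assms by (intro mop.base)
  moreover have "\<forall>x\<in>carrier A. (\<zero> \<otimes> x) \<otimes> c = \<zero>"
    using assms by auto
  ultimately show ?case
    by (intro bexI[of _ "\<lambda>x. (\<zero> \<otimes> x) \<otimes> c"]) auto
next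
  case (insert i I)
  then obtain S where S: "S \<in> mop B C" "\<And>x. x \<in> carrier A \<Longrightarrow> S x = (\<Oplus>i\<in>I. T i x)"
    by auto
  have "(\<lambda>x. T i x \<oplus> S x) \<in> mop B C"
    using S insert by (intro mop.sum) auto
  moreover have "(\<Oplus>i\<in>insert i I. T i x) = T i x \<oplus> S x" if "x \<in> carrier A" for x
    using insert that S mop_closed[OF _ assms(3,4) that] by (subst M.finsum_insert) (auto simp: Pi_def)
  ultimately show ?case
    by auto
qed

text \<open>Left coefficients multiply in the order of composition and right ones in the opposite
  order: \<open>(b ((b' x) c')) c = ((b b') x) (c' c)\<close> once all four coefficients are
  nuclear.\<close>

lemma mop_comp:
  assumes "S \<in> mop B C" "T \<in> mop B' C'" "B \<subseteq> N" "C \<subseteq> N" "B' \<subseteq> N" "C' \<subseteq> N"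
    "\<And>x y. x \<in> B \<Longrightarrow> y \<in> B' \<Longrightarrow> x \<otimes> y \<in> B''" "\<And>x y. x \<in> C' \<Longrightarrow> y \<in> C \<Longrightarrow> x \<otimes> y \<in> C''"
  shows "\<exists>R \<in> mop B'' C''. \<forall>x\<in>carrier A. R x = S (T x)"
  using assms(1)
proof induction
  case (base b c)
  from assms(2) show ?case
  proof induction
    case (base b' c')
    have "(\<lambda>x. ((b \<otimes> b') \<otimes> x) \<otimes> (c' \<otimes> c)) \<in> mop B'' C''"
      using base \<open>b \<in> B\<close> \<open>c \<in> C\<close> assms by (intro mop.base) auto
    moreover have "((b \<otimes> b') \<otimes> x) \<otimes> (c' \<otimes> c) = (b \<otimes> ((b' \<otimes> x) \<otimes> c')) \<otimes> c" if "x \<in> carrier A" for x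
    proof -
      have "b \<in> N" "b' \<in> N" "c \<in> N" "c' \<in> N"
        using base \<open>b \<in> B\<close> \<open>c \<in> C\<close> assms by auto
      then show ?thesis
        using that by (simp add: nuc1 nuc2 nuc3)
    qed
    ultimately show ?case
      by (intro bexI[of _ "\<lambda>x. ((b \<otimes> b') \<otimes> x) \<otimes> (c' \<otimes> c)"]) auto
  next
    case (sum S T)
    then obtain R R' where R: "R \<in> mop B'' C''" "\<forall>x\<in>carrier A. R x = b \<otimes> S x \<otimes> c"
      "R' \<in> mop B'' C''" "\<forall>x\<in>carrier A. R' x = b \<otimes> T x \<otimes> c"
      by blast
    have "b \<in> carrier A" "c \<in> carrier A"
      using base assms by auto
    moreover have "S x \<in> carrier A \<and> T x \<in> carrier A" if "x \<in> carrier A" for x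
      using sum that assms mop_closed[of _ B' C'] by (meson nuc_carr subsetI subset_trans)
    ultimately have "\<forall>x\<in>carrier A. R x \<oplus> R' x = b \<otimes> (S x \<oplus> T x) \<otimes> c"
      using R by (auto simp: mult_l_distr mult_r_distr)
    then show ?case
      using mop.sum[OF R(1,3)] by (intro bexI[of _ "\<lambda>x. R x \<oplus> R' x"]) auto
  qed
next
  case (sum S S')
  then obtain R R' where R: "R \<in> mop B'' C''" "\<forall>x\<in>carrier A. R x = S (T x)"
      "R' \<in> mop B'' C''" "\<forall>x\<in>carrier A. R' x = S' (T x)"
    by blast
  then show ?case
    using mop.sum[OF R(1,3)] by (intro bexI[of _ "\<lambda>x. R x \<oplus> R' x"]) auto
qed

end

section \<open>Finite dimensional subspaces\<close>

context alg begin

text \<open>\<open>lin_span\<close> is an intersection of submodules and yields no coefficients;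
  this is the span with explicit ones, meant for finite \<open>B\<close>.\<close>

definition comb :: "'a set \<Rightarrow> 'a set" where
  "comb B = {\<Oplus>b\<in>B. c b \<odot> b | c. c \<in> B \<rightarrow> carrier F}"

definition indep :: "'a set \<Rightarrow> bool" where
  "indep B \<longleftrightarrow> finite B \<and> B \<subseteq> carrier A \<and>
     (\<forall>c \<in> B \<rightarrow> carrier F. (\<Oplus>b\<in>B. c b \<odot> b) = \<zero> \<longrightarrow> (\<forall>b\<in>B. c b = \<zero>\<^bsub>F\<^esub>))"

definition basis :: "'a set \<Rightarrow> 'a set \<Rightarrow> bool" where
  "basis V B \<longleftrightarrow> indep B \<and> comb B = V"

lemma comb_add:
  assumes "B \<subseteq> carrier A" "c \<in> B \<rightarrow> carrier F" "d \<in> B \<rightarrow> carrier F"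
  shows "(\<Oplus>b\<in>B. c b \<odot> b) \<oplus> (\<Oplus>b\<in>B. d b \<odot> b) = (\<Oplus>b\<in>B. (c b \<oplus>\<^bsub>F\<^esub> d b) \<odot> b)"
proof -
  have 1: "c b \<in> carrier F" "d b \<in> carrier F" "b \<in> carrier A" if "b \<in> B" for b
    using assms that by auto
  then have "(\<Oplus>b\<in>B. (c b \<oplus>\<^bsub>F\<^esub> d b) \<odot> b) = (\<Oplus>b\<in>B. c b \<odot> b \<oplus> d b \<odot> b)"
    by (intro M.finsum_cong') (auto simp: smult_l_distr)
  also have "\<dots> = (\<Oplus>b\<in>B. c b \<odot> b) \<oplus> (\<Oplus>b\<in>B. d b \<odot> b)"
    using 1 by (intro M.finsum_addf) auto
  finally show ?thesis ..
qed

lemma comb_smult: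
  assumes "finite B" "B \<subseteq> carrier A" "c \<in> B \<rightarrow> carrier F" "r \<in> carrier F"
  shows "r \<odot> (\<Oplus>b\<in>B. c b \<odot> b) = (\<Oplus>b\<in>B. (r \<otimes>\<^bsub>F\<^esub> c b) \<odot> b)"
proof -
  have 1: "c b \<in> carrier F" "b \<in> carrier A" if "b \<in> B" for b
    using assms that by auto
  have "r \<odot> (\<Oplus>b\<in>B. c b \<odot> b) = (\<Oplus>b\<in>B. r \<odot> (c b \<odot> b))"
    using assms 1 by (intro finsum_smult_ldistr) auto
  also have "\<dots> = (\<Oplus>b\<in>B. (r \<otimes>\<^bsub>F\<^esub> c b) \<odot> b)"
    using assms 1 by (intro M.finsum_cong') (auto simp: smult_assoc1)
  finally show ?thesis .
qed

lemma comb_closed: "B \<subseteq> carrier A \<Longrightarrow> c \<in> B \<rightarrow> carrier F \<Longrightarrow> (\<Oplus>b\<in>B. c b \<odot> b) \<in> carrier A"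
  by (intro M.finsum_closed) auto

lemma comb_subspace:
  assumes "finite B" "B \<subseteq> carrier A"
  shows "subspace (comb B)"
proof (rule subspaceI)
  show "comb B \<subseteq> carrier A"
    using comb_closed assms by (auto simp: comb_def)
  have "(\<Oplus>b\<in>B. \<zero>\<^bsub>F\<^esub> \<odot> b) = (\<Oplus>b\<in>B. \<zero>)"
    using assms by (intro M.finsum_cong') auto
  then have "(\<Oplus>b\<in>B. \<zero>\<^bsub>F\<^esub> \<odot> b) = \<zero>"
    by simp
  then show "\<zero> \<in> comb B"
    unfolding comb_def by (intro CollectI exI[of _ "\<lambda>_. \<zero>\<^bsub>F\<^esub>"]) auto
next
  fix x y assume "x \<in> comb B" "y \<in> comb B"
  then obtain c d where c: "c \<in> B \<rightarrow> carrier F" "x = (\<Oplus>b\<in>B. c b \<odot> b)"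
    and d: "d \<in> B \<rightarrow> carrier F" "y = (\<Oplus>b\<in>B. d b \<odot> b)"
    by (auto simp: comb_def)
  have "(\<lambda>b. c b \<oplus>\<^bsub>F\<^esub> d b) \<in> B \<rightarrow> carrier F"
    using c d by auto
  then show "x \<oplus> y \<in> comb B"
    using c d comb_add[OF assms(2) c(1) d(1)] by (auto simp: comb_def)
next
  fix r x assume r: "r \<in> carrier F" and "x \<in> comb B"
  then obtain c where c: "c \<in> B \<rightarrow> carrier F" "x = (\<Oplus>b\<in>B. c b \<odot> b)"
    by (auto simp: comb_def)
  have "(\<lambda>b. r \<otimes>\<^bsub>F\<^esub> c b) \<in> B \<rightarrow> carrier F"
    using c r by auto
  then show "r \<odot> x \<in> comb B"
    using c comb_smult[OF assms c(1) r] by (auto simp: comb_def)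
qed

lemma comb_incl:
  assumes "finite B" "B \<subseteq> carrier A"
  shows "B \<subseteq> comb B"
proof
  fix x assume x: "x \<in> B"
  have "(\<Oplus>b\<in>B. (if x = b then \<one>\<^bsub>F\<^esub> else \<zero>\<^bsub>F\<^esub>) \<odot> b) = (\<Oplus>b\<in>B. if x = b then b else \<zero>)"
    using assms by (intro M.finsum_cong') auto
  also have "\<dots> = x"
    using assms x by (intro M.finsum_singleton) auto
  finally show "x \<in> comb B"
    unfolding comb_def by (intro CollectI exI[of _ "\<lambda>b. if x = b then \<one>\<^bsub>F\<^esub> else \<zero>\<^bsub>F\<^esub>"]) auto
qed

lemma comb_least: "subspace V \<Longrightarrow> B \<subseteq> V \<Longrightarrow> comb B \<subseteq> V"
  unfolding comb_def by (clarify, rule subspace_finsum) (auto dest: subspaceD(6))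

lemma basis_subspace: "basis V B \<Longrightarrow> subspace V"
  using comb_subspace by (auto simp: basis_def indep_def)

lemma basis_incl: "basis V B \<Longrightarrow> B \<subseteq> V"
  using comb_incl by (auto simp: basis_def indep_def)

text \<open>Independence makes the coefficients unique, and uniqueness makes them linear in the
  vector.\<close>

lemma basis_coord:
  assumes "basis V B"
  obtains f where "\<And>v b. v \<in> V \<Longrightarrow> b \<in> B \<Longrightarrow> f v b \<in> carrier F"
    "\<And>v. v \<in> V \<Longrightarrow> v = (\<Oplus>b\<in>B. f v b \<odot> b)"
    "\<And>v w b. v \<in> V \<Longrightarrow> w \<in> V \<Longrightarrow> b \<in> B \<Longrightarrow> f (v \<oplus> w) b = f v b \<oplus>\<^bsub>F\<^esub> f w b"
    "\<And>c v b. c \<in> carrier F \<Longrightarrow> v \<in> V \<Longrightarrow> b \<in> B \<Longrightarrow> f (c \<odot> v) b = c \<otimes>\<^bsub>F\<^esub> f v b"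
proof -
  have B: "finite B" "B \<subseteq> carrier A" and V: "comb B = V"
    using assms by (auto simp: basis_def indep_def)
  have "\<forall>v\<in>V. \<exists>c. c \<in> B \<rightarrow> carrier F \<and> v = (\<Oplus>b\<in>B. c b \<odot> b)"
    using V by (auto simp: comb_def)
  then obtain f where f: "\<And>v. v \<in> V \<Longrightarrow> f v \<in> B \<rightarrow> carrier F"
    "\<And>v. v \<in> V \<Longrightarrow> v = (\<Oplus>b\<in>B. f v b \<odot> b)"
    by metis
  have uniq: "\<forall>b\<in>B. c b = d b" if c: "c \<in> B \<rightarrow> carrier F" and d: "d \<in> B \<rightarrow> carrier F"
    and eq: "(\<Oplus>b\<in>B. c b \<odot> b) = (\<Oplus>b\<in>B. d b \<odot> b)" for c d
  proof -
    \<comment> \<open>This is the difference of \<open>c\<close> and \<open>d\<close>; the sign is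
      written as a scalar so that \<open>comb_smult\<close> applies to it.\<close>
    define e where "e = (\<lambda>b. c b \<oplus>\<^bsub>F\<^esub> (\<ominus>\<^bsub>F\<^esub> \<one>\<^bsub>F\<^esub> \<otimes>\<^bsub>F\<^esub> d b))"
    have e: "e \<in> B \<rightarrow> carrier F" and d': "(\<lambda>b. \<ominus>\<^bsub>F\<^esub> \<one>\<^bsub>F\<^esub> \<otimes>\<^bsub>F\<^esub> d b) \<in> B \<rightarrow> carrier F"
      using c d by (auto simp: e_def)
    have "(\<Oplus>b\<in>B. e b \<odot> b) = (\<Oplus>b\<in>B. c b \<odot> b) \<oplus> (\<ominus>\<^bsub>F\<^esub> \<one>\<^bsub>F\<^esub>) \<odot> (\<Oplus>b\<in>B. d b \<odot> b)"
      unfolding e_def using comb_add[OF B(2) c d'] comb_smult[OF B d, of "\<ominus>\<^bsub>F\<^esub> \<one>\<^bsub>F\<^esub>"] by simp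
    also have "\<dots> = \<zero>"
      using eq comb_closed[OF B(2) d] by (simp add: smult_l_minus M.r_neg)
    finally have "\<forall>b\<in>B. e b = \<zero>\<^bsub>F\<^esub>"
      using assms e by (auto simp: basis_def indep_def)
    then have "c b \<oplus>\<^bsub>F\<^esub> \<ominus>\<^bsub>F\<^esub> d b = \<zero>\<^bsub>F\<^esub>" if "b \<in> B" for b
      using that c d by (auto simp: e_def R.l_minus Pi_iff)
    then show ?thesis
      using c d R.minus_equality R.minus_minus by (metis Pi_mem R.a_inv_closed)
  qed
  have sV: "subspace V"
    using assms basis_subspace by blast
  show ?thesis
  proof (rule that[of f])
    fix v w b assume v: "v \<in> V" "w \<in> V" "b \<in> B"
    have "(\<Oplus>b\<in>B. f (v \<oplus> w) b \<odot> b) = (\<Oplus>b\<in>B. (f v b \<oplus>\<^bsub>F\<^esub> f w b) \<odot> b)"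
      using comb_add[OF B(2) f(1)[OF v(1)] f(1)[OF v(2)]]
      unfolding f(2)[OF v(1), symmetric] f(2)[OF v(2), symmetric]
        f(2)[OF subspaceD(4)[OF sV v(1,2)], symmetric] .
    moreover have "(\<lambda>b. f v b \<oplus>\<^bsub>F\<^esub> f w b) \<in> B \<rightarrow> carrier F"
      using f(1)[OF v(1)] f(1)[OF v(2)] by auto
    ultimately show "f (v \<oplus> w) b = f v b \<oplus>\<^bsub>F\<^esub> f w b"
      using uniq f(1)[OF subspaceD(4)[OF sV v(1,2)]] v by blast
  next
    fix c v b assume v: "c \<in> carrier F" "v \<in> V" "b \<in> B"
    have "(\<Oplus>b\<in>B. f (c \<odot> v) b \<odot> b) = (\<Oplus>b\<in>B. (c \<otimes>\<^bsub>F\<^esub> f v b) \<odot> b)"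
      using comb_smult[OF B f(1)[OF v(2)] v(1)]
      unfolding f(2)[OF v(2), symmetric] f(2)[OF subspaceD(6)[OF sV v(1,2)], symmetric] .
    moreover have "(\<lambda>b. c \<otimes>\<^bsub>F\<^esub> f v b) \<in> B \<rightarrow> carrier F"
      using f(1)[OF v(2)] v by auto
    ultimately show "f (c \<odot> v) b = c \<otimes>\<^bsub>F\<^esub> f v b"
      using uniq f(1)[OF subspaceD(6)[OF sV v(1,2)]] v by blast
  qed (use f in auto)
qed

text \<open>A nonzero vector has a nonzero coordinate, and that coordinate is the
  functional.\<close>

lemma basis_functional:
  assumes "basis V B" "v \<in> V" "v \<noteq> \<zero>"
  obtains g where "g \<in> V \<rightarrow> carrier F" "g v \<noteq> \<zero>\<^bsub>F\<^esub>"
    "\<And>x y. x \<in> V \<Longrightarrow> y \<in> V \<Longrightarrow> g (x \<oplus> y) = g x \<oplus>\<^bsub>F\<^esub> g y"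
    "\<And>c x. c \<in> carrier F \<Longrightarrow> x \<in> V \<Longrightarrow> g (c \<odot> x) = c \<otimes>\<^bsub>F\<^esub> g x"
proof -
  obtain f where f: "\<And>v b. v \<in> V \<Longrightarrow> b \<in> B \<Longrightarrow> f v b \<in> carrier F"
    "\<And>v. v \<in> V \<Longrightarrow> v = (\<Oplus>b\<in>B. f v b \<odot> b)"
    "\<And>v w b. v \<in> V \<Longrightarrow> w \<in> V \<Longrightarrow> b \<in> B \<Longrightarrow> f (v \<oplus> w) b = f v b \<oplus>\<^bsub>F\<^esub> f w b"
    "\<And>c v b. c \<in> carrier F \<Longrightarrow> v \<in> V \<Longrightarrow> b \<in> B \<Longrightarrow> f (c \<odot> v) b = c \<otimes>\<^bsub>F\<^esub> f v b"
    by (rule basis_coord[OF assms(1)]) blast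
  have B: "B \<subseteq> carrier A"
    using assms by (auto simp: basis_def indep_def)
  have "\<exists>b\<in>B. f v b \<noteq> \<zero>\<^bsub>F\<^esub>"
  proof (rule ccontr)
    assume "\<not> (\<exists>b\<in>B. f v b \<noteq> \<zero>\<^bsub>F\<^esub>)"
    then have "(\<Oplus>b\<in>B. f v b \<odot> b) = (\<Oplus>b\<in>B. \<zero>)"
      using B by (intro M.finsum_cong') auto
    then show False
      using f(2)[OF assms(2)] assms(3) by simp
  qed
  then obtain b where "b \<in> B" "f v b \<noteq> \<zero>\<^bsub>F\<^esub>"
    by blast
  with f show ?thesis
    by (intro that[of "\<lambda>x. f x b"]) auto
qed

text \<open>The measure of \<open>V\<close> counts the pivots of \<open>V\<close> with respect to a fixed spanning list.\<close>

lemma dimension_measure: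
  assumes "fin_dim F A"
  obtains \<mu> :: "'a set \<Rightarrow> nat" and n where "\<And>V. \<mu> V \<le> n"
    "\<And>V W. subspace V \<Longrightarrow> subspace W \<Longrightarrow> V \<subset> W \<Longrightarrow> \<mu> V < \<mu> W"
proof -
  obtain S where S: "finite S" "S \<subseteq> carrier A" "lin_span F A S = carrier A"
    using assms by (auto simp: fin_dim_def)
  obtain ss where ss: "set ss = S"
    using S(1) finite_list by blast
  define n where "n = length ss"
  define fl where "fl = (\<lambda>k. comb (set (take k ss)))"
  have sub: "set (take k ss) \<subseteq> carrier A" for k
    using ss S(2) set_take_subset by fast
  have flsub: "subspace (fl k)" for k
    unfolding fl_def using sub by (intro comb_subspace) auto
  have fln: "fl n = carrier A"
  proof -
    have "S \<subseteq> fl n"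
      unfolding fl_def n_def using ss comb_incl S by simp
    then have "lin_span F A S \<subseteq> fl n"
      using flsub by (auto simp: lin_span_def)
    then show ?thesis
      using S(3) subspaceD(1)[OF flsub] by blast
  qed
  \<comment> \<open>Passing from one span of the flag to the next adds a multiple of a single
    vector. The representation need not be unique, since the spanning list may be dependent.\<close>
  have flSuc: "\<exists>c w. c \<in> carrier F \<and> w \<in> fl k \<and> v = c \<odot> ss ! k \<oplus> w"
    if k: "k < n" and v: "v \<in> fl (Suc k)" for k v
  proof -
    have s: "ss ! k \<in> carrier A"
      using k ss S(2) n_def nth_mem by blast
    define G where "G = {c \<odot> ss ! k \<oplus> w | c w. c \<in> carrier F \<and> w \<in> fl k}"
    have "subspace G"
    proof (rule subspaceI)
      show "G \<subseteq> carrier A"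
        using s subspaceD(7)[OF flsub] by (auto simp: G_def)
      have "\<zero> = \<zero>\<^bsub>F\<^esub> \<odot> ss ! k \<oplus> \<zero>"
        using s by simp
      then show "\<zero> \<in> G"
        using subspaceD(2)[OF flsub] unfolding G_def by blast
    next
      fix x y assume "x \<in> G" "y \<in> G"
      then obtain c w d u where 1: "c \<in> carrier F" "w \<in> fl k" "x = c \<odot> ss ! k \<oplus> w"
        "d \<in> carrier F" "u \<in> fl k" "y = d \<odot> ss ! k \<oplus> u"
        by (auto simp: G_def)
      have "x \<oplus> y = (c \<oplus>\<^bsub>F\<^esub> d) \<odot> ss ! k \<oplus> (w \<oplus> u)"
        using 1 s subspaceD(7)[OF flsub] by (simp add: smult_l_distr M.a_ac)
      then show "x \<oplus> y \<in> G"
        unfolding G_def using 1 subspaceD(4)[OF flsub] R.add.m_closed by blast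
    next
      fix r x assume r: "r \<in> carrier F" and "x \<in> G"
      then obtain c w where 1: "c \<in> carrier F" "w \<in> fl k" "x = c \<odot> ss ! k \<oplus> w"
        by (auto simp: G_def)
      have "r \<odot> x = (r \<otimes>\<^bsub>F\<^esub> c) \<odot> ss ! k \<oplus> r \<odot> w"
        using 1 s r subspaceD(7)[OF flsub] by (simp add: smult_r_distr smult_assoc1)
      then show "r \<odot> x \<in> G"
        unfolding G_def using 1 r subspaceD(6)[OF flsub] R.m_closed by blast
    qed
    moreover have "set (take (Suc k) ss) \<subseteq> G"
    proof
      fix x assume "x \<in> set (take (Suc k) ss)"
      then consider "x = ss ! k" | "x \<in> set (take k ss)"
        using k by (auto simp: take_Suc_conv_app_nth n_def)
      then show "x \<in> G"
      proof cases
        case 1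
        then have "x = \<one>\<^bsub>F\<^esub> \<odot> ss ! k \<oplus> \<zero>"
          using s by simp
        then show ?thesis
          unfolding G_def using subspaceD(2)[OF flsub] by blast
      next
        case 2
        then have x: "x \<in> fl k"
          unfolding fl_def using comb_incl[OF _ sub] by blast
        then have "x = \<zero>\<^bsub>F\<^esub> \<odot> ss ! k \<oplus> x"
          using s subspaceD(7)[OF flsub] by simp
        then show ?thesis
          unfolding G_def using x by blast
      qed
    qed
    ultimately have "fl (Suc k) \<subseteq> G"
      unfolding fl_def by (rule comb_least)
    then show ?thesis
      using v by (auto simp: G_def)
  qed
  \<comment> \<open>As in row reduction, \<open>k\<close> is a pivot of \<open>V\<close> when
    \<open>V\<close> contains a vector with coefficient 1 at \<open>ss ! k\<close> and remainder in
    the earlier span. The number of pivots plays the role of the dimension.\<close>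
  define pv where "pv = (\<lambda>V. {k. k < n \<and> (\<exists>w\<in>fl k. ss ! k \<oplus> w \<in> V)})"
  have fin: "finite (pv V)" for V
    by (simp add: pv_def)
  \<comment> \<open>Induction along the flag: the leading term of \<open>w\<close> is cancelled by a
    vector of \<open>V\<close> with the same pivot, and the difference lies one step lower.\<close>
  have strict: "W \<subseteq> V" if V: "subspace V" and W: "subspace W" and le: "V \<subseteq> W" and eq: "pv V = pv W"
    for V W
  proof -
    have "w \<in> V" if "k \<le> n" "w \<in> fl k" "w \<in> W" for k w
      using that
    proof (induction k arbitrary: w)
      case 0
      then have "w = \<zero>"
        by (auto simp: fl_def comb_def)
      then show ?case
        using subspaceD(2)[OF V] by simp
    next
      case (Suc k)
      have k: "k < n" and s: "ss ! k \<in> carrier A"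
        using Suc.prems ss S(2) n_def nth_mem by fastforce+
      obtain c u where c: "c \<in> carrier F" "u \<in> fl k" "w = c \<odot> ss ! k \<oplus> u"
        using flSuc[OF k Suc.prems(2)] by blast
      have u: "u \<in> carrier A" and wA: "w \<in> carrier A"
        using c(2) subspaceD(7)[OF flsub] Suc.prems subspaceD(7)[OF W] by blast+
      show ?case
      proof (cases "c = \<zero>\<^bsub>F\<^esub>")
        case True
        then have "w = u"
          using c u s by simp
        then show ?thesis
          using Suc c k by simp
      next
        case False
        then have cU: "c \<in> Units F"
          using c by (simp add: F.field_Units)
        define d where "d = inv\<^bsub>F\<^esub> c"
        have d: "d \<in> carrier F" "d \<otimes>\<^bsub>F\<^esub> c = \<one>\<^bsub>F\<^esub>" "c \<otimes>\<^bsub>F\<^esub> d = \<one>\<^bsub>F\<^esub>"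
          using cU by (auto simp: d_def)
        have dw: "d \<odot> w = ss ! k \<oplus> d \<odot> u"
          using c d s u by (simp add: smult_r_distr flip: smult_assoc1)
        have du: "d \<odot> u \<in> fl k"
          using c d subspaceD(6)[OF flsub] by blast
        have "k \<in> pv W"
          unfolding pv_def using k du dw subspaceD(6)[OF W d(1) Suc.prems(3)] by auto
        then obtain x where x: "x \<in> fl k" "ss ! k \<oplus> x \<in> V"
          using eq unfolding pv_def by blast
        have xA: "x \<in> carrier A"
          using x subspaceD(7)[OF flsub] by blast
        have duA: "d \<odot> u \<in> carrier A"
          using d u by simp
        have e: "d \<odot> w \<ominus> (ss ! k \<oplus> x) = d \<odot> u \<ominus> x"
          using add_minus_add[OF s duA s xA] dw s duA xA by simp
        have "d \<odot> w \<ominus> (ss ! k \<oplus> x) \<in> W"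
          using x le subspaceD(5)[OF W] subspaceD(6)[OF W d(1) Suc.prems(3)] by blast
        moreover have "d \<odot> u \<ominus> x \<in> fl k"
          using x du subspaceD(5)[OF flsub] by blast
        ultimately have "d \<odot> w \<ominus> (ss ! k \<oplus> x) \<in> V"
          using Suc.IH k e by simp
        then have "d \<odot> w \<in> V"
          using subspace_mem_diff[OF V _ x(2)] d wA by simp
        then have "c \<odot> (d \<odot> w) \<in> V"
          using c subspaceD(6)[OF V] by blast
        then show ?thesis
          using c d wA by (simp flip: smult_assoc1)
      qed
    qed
    then show ?thesis
      using fln subspaceD(7)[OF W] by blast
  qed
  show ?thesis
  proof (rule that[of "\<lambda>V. card (pv V)" n])
    fix V
    have "pv V \<subseteq> {..<n}"
      by (auto simp: pv_def)
    then show "card (pv V) \<le> n"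
      using card_mono[of "{..<n}" "pv V"] by simp
  next
    fix V W assume V: "subspace V" "subspace W" "V \<subset> W"
    then have "pv V \<subseteq> pv W"
      by (auto simp: pv_def)
    moreover have "pv V \<noteq> pv W"
      using strict[OF V(1,2)] V(3) by blast
    ultimately show "card (pv V) < card (pv W)"
      by (intro psubset_card_mono fin) auto
  qed
qed

lemma indep_insert:
  assumes B: "indep B" and v: "v \<in> carrier A" "v \<notin> comb B"
  shows "indep (insert v B)"
proof -
  have fin: "finite B" "B \<subseteq> carrier A"
    using B by (auto simp: indep_def)
  have vB: "v \<notin> B"
    using comb_incl[OF fin] v by blast
  have "\<forall>b\<in>insert v B. c b = \<zero>\<^bsub>F\<^esub>"
    if c: "c \<in> insert v B \<rightarrow> carrier F" and z: "(\<Oplus>b\<in>insert v B. c b \<odot> b) = \<zero>" for c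
  proof -
    have cB: "c \<in> B \<rightarrow> carrier F" "c v \<in> carrier F"
      using c by auto
    define s where "s = (\<Oplus>b\<in>B. c b \<odot> b)"
    have s: "s \<in> carrier A" "s \<in> comb B"
      using comb_closed[OF fin(2) cB(1)] cB by (auto simp: s_def comb_def)
    have vs: "c v \<odot> v \<oplus> s = \<zero>"
      using z fin vB v cB unfolding s_def by (subst (asm) M.finsum_insert) (auto simp: Pi_def)
    have cv: "c v = \<zero>\<^bsub>F\<^esub>"
    proof (rule ccontr)
      assume "c v \<noteq> \<zero>\<^bsub>F\<^esub>"
      then have cU: "c v \<in> Units F"
        using cB by (simp add: F.field_Units)
      have "c v \<odot> v = \<ominus> s"
        using vs s cB v by (metis M.minus_equality smult_closed M.minus_minus)
      then have "c v \<odot> v \<in> comb B"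
        using s subspaceD(3)[OF comb_subspace[OF fin]] by simp
      then have "inv\<^bsub>F\<^esub> (c v) \<odot> (c v \<odot> v) \<in> comb B"
        using cU subspaceD(6)[OF comb_subspace[OF fin]] by simp
      then show False
        using cU v cB by (simp flip: smult_assoc1)
    qed
    then have "s = \<zero>"
      using vs v s by simp
    then have "\<forall>b\<in>B. c b = \<zero>\<^bsub>F\<^esub>"
      using B cB by (auto simp: indep_def s_def)
    then show ?thesis
      using cv by simp
  qed
  then show ?thesis
    using fin v unfolding indep_def by blast
qed

text \<open>An independent subset of \<open>V\<close> whose span has the largest measure spans
  \<open>V\<close>: a vector outside the span could be adjoined, and that would enlarge the span
  strictly.\<close>

lemma basis_exists:
  assumes "fin_dim F A" "subspace V"
  obtains B where "basis V B"
proof -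
  obtain \<mu> :: "'a set \<Rightarrow> nat" and n where mu: "\<And>V. \<mu> V \<le> n"
    "\<And>V W. subspace V \<Longrightarrow> subspace W \<Longrightarrow> V \<subset> W \<Longrightarrow> \<mu> V < \<mu> W"
    using dimension_measure[OF assms(1)] by metis
  define P where "P = (\<lambda>B. indep B \<and> B \<subseteq> V)"
  have "P {}"
    by (simp add: P_def indep_def)
  moreover have "\<forall>B. P B \<longrightarrow> \<mu> (comb B) < Suc n"
    using mu(1) by (simp add: less_Suc_eq_le)
  ultimately obtain B where B: "P B" "\<forall>C. P C \<longrightarrow> \<mu> (comb C) \<le> \<mu> (comb B)"
    using ex_has_greatest_nat[of P "{}" "\<lambda>B. \<mu> (comb B)" "Suc n"] by blast
  have B': "indep B" "B \<subseteq> V" "finite B" "B \<subseteq> carrier A"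
    using B by (auto simp: P_def indep_def)
  have "comb B = V"
  proof (rule ccontr)
    assume "comb B \<noteq> V"
    then obtain v where v: "v \<in> V" "v \<notin> comb B"
      using comb_least[OF assms(2) B'(2)] by blast
    have vA: "v \<in> carrier A"
      using v subspaceD(7)[OF assms(2)] by blast
    have i: "indep (insert v B)"
      using indep_insert[OF B'(1) vA v(2)] .
    then have P: "P (insert v B)"
      using B' v by (simp add: P_def)
    have s: "subspace (comb (insert v B))"
      using i by (intro comb_subspace) (auto simp: indep_def)
    have "insert v B \<subseteq> comb (insert v B)"
      using i by (intro comb_incl) (auto simp: indep_def)
    then have "comb B \<subset> comb (insert v B)"
      using comb_least[OF s, of B] v by blast
    then have "\<mu> (comb B) < \<mu> (comb (insert v B))"
      using mu(2) s comb_subspace B' by blast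
    then show False
      using B(2) P by force
  qed
  then show ?thesis
    using that B' by (auto simp: basis_def)
qed

text \<open>The measure decreases along proper inclusions, so a member of least measure below
  \<open>V\<close> is minimal for inclusion. It is used for ideals of the nucleus.\<close>

lemma minimal_subspace:
  assumes "fin_dim F A" "P V" "\<And>V. P V \<Longrightarrow> subspace V"
  obtains W where "P W" "W \<subseteq> V" "\<And>U. P U \<Longrightarrow> U \<subseteq> W \<Longrightarrow> U = W"
proof -
  obtain \<mu> :: "'a set \<Rightarrow> nat" and n where mu: "\<And>V. \<mu> V \<le> n"
    "\<And>V W. subspace V \<Longrightarrow> subspace W \<Longrightarrow> V \<subset> W \<Longrightarrow> \<mu> V < \<mu> W"
    using dimension_measure[OF assms(1)] by metis
  obtain W where W: "P W \<and> W \<subseteq> V" "\<forall>U. P U \<and> U \<subseteq> V \<longrightarrow> \<mu> W \<le> \<mu> U"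
    using ex_has_least_nat[of "\<lambda>W. P W \<and> W \<subseteq> V" V \<mu>] assms(2) by blast
  have "U = W" if "P U" "U \<subseteq> W" for U
  proof (rule ccontr)
    assume "U \<noteq> W"
    then have "\<mu> U < \<mu> W"
      using that mu(2) assms(3) W(1) by blast
    then show False
      using that W by (meson leD subset_trans)
  qed
  then show ?thesis
    using that W(1) by blast
qed

end

section \<open>The Jacobson radical\<close>

context ring begin

lemma left_idealD:
  assumes "left_ideal L R"
  shows "L \<subseteq> carrier R" "\<zero> \<in> L" "\<And>x y. x \<in> L \<Longrightarrow> y \<in> L \<Longrightarrow> x \<oplus> y \<in> L"
    "\<And>r x. r \<in> carrier R \<Longrightarrow> x \<in> L \<Longrightarrow> r \<otimes> x \<in> L"
  using assms
  by (auto simp: left_ideal_def additive_subgroup.a_subset additive_subgroup.zero_closed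
      additive_subgroup.a_closed dest: subsetD[OF additive_subgroup.a_subset])

lemma left_idealI:
  assumes "L \<subseteq> carrier R" "\<zero> \<in> L" "\<And>x y. x \<in> L \<Longrightarrow> y \<in> L \<Longrightarrow> x \<oplus> y \<in> L"
    "\<And>r x. r \<in> carrier R \<Longrightarrow> x \<in> L \<Longrightarrow> r \<otimes> x \<in> L"
  shows "left_ideal L R"
proof -
  have "\<ominus> x \<in> L" if "x \<in> L" for x
    using assms(4)[of "\<ominus> \<one>" x] that assms(1) by (auto simp: l_minus)
  then have "subgroup L (add_monoid R)"
    using assms by (intro add.subgroupI) (auto simp: a_inv_def)
  then show ?thesis
    using assms by (auto simp: left_ideal_def intro: additive_subgroupI)
qed

text \<open>Zorn's lemma for the left ideals above \<open>I\<close> that avoid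
  \<open>\<one>\<close>. A maximal one among them is maximal among all proper left ideals, as
  containing \<open>\<one>\<close> means being everything.\<close>

lemma maximal_left_ideal_exists:
  assumes I: "left_ideal I R" "\<one> \<notin> I"
  obtains M where "maximal_left_ideal M R" "I \<subseteq> M"
proof -
  define P where "P = {J. left_ideal J R \<and> I \<subseteq> J \<and> \<one> \<notin> J}"
  have "\<Union>C \<in> P" if C: "C \<noteq> {}" "subset.chain P C" for C
  proof -
    have CP: "J \<in> P" if "J \<in> C" for J
      using C that by (auto simp: subset.chain_def)
    obtain J0 where J0: "J0 \<in> C"
      using C by blast
    have "left_ideal (\<Union>C) R"
    proof (rule left_idealI)
      show "\<Union>C \<subseteq> carrier R"
        using CP left_idealD(1) by (auto simp: P_def)
      show "\<zero> \<in> \<Union>C"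
        using CP[OF J0] J0 left_idealD(2) by (auto simp: P_def)
    next
      fix x y assume "x \<in> \<Union>C" "y \<in> \<Union>C"
      then obtain J K where JK: "J \<in> C" "K \<in> C" "x \<in> J" "y \<in> K"
        by blast
      then obtain L where L: "L \<in> C" "x \<in> L" "y \<in> L"
        using C(2) unfolding subset.chain_def by blast
      then show "x \<oplus> y \<in> \<Union>C"
        using CP[OF L(1)] left_idealD(3)[of L x y] by (auto simp: P_def)
    next
      fix r x assume "r \<in> carrier R" "x \<in> \<Union>C"
      then show "r \<otimes> x \<in> \<Union>C"
        using CP left_idealD(4) unfolding P_def by blast
    qed
    moreover have "I \<subseteq> \<Union>C" "\<one> \<notin> \<Union>C"
      using CP J0 by (auto simp: P_def)
    ultimately show ?thesis
      by (simp add: P_def)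
  qed
  moreover have "P \<noteq> {}"
    using I by (auto simp: P_def)
  ultimately obtain M where M: "M \<in> P" "\<forall>J\<in>P. M \<subseteq> J \<longrightarrow> J = M"
    using subset_Zorn_nonempty[of P] by blast
  have "maximal_left_ideal M R"
    unfolding maximal_left_ideal_def
  proof (intro conjI allI impI)
    show "left_ideal M R" "M \<noteq> carrier R"
      using M by (auto simp: P_def)
    fix J assume J: "left_ideal J R \<and> M \<subseteq> J"
    show "J = M \<or> J = carrier R"
    proof (cases "\<one> \<in> J")
      case True
      have "r \<in> J" if "r \<in> carrier R" for r
        using left_idealD(4)[of J r \<one>] J True that by simp
      then show ?thesis
        using J left_idealD(1) by blast
    next
      case False
      then show ?thesis
        using M J unfolding P_def by blast
    qed
  qed
  then show ?thesis
    using that M by (auto simp: P_def)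
qed

text \<open>The map \<open>y \<mapsto> y r\<close> embeds \<open>R / L\<close> into the simple
  module \<open>R / M\<close>, so \<open>R / L\<close> is zero or simple.\<close>

lemma maximal_left_ideal_colon:
  assumes M: "maximal_left_ideal M R" and r: "r \<in> carrier R"
  defines "L \<equiv> {y \<in> carrier R. y \<otimes> r \<in> M}"
  shows "L = carrier R \<or> maximal_left_ideal L R"
proof (rule disjCI)
  assume nm: "\<not> maximal_left_ideal L R"
  have MI: "left_ideal M R"
    using M by (simp add: maximal_left_ideal_def)
  note MD = left_idealD[OF MI]
  have L: "left_ideal L R"
    unfolding L_def
  proof (rule left_idealI, goal_cases)
    case (3 x y)
    then show ?case
      using MD r by (auto simp: l_distr)
  next
    case (4 s x)
    then show ?case
      using MD r by (auto simp: m_assoc)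
  qed (use MD r in auto)
  show "L = carrier R"
  proof (rule ccontr)
    assume ne: "L \<noteq> carrier R"
    then obtain J where J: "left_ideal J R" "L \<subseteq> J" "J \<noteq> L" "J \<noteq> carrier R"
      using nm L by (auto simp: maximal_left_ideal_def)
    then obtain y where y: "y \<in> J" "y \<notin> L"
      by blast
    have yR: "y \<in> carrier R"
      using y left_idealD(1)[OF J(1)] by blast
    \<comment> \<open>Since \<open>y \<otimes> r\<close> is not in \<open>M\<close>, maximality
      forces this left ideal to be everything. Each \<open>s\<close> then differs from a multiple of
      \<open>y\<close> by an element of \<open>L\<close>, which puts \<open>s\<close> into
      \<open>J\<close>.\<close>
    define H where "H = {m \<oplus> n \<otimes> (y \<otimes> r) | m n. m \<in> M \<and> n \<in> carrier R}"
    have "left_ideal H R"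
    proof (rule left_idealI)
      show "H \<subseteq> carrier R"
        using MD yR r by (auto simp: H_def)
      have "\<zero> = \<zero> \<oplus> \<zero> \<otimes> (y \<otimes> r)"
        using yR r by simp
      then show "\<zero> \<in> H"
        unfolding H_def using MD(2) by blast
    next
      fix a b assume "a \<in> H" "b \<in> H"
      then obtain m n m' n' where *: "m \<in> M" "n \<in> carrier R" "a = m \<oplus> n \<otimes> (y \<otimes> r)"
        "m' \<in> M" "n' \<in> carrier R" "b = m' \<oplus> n' \<otimes> (y \<otimes> r)"
        by (auto simp: H_def)
      moreover have "m \<in> carrier R" "m' \<in> carrier R"
        using * MD by auto
      ultimately have "a \<oplus> b = (m \<oplus> m') \<oplus> (n \<oplus> n') \<otimes> (y \<otimes> r)"
        using yR r by (simp add: l_distr a_ac)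
      then show "a \<oplus> b \<in> H"
        unfolding H_def using * MD(3) add.m_closed by blast
    next
      fix s a assume s: "s \<in> carrier R" and "a \<in> H"
      then obtain m n where *: "m \<in> M" "n \<in> carrier R" "a = m \<oplus> n \<otimes> (y \<otimes> r)"
        by (auto simp: H_def)
      moreover have "m \<in> carrier R"
        using * MD by auto
      ultimately have "s \<otimes> a = s \<otimes> m \<oplus> (s \<otimes> n) \<otimes> (y \<otimes> r)"
        using yR r s by (simp add: r_distr m_assoc)
      then show "s \<otimes> a \<in> H"
        unfolding H_def using * s MD(4) m_closed by blast
    qed
    moreover have "M \<subseteq> H"
    proof
      fix m assume m: "m \<in> M"
      then have "m = m \<oplus> \<zero> \<otimes> (y \<otimes> r)"
        using MD yR r by auto
      then show "m \<in> H"
        unfolding H_def using m by blast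
    qed
    moreover have "y \<otimes> r \<in> H"
    proof -
      have "y \<otimes> r = \<zero> \<oplus> \<one> \<otimes> (y \<otimes> r)"
        using yR r by simp
      then show ?thesis
        unfolding H_def using MD(2) by blast
    qed
    moreover have "y \<otimes> r \<notin> M"
      using y yR by (auto simp: L_def)
    ultimately have H: "H = carrier R"
      using M unfolding maximal_left_ideal_def by blast
    have "s \<in> J" if s: "s \<in> carrier R" for s
    proof -
      have "s \<otimes> r \<in> H"
        using H s r by simp
      then obtain m n where *: "m \<in> M" "n \<in> carrier R" "s \<otimes> r = m \<oplus> n \<otimes> (y \<otimes> r)"
        by (auto simp: H_def)
      have mR: "m \<in> carrier R"
        using * MD by auto
      have "(s \<ominus> n \<otimes> y) \<otimes> r = s \<otimes> r \<ominus> n \<otimes> (y \<otimes> r)"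
        using s r yR * by (simp add: minus_eq l_distr l_minus m_assoc)
      also have "\<dots> = m"
        using * mR yR r by (simp add: minus_eq a_assoc r_neg)
      finally have "s \<ominus> n \<otimes> y \<in> L"
        using * s yR by (simp add: L_def)
      then have "s \<ominus> n \<otimes> y \<in> J" "n \<otimes> y \<in> J"
        using J(2) * y left_idealD(4)[OF J(1)] by auto
      then have "(s \<ominus> n \<otimes> y) \<oplus> n \<otimes> y \<in> J"
        using left_idealD(3)[OF J(1)] by blast
      then show ?thesis
        using s * yR by (simp add: minus_eq a_assoc l_neg)
    qed
    then show False
      using J left_idealD(1)[OF J(1)] by blast
  qed
qed

text \<open>Closure under right multiplication comes from the colon ideals:
  \<open>a \<otimes> x\<close> lies in a maximal left ideal \<open>M\<close> because
  \<open>a\<close> lies in the set of all \<open>y\<close> with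
  \<open>y \<otimes> x \<in> M\<close>, which is itself maximal or the whole ring.\<close>

lemma jacobson_radical_ideal: "ideal (jacobson_radical R) R"
proof -
  have max: "left_ideal M R" if "maximal_left_ideal M R" for M
    using that by (simp add: maximal_left_ideal_def)
  have L: "left_ideal (jacobson_radical R) R"
    unfolding jacobson_radical_def
    by (rule left_idealI) (use left_idealD[OF max] in auto)
  show ?thesis
  proof (intro ideal.intro ideal_axioms.intro)
    show "additive_subgroup (jacobson_radical R) R"
      using L by (simp add: left_ideal_def)
    show "ring R"
      by (rule ring_axioms)
  next
    fix a x assume "a \<in> jacobson_radical R" "x \<in> carrier R"
    then show "x \<otimes> a \<in> jacobson_radical R"
      using left_idealD(4)[OF L] by blast
  next
    fix a x assume a: "a \<in> jacobson_radical R" and x: "x \<in> carrier R"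
    have "a \<otimes> x \<in> M" if "maximal_left_ideal M R" for M
      using maximal_left_ideal_colon[OF that x] a by (auto simp: jacobson_radical_def)
    then show "a \<otimes> x \<in> jacobson_radical R"
      using a x by (auto simp: jacobson_radical_def)
  qed
qed

text \<open>If \<open>e\<close> were nonzero, the left ideal generated by
  \<open>\<one> \<ominus> e\<close> would be proper, being annihilated by \<open>e\<close> on the
  right. A maximal left ideal above it would contain both \<open>\<one> \<ominus> e\<close> and
  \<open>e\<close>.\<close>

lemma jacobson_radical_idempotent:
  assumes e: "e \<in> jacobson_radical R" "e \<otimes> e = e"
  shows "e = \<zero>"
proof (rule ccontr)
  assume ne: "e \<noteq> \<zero>"
  have eR: "e \<in> carrier R"
    using e by (simp add: jacobson_radical_def)
  define L where "L = {n \<otimes> (\<one> \<ominus> e) | n. n \<in> carrier R}"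
  have L: "left_ideal L R"
  proof (rule left_idealI)
    have "\<zero> = \<zero> \<otimes> (\<one> \<ominus> e)"
      using eR by simp
    then show "\<zero> \<in> L"
      unfolding L_def by blast
  next
    fix x y assume "x \<in> L" "y \<in> L"
    then obtain n m where *: "n \<in> carrier R" "m \<in> carrier R" "x = n \<otimes> (\<one> \<ominus> e)" "y = m \<otimes> (\<one> \<ominus> e)"
      by (auto simp: L_def)
    then have "x \<oplus> y = (n \<oplus> m) \<otimes> (\<one> \<ominus> e)"
      using eR by (simp add: l_distr)
    then show "x \<oplus> y \<in> L"
      unfolding L_def using * add.m_closed by blast
  next
    fix r x assume r: "r \<in> carrier R" and "x \<in> L"
    then obtain n where *: "n \<in> carrier R" "x = n \<otimes> (\<one> \<ominus> e)"
      by (auto simp: L_def)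
    then have "r \<otimes> x = (r \<otimes> n) \<otimes> (\<one> \<ominus> e)"
      using eR r by (simp add: m_assoc)
    then show "r \<otimes> x \<in> L"
      unfolding L_def using * r m_closed by blast
  qed (use eR in \<open>auto simp: L_def\<close>)
  have eL: "(\<one> \<ominus> e) \<otimes> e = \<zero>"
    using eR e by (simp add: minus_eq l_distr l_minus r_neg)
  have "\<one> \<notin> L"
  proof
    assume "\<one> \<in> L"
    then obtain n where n: "n \<in> carrier R" "\<one> = n \<otimes> (\<one> \<ominus> e)"
      by (auto simp: L_def)
    have "e = n \<otimes> (\<one> \<ominus> e) \<otimes> e"
      using n(2) eR by simp
    also have "\<dots> = \<zero>"
      using n(1) eR eL by (simp add: m_assoc)
    finally show False
      using ne by simp
  qed
  then obtain M where M: "maximal_left_ideal M R" "L \<subseteq> M"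
    using maximal_left_ideal_exists[OF L] by blast
  have MI: "left_ideal M R"
    using M by (simp add: maximal_left_ideal_def)
  have "e \<in> M"
    using e M by (auto simp: jacobson_radical_def)
  moreover have "\<one> \<ominus> e \<in> M"
    using M eR unfolding L_def by (auto intro!: exI[of _ \<one>])
  ultimately have "(\<one> \<ominus> e) \<oplus> e \<in> M"
    using left_idealD(3)[OF MI] by blast
  then have "\<one> \<in> M"
    using eR by (simp add: minus_eq a_assoc l_neg)
  then have "M = carrier R"
    using left_idealD(1,4)[OF MI] by (metis r_one subsetI subset_antisym)
  then show False
    using M by (simp add: maximal_left_ideal_def)
qed

end

section \<open>Linear maps on tensor products\<close>

text \<open>Stated for modules, so that one development serves both tensor products of the proof:
  \<open>K\<close> with itself, and \<open>D\<close> with the skew matrix algebra.\<close>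

locale two_modules = F: field F + A: module F A + B: module F B
  for F :: "('f, 'x) ring_scheme" and A :: "('f, 'a) module" and B :: "('f, 'b) module"
begin

abbreviation "T \<equiv> free_alg F A B"
abbreviation "I \<equiv> tensor_ideal F A B"

lemma T_mem:
  "f \<in> carrier T \<longleftrightarrow> (\<forall>p. f p \<in> carrier F) \<and> (\<forall>p. p \<notin> carrier A \<times> carrier B \<longrightarrow> f p = \<zero>\<^bsub>F\<^esub>) \<and>
    finite {p. f p \<noteq> \<zero>\<^bsub>F\<^esub>}"
  unfolding free_alg_def by (auto; metis F.zero_closed)

lemma T_sel: "f \<oplus>\<^bsub>T\<^esub> g = (\<lambda>p. f p \<oplus>\<^bsub>F\<^esub> g p)" "\<zero>\<^bsub>T\<^esub> = (\<lambda>p. \<zero>\<^bsub>F\<^esub>)"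
  "c \<odot>\<^bsub>T\<^esub> f = (\<lambda>p. c \<otimes>\<^bsub>F\<^esub> f p)"
  by (simp_all add: free_alg_def)

lemma T_val [simp]: "f \<in> carrier T \<Longrightarrow> f p \<in> carrier F"
  using T_mem by blast

lemma T_support:
  "f \<in> carrier T \<Longrightarrow> finite {p. f p \<noteq> \<zero>\<^bsub>F\<^esub>}"
  "f \<in> carrier T \<Longrightarrow> {p. f p \<noteq> \<zero>\<^bsub>F\<^esub>} \<subseteq> carrier A \<times> carrier B"
  using T_mem by blast+

lemma T_support_mem:
  "f (a, b) \<noteq> \<zero>\<^bsub>F\<^esub> \<Longrightarrow> f \<in> carrier T \<Longrightarrow> a \<in> carrier A \<and> b \<in> carrier B"
  using T_support(2) by blast

lemma T_memI:
  assumes "\<And>p. f p \<in> carrier F" "\<And>p. f p \<noteq> \<zero>\<^bsub>F\<^esub> \<Longrightarrow> p \<in> S" "finite S"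
    "S \<subseteq> carrier A \<times> carrier B"
  shows "f \<in> carrier T"
proof -
  have "{p. f p \<noteq> \<zero>\<^bsub>F\<^esub>} \<subseteq> S"
    using assms(2) by blast
  then show ?thesis
    using assms finite_subset unfolding T_mem by blast
qed

lemma T_add: "f \<in> carrier T \<Longrightarrow> g \<in> carrier T \<Longrightarrow> f \<oplus>\<^bsub>T\<^esub> g \<in> carrier T"
  by (rule T_memI[of _ "{p. f p \<noteq> \<zero>\<^bsub>F\<^esub>} \<union> {p. g p \<noteq> \<zero>\<^bsub>F\<^esub>}"]) (auto simp: T_sel T_support(1) dest: T_support_mem)

lemma T_smult: "c \<in> carrier F \<Longrightarrow> f \<in> carrier T \<Longrightarrow> c \<odot>\<^bsub>T\<^esub> f \<in> carrier T"
  by (rule T_memI[of _ "{p. f p \<noteq> \<zero>\<^bsub>F\<^esub>}"]) (auto simp: T_sel T_support(1) dest: T_support_mem)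

lemma T_zero: "\<zero>\<^bsub>T\<^esub> \<in> carrier T"
  by (rule T_memI[of _ "{}"]) (auto simp: T_sel)

lemma free_gen_mem: "a \<in> carrier A \<Longrightarrow> b \<in> carrier B \<Longrightarrow> free_gen F a b \<in> carrier T"
  by (rule T_memI[of _ "{(a, b)}"]) (auto simp: free_gen_def split: if_splits)

lemma T_module: "module F T"
proof (rule moduleI)
  show "cring F"
    by (rule F.cring_axioms)
  show "abelian_group T"
  proof (rule abelian_groupI)
    fix f assume f: "f \<in> carrier T"
    then have "(\<lambda>p. \<ominus>\<^bsub>F\<^esub> f p) \<in> carrier T"
      by (intro T_memI[of _ "{p. f p \<noteq> \<zero>\<^bsub>F\<^esub>}"]) (auto simp: T_support(1) dest: T_support_mem)
    moreover have "(\<lambda>p. \<ominus>\<^bsub>F\<^esub> f p) \<oplus>\<^bsub>T\<^esub> f = \<zero>\<^bsub>T\<^esub>"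
      using f by (auto simp: T_sel F.l_neg)
    ultimately show "\<exists>g\<in>carrier T. g \<oplus>\<^bsub>T\<^esub> f = \<zero>\<^bsub>T\<^esub>"
      by blast
  next
    fix f g assume "f \<in> carrier T" "g \<in> carrier T"
    then show "f \<oplus>\<^bsub>T\<^esub> g = g \<oplus>\<^bsub>T\<^esub> f"
      unfolding T_sel by (intro ext) (simp add: F.a_comm)
  next
    fix f g h assume "f \<in> carrier T" "g \<in> carrier T" "h \<in> carrier T"
    then show "f \<oplus>\<^bsub>T\<^esub> g \<oplus>\<^bsub>T\<^esub> h = f \<oplus>\<^bsub>T\<^esub> (g \<oplus>\<^bsub>T\<^esub> h)"
      by (simp add: T_sel F.a_assoc)
  next
    fix f assume "f \<in> carrier T"
    then show "\<zero>\<^bsub>T\<^esub> \<oplus>\<^bsub>T\<^esub> f = f"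
      by (simp add: T_sel)
  qed (use T_add T_zero in auto)
next
  fix a b f assume "a \<in> carrier F" "b \<in> carrier F" "f \<in> carrier T"
  then show "(a \<oplus>\<^bsub>F\<^esub> b) \<odot>\<^bsub>T\<^esub> f = a \<odot>\<^bsub>T\<^esub> f \<oplus>\<^bsub>T\<^esub> b \<odot>\<^bsub>T\<^esub> f"
    by (simp add: T_sel F.l_distr)
next
  fix a f g assume "a \<in> carrier F" "f \<in> carrier T" "g \<in> carrier T"
  then show "a \<odot>\<^bsub>T\<^esub> (f \<oplus>\<^bsub>T\<^esub> g) = a \<odot>\<^bsub>T\<^esub> f \<oplus>\<^bsub>T\<^esub> a \<odot>\<^bsub>T\<^esub> g"
    by (simp add: T_sel F.r_distr)
next
  fix a b f assume "a \<in> carrier F" "b \<in> carrier F" "f \<in> carrier T"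
  then show "(a \<otimes>\<^bsub>F\<^esub> b) \<odot>\<^bsub>T\<^esub> f = a \<odot>\<^bsub>T\<^esub> (b \<odot>\<^bsub>T\<^esub> f)"
    by (simp add: T_sel F.m_assoc)
next
  fix f assume "f \<in> carrier T"
  then show "\<one>\<^bsub>F\<^esub> \<odot>\<^bsub>T\<^esub> f = f"
    by (simp add: T_sel)
qed (use T_smult in auto)

sublocale T: module F T
  by (rule T_module)

lemma tensor_relations_subset: "tensor_relations F A B \<subseteq> carrier T"
  unfolding tensor_relations_def Let_def
  by (auto intro!: T.minus_closed T_add T_smult free_gen_mem A.smult_closed B.smult_closed)

lemma tensor_ideal_submodule: "submodule I F T"
proof (rule T.submoduleI)
  show "I \<subseteq> carrier T"
    unfolding tensor_ideal_def lin_span_def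
    using T.carrier_is_submodule tensor_relations_subset by blast
qed (auto simp: tensor_ideal_def lin_span_def dest: T.submoduleE submodule.axioms(1)
    intro: subgroup.one_closed[of _ "add_monoid T", simplified])

lemma I_carr: "f \<in> I \<Longrightarrow> f \<in> carrier T"
  using T.submoduleE(1)[OF tensor_ideal_submodule] by blast

lemma I_zero: "\<zero>\<^bsub>T\<^esub> \<in> I"
  using subgroup.one_closed[OF submodule.axioms(1)[OF tensor_ideal_submodule]] by simp

lemma tensor_relations_ideal: "tensor_relations F A B \<subseteq> I"
  by (auto simp: tensor_ideal_def lin_span_def)

lemma tensor_ideal_least: "submodule H F T \<Longrightarrow> tensor_relations F A B \<subseteq> H \<Longrightarrow> I \<subseteq> H"
  by (auto simp: tensor_ideal_def lin_span_def)

end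

text \<open>The linear extension of \<open>\<beta>\<close> from the generators to the free module.
  For \<open>\<beta> p = (fst p \<otimes> a) \<otimes> snd p\<close> it is the sum inside
  \<open>bimod_act\<close>.\<close>

definition free_eval ::
  "('f, 'x) ring_scheme \<Rightarrow> ('f, 'm, 'y) module_scheme \<Rightarrow> ('p \<Rightarrow> 'm) \<Rightarrow> ('p \<Rightarrow> 'f) \<Rightarrow> 'm" where
  "free_eval F M \<beta> f = (\<Oplus>\<^bsub>M\<^esub>p \<in> {p. f p \<noteq> \<zero>\<^bsub>F\<^esub>}. f p \<odot>\<^bsub>M\<^esub> \<beta> p)"

locale bilinear_map = two_modules F A B + M: module F M
  for F :: "('f, 'x) ring_scheme" and A :: "('f, 'a) module" and B :: "('f, 'b) module"
    and M :: "('f, 'm, 'y) module_scheme" +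
  fixes \<beta> :: "'a \<times> 'b \<Rightarrow> 'm"
  assumes beta_closed: "a \<in> carrier A \<Longrightarrow> b \<in> carrier B \<Longrightarrow> \<beta> (a, b) \<in> carrier M"
    and beta_add_l: "\<lbrakk>a \<in> carrier A; a' \<in> carrier A; b \<in> carrier B\<rbrakk>
      \<Longrightarrow> \<beta> (a \<oplus>\<^bsub>A\<^esub> a', b) = \<beta> (a, b) \<oplus>\<^bsub>M\<^esub> \<beta> (a', b)"
    and beta_add_r: "\<lbrakk>a \<in> carrier A; b \<in> carrier B; b' \<in> carrier B\<rbrakk>
      \<Longrightarrow> \<beta> (a, b \<oplus>\<^bsub>B\<^esub> b') = \<beta> (a, b) \<oplus>\<^bsub>M\<^esub> \<beta> (a, b')"
    and beta_smult_l: "\<lbrakk>c \<in> carrier F; a \<in> carrier A; b \<in> carrier B\<rbrakk>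
      \<Longrightarrow> \<beta> (c \<odot>\<^bsub>A\<^esub> a, b) = c \<odot>\<^bsub>M\<^esub> \<beta> (a, b)"
    and beta_smult_r: "\<lbrakk>c \<in> carrier F; a \<in> carrier A; b \<in> carrier B\<rbrakk>
      \<Longrightarrow> \<beta> (a, c \<odot>\<^bsub>B\<^esub> b) = c \<odot>\<^bsub>M\<^esub> \<beta> (a, b)"
begin

abbreviation "ev \<equiv> free_eval F M \<beta>"

lemma beta_closed': "p \<in> carrier A \<times> carrier B \<Longrightarrow> \<beta> p \<in> carrier M"
  using beta_closed by (cases p) auto

text \<open>Elements of the free module have different supports; summing over a common finite
  superset makes their values comparable.\<close>

lemma ev_superset:
  assumes f: "f \<in> carrier T" and S: "finite S" "{p. f p \<noteq> \<zero>\<^bsub>F\<^esub>} \<subseteq> S" "S \<subseteq> carrier A \<times> carrier B"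
  shows "ev f = (\<Oplus>\<^bsub>M\<^esub>p\<in>S. f p \<odot>\<^bsub>M\<^esub> \<beta> p)"
  unfolding free_eval_def
proof (rule M.add.finprod_mono_neutral_cong_left)
  show "finite S" "{p. f p \<noteq> \<zero>\<^bsub>F\<^esub>} \<subseteq> S"
    using S by auto
next
  show "f i \<odot>\<^bsub>M\<^esub> \<beta> i = \<zero>\<^bsub>M\<^esub>" if "i \<in> S - {p. f p \<noteq> \<zero>\<^bsub>F\<^esub>}" for i
    using that S beta_closed' by auto
  show "(\<lambda>p. f p \<odot>\<^bsub>M\<^esub> \<beta> p) \<in> S \<rightarrow> carrier M"
    using f S beta_closed' by auto
qed (use S in auto)

lemma ev_closed: "f \<in> carrier T \<Longrightarrow> ev f \<in> carrier M"
  unfolding free_eval_def using beta_closed' T_support(2)[of f] T_val[of f]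
  by (intro M.finsum_closed Pi_I M.smult_closed) blast+

lemma ev_add:
  assumes f: "f \<in> carrier T" and g: "g \<in> carrier T"
  shows "ev (f \<oplus>\<^bsub>T\<^esub> g) = ev f \<oplus>\<^bsub>M\<^esub> ev g"
proof -
  define S where "S = {p. f p \<noteq> \<zero>\<^bsub>F\<^esub>} \<union> {p. g p \<noteq> \<zero>\<^bsub>F\<^esub>}"
  have S: "finite S" "S \<subseteq> carrier A \<times> carrier B"
    using f g T_support[of f] T_support[of g] by (auto simp: S_def)
  have "{p. f p \<noteq> \<zero>\<^bsub>F\<^esub>} \<subseteq> S" "{p. g p \<noteq> \<zero>\<^bsub>F\<^esub>} \<subseteq> S" "{p. (f \<oplus>\<^bsub>T\<^esub> g) p \<noteq> \<zero>\<^bsub>F\<^esub>} \<subseteq> S"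
    using f g by (auto simp: S_def T_sel)
  then have *: "ev f = (\<Oplus>\<^bsub>M\<^esub>p\<in>S. f p \<odot>\<^bsub>M\<^esub> \<beta> p)" "ev g = (\<Oplus>\<^bsub>M\<^esub>p\<in>S. g p \<odot>\<^bsub>M\<^esub> \<beta> p)"
    "ev (f \<oplus>\<^bsub>T\<^esub> g) = (\<Oplus>\<^bsub>M\<^esub>p\<in>S. (f \<oplus>\<^bsub>T\<^esub> g) p \<odot>\<^bsub>M\<^esub> \<beta> p)"
    using S f g T_add[OF f g] ev_superset by blast+
  have c: "f p \<in> carrier F" "g p \<in> carrier F" for p
    using f g by auto
  have b: "\<beta> p \<in> carrier M" if "p \<in> S" for p
    using that S beta_closed' by blast
  have "(\<Oplus>\<^bsub>M\<^esub>p\<in>S. (f \<oplus>\<^bsub>T\<^esub> g) p \<odot>\<^bsub>M\<^esub> \<beta> p) = (\<Oplus>\<^bsub>M\<^esub>p\<in>S. f p \<odot>\<^bsub>M\<^esub> \<beta> p \<oplus>\<^bsub>M\<^esub> g p \<odot>\<^bsub>M\<^esub> \<beta> p)"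
    using b c by (intro M.finsum_cong') (auto simp: T_sel M.smult_l_distr)
  also have "\<dots> = ev f \<oplus>\<^bsub>M\<^esub> ev g"
    unfolding * using b c by (intro M.finsum_addf) auto
  finally show ?thesis
    using * by simp
qed

lemma ev_smult:
  assumes r: "r \<in> carrier F" and f: "f \<in> carrier T"
  shows "ev (r \<odot>\<^bsub>T\<^esub> f) = r \<odot>\<^bsub>M\<^esub> ev f"
proof -
  define S where "S = {p. f p \<noteq> \<zero>\<^bsub>F\<^esub>}"
  have S: "finite S" "S \<subseteq> carrier A \<times> carrier B"
    using f T_support[of f] by (auto simp: S_def)
  have "{p. (r \<odot>\<^bsub>T\<^esub> f) p \<noteq> \<zero>\<^bsub>F\<^esub>} \<subseteq> S"
    using f r by (auto simp: S_def T_sel)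
  then have *: "ev (r \<odot>\<^bsub>T\<^esub> f) = (\<Oplus>\<^bsub>M\<^esub>p\<in>S. (r \<odot>\<^bsub>T\<^esub> f) p \<odot>\<^bsub>M\<^esub> \<beta> p)"
    using S r f T_smult ev_superset by blast
  have c: "f p \<in> carrier F" for p
    using f by auto
  have b: "\<beta> p \<in> carrier M" if "p \<in> S" for p
    using that S beta_closed' by blast
  have "(\<Oplus>\<^bsub>M\<^esub>p\<in>S. (r \<odot>\<^bsub>T\<^esub> f) p \<odot>\<^bsub>M\<^esub> \<beta> p) = (\<Oplus>\<^bsub>M\<^esub>p\<in>S. r \<odot>\<^bsub>M\<^esub> (f p \<odot>\<^bsub>M\<^esub> \<beta> p))"
    using b c r by (intro M.finsum_cong') (auto simp: T_sel M.smult_assoc1)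
  also have "\<dots> = r \<odot>\<^bsub>M\<^esub> ev f"
    unfolding free_eval_def S_def[symmetric]
    using b c S r by (intro M.finsum_smult_ldistr[symmetric]) auto
  finally show ?thesis
    using * by simp
qed

lemma ev_zero: "ev \<zero>\<^bsub>T\<^esub> = \<zero>\<^bsub>M\<^esub>"
  by (simp add: free_eval_def T_sel)

lemma ev_neg:
  assumes f: "f \<in> carrier T"
  shows "ev (\<ominus>\<^bsub>T\<^esub> f) = \<ominus>\<^bsub>M\<^esub> ev f"
proof -
  have "\<ominus>\<^bsub>T\<^esub> f = (\<ominus>\<^bsub>F\<^esub> \<one>\<^bsub>F\<^esub>) \<odot>\<^bsub>T\<^esub> f"
    using f by (simp add: T.smult_l_minus)
  then show ?thesis
    using f ev_closed[OF f] by (simp add: ev_smult M.smult_l_minus)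
qed

lemma ev_minus: "f \<in> carrier T \<Longrightarrow> g \<in> carrier T \<Longrightarrow> ev (f \<ominus>\<^bsub>T\<^esub> g) = ev f \<ominus>\<^bsub>M\<^esub> ev g"
  by (simp add: a_minus_def ev_add ev_neg)

lemma ev_gen:
  assumes "a \<in> carrier A" "b \<in> carrier B"
  shows "ev (free_gen F a b) = \<beta> (a, b)"
proof -
  have "ev (free_gen F a b) = (\<Oplus>\<^bsub>M\<^esub>p\<in>{(a, b)}. free_gen F a b p \<odot>\<^bsub>M\<^esub> \<beta> p)"
    using assms free_gen_mem by (intro ev_superset) (auto simp: free_gen_def split: if_splits)
  also have "\<dots> = \<beta> (a, b)"
    using beta_closed[OF assms] by (simp add: free_gen_def)
  finally show ?thesis .
qed

lemma ev_kernel: "submodule {f \<in> carrier T. ev f = \<zero>\<^bsub>M\<^esub>} F T"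
  by (rule T.submoduleI) (auto simp: ev_add ev_neg ev_smult ev_zero T_add T_smult T_zero)

text \<open>The universal property of the tensor product: bilinearity kills the four families of
  relations, hence the submodule they generate.\<close>

lemma ev_ideal:
  assumes "f \<in> I"
  shows "ev f = \<zero>\<^bsub>M\<^esub>"
proof -
  have "I \<subseteq> {f \<in> carrier T. ev f = \<zero>\<^bsub>M\<^esub>}"
  proof (rule tensor_ideal_least[OF ev_kernel], rule subsetI)
    fix r assume r: "r \<in> tensor_relations F A B"
    then have "r \<in> carrier T"
      using tensor_relations_subset by blast
    moreover have "ev r = \<zero>\<^bsub>M\<^esub>"
      using r unfolding tensor_relations_def Let_def
      by (auto simp: ev_minus ev_add ev_smult ev_gen free_gen_mem beta_add_l beta_add_r
          beta_smult_l beta_smult_r beta_closed M.minus_eq M.r_neg)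
    ultimately show "r \<in> {f \<in> carrier T. ev f = \<zero>\<^bsub>M\<^esub>}"
      by simp
  qed
  then show ?thesis
    using assms by blast
qed

end

section \<open>Minimal faithfulness\<close>

locale semiassoc = alg A F
  for A :: "('f, 'a) module" (structure) and F :: "('f, 'x) ring_scheme" (structure) +
  fixes K :: "'a set"
  assumes fd: "fin_dim F A" and cent: "central F A" and K_subalg: "subalg F A K"
    and K_nuc: "K \<subseteq> nucleus A" and K_etale: "etale F (A\<lparr>carrier := K\<rparr>)"
    and min_faithful: "minimally_faithful (tensor_alg F (A\<lparr>carrier := K\<rparr>) (A\<lparr>carrier := K\<rparr>)) (bimod F A)"
begin

lemma K_subspace: "subspace K" and K_one [simp]: "\<one> \<in> K"
  and K_mult [simp]: "x \<in> K \<Longrightarrow> y \<in> K \<Longrightarrow> x \<otimes> y \<in> K"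
  using K_subalg by (auto simp: subalg_def)

lemma K_nuc' [simp]: "x \<in> K \<Longrightarrow> x \<in> N"
  using K_nuc by blast

lemma K_carr: "K \<subseteq> carrier A"
  using K_nuc' nuc_carr by blast

abbreviation KA :: "('f, 'a) module" where "KA \<equiv> A\<lparr>carrier := K\<rparr>"
abbreviation KK where "KK \<equiv> tensor_alg F KA KA"

sublocale KA: two_modules F KA KA
proof -
  have "module F KA"
    using submodule.submodule_is_module[OF K_subspace] module_axioms by blast
  then show "two_modules F KA KA"
    by (intro two_modules.intro F.field_axioms)
qed

lemma act_bilinear:
  assumes "a \<in> carrier A"
  shows "bilinear_map F KA KA A (\<lambda>p. (fst p \<otimes> a) \<otimes> snd p)"
proof (intro bilinear_map.intro bilinear_map_axioms.intro)
  show "two_modules F KA KA" "module F A"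
    by (rule KA.two_modules_axioms module_axioms)+
qed (use assms in \<open>auto simp: mult_l_distr mult_r_distr smult_mult_l smult_mult_r\<close>)

text \<open>The evaluation is constant on a coset of the tensor ideal, so its image is a singleton
  and \<open>the_elem\<close> in the definition of the action returns the expected value.\<close>

lemma bimod_act_coset:
  assumes a: "a \<in> carrier A" and f: "f \<in> carrier KA.T"
  shows "bimod_act F A (KA.I +>\<^bsub>KA.T\<^esub> f) a = free_eval F A (\<lambda>p. (fst p \<otimes> a) \<otimes> snd p) f"
proof -
  interpret b: bilinear_map F KA KA A "\<lambda>p. (fst p \<otimes> a) \<otimes> snd p"
    by (rule act_bilinear[OF a])
  have e: "b.ev (i \<oplus>\<^bsub>KA.T\<^esub> f) = b.ev f" if "i \<in> KA.I" for i
    using b.ev_add[OF KA.I_carr[OF that] f] b.ev_ideal[OF that] b.ev_closed[OF f] by simp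
  have "b.ev ` (KA.I +>\<^bsub>KA.T\<^esub> f) = (\<lambda>i. b.ev (i \<oplus>\<^bsub>KA.T\<^esub> f)) ` KA.I"
    unfolding a_r_coset_def' by blast
  also have "\<dots> = (\<lambda>i. b.ev f) ` KA.I"
    using e by (intro image_cong) auto
  also have "\<dots> = {b.ev f}"
    using KA.I_zero by blast
  finally have "b.ev ` (KA.I +>\<^bsub>KA.T\<^esub> f) = {b.ev f}" .
  then show ?thesis
    unfolding bimod_act_def free_eval_def by simp
qed

text \<open>The coefficient \<open>f p\<close> is moved into the left factor, since \<open>K\<close>
  is closed under scalars; this turns the action of a tensor into an operator over
  \<open>K\<close>.\<close>

lemma act_mop:
  assumes f: "f \<in> carrier KA.T"
  obtains S where "S \<in> mop K K"
    "\<And>a. a \<in> carrier A \<Longrightarrow> free_eval F A (\<lambda>p. (fst p \<otimes> a) \<otimes> snd p) f = S a"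
proof -
  define P where "P = {p. f p \<noteq> \<zero>\<^bsub>F\<^esub>}"
  define R where "R = (\<lambda>p a. ((f p \<odot> fst p) \<otimes> a) \<otimes> snd p)"
  have P: "finite P" "P \<subseteq> K \<times> K"
    using KA.T_support[OF f] by (auto simp: P_def)
  have fv: "f p \<in> carrier F" for p
    using KA.T_val[OF f] .
  have "R p \<in> mop K K" if "p \<in> P" for p
    unfolding R_def using that P fv subspaceD(6)[OF K_subspace] by (intro mop.base) auto
  then obtain S where S: "S \<in> mop K K" "\<And>a. a \<in> carrier A \<Longrightarrow> S a = (\<Oplus>p\<in>P. R p a)"
    using mop_finsum[OF P(1), of R K K \<one>] K_carr subspaceD(2)[OF K_subspace] by auto
  have "free_eval F A (\<lambda>p. (fst p \<otimes> a) \<otimes> snd p) f = S a" if a: "a \<in> carrier A" for a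
  proof -
    have "f p \<odot> ((fst p \<otimes> a) \<otimes> snd p) = R p a" "R p a \<in> carrier A" if "p \<in> P" for p
    proof -
      have "fst p \<in> carrier A" "snd p \<in> carrier A"
        using that P K_carr by auto
      then show "f p \<odot> ((fst p \<otimes> a) \<otimes> snd p) = R p a" "R p a \<in> carrier A"
        using a fv unfolding R_def by (simp_all add: smult_mult_l)
    qed
    then show ?thesis
      unfolding free_eval_def P_def[symmetric] S(2)[OF a] by (intro M.finsum_cong') auto
  qed
  with S(1) that show ?thesis
    by blast
qed

lemma KK_sel: "carrier KK = a_rcosets\<^bsub>KA.T\<^esub> KA.I" "\<zero>\<^bsub>KK\<^esub> = KA.I"
  by (simp_all add: tensor_alg_def quot_def)

lemma KK_act:
  assumes "r \<in> carrier KK"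
  obtains S where "S \<in> mop K K" "\<And>a. a \<in> carrier A \<Longrightarrow> bimod_act F A r a = S a"
proof -
  obtain f where f: "f \<in> carrier KA.T" "r = KA.I +>\<^bsub>KA.T\<^esub> f"
    using assms unfolding KK_sel A_RCOSETS_def' by blast
  obtain S where "S \<in> mop K K"
    "\<And>a. a \<in> carrier A \<Longrightarrow> free_eval F A (\<lambda>p. (fst p \<otimes> a) \<otimes> snd p) f = S a"
    using act_mop[OF f(1)] by metis
  then show ?thesis
    using that[of S] bimod_act_coset[OF _ f(1)] f(2) by simp
qed

lemma bimod_sel: "carrier (bimod F A) = carrier A" "\<zero>\<^bsub>bimod F A\<^esub> = \<zero>"
  "r \<odot>\<^bsub>bimod F A\<^esub> x = bimod_act F A r x" "x \<oplus>\<^bsub>bimod F A\<^esub> y = x \<oplus> y"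
  by (simp_all add: bimod_def)

lemma bimod_faithful: "r \<in> carrier KK \<Longrightarrow> (\<And>x. x \<in> carrier A \<Longrightarrow> bimod_act F A r x = \<zero>) \<Longrightarrow> r = \<zero>\<^bsub>KK\<^esub>"
  using conjunct1[OF min_faithful[unfolded minimally_faithful_def]]
  unfolding faithful_module_def bimod_sel by blast

lemma bimod_submodule:
  assumes "subspace H" "\<And>k x. k \<in> K \<Longrightarrow> x \<in> H \<Longrightarrow> k \<otimes> x \<in> H" "\<And>k x. k \<in> K \<Longrightarrow> x \<in> H \<Longrightarrow> x \<otimes> k \<in> H"
  shows "submodule H KK (bimod F A)"
proof (intro submodule.intro submodule_axioms.intro)
  have "subgroup H (add_monoid A)"
    using assms(1) by (simp add: submodule_def)
  then show "subgroup H (add_monoid (bimod F A))"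
    by (simp add: bimod_def subgroup_def m_inv_def)
next
  fix r x assume r: "r \<in> carrier KK" and x: "x \<in> H"
  obtain S where "S \<in> mop K K" "\<And>a. a \<in> carrier A \<Longrightarrow> bimod_act F A r a = S a"
    using KK_act[OF r] by blast
  then show "r \<odot>\<^bsub>bimod F A\<^esub> x \<in> H"
    using mop_preserves[of S K K H x] assms x subspaceD(7)[OF assms(1) x] by (simp add: bimod_sel)
qed

text \<open>Minimal faithfulness restated for operators. If \<open>r\<close> kills the section, its
  operator maps \<open>N1\<close> into \<open>N2\<close>, so it vanishes on \<open>A\<close> by the
  assumption \<open>faithful\<close>, and then \<open>r\<close> is zero because \<open>A\<close>
  itself is faithful.\<close>

lemma minimal_section:
  assumes N1: "subspace N1" "\<And>k x. k \<in> K \<Longrightarrow> x \<in> N1 \<Longrightarrow> k \<otimes> x \<in> N1"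
      "\<And>k x. k \<in> K \<Longrightarrow> x \<in> N1 \<Longrightarrow> x \<otimes> k \<in> N1"
    and N2: "subspace N2" "\<And>k x. k \<in> K \<Longrightarrow> x \<in> N2 \<Longrightarrow> k \<otimes> x \<in> N2"
      "\<And>k x. k \<in> K \<Longrightarrow> x \<in> N2 \<Longrightarrow> x \<otimes> k \<in> N2"
    and le: "N2 \<subseteq> N1"
    and faithful: "\<And>S x. S \<in> mop K K \<Longrightarrow> (\<And>x. x \<in> N1 \<Longrightarrow> S x \<in> N2) \<Longrightarrow> x \<in> carrier A \<Longrightarrow> S x = \<zero>"
  shows "N1 = carrier A" "N2 = {\<zero>}"
proof -
  let ?Q = "quot ((bimod F A)\<lparr>carrier := N1\<rparr>) N2"
  have co: "N2 +>\<^bsub>(bimod F A)\<lparr>carrier := N1\<rparr>\<^esub> x = {n \<oplus> x | n. n \<in> N2}" for x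
    by (auto simp: a_r_coset_def' bimod_sel)
  have mem: "x \<in> {n \<oplus> x | n. n \<in> N2}" if "x \<in> N1" for x
    using subspaceD(2)[OF N2(1)] subspaceD(7)[OF N1(1) that] by force
  have "faithful_module KK ?Q"
    unfolding faithful_module_def
  proof (intro ballI impI)
    fix r assume r: "r \<in> carrier KK" and z: "\<forall>C\<in>carrier ?Q. r \<odot>\<^bsub>?Q\<^esub> C = \<zero>\<^bsub>?Q\<^esub>"
    obtain S where S: "S \<in> mop K K" "\<And>a. a \<in> carrier A \<Longrightarrow> bimod_act F A r a = S a"
      using KK_act[OF r] by blast
    have "S x \<in> N2" if x: "x \<in> N1" for x
    proof -
      have xA: "x \<in> carrier A"
        using x subspaceD(7)[OF N1(1)] by blast
      have "{n \<oplus> x | n. n \<in> N2} \<in> carrier ?Q"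
        using x unfolding quot_def A_RCOSETS_def' co by auto
      then have "r \<odot>\<^bsub>?Q\<^esub> {n \<oplus> x | n. n \<in> N2} = N2"
        using z by (auto simp: quot_def)
      \<comment> \<open>Scalar multiplication in \<open>quot\<close> is a union over
        representatives; the representative \<open>x\<close> alone contributes the full coset of its
        image.\<close>
      moreover have "{n \<oplus> bimod_act F A r x | n. n \<in> N2} \<subseteq> r \<odot>\<^bsub>?Q\<^esub> {n \<oplus> x | n. n \<in> N2}"
        using mem[OF x] unfolding quot_def co by (auto simp: bimod_sel)
      moreover have "bimod_act F A r x \<in> N1"
        using S(2)[OF xA] mop_preserves[OF S(1) N1 x] by simp
      ultimately show ?thesis
        using mem S(2)[OF xA] by auto
    qed
    then have "S x = \<zero>" if "x \<in> carrier A" for x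
      using faithful[OF S(1)] that by blast
    then show "r = \<zero>\<^bsub>KK\<^esub>"
      using bimod_faithful[OF r] S(2) by simp
  qed
  moreover have "submodule N1 KK (bimod F A)" "submodule N2 KK (bimod F A)"
    using bimod_submodule N1 N2 by blast+
  ultimately have "N1 = carrier (bimod F A) \<and> N2 = {\<zero>\<^bsub>bimod F A\<^esub>}"
    using le
    by (intro mp[OF spec[OF spec[OF conjunct2[OF min_faithful[unfolded minimally_faithful_def]]]]] conjI)
  then show "N1 = carrier A" "N2 = {\<zero>}"
    by (auto simp: bimod_sel)
qed

lemma K_basis: obtains B where "basis K B"
  using basis_exists[OF fd K_subspace] .

text \<open>If all these products vanished, faithfulness would make the tensor of \<open>k\<close>
  and \<open>l\<close> zero. Over a field this is impossible: the product of a functional not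
  vanishing at \<open>k\<close> and one not vanishing at \<open>l\<close> detects the
  tensor.\<close>

lemma bimod_nonzero:
  assumes k: "k \<in> K" "k \<noteq> \<zero>" and l: "l \<in> K" "l \<noteq> \<zero>"
  obtains a where "a \<in> carrier A" "(k \<otimes> a) \<otimes> l \<noteq> \<zero>"
proof (rule ccontr)
  assume "\<not> thesis"
  then have z: "(k \<otimes> a) \<otimes> l = \<zero>" if "a \<in> carrier A" for a
    using that \<open>\<And>a. a \<in> carrier A \<Longrightarrow> k \<otimes> a \<otimes> l \<noteq> \<zero> \<Longrightarrow> thesis\<close> by blast
  let ?r = "KA.I +>\<^bsub>KA.T\<^esub> free_gen F k l"
  have g: "free_gen F k l \<in> carrier KA.T"
    using k l by (intro KA.free_gen_mem) auto
  have "?r \<in> carrier KK"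
    using g unfolding KK_sel A_RCOSETS_def' by blast
  moreover have "bimod_act F A ?r a = \<zero>" if a: "a \<in> carrier A" for a
  proof -
    interpret b: bilinear_map F KA KA A "\<lambda>p. (fst p \<otimes> a) \<otimes> snd p"
      by (rule act_bilinear[OF a])
    show ?thesis
      using bimod_act_coset[OF a g] b.ev_gen[of k l] k l z[OF a] by simp
  qed
  ultimately have r: "?r = KA.I"
    using bimod_faithful[of ?r] unfolding KK_sel by blast
  have "\<zero>\<^bsub>KA.T\<^esub> \<oplus>\<^bsub>KA.T\<^esub> free_gen F k l \<in> ?r"
    unfolding a_r_coset_def' using KA.I_zero by blast
  then have gI: "free_gen F k l \<in> KA.I"
    using g r by simp
  obtain B where B: "basis K B"
    by (rule K_basis)
  obtain u where u: "u \<in> K \<rightarrow> carrier F" "u k \<noteq> \<zero>\<^bsub>F\<^esub>"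
    "\<And>x y. x \<in> K \<Longrightarrow> y \<in> K \<Longrightarrow> u (x \<oplus> y) = u x \<oplus>\<^bsub>F\<^esub> u y"
    "\<And>c x. c \<in> carrier F \<Longrightarrow> x \<in> K \<Longrightarrow> u (c \<odot> x) = c \<otimes>\<^bsub>F\<^esub> u x"
    by (rule basis_functional[OF B k]) blast
  obtain v where v: "v \<in> K \<rightarrow> carrier F" "v l \<noteq> \<zero>\<^bsub>F\<^esub>"
    "\<And>x y. x \<in> K \<Longrightarrow> y \<in> K \<Longrightarrow> v (x \<oplus> y) = v x \<oplus>\<^bsub>F\<^esub> v y"
    "\<And>c x. c \<in> carrier F \<Longrightarrow> x \<in> K \<Longrightarrow> v (c \<odot> x) = c \<otimes>\<^bsub>F\<^esub> v x"
    by (rule basis_functional[OF B l]) blast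
  \<comment> \<open>The base field as a module over itself, the target of the bilinear form built
    from \<open>u\<close> and \<open>v\<close>.\<close>
  define FM :: "('f, 'f) module" where "FM = \<lparr>carrier = carrier F, monoid.mult = (\<otimes>\<^bsub>F\<^esub>), one = \<one>\<^bsub>F\<^esub>,
      ring.zero = \<zero>\<^bsub>F\<^esub>, add = (\<oplus>\<^bsub>F\<^esub>), smult = (\<otimes>\<^bsub>F\<^esub>)\<rparr>"
  have "module F FM"
  proof (rule moduleI)
    show "abelian_group FM"
    proof (rule abelian_groupI)
      fix x assume "x \<in> carrier FM"
      then show "\<exists>y\<in>carrier FM. y \<oplus>\<^bsub>FM\<^esub> x = \<zero>\<^bsub>FM\<^esub>"
        by (intro bexI[of _ "\<ominus>\<^bsub>F\<^esub> x"]) (auto simp: FM_def R.l_neg)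
    qed (auto simp: FM_def R.a_ac)
  qed (auto simp: FM_def R.l_distr R.r_distr R.m_assoc R.cring_axioms)
  then interpret b: bilinear_map F KA KA FM "\<lambda>p. u (fst p) \<otimes>\<^bsub>F\<^esub> v (snd p)"
  proof (intro bilinear_map.intro bilinear_map_axioms.intro KA.two_modules_axioms, goal_cases)
  qed (use u v in \<open>auto simp: FM_def R.l_distr R.r_distr R.m_assoc R.m_lcomm Pi_iff\<close>)
  have "b.ev (free_gen F k l) = u k \<otimes>\<^bsub>F\<^esub> v l"
    using k l b.ev_gen[of k l] by simp
  moreover have "b.ev (free_gen F k l) = \<zero>\<^bsub>F\<^esub>"
    using b.ev_ideal[OF gI] by (simp add: FM_def)
  moreover have "u k \<in> carrier F" "v l \<in> carrier F"
    using u(1) v(1) k l by auto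
  ultimately show False
    using u(2) v(2) F.integral[of "u k" "v l"] by auto
qed

end

section \<open>Separability\<close>

lemma (in alg) add_pow_smult:
  fixes n :: nat
  assumes "c \<in> carrier F" "x \<in> carrier A"
  shows "([n] \<cdot>\<^bsub>F\<^esub> c) \<odot> x = c \<odot> ([n] \<cdot> x)"
proof (induction n)
  case 0
  then show ?case
    using assms by (simp add: add_pow_def)
next
  case (Suc n)
  have 1: "[Suc n] \<cdot>\<^bsub>F\<^esub> c = [n] \<cdot>\<^bsub>F\<^esub> c \<oplus>\<^bsub>F\<^esub> c" "[Suc n] \<cdot> x = [n] \<cdot> x \<oplus> x"
    by (simp_all add: add_pow_def)
  have "[n] \<cdot>\<^bsub>F\<^esub> c \<in> carrier F" "[n] \<cdot> x \<in> carrier A"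
    using assms R.add.nat_pow_closed[of c n] M.add.nat_pow_closed[of x n] by (simp_all add: add_pow_def)
  then show ?case
    unfolding 1 using assms Suc by (simp add: smult_l_distr smult_r_distr)
qed

lemma up_mem_UP: "p \<in> up R \<Longrightarrow> p \<in> carrier (UP R) \<and> coeff (UP R) p k = p k"
  by (simp add: UP_def)

text \<open>Evaluating the Bezout identity \<open>u p + v p' = 1\<close> at the root
  \<open>x\<close> leaves \<open>v(x) p'(x) = 1\<close>. The conclusion is spelled out in
  coefficients because they are later reused with an element of \<open>K\<close> in place of
  \<open>x\<close>.\<close>

lemma separable_evaluation:
  fixes L :: "('f, 'b) module"
  assumes "unital_algebra F L" "field L" and x: "x \<in> carrier L" and p: "p \<in> carrier (UP F)"
    and sep: "separable_poly F p"
    and root: "UnivPoly.eval F L (\<lambda>c. c \<odot>\<^bsub>L\<^esub> \<one>\<^bsub>L\<^esub>) x p = \<zero>\<^bsub>L\<^esub>"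
  obtains n :: nat and c w where "\<And>k. c k \<in> carrier F"
    "(\<Oplus>\<^bsub>L\<^esub>k\<in>{..Suc n}. c k \<odot>\<^bsub>L\<^esub> x [^]\<^bsub>L\<^esub> k) = \<zero>\<^bsub>L\<^esub>" "w \<in> carrier L"
    "w \<otimes>\<^bsub>L\<^esub> (\<Oplus>\<^bsub>L\<^esub>k\<in>{..n}. c (Suc k) \<odot>\<^bsub>L\<^esub> ([Suc k] \<cdot>\<^bsub>L\<^esub> (x [^]\<^bsub>L\<^esub> k))) = \<one>\<^bsub>L\<^esub>"
proof -
  interpret L: alg L F
    using assms(1) by (simp add: alg_def)
  interpret LF: field L
    by (rule assms(2))
  define h where "h = (\<lambda>c. c \<odot>\<^bsub>L\<^esub> \<one>\<^bsub>L\<^esub>)"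
  interpret UP: UP_pre_univ_prop F L h "UP F"
  proof (intro UP_pre_univ_prop.intro UP_cring.intro)
    show "ring_hom_cring F L h"
    proof (intro ring_hom_cring.intro ring_hom_cring_axioms.intro ring_hom_memI)
      show "cring F" "cring L"
        by (rule L.R.cring_axioms LF.cring_axioms)+
    qed (auto simp: h_def L.smult_l_distr L.smult_mult_l L.smult_assoc1)
    show "cring F"
      by (rule L.R.cring_axioms)
  qed simp
  let ?ev = "UnivPoly.eval F L h x"
  define c where "c = coeff (UP F) p"
  define n where "n = deg F p"
  have c: "c k \<in> carrier F" for k
    unfolding c_def using p by simp
  have c0: "c k = \<zero>\<^bsub>F\<^esub>" if "n < k" for k
    unfolding c_def using p that n_def UP.deg_aboveD by simp
  have hc: "h a \<otimes>\<^bsub>L\<^esub> y = a \<odot>\<^bsub>L\<^esub> y" if "a \<in> carrier F" "y \<in> carrier L" for a y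
    using that by (simp add: h_def L.smult_mult_l)
  have xk: "x [^]\<^bsub>L\<^esub> k \<in> carrier L" for k :: nat
    using x by simp
  have ev: "?ev q = (\<Oplus>\<^bsub>L\<^esub>k\<in>{..m}. coeff (UP F) q k \<odot>\<^bsub>L\<^esub> x [^]\<^bsub>L\<^esub> k)"
    if q: "q \<in> carrier (UP F)" and m: "\<And>k. m < k \<Longrightarrow> coeff (UP F) q k = \<zero>\<^bsub>F\<^esub>" for q m
  proof -
    have "?ev q = (\<Oplus>\<^bsub>L\<^esub>k\<in>{..deg F q}. h (coeff (UP F) q k) \<otimes>\<^bsub>L\<^esub> x [^]\<^bsub>L\<^esub> k)"
      using q by (rule UP.eval_on_carrier)
    also have "\<dots> = (\<Oplus>\<^bsub>L\<^esub>k\<in>{..m}. coeff (UP F) q k \<odot>\<^bsub>L\<^esub> x [^]\<^bsub>L\<^esub> k)"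
    proof (rule L.M.add.finprod_mono_neutral_cong_left)
      show "{..deg F q} \<subseteq> {..m}"
        using UP.deg_aboveI[OF m q] by auto
    next
      fix k assume "k \<in> {..m} - {..deg F q}"
      then show "coeff (UP F) q k \<odot>\<^bsub>L\<^esub> x [^]\<^bsub>L\<^esub> k = \<zero>\<^bsub>L\<^esub>"
        using UP.deg_aboveD[OF _ q] xk by simp
    qed (use q xk hc in auto)
    finally show ?thesis .
  qed
  \<comment> \<open>The sum runs to \<open>Suc n\<close> although the degree is \<open>n\<close>.
    The last coefficient is zero, and the derivative then has exactly the indices up to
    \<open>n\<close>.\<close>
  have px: "(\<Oplus>\<^bsub>L\<^esub>k\<in>{..Suc n}. c k \<odot>\<^bsub>L\<^esub> x [^]\<^bsub>L\<^esub> k) = \<zero>\<^bsub>L\<^esub>"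
    using root ev[OF p, of "Suc n"] c0 by (simp add: h_def c_def)
  define p' where "p' = poly_deriv F p"
  have p': "p' k = [Suc k] \<cdot>\<^bsub>F\<^esub> c (Suc k)" for k
    by (simp add: p'_def poly_deriv_def c_def)
  have p'0: "p' k = \<zero>\<^bsub>F\<^esub>" if "n < k" for k
    unfolding p' using c0[of "Suc k"] that L.R.add.nat_pow_one[of "Suc k"] by (simp add: add_pow_def)
  have p'F: "p' k \<in> carrier F" for k
    unfolding p' using c L.R.add.nat_pow_closed[of "c (Suc k)" "Suc k"] by (simp add: add_pow_def)
  have p'up: "p' \<in> up F"
    using p'F p'0 by (intro mem_upI exI[of _ n] bound.intro) auto
  have p'UP: "p' \<in> carrier (UP F)" and p'co: "coeff (UP F) p' k = p' k" for k
    using up_mem_UP[OF p'up] by blast+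
  have evp': "?ev p' = (\<Oplus>\<^bsub>L\<^esub>k\<in>{..n}. c (Suc k) \<odot>\<^bsub>L\<^esub> ([Suc k] \<cdot>\<^bsub>L\<^esub> (x [^]\<^bsub>L\<^esub> k)))"
  proof -
    have "?ev p' = (\<Oplus>\<^bsub>L\<^esub>k\<in>{..n}. p' k \<odot>\<^bsub>L\<^esub> x [^]\<^bsub>L\<^esub> k)"
      using ev[OF p'UP, of n] p'0 unfolding p'co by blast
    then show ?thesis
      unfolding p' L.add_pow_smult[OF c xk] .
  qed
  obtain u v where uv: "u \<in> carrier (UP F)" "v \<in> carrier (UP F)"
    "u \<otimes>\<^bsub>UP F\<^esub> p \<oplus>\<^bsub>UP F\<^esub> v \<otimes>\<^bsub>UP F\<^esub> p' = \<one>\<^bsub>UP F\<^esub>"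
    using sep by (auto simp: separable_poly_def p'_def)
  note evh = UP.eval_ring_hom[OF x]
  have "\<one>\<^bsub>L\<^esub> = ?ev (u \<otimes>\<^bsub>UP F\<^esub> p \<oplus>\<^bsub>UP F\<^esub> v \<otimes>\<^bsub>UP F\<^esub> p')"
    using uv(3) ring_hom_one[OF evh] by simp
  also have "\<dots> = ?ev u \<otimes>\<^bsub>L\<^esub> ?ev p \<oplus>\<^bsub>L\<^esub> ?ev v \<otimes>\<^bsub>L\<^esub> ?ev p'"
    using uv(1,2) p p'UP
    by (simp only: ring_hom_add[OF evh] ring_hom_mult[OF evh] UP.UP_mult_closed)
  also have "\<dots> = ?ev v \<otimes>\<^bsub>L\<^esub> ?ev p'"
    using root uv p p'UP by (simp add: h_def[symmetric] ring_hom_closed[OF evh])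
  finally show ?thesis
    using that[of c n "?ev v"] c px evp' ring_hom_closed[OF evh uv(2)] by simp
qed

section \<open>Coordinates and regularity of the etale subalgebra; divided powers\<close>

context semiassoc begin

text \<open>The isomorphism with a product of fields, unpacked into coordinate maps. The last two
  facts are its injectivity and surjectivity; restricting to indices below \<open>n\<close> hides
  the extensional functions of \<open>prod_alg\<close>.\<close>

lemma etale_coordinates:
  obtains n :: nat and L :: "nat \<Rightarrow> ('f, 'a) module" and \<psi> :: "nat \<Rightarrow> 'a \<Rightarrow> 'a"
  where "\<And>i. i < n \<Longrightarrow> finite_separable_extension F (L i)"
    "\<And>i x. i < n \<Longrightarrow> x \<in> K \<Longrightarrow> \<psi> i x \<in> carrier (L i)"
    "\<And>i x y. i < n \<Longrightarrow> x \<in> K \<Longrightarrow> y \<in> K \<Longrightarrow> \<psi> i (x \<oplus> y) = \<psi> i x \<oplus>\<^bsub>L i\<^esub> \<psi> i y"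
    "\<And>i x y. i < n \<Longrightarrow> x \<in> K \<Longrightarrow> y \<in> K \<Longrightarrow> \<psi> i (x \<otimes> y) = \<psi> i x \<otimes>\<^bsub>L i\<^esub> \<psi> i y"
    "\<And>i. i < n \<Longrightarrow> \<psi> i \<one> = \<one>\<^bsub>L i\<^esub>"
    "\<And>i c x. i < n \<Longrightarrow> c \<in> carrier F \<Longrightarrow> x \<in> K \<Longrightarrow> \<psi> i (c \<odot> x) = c \<odot>\<^bsub>L i\<^esub> \<psi> i x"
    "\<And>x y. x \<in> K \<Longrightarrow> y \<in> K \<Longrightarrow> (\<And>i. i < n \<Longrightarrow> \<psi> i x = \<psi> i y) \<Longrightarrow> x = y"
    "\<And>y. (\<And>i. i < n \<Longrightarrow> y i \<in> carrier (L i)) \<Longrightarrow> \<exists>x\<in>K. \<forall>i<n. \<psi> i x = y i"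
proof -
  obtain n and L :: "nat \<Rightarrow> ('f, 'a) module" where L: "\<And>i. i < n \<Longrightarrow> finite_separable_extension F (L i)"
    and iso: "alg_isomorphic F KA (prod_alg n L)"
    using K_etale unfolding etale_def by blast
  obtain g where g: "g \<in> ring_iso KA (prod_alg n L)"
    and gs: "\<And>c x. c \<in> carrier F \<Longrightarrow> x \<in> K \<Longrightarrow> g (c \<odot> x) = c \<odot>\<^bsub>prod_alg n L\<^esub> g x"
    using iso unfolding alg_isomorphic_def by auto
  note gE = ring_iso_memE[OF g]
  have gK: "g x \<in> (\<Pi>\<^sub>E i\<in>{..<n}. carrier (L i))" if "x \<in> K" for x
    using gE(1)[of x] that by (simp add: prod_alg_def)
  have bij: "bij_betw g K (\<Pi>\<^sub>E i\<in>{..<n}. carrier (L i))"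
    using gE(5) by (simp add: prod_alg_def)
  show ?thesis
  proof (rule that[of n L "\<lambda>i x. g x i"])
    show "finite_separable_extension F (L i)" if "i < n" for i
      using L that .
    show "g x i \<in> carrier (L i)" if "i < n" "x \<in> K" for i x
      using gK[OF that(2)] that(1) by auto
    show "g (x \<oplus> y) i = g x i \<oplus>\<^bsub>L i\<^esub> g y i" if "i < n" "x \<in> K" "y \<in> K" for i x y
      using gE(3)[of x y] that by (simp add: prod_alg_def)
    show "g (x \<otimes> y) i = g x i \<otimes>\<^bsub>L i\<^esub> g y i" if "i < n" "x \<in> K" "y \<in> K" for i x y
      using gE(2)[of x y] that by (simp add: prod_alg_def)
    show "g \<one> i = \<one>\<^bsub>L i\<^esub>" if "i < n" for i
      using gE(4) that by (simp add: prod_alg_def)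
    show "g (c \<odot> x) i = c \<odot>\<^bsub>L i\<^esub> g x i" if "i < n" "c \<in> carrier F" "x \<in> K" for i c x
      using gs that by (simp add: prod_alg_def)
    show "x = y" if xy: "x \<in> K" "y \<in> K" "\<And>i. i < n \<Longrightarrow> g x i = g y i" for x y
    proof -
      have "g x = g y"
        using gK[OF xy(1)] gK[OF xy(2)] xy(3) by (intro PiE_ext) auto
      then show ?thesis
        using bij xy(1,2) by (auto simp: bij_betw_def inj_on_def)
    qed
    show "\<exists>x\<in>K. \<forall>i<n. g x i = y i" if y: "\<And>i. i < n \<Longrightarrow> y i \<in> carrier (L i)" for y
    proof -
      have "restrict y {..<n} \<in> g ` K"
        using y bij by (auto simp: bij_betw_def)
      then obtain x where "x \<in> K" "restrict y {..<n} = g x"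
        by blast
      then show ?thesis
        by (metis lessThan_iff restrict_apply')
    qed
  qed
qed

lemma K_comm:
  assumes "x \<in> K" "y \<in> K"
  shows "x \<otimes> y = y \<otimes> x"
proof (rule etale_coordinates, goal_cases)
  case (1 n L \<psi>)
  show ?case
  proof (rule 1(7))
    fix i assume i: "i < n"
    then interpret L: field "L i"
      using 1(1) by (simp add: finite_separable_extension_def)
    show "\<psi> i (x \<otimes> y) = \<psi> i (y \<otimes> x)"
      using i assms 1(2)[OF i] 1(4)[OF i] L.m_comm by simp
  qed (use assms in auto)
qed

text \<open>Von Neumann regularity, obtained by inverting the nonzero coordinates and leaving the
  others zero. It is what makes \<open>K\<close> meet the radical trivially.\<close>

lemma K_regular:
  assumes "x \<in> K"
  shows "\<exists>y\<in>K. (x \<otimes> y) \<otimes> x = x"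
proof (rule etale_coordinates, goal_cases)
  case (1 n L \<psi>)
  define z where "z = (\<lambda>i. if \<psi> i x = \<zero>\<^bsub>L i\<^esub> then \<zero>\<^bsub>L i\<^esub> else inv\<^bsub>L i\<^esub> \<psi> i x)"
  have z: "z i \<in> carrier (L i) \<and> \<psi> i x \<otimes>\<^bsub>L i\<^esub> z i \<otimes>\<^bsub>L i\<^esub> \<psi> i x = \<psi> i x" if i: "i < n" for i
  proof -
    interpret L: field "L i"
      using 1(1) i by (simp add: finite_separable_extension_def)
    show ?thesis
      using 1(2)[OF i assms] by (auto simp: z_def L.field_Units)
  qed
  then obtain y where y: "y \<in> K" "\<forall>i<n. \<psi> i y = z i"
    using 1(8)[of z] by blast
  have "(x \<otimes> y) \<otimes> x = x"
  proof (rule 1(7))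
    fix i assume i: "i < n"
    then have "\<psi> i ((x \<otimes> y) \<otimes> x) = \<psi> i x \<otimes>\<^bsub>L i\<^esub> z i \<otimes>\<^bsub>L i\<^esub> \<psi> i x"
      using 1(4)[OF i] assms y by simp
    then show "\<psi> i ((x \<otimes> y) \<otimes> x) = \<psi> i x"
      using z[OF i] by simp
  qed (use assms y in auto)
  then show ?case
    using y(1) by blast
qed

text \<open>
  The operators \<open>T\<^sub>k(a) = \<Sum>\<^sub>j x\<^sup>j a x\<^bsup>k-1-j\<^esup>\<close>, combined with the coefficients of a polynomial \<open>p\<close>,
  represent \<open>(p(X) - p(Y)) / (X - Y)\<close>.
\<close>

primrec divided_power :: "'a \<Rightarrow> nat \<Rightarrow> 'a \<Rightarrow> 'a" where
  "divided_power x 0 a = \<zero>"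
| "divided_power x (Suc k) a = x \<otimes> divided_power x k a \<oplus> a \<otimes> ((\<lambda>y. y \<otimes> x) ^^ k) \<one>"

lemma K_power: "x \<in> K \<Longrightarrow> ((\<lambda>y. y \<otimes> x) ^^ k) \<one> \<in> K"
  by (induction k) auto

lemma mop_comp_K:
  assumes "S \<in> mop K K" "T \<in> mop K K"
  obtains R where "R \<in> mop K K" "\<And>a. a \<in> carrier A \<Longrightarrow> R a = S (T a)"
  using mop_comp[OF assms K_nuc K_nuc K_nuc K_nuc, of K K] by auto

lemmas mop_closed_K = mop_closed[OF _ K_carr K_carr]

lemma mop_left_K:
  assumes "T \<in> mop K K" "k \<in> K" "l \<in> K"
  obtains R where "R \<in> mop K K" "\<And>a. a \<in> carrier A \<Longrightarrow> R a = (k \<otimes> T a) \<otimes> l"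
  using mop_comp_K[OF mop.base[OF assms(2,3)] assms(1)] by metis

lemma divided_power_mop:
  assumes "x \<in> K"
  obtains T where "T \<in> mop K K" "\<And>a. a \<in> carrier A \<Longrightarrow> T a = divided_power x k a"
proof -
  have "\<exists>T \<in> mop K K. \<forall>a\<in>carrier A. T a = divided_power x k a"
  proof (induction k)
    case 0
    have "(\<lambda>a. (\<zero> \<otimes> a) \<otimes> \<one>) \<in> mop K K"
      using subspaceD(2)[OF K_subspace] by (intro mop.base) auto
    then show ?case
      by (rule bexI[rotated]) auto
  next
    case (Suc k)
    then obtain T where T: "T \<in> mop K K" "\<And>a. a \<in> carrier A \<Longrightarrow> T a = divided_power x k a"
      by blast
    obtain R where R: "R \<in> mop K K" "\<And>a. a \<in> carrier A \<Longrightarrow> R a = (x \<otimes> T a) \<otimes> \<one>"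
      using mop_left_K[OF T(1) assms K_one] by metis
    let ?y = "((\<lambda>y. y \<otimes> x) ^^ k) \<one>"
    have y: "?y \<in> K"
      using K_power[OF assms] .
    have "(\<lambda>a. R a \<oplus> (\<one> \<otimes> a) \<otimes> ?y) \<in> mop K K"
      using R y by (intro mop.sum mop.base) auto
    moreover have "R a \<oplus> (\<one> \<otimes> a) \<otimes> ?y = divided_power x (Suc k) a" if a: "a \<in> carrier A" for a
    proof -
      have "x \<in> carrier A"
        using assms by simp
      then show ?thesis
        using R(2)[OF a] T(2)[OF a] mop_closed_K[OF T(1) a] a by simp
    qed
    ultimately show ?case
      by (intro bexI[of _ "\<lambda>a. R a \<oplus> (\<one> \<otimes> a) \<otimes> ?y"] ballI) auto
  qed
  then show ?thesis
    using that by blast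
qed

text \<open>Telescoping of the sum of the \<open>x^j a x^(k-1-j)\<close>. With \<open>X\<close> and
  \<open>Y\<close> the multiplications by \<open>x\<close> from the left and from the right, this is
  \<open>X^k - Y^k\<close> recovered from its quotient by \<open>X - Y\<close>.\<close>

lemma divided_power_commutator:
  assumes x: "x \<in> K" and a: "a \<in> carrier A"
  shows "x \<otimes> divided_power x k a \<ominus> divided_power x k a \<otimes> x =
    ((\<lambda>y. y \<otimes> x) ^^ k) \<one> \<otimes> a \<ominus> a \<otimes> ((\<lambda>y. y \<otimes> x) ^^ k) \<one>"
proof (induction k)
  case 0
  then show ?case
    using x a by (simp add: M.minus_eq M.r_neg)
next
  case (Suc k)
  let ?y = "((\<lambda>y. y \<otimes> x) ^^ k) \<one>" and ?t = "divided_power x k a"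
  have y: "?y \<in> K"
    using K_power[OF x] .
  obtain T where T: "T \<in> mop K K" "\<And>a. a \<in> carrier A \<Longrightarrow> T a = divided_power x k a"
    using divided_power_mop[OF x] by metis
  have c: "?t \<in> carrier A" "x \<in> carrier A" "?y \<in> carrier A" "x \<in> N" "?y \<in> N"
    using T a mop_closed_K[OF T(1) a] x y by auto
  have "x \<otimes> divided_power x (Suc k) a \<ominus> divided_power x (Suc k) a \<otimes> x =
    (x \<otimes> (x \<otimes> ?t) \<oplus> x \<otimes> (a \<otimes> ?y)) \<ominus> (x \<otimes> (?t \<otimes> x) \<oplus> a \<otimes> (?y \<otimes> x))"
    using c a by (simp add: mult_l_distr mult_r_distr nuc1 nuc2 nuc3)
  also have "\<dots> = x \<otimes> (x \<otimes> ?t \<ominus> ?t \<otimes> x) \<oplus> (x \<otimes> (a \<otimes> ?y) \<ominus> a \<otimes> (?y \<otimes> x))"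
    using c a by (simp add: add_minus_add mult_minus_r)
  also have "\<dots> = (x \<otimes> (?y \<otimes> a) \<ominus> x \<otimes> (a \<otimes> ?y)) \<oplus> (x \<otimes> (a \<otimes> ?y) \<ominus> a \<otimes> (?y \<otimes> x))"
    unfolding Suc using c a by (simp add: mult_minus_r)
  also have "\<dots> = x \<otimes> (?y \<otimes> a) \<ominus> a \<otimes> (?y \<otimes> x)"
    using c a by (intro minus_trans) auto
  also have "x \<otimes> (?y \<otimes> a) = (?y \<otimes> x) \<otimes> a"
    using c a K_comm[OF x y] by (simp add: nuc1[of x ?y, symmetric])
  finally show ?case
    by simp
qed

end

lemma (in alg) finsum_minus:
  "\<lbrakk>\<And>i. i \<in> I \<Longrightarrow> f i \<in> carrier A; \<And>i. i \<in> I \<Longrightarrow> g i \<in> carrier A\<rbrakk>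
    \<Longrightarrow> (\<Oplus>i\<in>I. f i) \<ominus> (\<Oplus>i\<in>I. g i) = (\<Oplus>i\<in>I. f i \<ominus> g i)"
proof (induction I rule: infinite_finite_induct)
  case (insert i I)
  then have c: "f i \<in> carrier A" "g i \<in> carrier A" "f \<in> I \<rightarrow> carrier A" "g \<in> I \<rightarrow> carrier A"
    "(\<lambda>i. f i \<ominus> g i) \<in> I \<rightarrow> carrier A"
    by auto
  then have "(\<Oplus>i\<in>I. f i) \<in> carrier A" "(\<Oplus>i\<in>I. g i) \<in> carrier A"
    by simp_all
  then show ?case
    using insert c by (simp add: add_minus_add)
qed auto

section \<open>The separability idempotent of \<open>K\<close> as an operator\<close>

context semiassoc begin

text \<open>Let \<open>p\<close> be a separable polynomial killing \<open>\<psi> x\<close>. The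
  operator \<open>Q\<close> is \<open>(p(X) - p(Y)) / (X - Y)\<close> for the two multiplications by
  \<open>x\<close>. Its commutator with \<open>x\<close> is \<open>p(x) a - a p(x)\<close>, which
  dies between two factors \<open>e\<close> because \<open>p(x)\<close> vanishes in
  \<open>L\<close>. At \<open>\<one>\<close> its value is \<open>p'(x)\<close>, whose inverse in
  \<open>L\<close> is lifted to \<open>v\<close>. The operator sought is
  \<open>a \<mapsto> e v Q(a) e\<close>.\<close>

lemma separability_component:
  fixes L :: "('f, 'a) module"
  assumes L: "finite_separable_extension F L"
    and \<psi>: "\<And>x. x \<in> K \<Longrightarrow> \<psi> x \<in> carrier L"
      "\<And>x y. x \<in> K \<Longrightarrow> y \<in> K \<Longrightarrow> \<psi> (x \<oplus> y) = \<psi> x \<oplus>\<^bsub>L\<^esub> \<psi> y"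
      "\<And>x y. x \<in> K \<Longrightarrow> y \<in> K \<Longrightarrow> \<psi> (x \<otimes> y) = \<psi> x \<otimes>\<^bsub>L\<^esub> \<psi> y" "\<psi> \<one> = \<one>\<^bsub>L\<^esub>"
      "\<And>c x. c \<in> carrier F \<Longrightarrow> x \<in> K \<Longrightarrow> \<psi> (c \<odot> x) = c \<odot>\<^bsub>L\<^esub> \<psi> x"
      "\<And>y. y \<in> carrier L \<Longrightarrow> \<exists>x\<in>K. \<psi> x = y"
    and e: "e \<in> K" "e \<otimes> e = e" "\<And>x. x \<in> K \<Longrightarrow> \<psi> x = \<zero>\<^bsub>L\<^esub> \<Longrightarrow> e \<otimes> x = \<zero>"
    and x: "x \<in> K"
  obtains T where "T \<in> mop K K" "\<And>a. a \<in> carrier A \<Longrightarrow> x \<otimes> T a = T a \<otimes> x" "T \<one> = e"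
proof -
  have Lu: "unital_algebra F L" "field L"
    using L by (auto simp: finite_separable_extension_def)
  interpret L: alg L F
    using Lu(1) by (simp add: alg_def)
  interpret LF: field L
    by (rule Lu(2))
  obtain p where p: "p \<in> carrier (UP F)" "separable_poly F p"
    "UnivPoly.eval F L (\<lambda>c. c \<odot>\<^bsub>L\<^esub> \<one>\<^bsub>L\<^esub>) (\<psi> x) p = \<zero>\<^bsub>L\<^esub>"
    using L \<psi>(1)[OF x] by (auto simp: finite_separable_extension_def)
  obtain n :: nat and c w where c: "\<And>k. c k \<in> carrier F"
    and root: "(\<Oplus>\<^bsub>L\<^esub>k\<in>{..Suc n}. c k \<odot>\<^bsub>L\<^esub> \<psi> x [^]\<^bsub>L\<^esub> k) = \<zero>\<^bsub>L\<^esub>" and w: "w \<in> carrier L"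
    and sep: "w \<otimes>\<^bsub>L\<^esub> (\<Oplus>\<^bsub>L\<^esub>k\<in>{..n}. c (Suc k) \<odot>\<^bsub>L\<^esub> ([Suc k] \<cdot>\<^bsub>L\<^esub> (\<psi> x [^]\<^bsub>L\<^esub> k))) = \<one>\<^bsub>L\<^esub>"
    by (rule separable_evaluation[OF Lu \<psi>(1)[OF x] p]) blast
  obtain v where v: "v \<in> K" "\<psi> v = w"
    using \<psi>(6)[OF w] by blast
  define pw where "pw = (\<lambda>k. ((\<lambda>y. y \<otimes> x) ^^ k) \<one>)"
  have pw: "pw k \<in> K" for k
    using K_power[OF x] by (simp add: pw_def)
  have psi_zero: "\<psi> \<zero> = \<zero>\<^bsub>L\<^esub>"
    using \<psi>(5)[of "\<zero>\<^bsub>F\<^esub>" \<one>] \<psi>(1)[of \<one>] by simp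
  have psi_sum: "\<psi> (\<Oplus>i\<in>I. f i) = (\<Oplus>\<^bsub>L\<^esub>i\<in>I. \<psi> (f i)) \<and> (\<Oplus>i\<in>I. f i) \<in> K"
    if "finite I" "\<And>i. i \<in> I \<Longrightarrow> f i \<in> K" for f and I :: "nat set"
    using that
  proof (induction I)
    case empty
    then show ?case
      using psi_zero subspaceD(2)[OF K_subspace] by simp
  next
    case (insert i I)
    have "f \<in> I \<rightarrow> carrier A" "f i \<in> carrier A"
      using insert K_carr by auto
    then have s: "(\<Oplus>i\<in>insert i I. f i) = f i \<oplus> (\<Oplus>i\<in>I. f i)"
      using insert by simp
    have "(\<lambda>i. \<psi> (f i)) \<in> I \<rightarrow> carrier L" "\<psi> (f i) \<in> carrier L"
      using insert \<psi>(1) by auto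
    then have "(\<Oplus>\<^bsub>L\<^esub>i\<in>insert i I. \<psi> (f i)) = \<psi> (f i) \<oplus>\<^bsub>L\<^esub> (\<Oplus>\<^bsub>L\<^esub>i\<in>I. \<psi> (f i))"
      using insert by simp
    then show ?case
      using insert s \<psi>(2) subspaceD(4)[OF K_subspace] by simp
  qed
  have psi_pw: "\<psi> (pw k) = \<psi> x [^]\<^bsub>L\<^esub> k" for k
  proof (induction k)
    case 0
    then show ?case
      using \<psi>(4) by (simp add: pw_def)
  next
    case (Suc k)
    have "pw (Suc k) = pw k \<otimes> x"
      by (simp add: pw_def)
    then show ?case
      using Suc \<psi>(3)[OF pw[of k] x] by simp
  qed
  define px where "px = (\<Oplus>k\<in>{..Suc n}. c k \<odot> pw k)"
  have cpw: "c k \<odot> pw k \<in> K" for k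
    using subspaceD(6)[OF K_subspace c pw] .
  have px: "px \<in> K" "\<psi> px = \<zero>\<^bsub>L\<^esub>"
    using psi_sum[of "{..Suc n}" "\<lambda>k. c k \<odot> pw k"] cpw root by (auto simp: px_def \<psi>(5) c pw psi_pw)
  have epx: "e \<otimes> px = \<zero>" "px \<otimes> e = \<zero>"
    using e(3)[OF px] K_comm[OF e(1) px(1)] by auto
  have "\<exists>T. \<forall>k. T k \<in> mop K K \<and> (\<forall>a\<in>carrier A. T k a = divided_power x k a)"
    using divided_power_mop[OF x] by (intro choice) metis
  then obtain T where T: "\<And>k. T k \<in> mop K K" "\<And>k a. a \<in> carrier A \<Longrightarrow> T k a = divided_power x k a"
    by blast
  have "\<exists>R\<in>mop K K. \<forall>a\<in>carrier A. R a = c k \<odot> T k a" for k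
  proof -
    obtain R where R: "R \<in> mop K K" "\<And>a. a \<in> carrier A \<Longrightarrow> R a = ((c k \<odot> \<one>) \<otimes> T k a) \<otimes> \<one>"
      using mop_left_K[OF T(1)[of k] subspaceD(6)[OF K_subspace c K_one] K_one] by metis
    have "R a = c k \<odot> T k a" if "a \<in> carrier A" for a
      using R(2)[OF that] mop_closed_K[OF T(1) that] c by (simp add: smult_mult_l)
    then show ?thesis
      using R(1) by blast
  qed
  then obtain R where R: "\<And>k. R k \<in> mop K K" "\<And>k a. a \<in> carrier A \<Longrightarrow> R k a = c k \<odot> T k a"
    by metis
  obtain Q where Q: "Q \<in> mop K K" "\<And>a. a \<in> carrier A \<Longrightarrow> Q a = (\<Oplus>k\<in>{..Suc n}. R k a)"
    using mop_finsum[of "{..Suc n}" R K K \<one>] R K_carr subspaceD(2)[OF K_subspace] by auto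
  have Rc: "R k a \<in> carrier A" if "a \<in> carrier A" for k a
    using mop_closed_K[OF R(1) that] .
  have xc: "x \<in> carrier A" "x \<in> N" and pwc: "pw k \<in> carrier A" for k
    using x pw K_carr by auto
  define J where "J = {..Suc n}"
  \<comment> \<open>Termwise \<open>divided_power_commutator\<close>; the sum of the terms
    \<open>c k\<close> times the \<open>k\<close>-th power is \<open>px\<close>, the value of the
    polynomial at \<open>x\<close>.\<close>
  have Qx: "x \<otimes> Q a \<ominus> Q a \<otimes> x = px \<otimes> a \<ominus> a \<otimes> px" if a: "a \<in> carrier A" for a
  proof -
    have sub: "(\<Oplus>k\<in>J. f k) \<ominus> (\<Oplus>k\<in>J. g k) = (\<Oplus>k\<in>J. f k \<ominus> g k)"
      if "\<And>k. f k \<in> carrier A" "\<And>k. g k \<in> carrier A" for f g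
      using that by (intro finsum_minus) auto
    have "x \<otimes> Q a \<ominus> Q a \<otimes> x = (\<Oplus>k\<in>J. x \<otimes> R k a \<ominus> R k a \<otimes> x)"
      unfolding Q(2)[OF a, folded J_def] using Rc[OF a] xc by (simp add: finsum_mult_l finsum_mult_r sub)
    also have "\<dots> = (\<Oplus>k\<in>J. (c k \<odot> pw k) \<otimes> a \<ominus> a \<otimes> (c k \<odot> pw k))"
    proof (intro M.finsum_cong' refl)
      fix k
      have d: "divided_power x k a \<in> carrier A"
        using mop_closed_K[OF T(1) a, of k] T(2)[OF a] by simp
      have "x \<otimes> R k a \<ominus> R k a \<otimes> x = c k \<odot> (x \<otimes> divided_power x k a \<ominus> divided_power x k a \<otimes> x)"
        unfolding R(2)[OF a] T(2)[OF a] using d xc c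
        by (simp add: smult_mult_l smult_mult_r smult_minus_r)
      also have "\<dots> = c k \<odot> (pw k \<otimes> a \<ominus> a \<otimes> pw k)"
        using divided_power_commutator[OF x a] by (simp add: pw_def)
      also have "\<dots> = (c k \<odot> pw k) \<otimes> a \<ominus> a \<otimes> (c k \<odot> pw k)"
        using pwc a c by (simp add: smult_mult_l smult_mult_r smult_minus_r)
      finally show "x \<otimes> R k a \<ominus> R k a \<otimes> x = (c k \<odot> pw k) \<otimes> a \<ominus> a \<otimes> (c k \<odot> pw k)" .
    qed (use pwc a c in auto)
    also have "\<dots> = px \<otimes> a \<ominus> a \<otimes> px"
      unfolding px_def J_def[symmetric] using pwc c a by (simp add: finsum_mult_l finsum_mult_r sub)
    finally show ?thesis .
  qed
  have TK: "T k \<one> \<in> K" for k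
    using mop_preserves[OF T(1) K_subspace] by simp
  have T0: "T 0 \<one> = \<zero>" and TS: "T (Suc k) \<one> = x \<otimes> T k \<one> \<oplus> pw k" for k
    using T(2)[OF unit_closed] pw by (simp_all add: pw_def)
  \<comment> \<open>At \<open>\<one>\<close> the summands of the divided power all coincide, which
    produces the integer factor of the derivative.\<close>
  have psi_T: "\<psi> (T (Suc k) \<one>) = [Suc k] \<cdot>\<^bsub>L\<^esub> (\<psi> x [^]\<^bsub>L\<^esub> k)" for k
  proof (induction k)
    case 0
    then show ?case
      using TS[of 0] T0 xc \<psi>(4) by (simp add: pw_def add_pow_def)
  next
    case (Suc k)
    have "\<psi> (T (Suc (Suc k)) \<one>) = \<psi> x \<otimes>\<^bsub>L\<^esub> [Suc k] \<cdot>\<^bsub>L\<^esub> (\<psi> x [^]\<^bsub>L\<^esub> k) \<oplus>\<^bsub>L\<^esub> \<psi> x [^]\<^bsub>L\<^esub> Suc k"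
      unfolding TS[of "Suc k"] using \<psi>(2,3) x TK pw psi_pw[of "Suc k"] Suc by simp
    also have "\<psi> x \<otimes>\<^bsub>L\<^esub> [Suc k] \<cdot>\<^bsub>L\<^esub> (\<psi> x [^]\<^bsub>L\<^esub> k) = [Suc k] \<cdot>\<^bsub>L\<^esub> (\<psi> x [^]\<^bsub>L\<^esub> Suc k)"
      using \<psi>(1)[OF x] LF.add_pow_rdistr[of "\<psi> x" "\<psi> x [^]\<^bsub>L\<^esub> k" "Suc k"]
        LF.m_comm[of "\<psi> x" "\<psi> x [^]\<^bsub>L\<^esub> k"] by simp
    finally show ?case
      by (simp add: add_pow_def)
  qed
  have QK: "Q \<one> \<in> K"
    using mop_preserves[OF Q(1) K_subspace] by simp
  have "\<psi> (Q \<one>) = (\<Oplus>\<^bsub>L\<^esub>k\<in>{..Suc n}. c k \<odot>\<^bsub>L\<^esub> \<psi> (T k \<one>))"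
  proof -
    have "\<psi> (Q \<one>) = (\<Oplus>\<^bsub>L\<^esub>k\<in>{..Suc n}. \<psi> (c k \<odot> T k \<one>))"
      unfolding Q(2)[OF unit_closed] R(2)[OF unit_closed]
      using psi_sum[of "{..Suc n}" "\<lambda>k. c k \<odot> T k \<one>"] TK c subspaceD(6)[OF K_subspace] by blast
    then show ?thesis
      using \<psi>(5)[OF c TK] by simp
  qed
  \<comment> \<open>The index 0 is split off: the divided power of index 0 is zero, so the constant
    coefficient of the polynomial drops out and the derivative remains.\<close>
  also have "\<dots> = (\<Oplus>\<^bsub>L\<^esub>k\<in>{..n}. c (Suc k) \<odot>\<^bsub>L\<^esub> \<psi> (T (Suc k) \<one>)) \<oplus>\<^bsub>L\<^esub> c 0 \<odot>\<^bsub>L\<^esub> \<psi> (T 0 \<one>)"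
    using c \<psi>(1)[OF TK] by (intro L.M.finsum_Suc2) auto
  also have "\<dots> = (\<Oplus>\<^bsub>L\<^esub>k\<in>{..n}. c (Suc k) \<odot>\<^bsub>L\<^esub> ([Suc k] \<cdot>\<^bsub>L\<^esub> (\<psi> x [^]\<^bsub>L\<^esub> k))) \<oplus>\<^bsub>L\<^esub> \<zero>\<^bsub>L\<^esub>"
    unfolding psi_T T0 psi_zero using c by (simp only: L.smult_r_null)
  finally have eq: "\<psi> (Q \<one>) =
    (\<Oplus>\<^bsub>L\<^esub>k\<in>{..n}. c (Suc k) \<odot>\<^bsub>L\<^esub> ([Suc k] \<cdot>\<^bsub>L\<^esub> (\<psi> x [^]\<^bsub>L\<^esub> k))) \<oplus>\<^bsub>L\<^esub> \<zero>\<^bsub>L\<^esub>" .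
  have "(\<Oplus>\<^bsub>L\<^esub>k\<in>{..n}. c (Suc k) \<odot>\<^bsub>L\<^esub> ([Suc k] \<cdot>\<^bsub>L\<^esub> (\<psi> x [^]\<^bsub>L\<^esub> k))) \<in> carrier L"
    unfolding psi_T[symmetric] using c \<psi>(1)[OF TK] by (intro L.M.finsum_closed) auto
  then have psi_Q: "w \<otimes>\<^bsub>L\<^esub> \<psi> (Q \<one>) = \<one>\<^bsub>L\<^esub>"
    unfolding eq using sep by (simp only: L.M.r_zero)
  obtain S where S: "S \<in> mop K K" "\<And>a. a \<in> carrier A \<Longrightarrow> S a = ((e \<otimes> v) \<otimes> Q a) \<otimes> e"
    using mop_left_K[OF Q(1) K_mult[OF e(1) v(1)] e(1)] by metis
  have ev: "e \<otimes> v \<in> K" "e \<otimes> v \<in> carrier A" "e \<in> carrier A" "e \<otimes> v \<in> N" "e \<in> N" "v \<in> carrier A" "v \<in> N"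
    using e v by auto
  show ?thesis
  proof (rule that[OF S(1)])
    fix a assume a: "a \<in> carrier A"
    have Qa: "Q a \<in> carrier A"
      using mop_closed_K[OF Q(1) a] .
    have pxc: "px \<in> carrier A" "px \<in> N"
      using px by auto
    have 1: "x \<otimes> S a = ((e \<otimes> v) \<otimes> (x \<otimes> Q a)) \<otimes> e"
    proof -
      have "x \<otimes> S a = ((x \<otimes> (e \<otimes> v)) \<otimes> Q a) \<otimes> e"
        using S(2)[OF a] xc ev Qa by (simp add: nuc1)
      also have "x \<otimes> (e \<otimes> v) = (e \<otimes> v) \<otimes> x"
        using K_comm[OF x ev(1)] .
      also have "(((e \<otimes> v) \<otimes> x) \<otimes> Q a) \<otimes> e = ((e \<otimes> v) \<otimes> (x \<otimes> Q a)) \<otimes> e"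
        using nuc1[OF ev(4) xc(1) Qa] by simp
      finally show ?thesis .
    qed
    have 2: "S a \<otimes> x = ((e \<otimes> v) \<otimes> (Q a \<otimes> x)) \<otimes> e"
    proof -
      have "S a \<otimes> x = ((e \<otimes> v) \<otimes> Q a) \<otimes> (e \<otimes> x)"
        using S(2)[OF a] xc ev Qa by (simp add: nuc2)
      also have "e \<otimes> x = x \<otimes> e"
        using K_comm[OF x e(1)] by simp
      also have "((e \<otimes> v) \<otimes> Q a) \<otimes> (x \<otimes> e) = (((e \<otimes> v) \<otimes> Q a) \<otimes> x) \<otimes> e"
        using nuc2[OF xc(2), of "(e \<otimes> v) \<otimes> Q a" e] xc ev Qa by simp
      also have "((e \<otimes> v) \<otimes> Q a) \<otimes> x = (e \<otimes> v) \<otimes> (Q a \<otimes> x)"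
        using nuc1[OF ev(4) Qa xc(1)] .
      finally show ?thesis .
    qed
    have "x \<otimes> S a \<ominus> S a \<otimes> x = ((e \<otimes> v) \<otimes> (x \<otimes> Q a \<ominus> Q a \<otimes> x)) \<otimes> e"
      unfolding 1 2 using xc ev(2,3) Qa by (simp add: mult_minus_l mult_minus_r)
    also have "\<dots> = ((e \<otimes> v) \<otimes> (px \<otimes> a)) \<otimes> e \<ominus> ((e \<otimes> v) \<otimes> (a \<otimes> px)) \<otimes> e"
      unfolding Qx[OF a] using pxc ev(2,3) a by (simp add: mult_minus_l mult_minus_r)
    also have "(e \<otimes> v) \<otimes> (px \<otimes> a) = ((e \<otimes> v) \<otimes> px) \<otimes> a"
      using nuc1[OF ev(4) pxc(1) a] by simp
    also have "(e \<otimes> v) \<otimes> px = v \<otimes> (e \<otimes> px)"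
      using K_comm[OF e(1) v(1)] nuc1[OF ev(7,3) pxc(1)] by simp
    also have "((e \<otimes> v) \<otimes> (a \<otimes> px)) \<otimes> e = (e \<otimes> v) \<otimes> (a \<otimes> (px \<otimes> e))"
      using ev a pxc by (simp add: nuc1 nuc2)
    finally have "x \<otimes> S a \<ominus> S a \<otimes> x = \<zero>"
      using epx ev a by simp
    then show "x \<otimes> S a = S a \<otimes> x"
      using minus_eq_zero_iff mop_closed_K[OF S(1) a] xc by simp
  next
    define k where "k = v \<otimes> Q \<one>"
    have k: "k \<in> K" "k \<in> carrier A" "\<psi> k = \<one>\<^bsub>L\<^esub>"
      using v QK psi_Q \<psi>(3) by (auto simp: k_def)
    \<comment> \<open>The difference of \<open>k\<close> and \<open>\<one>\<close>, with the sign
      written as a scalar because \<open>\<psi>\<close> is known to respect sums and scalars but not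
      yet negatives.\<close>
    let ?d = "k \<oplus> (\<ominus>\<^bsub>F\<^esub> \<one>\<^bsub>F\<^esub>) \<odot> \<one>"
    have m: "(\<ominus>\<^bsub>F\<^esub> \<one>\<^bsub>F\<^esub>) \<odot> \<one> \<in> K"
      using subspaceD(6)[OF K_subspace] by simp
    then have "?d \<in> K"
      using subspaceD(4)[OF K_subspace] k by blast
    moreover have "\<psi> ?d = \<zero>\<^bsub>L\<^esub>"
      using \<psi>(2)[OF k(1) m] \<psi>(5)[of "\<ominus>\<^bsub>F\<^esub> \<one>\<^bsub>F\<^esub>" \<one>] k \<psi>(4) by (simp add: L.smult_l_minus L.M.r_neg)
    ultimately have "e \<otimes> ?d = \<zero>"
      by (rule e(3))
    then have "e \<otimes> (k \<ominus> \<one>) = \<zero>"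
      using k by (simp add: smult_l_minus M.minus_eq)
    then have "e \<otimes> k = e"
      using k ev by (simp add: mult_minus_r minus_eq_zero_iff)
    moreover have "S \<one> = (e \<otimes> k) \<otimes> e"
      using S(2)[OF unit_closed] QK ev by (simp add: k_def nuc1)
    ultimately show "S \<one> = e"
      using e(2) by simp
  qed
qed

lemma finsum_commute_right:
  assumes "finite I" "\<And>i. i \<in> I \<Longrightarrow> f i \<in> carrier A" "x \<in> carrier A" "\<And>i. i \<in> I \<Longrightarrow> x \<otimes> f i = f i \<otimes> x"
  shows "x \<otimes> (\<Oplus>i\<in>I. f i) = (\<Oplus>i\<in>I. f i) \<otimes> x"
proof -
  have "f \<in> I \<rightarrow> carrier A"
    using assms by auto
  then show ?thesis
    using assms by (simp add: finsum_mult_l finsum_mult_r) (intro M.finsum_cong', auto)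
qed

text \<open>As \<open>K\<close> is commutative, operators with coefficients in \<open>K\<close>
  preserve the centralizer of each \<open>t \<in> K\<close>. Composing with a further operator
  therefore does not spoil a commutation already achieved.\<close>

lemma mop_commute_K:
  assumes "T \<in> mop K K" "t \<in> K" "b \<in> carrier A" "t \<otimes> b = b \<otimes> t"
  shows "t \<otimes> T b = T b \<otimes> t"
  using assms(1)
proof induction
  case (base k l)
  have c: "k \<in> N" "l \<in> N" "t \<in> N" "k \<in> carrier A" "l \<in> carrier A" "t \<in> carrier A"
    using base assms by auto
  have "t \<otimes> ((k \<otimes> b) \<otimes> l) = ((t \<otimes> k) \<otimes> b) \<otimes> l"
    using c assms by (simp add: nuc1)
  also have "\<dots> = (k \<otimes> (t \<otimes> b)) \<otimes> l"
    using c assms K_comm[OF assms(2) base(1)] by (simp add: nuc1)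
  also have "\<dots> = (k \<otimes> b) \<otimes> (t \<otimes> l)"
    unfolding assms(4) using c assms by (simp add: nuc1 nuc2)
  also have "\<dots> = ((k \<otimes> b) \<otimes> l) \<otimes> t"
    unfolding K_comm[OF assms(2) base(2)] using c assms by (simp add: nuc2)
  finally show ?case .
next
  case (sum S T)
  then show ?case
    using assms mop_closed_K[OF sum(1) assms(3)] mop_closed_K[OF sum(2) assms(3)]
    by (simp add: mult_l_distr mult_r_distr)
qed

text \<open>The operators of the single factors, one for each primitive idempotent
  \<open>e i\<close> of \<open>K\<close>, are added up; these idempotents have sum
  \<open>\<one>\<close>.\<close>

lemma separability_element:
  assumes x: "x \<in> K"
  shows "\<exists>T\<in>mop K K. (\<forall>a\<in>carrier A. x \<otimes> T a = T a \<otimes> x) \<and> T \<one> = \<one>"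
proof (rule etale_coordinates, goal_cases)
  case (1 n L \<psi>)
  have Lf: "field (L i)" "unital_algebra F (L i)" if "i < n" for i
    using 1(1)[OF that] by (auto simp: finite_separable_extension_def)
  have "\<exists>e\<in>K. \<forall>j<n. \<psi> j e = (if j = i then \<one>\<^bsub>L j\<^esub> else \<zero>\<^bsub>L j\<^esub>)" for i
  proof (rule 1(8))
    fix j assume "j < n"
    then interpret L: field "L j"
      by (rule Lf)
    show "(if j = i then \<one>\<^bsub>L j\<^esub> else \<zero>\<^bsub>L j\<^esub>) \<in> carrier (L j)"
      by (metis L.one_closed L.zero_closed)
  qed
  then obtain e where e: "\<And>i. e i \<in> K"
    "\<And>i j. j < n \<Longrightarrow> \<psi> j (e i) = (if j = i then \<one>\<^bsub>L j\<^esub> else \<zero>\<^bsub>L j\<^esub>)"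
    by metis
  have psi_zero: "\<psi> j \<zero> = \<zero>\<^bsub>L j\<^esub>" if j: "j < n" for j
  proof -
    interpret L: alg "L j" F
      using Lf[OF j] by (simp add: alg_def)
    show ?thesis
      using 1(6)[OF j, of "\<zero>\<^bsub>F\<^esub>" \<one>] 1(2)[OF j, of \<one>] by simp
  qed
  have comp: "\<exists>T\<in>mop K K. (\<forall>a\<in>carrier A. x \<otimes> T a = T a \<otimes> x) \<and> T \<one> = e i" if i: "i < n" for i
  proof (rule separability_component[OF 1(1)[OF i] 1(2)[OF i] 1(3)[OF i] 1(4)[OF i] 1(5)[OF i] 1(6)[OF i] _ e(1)[of i] _ _ x])
    fix y assume y: "y \<in> carrier (L i)"
    have "\<exists>x\<in>K. \<forall>j<n. \<psi> j x = (if j = i then y else \<zero>\<^bsub>L j\<^esub>)"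
    proof (rule 1(8))
      fix j assume "j < n"
      then interpret L: field "L j"
        by (rule Lf)
      show "(if j = i then y else \<zero>\<^bsub>L j\<^esub>) \<in> carrier (L j)"
        using y by simp
    qed
    then obtain k where "k \<in> K" "\<forall>j<n. \<psi> j k = (if j = i then y else \<zero>\<^bsub>L j\<^esub>)"
      by blast
    then show "\<exists>x\<in>K. \<psi> i x = y"
      using i by (intro bexI[of _ k]) simp_all
  next
    show "e i \<otimes> e i = e i"
    proof (rule 1(7))
      fix j assume j: "j < n"
      then interpret L: field "L j"
        by (rule Lf)
      show "\<psi> j (e i \<otimes> e i) = \<psi> j (e i)"
        using 1(4)[OF j e(1)[of i] e(1)[of i]] e(2)[OF j, of i]
        by (metis L.r_one L.one_closed L.zero_closed L.r_null)
    qed (use e in auto)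
  next
    fix k assume k: "k \<in> K" "\<psi> i k = \<zero>\<^bsub>L i\<^esub>"
    show "e i \<otimes> k = \<zero>"
    proof (rule 1(7))
      fix j assume j: "j < n"
      then interpret L: field "L j"
        by (rule Lf)
      show "\<psi> j (e i \<otimes> k) = \<psi> j \<zero>"
        using 1(4)[OF j e(1)[of i] k(1)] e(2)[OF j, of i] k(2) psi_zero[OF j] 1(2)[OF j k(1)]
        by (metis L.l_null L.r_null L.one_closed)
    qed (use e k subspaceD(2)[OF K_subspace] in auto)
  qed auto
  then obtain T where T: "\<And>i. i < n \<Longrightarrow> T i \<in> mop K K"
    "\<And>i a. i < n \<Longrightarrow> a \<in> carrier A \<Longrightarrow> x \<otimes> T i a = T i a \<otimes> x" "\<And>i. i < n \<Longrightarrow> T i \<one> = e i"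
    by metis
  obtain S where S: "S \<in> mop K K" "\<And>a. a \<in> carrier A \<Longrightarrow> S a = (\<Oplus>i\<in>{..<n}. T i a)"
    using mop_finsum[of "{..<n}" T K K \<one>] T K_carr subspaceD(2)[OF K_subspace] by auto
  have "x \<otimes> S a = S a \<otimes> x" if a: "a \<in> carrier A" for a
    unfolding S(2)[OF a] using T a x mop_closed_K by (intro finsum_commute_right) auto
  moreover have "S \<one> = \<one>"
  proof -
    have eA: "e i \<in> carrier A" for i
      using e(1)[of i] by simp
    have "S \<one> = (\<Oplus>i\<in>{..<n}. e i)"
      unfolding S(2)[OF unit_closed] using T(3) eA by (intro M.finsum_cong') auto
    also have "\<dots> = \<one>"
    proof -
    have sK: "(\<Oplus>i\<in>J. e i) \<in> K" for J
      by (rule subspace_finsum[OF K_subspace e(1)])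
    show ?thesis
    proof (rule 1(7)[OF sK K_one])
      fix j assume j: "j < n"
      interpret L: field "L j"
        using j by (rule Lf)
      have "\<psi> j (\<Oplus>i\<in>J. e i) = (if j \<in> J then \<one>\<^bsub>L j\<^esub> else \<zero>\<^bsub>L j\<^esub>)" if "finite J" for J
        using that
      proof (induction J)
        case empty
        then show ?case
          using psi_zero[OF j] by simp
      next
        case (insert i J)
        have "(\<Oplus>i\<in>insert i J. e i) = e i \<oplus> (\<Oplus>i\<in>J. e i)"
          using insert eA by simp
        then show ?case
          using insert(2,3) 1(3)[OF j e(1)[of i] sK[of J]] e(2)[OF j, of i]
          by (metis insert_iff L.one_closed L.zero_closed L.l_zero L.r_zero)
      qed
      then show "\<psi> j (\<Oplus>i\<in>{..<n}. e i) = \<psi> j \<one>"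
        using 1(5)[OF j] j by simp
    qed
    qed
    finally show ?thesis .
  qed
  ultimately show ?case
    using S(1) by blast
qed

text \<open>The operators belonging to the vectors of a finite basis are composed: each fixes
  \<open>\<one>\<close> and keeps the commutation gained before. Commutation with all of
  \<open>K\<close> follows by linearity.\<close>

lemma separability_idempotent:
  obtains E where "E \<in> mop K K" "\<And>k a. k \<in> K \<Longrightarrow> a \<in> carrier A \<Longrightarrow> k \<otimes> E a = E a \<otimes> k" "E \<one> = \<one>"
proof -
  obtain B where B: "basis K B"
    by (rule K_basis)
  then have fin: "finite B" and BK: "B \<subseteq> K" and KB: "comb B = K"
    using basis_incl by (auto simp: basis_def indep_def)
  have "\<exists>E\<in>mop K K. (\<forall>k\<in>S. \<forall>a\<in>carrier A. k \<otimes> E a = E a \<otimes> k) \<and> E \<one> = \<one>" if "finite S" "S \<subseteq> K" for S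
    using that
  proof (induction S)
    case empty
    have "(\<lambda>a. (\<one> \<otimes> a) \<otimes> \<one>) \<in> mop K K"
      by (intro mop.base) auto
    then show ?case
      by (rule bexI[rotated]) auto
  next
    case (insert s S)
    then obtain E where E: "E \<in> mop K K" "\<forall>k\<in>S. \<forall>a\<in>carrier A. k \<otimes> E a = E a \<otimes> k" "E \<one> = \<one>"
      by auto
    obtain T where T: "T \<in> mop K K" "\<forall>a\<in>carrier A. s \<otimes> T a = T a \<otimes> s" "T \<one> = \<one>"
      using separability_element[of s] insert by auto
    obtain R where R: "R \<in> mop K K" "\<And>a. a \<in> carrier A \<Longrightarrow> R a = T (E a)"
      using mop_comp_K[OF T(1) E(1)] by metis
    have "k \<otimes> R a = R a \<otimes> k" if "k \<in> insert s S" "a \<in> carrier A" for k a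
    proof -
      have Ea: "E a \<in> carrier A"
        using mop_closed_K[OF E(1) that(2)] .
      show ?thesis
      proof (cases "k = s")
        case True
        then show ?thesis
          using R(2)[OF that(2)] T(2) Ea by simp
      next
        case False
        then show ?thesis
          using R(2)[OF that(2)] E(2) that insert mop_commute_K[OF T(1) _ Ea, of k] by auto
      qed
    qed
    then show ?case
      using R E(3) T(3) by (intro bexI[of _ R]) auto
  qed
  then obtain E where E: "E \<in> mop K K" "\<And>k a. k \<in> B \<Longrightarrow> a \<in> carrier A \<Longrightarrow> k \<otimes> E a = E a \<otimes> k" "E \<one> = \<one>"
    using fin BK by metis
  have "k \<otimes> E a = E a \<otimes> k" if k: "k \<in> K" and a: "a \<in> carrier A" for k a
  proof -
    have Ea: "E a \<in> carrier A"
      using mop_closed_K[OF E(1) a] .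
    obtain c where c: "c \<in> B \<rightarrow> carrier F" "k = (\<Oplus>b\<in>B. c b \<odot> b)"
      using k KB by (auto simp: comb_def)
    have cb: "c b \<odot> b \<in> carrier A" "c b \<in> carrier F" "b \<in> carrier A" if "b \<in> B" for b
      using c BK K_carr that by auto
    show ?thesis
      unfolding c(2) using cb E(2)[OF _ a] Ea fin
      by (intro finsum_commute_right[symmetric]) (auto simp: smult_mult_l smult_mult_r)
  qed
  then show ?thesis
    using that E by blast
qed

end

section \<open>Faithfulness of bimodules over simple rings\<close>

context alg begin

text \<open>\<open>B / J\<close> is a simple ring with unit \<open>e\<close>.\<close>

definition simple_mod :: "'a set \<Rightarrow> 'a set \<Rightarrow> 'a \<Rightarrow> bool" where
  "simple_mod B J e \<longleftrightarrow> subspace B \<and> B \<subseteq> N \<and> (\<forall>x\<in>B. \<forall>y\<in>B. x \<otimes> y \<in> B) \<and> e \<in> B \<and>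
     (\<forall>x\<in>B. e \<otimes> x = x \<and> x \<otimes> e = x) \<and> subspace J \<and> J \<subseteq> B \<and>
     (\<forall>x\<in>B. \<forall>y\<in>J. x \<otimes> y \<in> J \<and> y \<otimes> x \<in> J) \<and> (\<forall>y\<in>B - J. \<exists>T\<in>mop B B. T y \<ominus> e \<in> J)"

definition central_mod :: "'a set \<Rightarrow> 'a set \<Rightarrow> 'a \<Rightarrow> bool" where
  "central_mod B J e \<longleftrightarrow> (\<forall>y\<in>B. (\<forall>x\<in>B. y \<otimes> x \<ominus> x \<otimes> y \<in> J) \<longrightarrow> (\<exists>c\<in>carrier F. y \<ominus> c \<odot> e \<in> J))"

lemma simple_modD:
  assumes "simple_mod B J e"
  shows "subspace B" "B \<subseteq> N" "\<And>x y. x \<in> B \<Longrightarrow> y \<in> B \<Longrightarrow> x \<otimes> y \<in> B" "e \<in> B"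
    "\<And>x. x \<in> B \<Longrightarrow> e \<otimes> x = x" "\<And>x. x \<in> B \<Longrightarrow> x \<otimes> e = x" "subspace J" "J \<subseteq> B"
    "\<And>x y. x \<in> B \<Longrightarrow> y \<in> J \<Longrightarrow> x \<otimes> y \<in> J" "\<And>x y. x \<in> B \<Longrightarrow> y \<in> J \<Longrightarrow> y \<otimes> x \<in> J"
    "\<And>y. y \<in> B \<Longrightarrow> y \<notin> J \<Longrightarrow> \<exists>T\<in>mop B B. T y \<ominus> e \<in> J"
  using assms unfolding simple_mod_def by blast+

text \<open>The shortest relation argument for the simplicity of a tensor product of two simple
  rings, the first of them central, carried out modulo \<open>JB\<close>, \<open>JC\<close> and
  \<open>Y\<close> so that it applies to sections. \<open>JX\<close> and \<open>XJ\<close> say that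
  the radicals act as zero on \<open>X1\<close> modulo \<open>Y\<close>. Induction on
  \<open>L\<close> replaces the choice of a relation of least length.\<close>

lemma bimodule_faithful:
  assumes B: "simple_mod B JB eB" "central_mod B JB eB" and C: "simple_mod C JC eC"
    and sX: "subspace X1" and Y: "subspace Y" and XY: "\<not> X1 \<subseteq> Y"
    and BX: "\<And>b x. b \<in> B \<Longrightarrow> x \<in> X1 \<Longrightarrow> b \<otimes> x \<in> X1" and BY: "\<And>b x. b \<in> B \<Longrightarrow> x \<in> Y \<Longrightarrow> b \<otimes> x \<in> Y"
    and XC: "\<And>c x. c \<in> C \<Longrightarrow> x \<in> X1 \<Longrightarrow> x \<otimes> c \<in> X1" and YC: "\<And>c x. c \<in> C \<Longrightarrow> x \<in> Y \<Longrightarrow> x \<otimes> c \<in> Y"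
    and JX: "\<And>b x. b \<in> JB \<Longrightarrow> x \<in> X1 \<Longrightarrow> b \<otimes> x \<in> Y" and XJ: "\<And>c x. c \<in> JC \<Longrightarrow> x \<in> X1 \<Longrightarrow> x \<otimes> c \<in> Y"
    and eX: "\<And>x. x \<in> X1 \<Longrightarrow> eB \<otimes> x = x" and Xe: "\<And>x. x \<in> X1 \<Longrightarrow> x \<otimes> eC = x"
    and L: "finite L" "L \<subseteq> C"
    and ind: "\<And>c. c \<in> L \<rightarrow> carrier F \<Longrightarrow> (\<Oplus>l\<in>L. c l \<odot> l) \<in> JC \<Longrightarrow> \<forall>l\<in>L. c l = \<zero>\<^bsub>F\<^esub>"
    and a: "\<And>l. l \<in> L \<Longrightarrow> a l \<in> B" and kill: "\<And>x. x \<in> X1 \<Longrightarrow> (\<Oplus>l\<in>L. (a l \<otimes> x) \<otimes> l) \<in> Y"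
  shows "\<forall>l\<in>L. a l \<in> JB"
  using L ind a kill
proof (induction L arbitrary: a rule: finite_psubset_induct)
  case (psubset L)
  note BD = simple_modD[OF B(1)] and CD = simple_modD[OF C]
  have BN: "x \<in> N" "x \<in> carrier A" if "x \<in> B" for x
    using that BD(2) by auto
  have CN: "x \<in> N" "x \<in> carrier A" if "x \<in> C" for x
    using that CD(2) by auto
  have LN: "l \<in> N" "l \<in> carrier A" "l \<in> C" if "l \<in> L" for l
    using that CN psubset.prems by blast+
  have XA: "x \<in> carrier A" if "x \<in> X1" for x
    using that subspaceD(7)[OF sX] by blast
  have YA: "x \<in> carrier A" if "x \<in> Y" for x
    using that subspaceD(7)[OF Y] by blast
  show ?case
  proof (rule ccontr)
    assume "\<not> (\<forall>l\<in>L. a l \<in> JB)"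
    then obtain m where m: "m \<in> L" "a m \<notin> JB"
      by blast
    obtain T where T: "T \<in> mop B B" "T (a m) \<ominus> eB \<in> JB"
      using BD(11)[OF psubset.prems(3)[OF m(1)] m(2)] by blast
    have mopB: "S y \<in> B" if "S \<in> mop B B" "y \<in> B" for S y
      using mop_preserves[OF that(1) BD(1)] BD(3) that(2) by blast
    have mopC: "S y \<in> C" if "S \<in> mop C C" "y \<in> C" for S y
      using mop_preserves[OF that(1) CD(1)] CD(3) that(2) by blast
    define a' where "a' = (\<lambda>l. T (a l))"
    have a'B: "a' l \<in> B" if "l \<in> L" for l
      unfolding a'_def using mopB[OF T(1) psubset.prems(3)[OF that]] .
    \<comment> \<open>Multiplying every coefficient by \<open>p\<close> on the left and
      \<open>q\<close> on the right amounts to taking the relation at \<open>q \<otimes> x\<close>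
      and multiplying it by \<open>p\<close>. So relations are stable under operators on the
      coefficients.\<close>
    have kill': "(\<Oplus>l\<in>L. (S (a l) \<otimes> x) \<otimes> l) \<in> Y" if "S \<in> mop B B" "x \<in> X1" for S x
      using that(1)
    proof induction
      case (base p q)
      have qx: "q \<otimes> x \<in> X1"
        using BX base that by blast
      have c: "(a l \<otimes> (q \<otimes> x)) \<otimes> l \<in> carrier A" if "l \<in> L" for l
        using BN psubset.prems(3)[OF that] XA[OF qx] LN[OF that] by simp
      have "(\<Oplus>l\<in>L. (((p \<otimes> a l) \<otimes> q) \<otimes> x) \<otimes> l) = (\<Oplus>l\<in>L. p \<otimes> ((a l \<otimes> (q \<otimes> x)) \<otimes> l))"
      proof (intro M.finsum_cong' refl)
        fix l assume l: "l \<in> L"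
        show "(((p \<otimes> a l) \<otimes> q) \<otimes> x) \<otimes> l = p \<otimes> ((a l \<otimes> (q \<otimes> x)) \<otimes> l)"
          using BN[OF base(1)] BN[OF base(2)] BN[OF psubset.prems(3)[OF l]] LN[OF l] XA[OF that(2)]
          by (simp add: nuc1 nuc2)
      qed (use c BN[OF base(1)] in auto)
      also have "\<dots> = p \<otimes> (\<Oplus>l\<in>L. (a l \<otimes> (q \<otimes> x)) \<otimes> l)"
        using c BN[OF base(1)] by (intro finsum_mult_r[symmetric]) auto
      finally show ?case
        using BY[OF base(1) psubset.prems(4)[OF qx]] by simp
    next
      case (sum S R)
      have c: "S (a l) \<in> carrier A" "R (a l) \<in> carrier A" if "l \<in> L" for l
        using sum mopB psubset.prems(3)[OF that] BN by blast+
      have "(\<Oplus>l\<in>L. ((S (a l) \<oplus> R (a l)) \<otimes> x) \<otimes> l) = (\<Oplus>l\<in>L. (S (a l) \<otimes> x) \<otimes> l \<oplus> (R (a l) \<otimes> x) \<otimes> l)"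
        using c LN XA[OF that(2)] by (intro M.finsum_cong') (auto simp: mult_l_distr)
      also have "\<dots> = (\<Oplus>l\<in>L. (S (a l) \<otimes> x) \<otimes> l) \<oplus> (\<Oplus>l\<in>L. (R (a l) \<otimes> x) \<otimes> l)"
        using c LN XA[OF that(2)] by (intro M.finsum_addf) auto
      finally show ?case
        using sum subspaceD(4)[OF Y] by simp
    qed
    have killa': "(\<Oplus>l\<in>L. (a' l \<otimes> x) \<otimes> l) \<in> Y" if "x \<in> X1" for x
      unfolding a'_def using kill'[OF T(1) that] .
    have am: "a' m \<in> B" "a' m \<ominus> eB \<in> JB"
      using a'B[OF m(1)] T(2) by (auto simp: a'_def)
    \<comment> \<open>The commutators with \<open>y\<close> satisfy a relation again, and its term
      at \<open>m\<close> drops out because \<open>a' m\<close> is congruent to the unit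
      \<open>eB\<close>. The induction hypothesis for \<open>L - {m}\<close> then puts all
      commutators into \<open>JB\<close>.\<close>
    have comm: "y \<otimes> a' l \<ominus> a' l \<otimes> y \<in> JB" if y: "y \<in> B" and l: "l \<in> L" for y l
    proof -
      define d where "d = (\<lambda>l. y \<otimes> a' l \<ominus> a' l \<otimes> y)"
      have dB: "d l \<in> B" if "l \<in> L" for l
        unfolding d_def using a'B[OF that] y BD(3) subspaceD(5)[OF BD(1)] by blast
      have dm: "d m \<in> JB"
      proof -
        let ?r = "a' m \<ominus> eB"
        have "y \<otimes> ?r \<ominus> ?r \<otimes> y = (y \<otimes> a' m \<ominus> y) \<ominus> (a' m \<otimes> y \<ominus> y)"
          using y BN[OF y] BN[OF am(1)] BN[OF BD(4)] BD(5,6) by (simp add: mult_minus_l mult_minus_r)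
        also have "\<dots> = d m"
          unfolding d_def using BN[OF y] BN[OF am(1)]
          by (simp add: M.minus_eq M.minus_add M.a_ac M.r_neg2 M.r_neg)
        finally show ?thesis
          using subspaceD(5)[OF BD(7) BD(9)[OF y am(2)] BD(10)[OF y am(2)]] by simp
      qed
      have "(\<Oplus>l\<in>L - {m}. (d l \<otimes> x) \<otimes> l) \<in> Y" if x: "x \<in> X1" for x
      proof -
        have c: "(d l \<otimes> x) \<otimes> l \<in> carrier A" "(y \<otimes> (a' l \<otimes> x)) \<otimes> l \<in> carrier A" "(a' l \<otimes> (y \<otimes> x)) \<otimes> l \<in> carrier A"
          "(a' l \<otimes> x) \<otimes> l \<in> carrier A"
          if "l \<in> L" for l
          using BN[OF dB[OF that]] BN[OF a'B[OF that]] LN[OF that] XA[OF x] BN[OF y] by simp_all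
        have yx: "y \<otimes> x \<in> X1"
          using BX[OF y x] .
        have "(\<Oplus>l\<in>L. (d l \<otimes> x) \<otimes> l) = (\<Oplus>l\<in>L. (y \<otimes> ((a' l \<otimes> x) \<otimes> l)) \<ominus> (a' l \<otimes> (y \<otimes> x)) \<otimes> l)"
        proof (intro M.finsum_cong' refl)
          fix l assume l: "l \<in> L"
          show "(d l \<otimes> x) \<otimes> l = (y \<otimes> ((a' l \<otimes> x) \<otimes> l)) \<ominus> (a' l \<otimes> (y \<otimes> x)) \<otimes> l"
            unfolding d_def using BN[OF a'B[OF l]] LN[OF l] XA[OF x] BN[OF y]
            by (simp add: mult_minus_l nuc1)
        qed (use c BN[OF y] in auto)
        also have "\<dots> = (\<Oplus>l\<in>L. y \<otimes> ((a' l \<otimes> x) \<otimes> l)) \<ominus> (\<Oplus>l\<in>L. (a' l \<otimes> (y \<otimes> x)) \<otimes> l)"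
          using c BN[OF y] by (intro finsum_minus[symmetric]) auto
        also have "(\<Oplus>l\<in>L. y \<otimes> ((a' l \<otimes> x) \<otimes> l)) = y \<otimes> (\<Oplus>l\<in>L. (a' l \<otimes> x) \<otimes> l)"
          using c BN[OF y] by (intro finsum_mult_r[symmetric]) auto
        finally have "(\<Oplus>l\<in>L. (d l \<otimes> x) \<otimes> l) \<in> Y"
          using subspaceD(5)[OF Y BY[OF y killa'[OF x]] killa'[OF yx]] by simp
        moreover have "(\<Oplus>l\<in>L. (d l \<otimes> x) \<otimes> l) = (d m \<otimes> x) \<otimes> m \<oplus> (\<Oplus>l\<in>L - {m}. (d l \<otimes> x) \<otimes> l)"
        proof -
          have "L = insert m (L - {m})"
            using m(1) by blast
          then show ?thesis
            using c psubset.hyps(1) m(1) M.finsum_insert[of "L - {m}" m "\<lambda>l. (d l \<otimes> x) \<otimes> l"] by auto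
        qed
        moreover have dY: "(d m \<otimes> x) \<otimes> m \<in> Y"
          using YC[OF LN(3)[OF m(1)] JX[OF dm x]] .
        moreover have "(\<Oplus>l\<in>L - {m}. (d l \<otimes> x) \<otimes> l) \<in> carrier A"
          using c by (intro M.finsum_closed) auto
        ultimately have "((d m \<otimes> x) \<otimes> m \<oplus> (\<Oplus>l\<in>L - {m}. (d l \<otimes> x) \<otimes> l)) \<ominus> (d m \<otimes> x) \<otimes> m \<in> Y"
          using subspaceD(5)[OF Y] by simp
        moreover have "(p \<oplus> q) \<ominus> p = q" if "p \<in> carrier A" "q \<in> carrier A" for p q
          using that by (simp add: M.minus_eq M.a_comm[of p q] M.a_assoc M.r_neg)
        ultimately show ?thesis
          using YA[OF dY] \<open>(\<Oplus>l\<in>L - {m}. (d l \<otimes> x) \<otimes> l) \<in> carrier A\<close> by simp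
      qed
      moreover have "\<forall>l\<in>L - {m}. c l = \<zero>\<^bsub>F\<^esub>"
        if c: "c \<in> L - {m} \<rightarrow> carrier F" and s: "(\<Oplus>l\<in>L - {m}. c l \<odot> l) \<in> JC" for c
      proof -
        \<comment> \<open>Extended by zero at \<open>m\<close>, so that the independence of all of
          \<open>L\<close> can be used.\<close>
        let ?c = "c(m := \<zero>\<^bsub>F\<^esub>)"
        have cF: "?c l \<in> carrier F" if "l \<in> L" for l
          using c that by auto
        have eq: "(\<Oplus>l\<in>L. ?c l \<odot> l) = (\<Oplus>l\<in>L - {m}. c l \<odot> l)"
        proof (rule M.add.finprod_mono_neutral_cong_right)
          show "(\<lambda>l. ?c l \<odot> l) \<in> L \<rightarrow> carrier A"
            using cF LN(2) smult_closed by blast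
        qed (use LN(2)[OF m(1)] psubset.hyps(1) m(1) in auto)
        have "\<forall>l\<in>L. ?c l = \<zero>\<^bsub>F\<^esub>"
        proof (rule psubset.prems(2))
          show "?c \<in> L \<rightarrow> carrier F"
            using cF by blast
          show "(\<Oplus>l\<in>L. ?c l \<odot> l) \<in> JC"
            unfolding eq by (rule s)
        qed
        then show ?thesis
          by (metis DiffE fun_upd_other singletonI)
      qed
      ultimately have "\<forall>l\<in>L - {m}. d l \<in> JB"
        using psubset.IH[of "L - {m}" d] psubset.prems(1) m(1) dB by blast
      then show ?thesis
        using dm l unfolding d_def by (cases "l = m") auto
    qed
    have "\<exists>c\<in>carrier F. a' l \<ominus> c \<odot> eB \<in> JB" if l: "l \<in> L" for l
    proof -
      have "a' l \<otimes> y \<ominus> y \<otimes> a' l \<in> JB" if "y \<in> B" for y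
        using subspace_sym[OF BD(7) comm[OF that l]] BN[OF that] BN[OF a'B[OF l]] by simp
      then show ?thesis
        using B(2) a'B[OF l] unfolding central_mod_def by blast
    qed
    then obtain c0 where c0: "\<And>l. l \<in> L \<Longrightarrow> c0 l \<in> carrier F \<and> a' l \<ominus> c0 l \<odot> eB \<in> JB"
      by metis
    \<comment> \<open>At \<open>m\<close> the scalar is taken to be exactly 1, which is legitimate
      since \<open>a' m\<close> is congruent to \<open>eB\<close>; this keeps the combination
      \<open>bb\<close> of the right coefficients out of \<open>JC\<close>.\<close>
    define c where "c = c0(m := \<one>\<^bsub>F\<^esub>)"
    have c: "c l \<in> carrier F" "a' l \<ominus> c l \<odot> eB \<in> JB" if "l \<in> L" for l
      using c0[OF that] am BN[OF BD(4)] by (auto simp: c_def)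
    define bb where "bb = (\<Oplus>l\<in>L. c l \<odot> l)"
    have bC: "bb \<in> C"
      unfolding bb_def using c LN subspaceD(6)[OF CD(1)] by (intro subspace_finsum[OF CD(1)]) blast
    have "bb \<notin> JC"
    proof
      assume "bb \<in> JC"
      have "\<forall>l\<in>L. c l = \<zero>\<^bsub>F\<^esub>"
      proof (rule psubset.prems(2))
        show "c \<in> L \<rightarrow> carrier F"
          using c(1) by blast
        show "(\<Oplus>l\<in>L. c l \<odot> l) \<in> JC"
          using \<open>bb \<in> JC\<close> by (simp only: bb_def)
      qed
      then have "c m = \<zero>\<^bsub>F\<^esub>"
        using m(1) by blast
      then show False
        by (simp add: c_def)
    qed
    then obtain R where R: "R \<in> mop C C" "R bb \<ominus> eC \<in> JC"
      using CD(11)[OF bC] by blast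
    \<comment> \<open>With all left coefficients congruent to scalars, the relation collapses to
      right multiplication by the single element \<open>bb\<close> of \<open>C\<close>.\<close>
    have xb: "x \<otimes> bb \<in> Y" if x: "x \<in> X1" for x
    proof -
      have cc: "(a' l \<otimes> x) \<otimes> l \<in> carrier A" "x \<otimes> (c l \<odot> l) \<in> carrier A" "a' l \<in> carrier A" "c l \<odot> eB \<in> carrier A"
        if "l \<in> L" for l
        using BN[OF a'B[OF that]] LN[OF that] XA[OF x] c[OF that] BN[OF BD(4)] by simp_all
      have "(\<Oplus>l\<in>L. (a' l \<otimes> x) \<otimes> l) \<ominus> (\<Oplus>l\<in>L. x \<otimes> (c l \<odot> l)) =
          (\<Oplus>l\<in>L. (a' l \<otimes> x) \<otimes> l \<ominus> x \<otimes> (c l \<odot> l))"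
        using cc by (intro finsum_minus) auto
      also have "\<dots> \<in> Y"
      proof (rule subspace_finsum[OF Y])
        fix l assume l: "l \<in> L"
        have "(a' l \<otimes> x) \<otimes> l \<ominus> x \<otimes> (c l \<odot> l) = ((a' l \<ominus> c l \<odot> eB) \<otimes> x) \<otimes> l"
          using cc[OF l] XA[OF x] LN[OF l] c[OF l] BN[OF BD(4)] eX[OF x]
          by (simp add: mult_minus_l smult_mult_l smult_mult_r)
        then show "(a' l \<otimes> x) \<otimes> l \<ominus> x \<otimes> (c l \<odot> l) \<in> Y"
          using YC[OF LN(3)[OF l] JX[OF c(2)[OF l] x]] by simp
      qed
      finally have "(\<Oplus>l\<in>L. x \<otimes> (c l \<odot> l)) \<in> Y"
        using subspace_mem_diff'[OF Y _ killa'[OF x]] cc by simp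
      moreover have "(\<Oplus>l\<in>L. x \<otimes> (c l \<odot> l)) = x \<otimes> bb"
        unfolding bb_def using LN c XA[OF x] by (intro finsum_mult_r[symmetric]) auto
      ultimately show ?thesis
        by simp
    qed
    \<comment> \<open>Simplicity of \<open>C\<close> modulo \<open>JC\<close> recovers the unit
      \<open>eC\<close> from \<open>bb\<close>, so that everything in \<open>X1\<close> ends up in
      \<open>Y\<close>, against the assumption \<open>XY\<close>.\<close>
    have xR: "x \<otimes> S bb \<in> Y" if "S \<in> mop C C" "x \<in> X1" for S x
      using that
    proof (induction arbitrary: x)
      case (base p q)
      have "x \<otimes> ((p \<otimes> bb) \<otimes> q) = ((x \<otimes> p) \<otimes> bb) \<otimes> q"
        using CN[OF base(1)] CN[OF base(2)] CN[OF bC] XA[OF base(3)] by (simp add: nuc1 nuc2 nuc3)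
      then show ?case
        using YC[OF base(2) xb[OF XC[OF base(1,3)]]] by simp
    next
      case (sum S R)
      have "S bb \<in> carrier A" "R bb \<in> carrier A"
        using sum.hyps mopC bC CN by blast+
      then show ?case
        using sum.IH[OF sum.prems] subspaceD(4)[OF Y] XA[OF sum.prems] by (simp add: mult_r_distr)
    qed
    have "x \<in> Y" if x: "x \<in> X1" for x
    proof -
      have Rb: "R bb \<in> carrier A" "eC \<in> carrier A"
        using mopC[OF R(1) bC] CN CD(4) by blast+
      have "x \<otimes> R bb \<ominus> x \<otimes> eC \<in> Y"
        using XJ[OF R(2) x] Rb XA[OF x] by (simp add: mult_minus_r)
      then show ?thesis
        using subspace_mem_diff'[OF Y _ xR[OF R(1) x]] Xe[OF x] XA[OF x] by simp
    qed
    then show False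
      using XY by blast
  qed
qed

end

section \<open>The semisimple quotient of the nucleus\<close>

context alg begin

abbreviation NA :: "('f, 'a) module" where "NA \<equiv> A\<lparr>carrier := N\<rparr>"
abbreviation J :: "'a set" where "J \<equiv> jacobson_radical NA"

lemma NA_ring: "ring NA"
proof (rule ringI)
  have "module F NA"
    using submodule.submodule_is_module[OF nuc_subspace] module_axioms by blast
  then show "abelian_group NA"
    by (simp add: module_def)
  show "monoid NA"
    by (rule monoidI) (auto simp: nuc1)
qed (auto simp: mult_l_distr mult_r_distr)

sublocale NA: ring NA
  by (rule NA_ring)

lemma J_ideal: "ideal J NA"
  by (rule NA.jacobson_radical_ideal)

sublocale J: ideal J NA
  by (rule J_ideal)

lemma J_nuc: "x \<in> J \<Longrightarrow> x \<in> N"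
  using J.a_subset by auto

lemma J_mult: "x \<in> J \<Longrightarrow> y \<in> N \<Longrightarrow> x \<otimes> y \<in> J" "x \<in> J \<Longrightarrow> y \<in> N \<Longrightarrow> y \<otimes> x \<in> J"
  using J.I_l_closed[of x y] J.I_r_closed[of x y] by auto

lemma J_subspace: "subspace J"
proof (rule subspaceI)
  show "J \<subseteq> carrier A"
    using J_nuc nuc_carr by blast
  show "\<zero> \<in> J"
    using J.zero_closed by simp
  show "x \<oplus> y \<in> J" if "x \<in> J" "y \<in> J" for x y
    using J.a_closed[OF that] by simp
  fix c x assume c: "c \<in> carrier F" and x: "x \<in> J"
  then have "(c \<odot> \<one>) \<otimes> x \<in> J"
    using J_mult(2)[OF x] subspaceD(6)[OF nuc_subspace c nuc_one] by blast
  then show "c \<odot> x \<in> J"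
    using c J_nuc[OF x] by (simp add: smult_mult_l)
qed

lemma J_idempotent: "e \<in> J \<Longrightarrow> e \<otimes> e = e \<Longrightarrow> e = \<zero>"
  using NA.jacobson_radical_idempotent[of e] by simp

lemma minus_zero [simp]: "x \<in> carrier A \<Longrightarrow> x \<ominus> \<zero> = x"
  using minus_add_cancel[of x \<zero>] by simp

text \<open>Elements of \<open>sigma A\<close> are handled through representatives in
  \<open>N\<close>, so statements about the quotient become congruences modulo
  \<open>J\<close>.\<close>

definition q :: "'a \<Rightarrow> 'a set" where "q x = J +>\<^bsub>NA\<^esub> x"

lemma q_eq: "x \<in> N \<Longrightarrow> q x = {y \<in> N. y \<ominus> x \<in> J}"
proof -
  assume x: "x \<in> N"
  have "q x = {j \<oplus> x | j. j \<in> J}"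
    by (auto simp: q_def a_r_coset_def')
  also have "\<dots> = {y \<in> N. y \<ominus> x \<in> J}"
  proof (intro subset_antisym subsetI)
    fix y assume "y \<in> {j \<oplus> x | j. j \<in> J}"
    then obtain j where j: "j \<in> J" "y = j \<oplus> x"
      by blast
    then have "y \<in> N" "y \<ominus> x = j"
      using x J_nuc[OF j(1)] subspaceD(4)[OF nuc_subspace] by (auto simp: M.minus_eq M.a_assoc M.r_neg)
    then show "y \<in> {y \<in> N. y \<ominus> x \<in> J}"
      using j by simp
  next
    fix y assume y: "y \<in> {y \<in> N. y \<ominus> x \<in> J}"
    then have "y = (y \<ominus> x) \<oplus> x"
      using x by (simp add: minus_add_cancel)
    then show "y \<in> {j \<oplus> x | j. j \<in> J}"
      using y by blast
  qed
  finally show ?thesis .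
qed

lemma q_mem: "x \<in> N \<Longrightarrow> y \<in> q x \<longleftrightarrow> y \<in> N \<and> y \<ominus> x \<in> J"
  by (simp only: q_eq mem_Collect_eq)

lemma q_self: "x \<in> N \<Longrightarrow> x \<in> q x"
  using subspaceD(2)[OF J_subspace] by (simp only: q_mem minus_self nuc_carr)

lemma q_eq_iff:
  assumes xy: "x \<in> N" "y \<in> N"
  shows "q x = q y \<longleftrightarrow> x \<ominus> y \<in> J"
proof
  assume "q x = q y"
  then show "x \<ominus> y \<in> J"
    using q_self[OF xy(1)] q_mem[OF xy(2)] by blast
next
  have "q u \<subseteq> q v" if d: "u \<ominus> v \<in> J" and uv: "u \<in> N" "v \<in> N" for u v
  proof
    fix z assume z: "z \<in> q u"
    then have "z \<in> N" "z \<ominus> u \<in> J"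
      using q_mem[OF uv(1)] by blast+
    then show "z \<in> q v"
      using subspace_trans[OF J_subspace _ d] uv q_mem[OF uv(2)] nuc_carr by blast
  qed
  moreover assume "x \<ominus> y \<in> J"
  ultimately show "q x = q y"
    using subspace_sym[OF J_subspace] xy nuc_carr by blast
qed

lemma q_zero: "q \<zero> = J"
proof -
  have "y \<in> q \<zero> \<longleftrightarrow> y \<in> J" for y
    using q_mem[OF subspaceD(2)[OF nuc_subspace], of y] minus_zero[of y] J_nuc[of y] nuc_carr[of y]
    by metis
  then show ?thesis
    by blast
qed

abbreviation S where "S \<equiv> sigma A"

lemma S_carrier: "carrier S = q ` N"
  by (auto simp: sigma_def quot_def A_RCOSETS_def' q_def)

lemma S_mult: "x \<in> N \<Longrightarrow> y \<in> N \<Longrightarrow> q x \<otimes>\<^bsub>S\<^esub> q y = q (x \<otimes> y)"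
  using J.rcoset_mult_add[of x y] by (simp add: sigma_def quot_def q_def)

lemma S_add: "x \<in> N \<Longrightarrow> y \<in> N \<Longrightarrow> q x \<oplus>\<^bsub>S\<^esub> q y = q (x \<oplus> y)"
  using J.a_rcos_sum[of x y] by (simp add: sigma_def quot_def q_def)

lemma S_zero: "\<zero>\<^bsub>S\<^esub> = q \<zero>"
  unfolding q_zero by (simp add: sigma_def quot_def)

lemma S_one: "\<one>\<^bsub>S\<^esub> = q \<one>"
  by (simp add: sigma_def quot_def q_def)

text \<open>Scalar multiplication in \<open>quot\<close> is a union over all representatives; it
  collapses to one coset because \<open>J\<close> is a subspace.\<close>

lemma S_smult:
  assumes "c \<in> carrier F" "x \<in> N"
  shows "c \<odot>\<^bsub>S\<^esub> q x = q (c \<odot> x)"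
proof -
  have "c \<odot>\<^bsub>S\<^esub> q x = (\<Union>y\<in>q x. q (c \<odot> y))"
    by (simp add: sigma_def quot_def q_def)
  also have "q (c \<odot> y) = q (c \<odot> x)" if "y \<in> q x" for y
  proof -
    have y: "y \<in> N" "y \<ominus> x \<in> J"
      using that q_mem[OF assms(2)] by blast+
    then have "c \<odot> (y \<ominus> x) \<in> J"
      using subspaceD(6)[OF J_subspace] assms by blast
    then show ?thesis
      using q_eq_iff[of "c \<odot> y" "c \<odot> x"] subspaceD(6)[OF nuc_subspace] y assms
      by (simp add: smult_minus_r)
  qed
  then have "(\<Union>y\<in>q x. q (c \<odot> y)) = (\<Union>y\<in>q x. q (c \<odot> x))"
    by simp
  also have "\<dots> = q (c \<odot> x)"
    using q_self[OF assms(2)] by blast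
  finally show ?thesis .
qed

lemma nuc_add [simp]: "x \<in> N \<Longrightarrow> y \<in> N \<Longrightarrow> x \<oplus> y \<in> N"
  and nuc_zero [simp]: "\<zero> \<in> N"
  and nuc_minus [simp]: "x \<in> N \<Longrightarrow> y \<in> N \<Longrightarrow> x \<ominus> y \<in> N"
  and nuc_smult [simp]: "c \<in> carrier F \<Longrightarrow> x \<in> N \<Longrightarrow> c \<odot> x \<in> N"
  by (rule subspaceD[OF nuc_subspace]; assumption)+

lemma S_elem: "x \<in> carrier S \<Longrightarrow> (\<And>a. a \<in> N \<Longrightarrow> x = q a \<Longrightarrow> P) \<Longrightarrow> P"
  unfolding S_carrier by blast

lemma q_S: "a \<in> N \<Longrightarrow> q a \<in> carrier S"
  unfolding S_carrier by blast

lemma S_ring: "ring S"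
proof (rule ringI)
  show "abelian_group S"
  proof (rule abelian_groupI)
    fix x assume "x \<in> carrier S"
    then obtain a where a: "a \<in> N" "x = q a"
      by (rule S_elem)
    have n: "\<ominus> a \<in> N"
      using subspaceD(3)[OF nuc_subspace a(1)] .
    have "q (\<ominus> a) \<oplus>\<^bsub>S\<^esub> x = \<zero>\<^bsub>S\<^esub>"
      unfolding a(2) S_add[OF n a(1)] S_zero using a by (simp add: M.l_neg)
    then show "\<exists>y\<in>carrier S. y \<oplus>\<^bsub>S\<^esub> x = \<zero>\<^bsub>S\<^esub>"
      using q_S[OF n] by blast
    show "\<zero>\<^bsub>S\<^esub> \<oplus>\<^bsub>S\<^esub> x = x"
      unfolding a(2) S_zero using a by (simp add: S_add)
  next
    show "\<zero>\<^bsub>S\<^esub> \<in> carrier S"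
      unfolding S_zero by (rule q_S) simp
  next
    fix x y assume "x \<in> carrier S" "y \<in> carrier S"
    then obtain a b where ab: "a \<in> N" "x = q a" "b \<in> N" "y = q b"
      by (meson S_elem)
    show "x \<oplus>\<^bsub>S\<^esub> y \<in> carrier S"
      unfolding ab(2,4) using ab by (simp add: S_add q_S)
    show "x \<oplus>\<^bsub>S\<^esub> y = y \<oplus>\<^bsub>S\<^esub> x"
      unfolding ab(2,4) using ab by (simp add: S_add M.a_comm)
  next
    fix x y z assume "x \<in> carrier S" "y \<in> carrier S" "z \<in> carrier S"
    then obtain a b c where ab: "a \<in> N" "x = q a" "b \<in> N" "y = q b" "c \<in> N" "z = q c"
      by (meson S_elem)
    show "(x \<oplus>\<^bsub>S\<^esub> y) \<oplus>\<^bsub>S\<^esub> z = x \<oplus>\<^bsub>S\<^esub> (y \<oplus>\<^bsub>S\<^esub> z)"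
      unfolding ab(2,4,6) using ab by (simp add: S_add M.a_assoc)
  qed
  show "monoid S"
  proof (rule monoidI)
    show "\<one>\<^bsub>S\<^esub> \<in> carrier S"
      unfolding S_one by (rule q_S) simp
  next
    fix x assume "x \<in> carrier S"
    then obtain a where a: "a \<in> N" "x = q a"
      by (rule S_elem)
    then show "\<one>\<^bsub>S\<^esub> \<otimes>\<^bsub>S\<^esub> x = x" "x \<otimes>\<^bsub>S\<^esub> \<one>\<^bsub>S\<^esub> = x"
      unfolding S_one by (simp_all add: S_mult)
  next
    fix x y assume "x \<in> carrier S" "y \<in> carrier S"
    then obtain a b where ab: "a \<in> N" "x = q a" "b \<in> N" "y = q b"
      by (meson S_elem)
    then show "x \<otimes>\<^bsub>S\<^esub> y \<in> carrier S"
      by (simp add: S_mult q_S)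
  next
    fix x y z assume "x \<in> carrier S" "y \<in> carrier S" "z \<in> carrier S"
    then obtain a b c where ab: "a \<in> N" "x = q a" "b \<in> N" "y = q b" "c \<in> N" "z = q c"
      by (meson S_elem)
    show "(x \<otimes>\<^bsub>S\<^esub> y) \<otimes>\<^bsub>S\<^esub> z = x \<otimes>\<^bsub>S\<^esub> (y \<otimes>\<^bsub>S\<^esub> z)"
      unfolding ab(2,4,6) using ab by (simp add: S_mult nuc1)
  qed
next
  fix x y z assume "x \<in> carrier S" "y \<in> carrier S" "z \<in> carrier S"
  then obtain a b c where ab: "a \<in> N" "x = q a" "b \<in> N" "y = q b" "c \<in> N" "z = q c"
    by (meson S_elem)
  show "(x \<oplus>\<^bsub>S\<^esub> y) \<otimes>\<^bsub>S\<^esub> z = x \<otimes>\<^bsub>S\<^esub> z \<oplus>\<^bsub>S\<^esub> y \<otimes>\<^bsub>S\<^esub> z"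
    unfolding ab(2,4,6) using ab by (simp add: S_mult S_add mult_l_distr)
  show "z \<otimes>\<^bsub>S\<^esub> (x \<oplus>\<^bsub>S\<^esub> y) = z \<otimes>\<^bsub>S\<^esub> x \<oplus>\<^bsub>S\<^esub> z \<otimes>\<^bsub>S\<^esub> y"
    unfolding ab(2,4,6) using ab by (simp add: S_mult S_add mult_r_distr)
qed

text \<open>These are the preimages in \<open>N\<close> of the ideals of
  \<open>sigma A\<close>.\<close>

definition nideal :: "'a set \<Rightarrow> bool" where
  "nideal P \<longleftrightarrow> subspace P \<and> J \<subseteq> P \<and> P \<subseteq> N \<and> (\<forall>x\<in>N. \<forall>y\<in>P. x \<otimes> y \<in> P \<and> y \<otimes> x \<in> P)"

definition minimal_nideal :: "'a set \<Rightarrow> bool" where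
  "minimal_nideal P \<longleftrightarrow> nideal P \<and> P \<noteq> J \<and> (\<forall>Q. nideal Q \<and> Q \<subseteq> P \<longrightarrow> Q = J \<or> Q = P)"

text \<open>The correspondence between the ideals of \<open>N\<close> above \<open>J\<close> and the
  ideals of \<open>sigma A\<close>, applied to minimal ones.\<close>

lemma minimal_nideal_component:
  assumes P: "minimal_nideal P"
  shows "simple_component (q ` P) S"
proof -
  have n: "nideal P" "subspace P" "J \<subseteq> P" "P \<subseteq> N" "P \<noteq> J"
    using P by (auto simp: minimal_nideal_def nideal_def)
  have PN: "x \<in> N" if "x \<in> P" for x
    using that n by blast
  have nm: "x \<otimes> y \<in> P" "y \<otimes> x \<in> P" if "x \<in> N" "y \<in> P" for x y
    using that n(1) by (auto simp: nideal_def)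
  interpret S: ring S
    by (rule S_ring)
  have "ideal (q ` P) S"
  proof (rule idealI)
    show "ring S"
      by (rule S_ring)
    show "subgroup (q ` P) (add_monoid S)"
    proof (rule S.add.subgroupI)
      show "q ` P \<subseteq> carrier S"
        using n by (auto simp: S_carrier)
      show "q ` P \<noteq> {}"
        using subspaceD(2)[OF n(2)] by blast
    next
      fix a assume "a \<in> q ` P"
      then obtain x where x: "x \<in> P" "a = q x"
        by blast
      have nx: "\<ominus> x \<in> P" "\<ominus> x \<in> N"
        using x subspaceD(3)[OF n(2)] PN by auto
      have "q (\<ominus> x) \<oplus>\<^bsub>S\<^esub> a = \<zero>\<^bsub>S\<^esub>"
        using x nx PN[OF x(1)] by (simp add: S_add S_zero M.l_neg)
      then have "\<ominus>\<^bsub>S\<^esub> a = q (\<ominus> x)"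
        using x nx PN[OF x(1)] by (intro S.minus_equality) (auto simp: S_carrier)
      then show "\<ominus>\<^bsub>S\<^esub> a \<in> q ` P"
        using nx by simp
    next
      fix a b assume "a \<in> q ` P" "b \<in> q ` P"
      then obtain x y where xy: "x \<in> P" "a = q x" "y \<in> P" "b = q y"
        by blast
      then have "a \<oplus>\<^bsub>S\<^esub> b = q (x \<oplus> y)" "x \<oplus> y \<in> P"
        using S_add PN subspaceD(4)[OF n(2)] by simp_all
      then show "a \<oplus>\<^bsub>S\<^esub> b \<in> q ` P"
        by blast
    qed
  qed (use PN nm in \<open>auto simp: S_carrier S_mult\<close>)
  moreover have "q ` P \<noteq> {\<zero>\<^bsub>S\<^esub>}"
  proof
    assume z: "q ` P = {\<zero>\<^bsub>S\<^esub>}"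
    have "x \<in> J" if "x \<in> P" for x
    proof -
      have "q x = q \<zero>"
        using z that by (auto simp: S_zero)
      then show ?thesis
        using q_eq_iff[OF PN[OF that], of \<zero>] PN[OF that] subspaceD(2)[OF nuc_subspace]
        by simp
    qed
    then show False
      using n by blast
  qed
  moreover have "I = {\<zero>\<^bsub>S\<^esub>} \<or> I = q ` P" if I: "ideal I S" and le: "I \<subseteq> q ` P" for I
  proof -
    interpret I: ideal I S
      by (rule I)
    define Q where "Q = {x \<in> N. q x \<in> I}"
    have qQ: "q ` Q = I"
      using le PN by (auto simp: Q_def)
    have "nideal Q"
      unfolding nideal_def
    proof (intro conjI ballI)
      show "subspace Q"
      proof (rule subspaceI)
        show "\<zero> \<in> Q"
          using I.zero_closed subspaceD(2)[OF nuc_subspace] by (simp add: Q_def S_zero)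
        show "x \<oplus> y \<in> Q" if "x \<in> Q" "y \<in> Q" for x y
          using that I.a_closed[of "q x" "q y"] subspaceD(4)[OF nuc_subspace] by (auto simp: Q_def S_add)
        \<comment> \<open>\<open>ideal\<close> is a notion for rings; closure under scalars follows
          from \<open>c x = (c 1) x\<close> with \<open>c 1\<close> nuclear.\<close>
        show "c \<odot> x \<in> Q" if "c \<in> carrier F" "x \<in> Q" for c x
        proof -
          have 1: "c \<odot> \<one> \<in> N" "x \<in> N" "q x \<in> I"
            using that subspaceD(6)[OF nuc_subspace] by (auto simp: Q_def)
          then have "q (c \<odot> \<one>) \<otimes>\<^bsub>S\<^esub> q x \<in> I"
            by (intro I.I_l_closed) (auto simp: S_carrier)
          then show ?thesis
            using 1 that subspaceD(6)[OF nuc_subspace] by (auto simp: Q_def S_mult smult_mult_l)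
        qed
      qed (auto simp: Q_def)
      show "J \<subseteq> Q"
      proof
        fix x assume x: "x \<in> J"
        then have "q x = q \<zero>"
          using q_eq_iff[OF J_nuc[OF x], of \<zero>] J_nuc[OF x] nuc_zero
          by simp
        then show "x \<in> Q"
          using J_nuc[OF x] I.zero_closed by (simp add: Q_def S_zero)
      qed
      show "Q \<subseteq> N"
        by (auto simp: Q_def)
      show "x \<otimes> y \<in> Q" "y \<otimes> x \<in> Q" if "x \<in> N" "y \<in> Q" for x y
        using that I.I_l_closed[of "q y" "q x"] I.I_r_closed[of "q y" "q x"]
        by (auto simp: Q_def S_mult S_carrier)
    qed
    moreover have "Q \<subseteq> P"
    proof
      fix x assume x: "x \<in> Q"
      then obtain y where y: "y \<in> P" "q x = q y"
        using le by (auto simp: Q_def)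
      then have "x \<ominus> y \<in> P"
        using q_eq_iff[of x y] x PN n by (auto simp: Q_def)
      then show "x \<in> P"
        using subspace_mem_diff[OF n(2) _ y(1)] x by (auto simp: Q_def)
    qed
    ultimately have "Q = J \<or> Q = P"
      using P by (auto simp: minimal_nideal_def)
    moreover have "q ` J = {q \<zero>}"
    proof -
      have "q x = q \<zero>" if "x \<in> J" for x
        using q_eq_iff[OF J_nuc[OF that], of \<zero>] J_nuc[OF that] that subspaceD(2)[OF nuc_subspace]
        by simp
      then show ?thesis
        using subspaceD(2)[OF J_subspace] by blast
    qed
    ultimately show ?thesis
      using qQ by (auto simp: S_zero)
  qed
  ultimately show ?thesis
    by (simp add: simple_component_def)
qed

end

section \<open>The etale subalgebra modulo the radical\<close>

context semiassoc begin

text \<open>By regularity \<open>x = x y x\<close> for some \<open>y\<close>, so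
  \<open>x \<otimes> y\<close> is an idempotent of the radical and vanishes.\<close>

lemma K_inter_J:
  assumes "x \<in> K" "x \<in> J"
  shows "x = \<zero>"
proof -
  obtain y where y: "y \<in> K" "(x \<otimes> y) \<otimes> x = x"
    using K_regular[OF assms(1)] by blast
  have xy: "x \<in> N" "y \<in> N"
    using assms y by auto
  have "x \<otimes> y \<in> J"
    using J_mult(1)[OF assms(2) xy(2)] .
  moreover have "(x \<otimes> y) \<otimes> (x \<otimes> y) = x \<otimes> y"
    using y xy by (simp add: nuc1[of "x \<otimes> y", symmetric])
  ultimately have "x \<otimes> y = \<zero>"
    by (rule J_idempotent)
  then show ?thesis
    using y xy by simp
qed

text \<open>Commutativity of \<open>K\<close> makes its operators endomorphisms of the bimodule
  \<open>A\<close> over \<open>K\<close>. In particular they respect the Peirce components belonging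
  to idempotents of \<open>K\<close>.\<close>

lemma mop_K_bimodule:
  assumes T: "T \<in> mop K K" and k: "k \<in> K" and a: "a \<in> carrier A"
  shows "T (k \<otimes> a) = k \<otimes> T a" "T (a \<otimes> k) = T a \<otimes> k"
proof -
  have "T (k \<otimes> a) = k \<otimes> T a \<and> T (a \<otimes> k) = T a \<otimes> k"
    using T
  proof induction
    case (base p r)
    have c: "p \<in> N" "r \<in> N" "k \<in> N"
      using base k by auto
    have "(p \<otimes> (k \<otimes> a)) \<otimes> r = ((p \<otimes> k) \<otimes> a) \<otimes> r"
      using c a by (simp add: nuc1)
    also have "\<dots> = k \<otimes> ((p \<otimes> a) \<otimes> r)"
      unfolding K_comm[OF base(1) k] using c a by (simp add: nuc1)
    finally have 1: "(p \<otimes> (k \<otimes> a)) \<otimes> r = k \<otimes> ((p \<otimes> a) \<otimes> r)" .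
    have "(p \<otimes> (a \<otimes> k)) \<otimes> r = (p \<otimes> a) \<otimes> (k \<otimes> r)"
      using c a by (simp add: nuc1 nuc2)
    also have "\<dots> = ((p \<otimes> a) \<otimes> r) \<otimes> k"
      unfolding K_comm[OF k base(2)] using c a by (simp add: nuc2)
    finally show ?case
      using 1 by simp
  next
    case (sum S R)
    then show ?case
      using mop_closed_K[OF sum(1) a] mop_closed_K[OF sum(2) a] k by (simp add: mult_l_distr mult_r_distr)
  qed
  then show "T (k \<otimes> a) = k \<otimes> T a" "T (a \<otimes> k) = T a \<otimes> k"
    by auto
qed

text \<open>The separability idempotent maps \<open>A\<close> onto the centralizer of \<open>K\<close>, which is \<open>K\<close> itself by minimality.\<close>

lemma centralizer_lift:
  assumes x: "x \<in> N" and comm: "\<And>k. k \<in> K \<Longrightarrow> k \<otimes> x \<ominus> x \<otimes> k \<in> J"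
  obtains y where "y \<in> K" "x \<ominus> y \<in> J"
proof -
  obtain E where E: "E \<in> mop K K" "\<And>k a. k \<in> K \<Longrightarrow> a \<in> carrier A \<Longrightarrow> k \<otimes> E a = E a \<otimes> k" "E \<one> = \<one>"
    using separability_idempotent by metis
  note EA = mop_closed_K[OF E(1)]
  \<comment> \<open>On an element \<open>c\<close> of the centralizer the left coefficients can be
    moved past \<open>c\<close>, so the operator acts as multiplication on the right by its value at
    \<open>\<one>\<close>.\<close>
  have central: "T c = c \<otimes> T \<one>" if "T \<in> mop K K" "c \<in> carrier A" "\<And>k. k \<in> K \<Longrightarrow> k \<otimes> c = c \<otimes> k" for T c
    using that(1)
  proof induction
    case (base k l)
    have kl: "k \<in> N" "l \<in> N"
      using base by auto
    then show ?case
      using that(2) that(3)[OF base(1)] by (simp add: nuc2)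
  next
    case (sum S R)
    then show ?case
      using that(2) mop_closed_K[OF sum(1) unit_closed] mop_closed_K[OF sum(2) unit_closed]
      by (simp add: mult_r_distr)
  qed
  have EE: "E (E a) = E a" if "a \<in> carrier A" for a
    using central[OF E(1) EA[OF that] E(2)[OF _ that]] E(3) EA[OF that] by simp
  \<comment> \<open>This subspace contains \<open>\<one>\<close> and the kernel of \<open>E\<close>.
    An operator vanishing on it kills \<open>a \<ominus> E a\<close>; it also kills
    \<open>E a\<close>, because its value at \<open>\<one>\<close> is zero. Minimality then says
    that \<open>E\<close> maps all of \<open>A\<close> into \<open>K\<close>.\<close>
  define N1 where "N1 = {a \<in> carrier A. E a \<in> K}"
  note kE = mop_K_bimodule[OF E(1)]
  have N1: "subspace N1"
    unfolding N1_def
    by (rule subspaceI) (use subspaceD[OF K_subspace] mop_add[OF E(1) K_carr K_carr]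
        mop_smult[OF E(1) K_carr K_carr] mop_zero[OF E(1) K_carr K_carr] in auto)
  have N1K: "k \<otimes> a \<in> N1" "a \<otimes> k \<in> N1" if "k \<in> K" "a \<in> N1" for k a
    using that kE by (auto simp: N1_def)
  have "N1 = carrier A"
  proof (rule minimal_section(1)[OF N1 N1K(1) N1K(2) subspace_zero])
    show "{\<zero>} \<subseteq> N1"
      using subspaceD(2)[OF N1] by simp
    fix T a assume T: "T \<in> mop K K" "\<And>x. x \<in> N1 \<Longrightarrow> T x \<in> {\<zero>}" and a: "a \<in> carrier A"
    have "E (a \<ominus> E a) = \<zero>"
      using mop_minus[OF E(1) K_carr K_carr a EA[OF a]] EE[OF a] EA[OF a] by simp
    then have "a \<ominus> E a \<in> N1"
      using a EA[OF a] subspaceD(2)[OF K_subspace] by (simp add: N1_def)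
    then have 1: "T (a \<ominus> E a) = \<zero>"
      using T(2) by blast
    have "\<one> \<in> N1"
      using E(3) by (simp add: N1_def)
    then have "T \<one> = \<zero>"
      using T(2) by blast
    then have 2: "T (E a) = \<zero>"
      using central[OF T(1) EA[OF a] E(2)[OF _ a]] EA[OF a] by simp
    show "T a = \<zero>"
      using mop_minus[OF T(1) K_carr K_carr a EA[OF a]] 1 2 mop_closed_K[OF T(1) a]
      by simp
  qed auto
  then have "E x \<in> K"
    using nuc_carr[OF x] unfolding N1_def by blast
  \<comment> \<open>Modulo \<open>J\<close> the element \<open>x\<close> behaves like an element of
    the centralizer, so \<open>E x\<close> is congruent to
    \<open>x \<otimes> E \<one> = x\<close>.\<close>
  moreover have "T x \<ominus> x \<otimes> T \<one> \<in> J" if "T \<in> mop K K" for T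
    using that
  proof induction
    case (base k l)
    have c: "k \<in> N" "l \<in> N"
      using base by auto
    have "(k \<otimes> x) \<otimes> l \<ominus> x \<otimes> ((k \<otimes> \<one>) \<otimes> l) = (k \<otimes> x \<ominus> x \<otimes> k) \<otimes> l"
      using c x by (simp add: mult_minus_l nuc1)
    then show ?case
      using J_mult(1)[OF comm[OF base(1)] c(2)] by simp
  next
    case (sum S R)
    have "S x \<in> carrier A" "R x \<in> carrier A" "S \<one> \<in> carrier A" "R \<one> \<in> carrier A"
      using sum mop_closed_K x by auto
    then show ?case
      using x sum subspaceD(4)[OF J_subspace] by (simp add: mult_r_distr add_minus_add)
  qed
  from this[OF E(1)] have "E x \<ominus> x \<in> J"
    using E(3) x by simp
  ultimately show ?thesis
    using that[of "E x"] subspace_sym[OF J_subspace] x by simp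
qed

end

section \<open>Matrix algebras\<close>

definition mat_unit :: "nat \<Rightarrow> ('f, 'd) module \<Rightarrow> nat \<Rightarrow> nat \<Rightarrow> 'd \<Rightarrow> nat \<times> nat \<Rightarrow> 'd" where
  "mat_unit m D i j d = (\<lambda>(k, l)\<in>{1..m} \<times> {1..m}. if k = i \<and> l = j then d else \<zero>\<^bsub>D\<^esub>)"

text \<open>The cutoff \<open>r\<close> serves one induction, the proof that the diagonal matrix
  units add up to the identity. The diagonal embedding of \<open>D\<close> is the case
  \<open>r = m\<close>.\<close>

definition mat_diag :: "nat \<Rightarrow> ('f, 'd) module \<Rightarrow> nat \<Rightarrow> 'd \<Rightarrow> nat \<times> nat \<Rightarrow> 'd" where
  "mat_diag m D r d = (\<lambda>(k, l)\<in>{1..m} \<times> {1..m}. if k = l \<and> k \<le> r then d else \<zero>\<^bsub>D\<^esub>)"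

lemma mat_alg_sel:
  "carrier (mat_alg m D) = ({1..m} \<times> {1..m} \<rightarrow>\<^sub>E carrier D)"
  "x \<otimes>\<^bsub>mat_alg m D\<^esub> y = (\<lambda>(i, j)\<in>{1..m} \<times> {1..m}. \<Oplus>\<^bsub>D\<^esub>k \<in> {1..m}. x (i, k) \<otimes>\<^bsub>D\<^esub> y (k, j))"
  "\<one>\<^bsub>mat_alg m D\<^esub> = (\<lambda>(i, j)\<in>{1..m} \<times> {1..m}. if i = j then \<one>\<^bsub>D\<^esub> else \<zero>\<^bsub>D\<^esub>)"
  "\<zero>\<^bsub>mat_alg m D\<^esub> = (\<lambda>p\<in>{1..m} \<times> {1..m}. \<zero>\<^bsub>D\<^esub>)"
  "x \<oplus>\<^bsub>mat_alg m D\<^esub> y = (\<lambda>p\<in>{1..m} \<times> {1..m}. x p \<oplus>\<^bsub>D\<^esub> y p)"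
  "c \<odot>\<^bsub>mat_alg m D\<^esub> x = (\<lambda>p\<in>{1..m} \<times> {1..m}. c \<odot>\<^bsub>D\<^esub> x p)"
  by (simp_all add: mat_alg_def Let_def)

context alg begin

lemma finsum_single:
  assumes "finite I" "i \<in> I" "\<And>k. k \<in> I \<Longrightarrow> k \<noteq> i \<Longrightarrow> f k = \<zero>" "f i \<in> carrier A"
  shows "(\<Oplus>k\<in>I. f k) = f i"
proof -
  have "(\<Oplus>k\<in>I. f k) = (\<Oplus>k\<in>I. if i = k then f k else \<zero>)"
    using assms by (intro M.finsum_cong') auto
  also have "\<dots> = f i"
  proof (rule M.finsum_singleton)
    show "f \<in> I \<rightarrow> carrier A"
      using assms(3,4) M.zero_closed by (metis Pi_I)
  qed (use assms in auto)
  finally show ?thesis .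
qed

lemma finsum_all_zero: "(\<And>k. k \<in> I \<Longrightarrow> f k = \<zero>) \<Longrightarrow> (\<Oplus>k\<in>I. f k) = \<zero>"
  by (rule M.add.finprod_one_eqI)

abbreviation "Mat m \<equiv> mat_alg m A"

lemma mat_ext:
  "x \<in> carrier (Mat m) \<Longrightarrow> y \<in> carrier (Mat m) \<Longrightarrow>
    (\<And>i j. i \<in> {1..m} \<Longrightarrow> j \<in> {1..m} \<Longrightarrow> x (i, j) = y (i, j)) \<Longrightarrow> x = y"
  unfolding mat_alg_sel by (rule PiE_ext) auto

lemma mat_val: "x \<in> carrier (Mat m) \<Longrightarrow> i \<in> {1..m} \<Longrightarrow> j \<in> {1..m} \<Longrightarrow> x (i, j) \<in> carrier A"
  unfolding mat_alg_sel by auto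

lemma mat_mult_val:
  "i \<in> {1..m} \<Longrightarrow> j \<in> {1..m} \<Longrightarrow> (x \<otimes>\<^bsub>Mat m\<^esub> y) (i, j) = (\<Oplus>k \<in> {1..m}. x (i, k) \<otimes> y (k, j))"
  unfolding mat_alg_sel by simp

lemma mat_mult_closed:
  "x \<in> carrier (Mat m) \<Longrightarrow> y \<in> carrier (Mat m) \<Longrightarrow> x \<otimes>\<^bsub>Mat m\<^esub> y \<in> carrier (Mat m)"
  using mat_val[of x m] mat_val[of y m] unfolding mat_alg_sel
  by (auto intro!: M.finsum_closed)

lemma mat_unit_val:
  "i \<in> {1..m} \<Longrightarrow> j \<in> {1..m} \<Longrightarrow> mat_unit m A k l d (i, j) = (if i = k \<and> j = l then d else \<zero>)"
  by (simp add: mat_unit_def)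

lemma mat_diag_val:
  "i \<in> {1..m} \<Longrightarrow> j \<in> {1..m} \<Longrightarrow> mat_diag m A r d (i, j) = (if i = j \<and> i \<le> r then d else \<zero>)"
  by (simp add: mat_diag_def)

lemma mat_unit_closed: "d \<in> carrier A \<Longrightarrow> mat_unit m A k l d \<in> carrier (Mat m)"
  unfolding mat_alg_sel mat_unit_def by auto

lemma mat_diag_closed: "d \<in> carrier A \<Longrightarrow> mat_diag m A r d \<in> carrier (Mat m)"
  unfolding mat_alg_sel mat_diag_def by auto

lemma mat_one_diag: "\<one>\<^bsub>Mat m\<^esub> = mat_diag m A m \<one>"
  unfolding mat_alg_sel mat_diag_def by (rule restrict_ext) auto

lemma mat_diag_zero: "mat_diag m A 0 d = \<zero>\<^bsub>Mat m\<^esub>"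
  unfolding mat_alg_sel mat_diag_def by (rule restrict_ext) auto

lemma mat_diag_mult_l:
  assumes x: "x \<in> carrier (Mat m)" and d: "d \<in> carrier A" and ij: "i \<in> {1..m}" "j \<in> {1..m}"
  shows "(mat_diag m A m d \<otimes>\<^bsub>Mat m\<^esub> x) (i, j) = d \<otimes> x (i, j)"
proof -
  have "(mat_diag m A m d \<otimes>\<^bsub>Mat m\<^esub> x) (i, j) = mat_diag m A m d (i, i) \<otimes> x (i, j)"
    unfolding mat_mult_val[OF ij] using ij d mat_val[OF x] by (intro finsum_single) (auto simp: mat_diag_val)
  then show ?thesis
    using ij by (simp add: mat_diag_val)
qed

lemma mat_diag_mult_r:
  assumes x: "x \<in> carrier (Mat m)" and d: "d \<in> carrier A" and ij: "i \<in> {1..m}" "j \<in> {1..m}"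
  shows "(x \<otimes>\<^bsub>Mat m\<^esub> mat_diag m A m d) (i, j) = x (i, j) \<otimes> d"
proof -
  have "(x \<otimes>\<^bsub>Mat m\<^esub> mat_diag m A m d) (i, j) = x (i, j) \<otimes> mat_diag m A m d (j, j)"
    unfolding mat_mult_val[OF ij] using ij d mat_val[OF x] by (intro finsum_single) (auto simp: mat_diag_val)
  then show ?thesis
    using ij by (simp add: mat_diag_val)
qed

lemma mat_one_mult:
  assumes "x \<in> carrier (Mat m)"
  shows "\<one>\<^bsub>Mat m\<^esub> \<otimes>\<^bsub>Mat m\<^esub> x = x" "x \<otimes>\<^bsub>Mat m\<^esub> \<one>\<^bsub>Mat m\<^esub> = x"
  unfolding mat_one_diag
  using assms mat_diag_mult_l[OF assms unit_closed] mat_diag_mult_r[OF assms unit_closed] mat_val[OF assms]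
  by (auto intro!: mat_ext[of _ m] mat_mult_closed mat_diag_closed)

lemma mat_unit_mult_l:
  assumes x: "x \<in> carrier (Mat m)" and d: "d \<in> carrier A" and kl: "k \<in> {1..m}" "l \<in> {1..m}"
    and ij: "i \<in> {1..m}" "j \<in> {1..m}"
  shows "(mat_unit m A k l d \<otimes>\<^bsub>Mat m\<^esub> x) (i, j) = (if i = k then d \<otimes> x (l, j) else \<zero>)"
proof -
  have "(mat_unit m A k l d \<otimes>\<^bsub>Mat m\<^esub> x) (i, j) = mat_unit m A k l d (i, l) \<otimes> x (l, j)"
    unfolding mat_mult_val[OF ij] using kl ij d mat_val[OF x]
    by (intro finsum_single) (auto simp: mat_unit_val)
  then show ?thesis
    using ij kl mat_val[OF x] by (simp add: mat_unit_val)
qed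

lemma mat_unit_mult_r:
  assumes x: "x \<in> carrier (Mat m)" and d: "d \<in> carrier A" and kl: "k \<in> {1..m}" "l \<in> {1..m}"
    and ij: "i \<in> {1..m}" "j \<in> {1..m}"
  shows "(x \<otimes>\<^bsub>Mat m\<^esub> mat_unit m A k l d) (i, j) = (if j = l then x (i, k) \<otimes> d else \<zero>)"
proof -
  have "(x \<otimes>\<^bsub>Mat m\<^esub> mat_unit m A k l d) (i, j) = x (i, k) \<otimes> mat_unit m A k l d (k, j)"
    unfolding mat_mult_val[OF ij] using kl ij d mat_val[OF x]
    by (intro finsum_single) (auto simp: mat_unit_val)
  then show ?thesis
    using ij kl mat_val[OF x] by (simp add: mat_unit_val)
qed

lemma mat_unit_mult:
  assumes d: "d \<in> carrier A" "e \<in> carrier A" and i: "i \<in> {1..m}" "j \<in> {1..m}" "k \<in> {1..m}" "l \<in> {1..m}"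
  shows "mat_unit m A i j d \<otimes>\<^bsub>Mat m\<^esub> mat_unit m A k l e = (if j = k then mat_unit m A i l (d \<otimes> e) else \<zero>\<^bsub>Mat m\<^esub>)"
proof (rule mat_ext[of _ m])
  show "(if j = k then mat_unit m A i l (d \<otimes> e) else \<zero>\<^bsub>Mat m\<^esub>) \<in> carrier (Mat m)"
    using d by (auto simp: mat_unit_closed) (auto simp: mat_alg_sel)
  fix p r assume pr: "p \<in> {1..m}" "r \<in> {1..m}"
  show "(mat_unit m A i j d \<otimes>\<^bsub>Mat m\<^esub> mat_unit m A k l e) (p, r) =
      (if j = k then mat_unit m A i l (d \<otimes> e) else \<zero>\<^bsub>Mat m\<^esub>) (p, r)"
    unfolding mat_unit_mult_l[OF mat_unit_closed[OF d(2)] d(1) i(1,2) pr]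
    using pr i d by (auto simp: mat_unit_val) (auto simp: mat_alg_sel)
qed (use d in \<open>auto intro!: mat_mult_closed mat_unit_closed\<close>)

lemma mat_diag_unit:
  assumes d: "d \<in> carrier A" "e \<in> carrier A" and i: "i \<in> {1..m}" "j \<in> {1..m}"
  shows "mat_diag m A m d \<otimes>\<^bsub>Mat m\<^esub> mat_unit m A i j e = mat_unit m A i j (d \<otimes> e)"
    "mat_unit m A i j e \<otimes>\<^bsub>Mat m\<^esub> mat_diag m A m d = mat_unit m A i j (e \<otimes> d)"
  using d mat_diag_mult_l[OF mat_unit_closed[OF d(2)] d(1)] mat_diag_mult_r[OF mat_unit_closed[OF d(2)] d(1)]
  by (auto intro!: mat_ext[of _ m] mat_mult_closed mat_diag_closed mat_unit_closed simp: mat_unit_val)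

lemma mat_diag_mult:
  assumes d: "d \<in> carrier A" "e \<in> carrier A"
  shows "mat_diag m A m d \<otimes>\<^bsub>Mat m\<^esub> mat_diag m A m e = mat_diag m A m (d \<otimes> e)"
  using d mat_diag_mult_l[OF mat_diag_closed[OF d(2)] d(1)]
  by (auto intro!: mat_ext[of _ m] mat_mult_closed mat_diag_closed simp: mat_diag_val)

lemma mat_diag_add:
  "d \<in> carrier A \<Longrightarrow> e \<in> carrier A \<Longrightarrow>
    mat_diag m A r (d \<oplus> e) = mat_diag m A r d \<oplus>\<^bsub>Mat m\<^esub> mat_diag m A r e"
  unfolding mat_alg_sel mat_diag_def by (rule restrict_ext) auto

lemma mat_diag_smult:
  "c \<in> carrier F \<Longrightarrow> d \<in> carrier A \<Longrightarrow> mat_diag m A r (c \<odot> d) = c \<odot>\<^bsub>Mat m\<^esub> mat_diag m A r d"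
  unfolding mat_alg_sel mat_diag_def by (rule restrict_ext) auto

lemma mat_diag_Suc:
  assumes "d \<in> carrier A" "r < m"
  shows "mat_diag m A (Suc r) d = mat_diag m A r d \<oplus>\<^bsub>Mat m\<^esub> mat_unit m A (Suc r) (Suc r) d"
  unfolding mat_alg_sel mat_diag_def mat_unit_def using assms by (intro restrict_ext) (auto simp: le_Suc_eq)

end

section \<open>Atoms\<close>

context alg begin

lemma nidealD:
  assumes "nideal P"
  shows "subspace P" "J \<subseteq> P" "\<And>x. x \<in> P \<Longrightarrow> x \<in> N" "\<And>x y. x \<in> N \<Longrightarrow> y \<in> P \<Longrightarrow> x \<otimes> y \<in> P"
    "\<And>x y. x \<in> N \<Longrightarrow> y \<in> P \<Longrightarrow> y \<otimes> x \<in> P"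
  using assms unfolding nideal_def by blast+

lemma minus_minus_comm:
  "\<lbrakk>a \<in> carrier A; b \<in> carrier A; c \<in> carrier A; d \<in> carrier A\<rbrakk>
    \<Longrightarrow> (a \<ominus> b) \<ominus> (c \<ominus> d) = (a \<ominus> c) \<ominus> (b \<ominus> d)"
  by (simp add: M.minus_eq M.minus_add M.a_ac)

text \<open>\<open>z\<close> represents the unit of the atom \<open>P / J\<close>.\<close>

definition unit_of :: "'a \<Rightarrow> 'a set \<Rightarrow> bool" where
  "unit_of z P \<longleftrightarrow> z \<in> P \<and> (\<forall>x\<in>P. z \<otimes> x \<ominus> x \<in> J \<and> x \<otimes> z \<ominus> x \<in> J)"

end

section \<open>The atoms of a homogeneous algebra and their idempotents\<close>

locale homog = semiassoc A F K
  for A :: "('f, 'a) module" (structure) and F :: "('f, 'x) ring_scheme" (structure) and K +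
  fixes D :: "('f, 'd) module"
  assumes homogeneous: "homogeneous F A" and common_div: "common_division_algebra F A D"
begin

sublocale D: alg D F
  using common_div by (simp add: common_division_algebra_def central_division_algebra_def alg_def)

lemma D_ring: "ring D"
  using common_div by (simp add: common_division_algebra_def central_division_algebra_def)

text \<open>The isomorphism of an atom with a matrix algebra, read backwards and through
  representatives: \<open>g\<close> chooses an element of \<open>P\<close> over each matrix, and all
  structure is recorded as congruences modulo \<open>J\<close>. The second fact is the centrality of
  the atom in the same language.\<close>

lemma atom_data:
  assumes P: "minimal_nideal P"
  obtains z m g where "unit_of z P"
    "\<And>y. y \<in> P \<Longrightarrow> (\<And>x. x \<in> P \<Longrightarrow> y \<otimes> x \<ominus> x \<otimes> y \<in> J) \<Longrightarrow> \<exists>c\<in>carrier F. y \<ominus> c \<odot> z \<in> J"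
    "m \<ge> 1" "\<And>x. x \<in> carrier (mat_alg m D) \<Longrightarrow> g x \<in> P"
    "\<And>x y. x \<in> carrier (mat_alg m D) \<Longrightarrow> y \<in> carrier (mat_alg m D) \<Longrightarrow> g (x \<oplus>\<^bsub>mat_alg m D\<^esub> y) \<ominus> (g x \<oplus> g y) \<in> J"
    "\<And>x y. x \<in> carrier (mat_alg m D) \<Longrightarrow> y \<in> carrier (mat_alg m D) \<Longrightarrow> g (x \<otimes>\<^bsub>mat_alg m D\<^esub> y) \<ominus> g x \<otimes> g y \<in> J"
    "\<And>c x. c \<in> carrier F \<Longrightarrow> x \<in> carrier (mat_alg m D) \<Longrightarrow> g (c \<odot>\<^bsub>mat_alg m D\<^esub> x) \<ominus> c \<odot> g x \<in> J"
    "g \<one>\<^bsub>mat_alg m D\<^esub> \<ominus> z \<in> J" "\<And>p. p \<in> P \<Longrightarrow> \<exists>x\<in>carrier (mat_alg m D). p \<ominus> g x \<in> J"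
proof -
  have nP: "nideal P"
    using P by (simp add: minimal_nideal_def)
  note PD = nidealD[OF nP]
  define B where "B = component_alg S (q ` P)"
  have "B \<in> atoms A"
    unfolding atoms_def B_def using minimal_nideal_component[OF P] by blast
  then have cenB: "central F B" and "\<exists>m\<ge>1. alg_isomorphic F B (mat_alg m D)"
    using homogeneous common_div unfolding homogeneous_def common_division_algebra_def by blast+
  then obtain m h where m: "m \<ge> 1" and h: "h \<in> ring_iso B (mat_alg m D)"
    and hs: "\<And>c x. c \<in> carrier F \<Longrightarrow> x \<in> carrier B \<Longrightarrow> h (c \<odot>\<^bsub>B\<^esub> x) = c \<odot>\<^bsub>mat_alg m D\<^esub> h x"
    unfolding alg_isomorphic_def by blast
  note hE = ring_iso_memE[OF h]
  have Bsel: "carrier B = q ` P" "x \<otimes>\<^bsub>B\<^esub> y = x \<otimes>\<^bsub>S\<^esub> y" "x \<oplus>\<^bsub>B\<^esub> y = x \<oplus>\<^bsub>S\<^esub> y" "\<zero>\<^bsub>B\<^esub> = \<zero>\<^bsub>S\<^esub>"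
    "c \<odot>\<^bsub>B\<^esub> x = c \<odot>\<^bsub>S\<^esub> x" "\<one>\<^bsub>B\<^esub> = (THE e. e \<in> q ` P \<and> (\<forall>x\<in>q ` P. e \<otimes>\<^bsub>S\<^esub> x = x \<and> x \<otimes>\<^bsub>S\<^esub> e = x))"
    for x y c
    by (simp_all add: B_def component_alg_def)
  have hbij: "bij_betw h (q ` P) (carrier (mat_alg m D))"
    using hE(5) by (simp add: Bsel)
  have hmult: "h (x \<otimes>\<^bsub>S\<^esub> y) = h x \<otimes>\<^bsub>mat_alg m D\<^esub> h y" if "x \<in> q ` P" "y \<in> q ` P" for x y
    using hE(2)[of x y] that by (simp add: Bsel)
  have hadd: "h (x \<oplus>\<^bsub>S\<^esub> y) = h x \<oplus>\<^bsub>mat_alg m D\<^esub> h y" if "x \<in> q ` P" "y \<in> q ` P" for x y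
    using hE(3)[of x y] that by (simp add: Bsel)
  have hsm: "h (c \<odot>\<^bsub>S\<^esub> x) = c \<odot>\<^bsub>mat_alg m D\<^esub> h x" if "c \<in> carrier F" "x \<in> q ` P" for c x
    using hs[of c x] that by (simp add: Bsel)
  have hclosed: "h x \<in> carrier (mat_alg m D)" if "x \<in> q ` P" for x
    using hE(1)[of x] that by (simp add: Bsel)
  have hinj: "x = y" if "x \<in> q ` P" "y \<in> q ` P" "h x = h y" for x y
    using hbij that unfolding bij_betw_def inj_on_def by blast
  have "\<forall>x\<in>carrier (mat_alg m D). \<exists>p\<in>P. h (q p) = x"
  proof
    fix x assume "x \<in> carrier (mat_alg m D)"
    then have "x \<in> h ` (q ` P)"
      using conjunct2[OF hbij[unfolded bij_betw_def]] by simp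
    then show "\<exists>p\<in>P. h (q p) = x"
      by blast
  qed
  then obtain g where g: "\<And>x. x \<in> carrier (mat_alg m D) \<Longrightarrow> g x \<in> P" "\<And>x. x \<in> carrier (mat_alg m D) \<Longrightarrow> h (q (g x)) = x"
    by metis
  have qinj: "x \<ominus> y \<in> J" if "x \<in> P" "y \<in> P" "h (q x) = h (q y)" for x y
    using hinj[of "q x" "q y"] that q_eq_iff[OF PD(3) PD(3), of x y] by blast
  have one: "\<one>\<^bsub>mat_alg m D\<^esub> \<in> carrier (mat_alg m D)"
    using D.mat_one_diag D.mat_diag_closed[OF D.unit_closed] by simp
  define z where "z = g \<one>\<^bsub>mat_alg m D\<^esub>"
  have z: "z \<in> P" "h (q z) = \<one>\<^bsub>mat_alg m D\<^esub>"
    unfolding z_def using g one by blast+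
  have hq: "h (q (x \<otimes> y)) = h (q x) \<otimes>\<^bsub>mat_alg m D\<^esub> h (q y)" if "x \<in> P" "y \<in> P" for x y
    using hmult[of "q x" "q y"] S_mult[OF PD(3) PD(3)] that by simp
  have zu: "unit_of z P"
    unfolding unit_of_def
  proof (intro conjI ballI z(1))
    fix x assume x: "x \<in> P"
    have m1: "h (q x) \<in> carrier (mat_alg m D)"
      using hclosed x by blast
    have p: "z \<otimes> x \<in> P" "x \<otimes> z \<in> P"
      using PD(3,4) x z by blast+
    show "z \<otimes> x \<ominus> x \<in> J" "x \<otimes> z \<ominus> x \<in> J"
      using qinj[OF p(1) x] qinj[OF p(2) x] hq[OF z(1) x] hq[OF x z(1)] z(2) D.mat_one_mult[OF m1] by simp_all
  qed
  \<comment> \<open>The unit of a component is a definite description; it is identified with the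
    element that corresponds to the identity matrix.\<close>
  have qz: "\<one>\<^bsub>B\<^esub> = q z"
    unfolding Bsel
  proof (rule the_equality)
    have "q z \<otimes>\<^bsub>S\<^esub> q x = q x" "q x \<otimes>\<^bsub>S\<^esub> q z = q x" if x: "x \<in> P" for x
    proof -
      have n: "x \<in> N" "z \<in> N"
        using PD(3) x z(1) by blast+
      have "z \<otimes> x \<ominus> x \<in> J" "x \<otimes> z \<ominus> x \<in> J"
        using zu x unfolding unit_of_def by blast+
      then show "q z \<otimes>\<^bsub>S\<^esub> q x = q x" "q x \<otimes>\<^bsub>S\<^esub> q z = q x"
        using n by (simp_all add: S_mult q_eq_iff)
    qed
    then show u: "q z \<in> q ` P \<and> (\<forall>x\<in>q ` P. q z \<otimes>\<^bsub>S\<^esub> x = x \<and> x \<otimes>\<^bsub>S\<^esub> q z = x)"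
      using z(1) by blast
    fix e assume "e \<in> q ` P \<and> (\<forall>x\<in>q ` P. e \<otimes>\<^bsub>S\<^esub> x = x \<and> x \<otimes>\<^bsub>S\<^esub> e = x)"
    then show "e = q z"
      using u by metis
  qed
  have cen: "\<exists>c\<in>carrier F. y \<ominus> c \<odot> z \<in> J" if y: "y \<in> P" and comm: "\<And>x. x \<in> P \<Longrightarrow> y \<otimes> x \<ominus> x \<otimes> y \<in> J" for y
  proof -
    \<comment> \<open>Associators in \<open>B\<close> are differences, so the additive group is
      needed to see that they vanish. The nonassociative centre of \<open>B\<close> used by
      \<open>central\<close> is then the ordinary centre of the ring.\<close>
    have "abelian_group B"
    proof (rule abelian_groupI)
      fix a assume "a \<in> carrier B"
      then obtain x where x: "x \<in> P" "a = q x"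
        by (auto simp: Bsel)
      have n: "x \<in> N" "\<ominus> x \<in> P" "\<ominus> x \<in> N"
        using x(1) PD(3) subspaceD(3)[OF PD(1)] by blast+
      have "q (\<ominus> x) \<oplus>\<^bsub>B\<^esub> a = \<zero>\<^bsub>B\<^esub>"
        unfolding Bsel x(2) using n by (simp add: S_add S_zero M.l_neg)
      then show "\<exists>b\<in>carrier B. b \<oplus>\<^bsub>B\<^esub> a = \<zero>\<^bsub>B\<^esub>"
        using n(2) unfolding Bsel(1) by blast
      show "\<zero>\<^bsub>B\<^esub> \<oplus>\<^bsub>B\<^esub> a = a"
        unfolding Bsel x(2) using n by (simp add: S_add S_zero)
    next
      show "\<zero>\<^bsub>B\<^esub> \<in> carrier B"
        unfolding Bsel S_zero using subspaceD(2)[OF PD(1)] by blast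
    next
      fix a b assume "a \<in> carrier B" "b \<in> carrier B"
      then obtain x y where x: "x \<in> P" "a = q x" "y \<in> P" "b = q y"
        by (auto simp: Bsel)
      have n: "x \<in> N" "y \<in> N" "x \<oplus> y \<in> P"
        using x(1,3) PD(3) subspaceD(4)[OF PD(1)] by blast+
      show "a \<oplus>\<^bsub>B\<^esub> b \<in> carrier B"
        unfolding Bsel x using n S_add by simp
      show "a \<oplus>\<^bsub>B\<^esub> b = b \<oplus>\<^bsub>B\<^esub> a"
        unfolding Bsel x using n by (simp add: S_add M.a_comm)
    next
      fix a b c assume "a \<in> carrier B" "b \<in> carrier B" "c \<in> carrier B"
      then obtain x y w where x: "x \<in> P" "a = q x" "y \<in> P" "b = q y" "w \<in> P" "c = q w"
        by (auto simp: Bsel)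
      have n: "x \<in> N" "y \<in> N" "w \<in> N"
        using x(1,3,5) PD(3) by blast+
      show "(a \<oplus>\<^bsub>B\<^esub> b) \<oplus>\<^bsub>B\<^esub> c = a \<oplus>\<^bsub>B\<^esub> (b \<oplus>\<^bsub>B\<^esub> c)"
        unfolding Bsel x using n by (simp add: S_add M.a_assoc)
    qed
    then interpret B: abelian_group B .
    interpret Sr: ring S
      by (rule S_ring)
    have ass: "associator B a b c = \<zero>\<^bsub>B\<^esub>" if abc: "a \<in> carrier B" "b \<in> carrier B" "c \<in> carrier B" for a b c
    proof -
      obtain x y w where x: "x \<in> P" "a = q x" "y \<in> P" "b = q y" "w \<in> P" "c = q w"
        using abc unfolding Bsel(1) by blast
      have n: "x \<in> N" "y \<in> N" "w \<in> N"
        using x(1,3,5) PD(3) by blast+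
      have "a \<otimes>\<^bsub>B\<^esub> b \<otimes>\<^bsub>B\<^esub> c = a \<otimes>\<^bsub>B\<^esub> (b \<otimes>\<^bsub>B\<^esub> c)"
        unfolding Bsel x using n by (simp add: S_mult nuc1)
      moreover have "a \<otimes>\<^bsub>B\<^esub> (b \<otimes>\<^bsub>B\<^esub> c) \<in> carrier B"
        unfolding Bsel x using n PD(4) x by (simp add: S_mult)
      ultimately show ?thesis
        unfolding associator_def by (simp add: a_minus_def B.r_neg)
    qed
    have qy: "q y \<in> carrier B"
      using y unfolding Bsel by blast
    have com: "q y \<otimes>\<^bsub>B\<^esub> a = a \<otimes>\<^bsub>B\<^esub> q y" if aB: "a \<in> carrier B" for a
    proof -
      obtain x where x: "x \<in> P" "a = q x"
        using aB unfolding Bsel(1) by blast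
      show ?thesis
        unfolding Bsel x using PD(3)[OF y] PD(3)[OF x(1)] comm[OF x(1)] by (simp add: S_mult q_eq_iff)
    qed
    have "q y \<in> alg_center B"
      unfolding alg_center_def nucleus_def using qy ass com by blast
    then obtain c where c: "c \<in> carrier F" "q y = c \<odot>\<^bsub>B\<^esub> \<one>\<^bsub>B\<^esub>"
      using cenB unfolding central_def by blast
    then have "q y = q (c \<odot> z)"
      unfolding qz unfolding Bsel using PD(3)[OF z(1)] by (simp add: S_smult)
    then show ?thesis
      using c(1) q_eq_iff[OF PD(3)[OF y] nuc_smult[OF c(1) PD(3)[OF z(1)]]] by blast
  qed
  show ?thesis
  proof (rule that[OF zu cen m g(1)])
    fix x y assume xy: "x \<in> carrier (mat_alg m D)" "y \<in> carrier (mat_alg m D)"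
    note gxy = g(1)[OF xy(1)] g(1)[OF xy(2)]
    have s: "x = h (q (g x))" "y = h (q (g y))"
      using g(2) xy by simp_all
    have "x \<oplus>\<^bsub>mat_alg m D\<^esub> y = h (q (g x \<oplus> g y))"
      using s hadd[of "q (g x)" "q (g y)"] gxy S_add[OF PD(3) PD(3)] by simp
    moreover have p: "g x \<oplus> g y \<in> P"
      using gxy subspaceD(4)[OF PD(1)] by blast
    ultimately have "x \<oplus>\<^bsub>mat_alg m D\<^esub> y \<in> carrier (mat_alg m D)" "x \<oplus>\<^bsub>mat_alg m D\<^esub> y = h (q (g x \<oplus> g y))"
      using hclosed by simp_all
    then show "g (x \<oplus>\<^bsub>mat_alg m D\<^esub> y) \<ominus> (g x \<oplus> g y) \<in> J"
      using g p qinj by simp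
    have "x \<otimes>\<^bsub>mat_alg m D\<^esub> y = h (q (g x \<otimes> g y))"
      using s hq[OF gxy] by simp
    moreover have p: "g x \<otimes> g y \<in> P"
      using gxy PD(3,4) by blast
    ultimately have "x \<otimes>\<^bsub>mat_alg m D\<^esub> y \<in> carrier (mat_alg m D)" "x \<otimes>\<^bsub>mat_alg m D\<^esub> y = h (q (g x \<otimes> g y))"
      using hclosed by simp_all
    then show "g (x \<otimes>\<^bsub>mat_alg m D\<^esub> y) \<ominus> g x \<otimes> g y \<in> J"
      using g p qinj by simp
  next
    fix c x assume c: "c \<in> carrier F" and x: "x \<in> carrier (mat_alg m D)"
    note gx = g(1)[OF x]
    have s: "x = h (q (g x))"
      using g(2) x by simp
    have "c \<odot>\<^bsub>mat_alg m D\<^esub> x = h (q (c \<odot> g x))"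
      using s hsm[OF c, of "q (g x)"] gx S_smult[OF c PD(3)[OF gx]] by simp
    moreover have p: "c \<odot> g x \<in> P"
      using gx c subspaceD(6)[OF PD(1)] by blast
    ultimately have "c \<odot>\<^bsub>mat_alg m D\<^esub> x \<in> carrier (mat_alg m D)" "c \<odot>\<^bsub>mat_alg m D\<^esub> x = h (q (c \<odot> g x))"
      using hclosed by simp_all
    then show "g (c \<odot>\<^bsub>mat_alg m D\<^esub> x) \<ominus> c \<odot> g x \<in> J"
      using g p qinj by simp
  next
    show "g \<one>\<^bsub>mat_alg m D\<^esub> \<ominus> z \<in> J"
      unfolding z_def using PD(3) g one subspaceD(2)[OF J_subspace] by simp
  next
    fix p assume p: "p \<in> P"
    have "h (q p) \<in> carrier (mat_alg m D)"
      using hclosed p by blast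
    then show "\<exists>x\<in>carrier (mat_alg m D). p \<ominus> g x \<in> J"
      using g p qinj by (intro bexI[of _ "h (q p)"]) simp_all
  qed auto
qed

lemma J_trans:
  "\<lbrakk>x \<ominus> y \<in> J; y \<ominus> z \<in> J; x \<in> N; y \<in> N; z \<in> N\<rbrakk> \<Longrightarrow> x \<ominus> z \<in> J"
  using subspace_trans[OF J_subspace] nuc_carr by blast

lemma J_sym: "\<lbrakk>x \<ominus> y \<in> J; x \<in> N; y \<in> N\<rbrakk> \<Longrightarrow> y \<ominus> x \<in> J"
  using subspace_sym[OF J_subspace] nuc_carr by blast

lemma J_mult_diff:
  assumes "x \<ominus> y \<in> J" "x \<in> N" "y \<in> N" "a \<in> N"
  shows "a \<otimes> x \<ominus> a \<otimes> y \<in> J" "x \<otimes> a \<ominus> y \<otimes> a \<in> J"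
  using J_mult[OF assms(1,4)] assms by (simp_all add: mult_minus_l mult_minus_r)

lemma K_diff: "\<lbrakk>x \<in> K; y \<in> K; x \<ominus> y \<in> J\<rbrakk> \<Longrightarrow> x = y"
  using K_inter_J[of "x \<ominus> y"] minus_eq_zero_iff[of x y] subspaceD(5)[OF K_subspace, of x y] by simp

text \<open>Both products are congruent to \<open>z x z\<close>, because
  \<open>z \<otimes> x\<close> and \<open>x \<otimes> z\<close> lie in \<open>P\<close>, where
  \<open>z\<close> acts as a unit.\<close>

lemma unit_of_central:
  assumes P: "nideal P" and z: "unit_of z P" and x: "x \<in> N"
  shows "z \<otimes> x \<ominus> x \<otimes> z \<in> J"
proof -
  note PD = nidealD[OF P]
  have zP: "z \<in> P" "z \<in> N"
    using z PD(3) by (auto simp: unit_of_def)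
  have p: "z \<otimes> x \<in> P" "x \<otimes> z \<in> P"
    by (rule PD(5)[OF x zP(1)] PD(4)[OF x zP(1)])+
  have 1: "(z \<otimes> x) \<otimes> z \<ominus> z \<otimes> x \<in> J" and 2: "z \<otimes> (x \<otimes> z) \<ominus> x \<otimes> z \<in> J"
    using z p unfolding unit_of_def by blast+
  have "z \<otimes> x \<ominus> z \<otimes> (x \<otimes> z) \<in> J"
    using J_sym[OF 1] x zP by (simp add: nuc1)
  then show ?thesis
    using J_trans[OF _ 2] x zP by simp
qed

text \<open>Stronger than \<open>unit_of\<close>: an honest idempotent, and one in \<open>K\<close>,
  so that compression to its Peirce components commutes with all operators over
  \<open>K\<close>.\<close>

definition atom_idem :: "'a \<Rightarrow> 'a set \<Rightarrow> bool" where
  "atom_idem z P \<longleftrightarrow> minimal_nideal P \<and> unit_of z P \<and> z \<in> K \<and> z \<otimes> z = z"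

text \<open>The unit of an atom commutes with \<open>K\<close> modulo \<open>J\<close>, so it can be
  corrected to an element \<open>z\<close> of \<open>K\<close>. Then
  \<open>z \<otimes> z \<ominus> z\<close> lies in \<open>K\<close> and in \<open>J\<close>, hence
  is zero.\<close>

lemma atom_idem_exists:
  assumes P: "minimal_nideal P"
  obtains z where "atom_idem z P"
proof -
  have nP: "nideal P"
    using P by (simp add: minimal_nideal_def)
  note PD = nidealD[OF nP]
  obtain y where y: "unit_of y P"
    using atom_data[OF P] by metis
  have yN: "y \<in> P" "y \<in> N"
    using y PD(3) by (auto simp: unit_of_def)
  have "k \<otimes> y \<ominus> y \<otimes> k \<in> J" if "k \<in> K" for k
    using J_sym[OF unit_of_central[OF nP y]] that yN by simp
  then obtain z where z: "z \<in> K" "y \<ominus> z \<in> J"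
    using centralizer_lift[OF yN(2)] by metis
  have zN: "z \<in> N"
    using z by simp
  have zP: "z \<in> P"
    using subspace_mem_diff'[OF PD(1) _ yN(1)] z(2) PD(2) zN by auto
  have zy: "z \<ominus> y \<in> J"
    using J_sym[OF z(2)] yN zN by simp
  have u: "unit_of z P"
    unfolding unit_of_def
  proof (intro conjI ballI zP)
    fix x assume x: "x \<in> P"
    have xN: "x \<in> N"
      using PD(3)[OF x] .
    have "y \<otimes> x \<ominus> x \<in> J" "x \<otimes> y \<ominus> x \<in> J"
      using y x unfolding unit_of_def by blast+
    then show "z \<otimes> x \<ominus> x \<in> J" "x \<otimes> z \<ominus> x \<in> J"
      using J_trans[OF J_mult_diff(2)[OF zy zN yN(2) xN]] J_trans[OF J_mult_diff(1)[OF zy zN yN(2) xN]]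
        xN zN yN by simp_all
  qed
  then have "z \<otimes> z \<ominus> z \<in> J"
    using zP unfolding unit_of_def by blast
  then have "z \<otimes> z = z"
    using K_diff z(1) by simp
  then show ?thesis
    using that P u z(1) unfolding atom_idem_def by blast
qed

lemma atom_idemD:
  assumes "atom_idem z P"
  shows "z \<in> K" "z \<in> N" "z \<in> carrier A" "z \<otimes> z = z" "minimal_nideal P" "nideal P" "unit_of z P" "z \<in> P" "z \<notin> J" "z \<noteq> \<zero>"
proof -
  show *: "z \<in> K" "z \<in> N" "z \<in> carrier A" "z \<otimes> z = z" "minimal_nideal P" "nideal P" "unit_of z P" "z \<in> P"
    using assms unfolding atom_idem_def minimal_nideal_def unit_of_def by auto
  note PD = nidealD[OF *(6)]
  show "z \<notin> J"
  proof
    assume zJ: "z \<in> J"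
    have "x \<in> J" if x: "x \<in> P" for x
    proof -
      have "z \<otimes> x \<ominus> x \<in> J"
        using *(7) x unfolding unit_of_def by blast
      then show ?thesis
        using subspace_mem_diff'[OF J_subspace] J_mult(1)[OF zJ PD(3)[OF x]] PD(3)[OF x] by simp
    qed
    then show False
      using PD(2) *(5) unfolding minimal_nideal_def by blast
  qed
  then show "z \<noteq> \<zero>"
    using subspaceD(2)[OF J_subspace] by blast
qed

text \<open>When \<open>w\<close> is idempotent this set is \<open>w N + J\<close>. Describing it by
  the congruence \<open>w x = x\<close> makes the ideal property a matter of moving \<open>w\<close>
  past elements of \<open>N\<close>.\<close>

lemma principal_nideal:
  assumes w: "w \<in> N" and central: "\<And>x. x \<in> N \<Longrightarrow> w \<otimes> x \<ominus> x \<otimes> w \<in> J"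
  shows "nideal {x \<in> N. w \<otimes> x \<ominus> x \<in> J}"
proof -
  have e1: "w \<otimes> (x \<oplus> y) \<ominus> (x \<oplus> y) = (w \<otimes> x \<ominus> x) \<oplus> (w \<otimes> y \<ominus> y)" if "x \<in> N" "y \<in> N" for x y
    using w that by (simp add: mult_r_distr add_minus_add)
  have e2: "w \<otimes> (c \<odot> x) \<ominus> c \<odot> x = c \<odot> (w \<otimes> x \<ominus> x)" if "x \<in> N" "c \<in> carrier F" for x c
    using w that by (simp add: smult_mult_r smult_minus_r)
  show ?thesis
    unfolding nideal_def
  proof (intro conjI ballI)
    show "subspace {x \<in> N. w \<otimes> x \<ominus> x \<in> J}"
    proof (rule subspaceI)
      show "\<zero> \<in> {x \<in> N. w \<otimes> x \<ominus> x \<in> J}"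
        using w subspaceD(2)[OF J_subspace] by simp
      show "x \<oplus> y \<in> {x \<in> N. w \<otimes> x \<ominus> x \<in> J}"
        if "x \<in> {x \<in> N. w \<otimes> x \<ominus> x \<in> J}" "y \<in> {x \<in> N. w \<otimes> x \<ominus> x \<in> J}" for x y
        using that e1 subspaceD(4)[OF J_subspace] by simp
      show "c \<odot> x \<in> {x \<in> N. w \<otimes> x \<ominus> x \<in> J}"
        if "c \<in> carrier F" "x \<in> {x \<in> N. w \<otimes> x \<ominus> x \<in> J}" for c x
        using that e2 subspaceD(6)[OF J_subspace] by simp
    qed auto
    show "J \<subseteq> {x \<in> N. w \<otimes> x \<ominus> x \<in> J}"
      using J_nuc J_mult(2)[OF _ w] subspaceD(5)[OF J_subspace] by blast
    fix x y assume x: "x \<in> N" and "y \<in> {x \<in> N. w \<otimes> x \<ominus> x \<in> J}"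
    then have y: "y \<in> N" "w \<otimes> y \<ominus> y \<in> J"
      by auto
    have "w \<otimes> (y \<otimes> x) \<ominus> y \<otimes> x \<in> J"
      using J_mult_diff(2)[OF y(2) _ y(1) x] w y(1) x by (simp add: nuc1)
    then show "y \<otimes> x \<in> {x \<in> N. w \<otimes> x \<ominus> x \<in> J}"
      using x y by simp
    have 1: "(w \<otimes> x) \<otimes> y \<ominus> (x \<otimes> w) \<otimes> y \<in> J"
      using J_mult_diff(2)[OF central[OF x] _ _ y(1)] w x by simp
    have 2: "(x \<otimes> w) \<otimes> y \<ominus> x \<otimes> y \<in> J"
      using J_mult_diff(1)[OF y(2) _ y(1) x] w y(1) x by (simp add: nuc1)
    have "w \<otimes> (x \<otimes> y) \<ominus> x \<otimes> y \<in> J"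
      using J_trans[OF 1 2] w x y by (simp add: nuc1)
    then show "x \<otimes> y \<in> {x \<in> N. w \<otimes> x \<ominus> x \<in> J}"
      using x y by simp
  qed auto
qed

text \<open>Induction on the size of the ideal of \<open>w\<close>. The idempotent \<open>z\<close>
  of an atom below \<open>w\<close> is split off; the rest \<open>w \<ominus> z\<close> is again an
  idempotent of \<open>K\<close> central modulo \<open>J\<close>, and its ideal is smaller because
  it does not contain \<open>z\<close>. Congruent elements of \<open>K\<close> are equal, so the
  summands are orthogonal on the nose.\<close>

lemma idempotent_decomposition:
  assumes "w \<in> K" "w \<otimes> w = w" "\<And>x. x \<in> N \<Longrightarrow> w \<otimes> x \<ominus> x \<otimes> w \<in> J"
  shows "\<exists>Z. finite Z \<and> (\<forall>z\<in>Z. (\<exists>P. atom_idem z P) \<and> w \<otimes> z = z) \<and>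
      (\<forall>y\<in>Z. \<forall>z\<in>Z. y \<noteq> z \<longrightarrow> y \<otimes> z = \<zero>) \<and> (\<Oplus>z\<in>Z. z) = w"
proof -
  obtain \<mu> :: "'a set \<Rightarrow> nat" and n where mu: "\<And>V. \<mu> V \<le> n"
    "\<And>V W. subspace V \<Longrightarrow> subspace W \<Longrightarrow> V \<subset> W \<Longrightarrow> \<mu> V < \<mu> W"
    by (rule dimension_measure[OF fd]) blast
  define I where "I = (\<lambda>w. {x \<in> N. w \<otimes> x \<ominus> x \<in> J})"
  show ?thesis
    using assms
  proof (induction "\<mu> (I w)" arbitrary: w rule: less_induct)
    case less
    have wN: "w \<in> N" "w \<in> carrier A"
      using less.prems(1) by auto
    show ?case
    proof (cases "w = \<zero>")
      case True
      then show ?thesis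
        by (intro exI[of _ "{}"]) (simp add: True)
    next
      case False
      have nI: "nideal (I w)"
        unfolding I_def using principal_nideal[OF wN(1) less.prems(3)] .
      have wI: "w \<in> I w" "w \<notin> J"
        using wN less.prems(2) subspaceD(2)[OF J_subspace] K_inter_J[OF less.prems(1)] False
        by (auto simp: I_def)
      \<comment> \<open>There is an ideal to start from, since \<open>w\<close> lies in
        \<open>I w\<close> but not in \<open>J\<close>.\<close>
      obtain P where P: "nideal P \<and> P \<noteq> J" "P \<subseteq> I w" "\<And>U. nideal U \<and> U \<noteq> J \<Longrightarrow> U \<subseteq> P \<Longrightarrow> U = P"
        by (rule minimal_subspace[OF fd, of "\<lambda>P. nideal P \<and> P \<noteq> J" "I w"]) (use nI wI nidealD(1) in blast)+
      have "minimal_nideal P"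
        unfolding minimal_nideal_def using P by blast
      then obtain z where z: "atom_idem z P"
        using atom_idem_exists by blast
      note zD = atom_idemD[OF z]
      have "w \<otimes> z \<ominus> z \<in> J"
        using zD(8) P(2) unfolding I_def by blast
      then have wz: "w \<otimes> z = z"
        using K_diff[OF K_mult[OF less.prems(1) zD(1)] zD(1)] by blast
      have zw: "z \<otimes> w = z"
        using wz K_comm[OF zD(1) less.prems(1)] by simp
      define v where "v = w \<ominus> z"
      have v: "v \<in> K" "v \<in> N" "v \<in> carrier A"
        unfolding v_def using subspaceD(5)[OF K_subspace less.prems(1) zD(1)] by auto
      have vw: "v \<otimes> w = v" "w \<otimes> v = v"
        unfolding v_def using wN zD wz zw less.prems(2) by (simp_all add: mult_minus_l mult_minus_r)
      have vz: "v \<otimes> z = \<zero>" "z \<otimes> v = \<zero>"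
        unfolding v_def using wN zD wz zw by (simp_all add: mult_minus_l mult_minus_r)
      have vv: "v \<otimes> v = v"
        using vw vz v wN zD unfolding v_def[symmetric] by (subst (2) v_def) (simp add: mult_minus_r)
      have vcent: "v \<otimes> x \<ominus> x \<otimes> v \<in> J" if x: "x \<in> N" for x
      proof -
        have "v \<otimes> x \<ominus> x \<otimes> v = (w \<otimes> x \<ominus> x \<otimes> w) \<ominus> (z \<otimes> x \<ominus> x \<otimes> z)"
          unfolding v_def using wN zD x by (simp add: mult_minus_l mult_minus_r minus_minus_comm)
        then show ?thesis
          using subspaceD(5)[OF J_subspace less.prems(3)[OF x] unit_of_central[OF zD(6,7) x]] by simp
      qed
      have nv: "nideal (I v)"
        unfolding I_def using principal_nideal[OF v(2) vcent] .
      have "I v \<subseteq> I w"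
      proof
        fix x assume "x \<in> I v"
        then have x: "x \<in> N" "v \<otimes> x \<ominus> x \<in> J"
          by (auto simp: I_def)
        have "w \<otimes> (v \<otimes> x) \<ominus> w \<otimes> x \<in> J"
          using J_mult_diff(1)[OF x(2) _ x(1) wN(1)] v x by simp
        moreover have "w \<otimes> (v \<otimes> x) = v \<otimes> x"
          using nuc1[OF wN(1) v(3), of x] x(1) vw(2) by simp
        ultimately have "v \<otimes> x \<ominus> w \<otimes> x \<in> J"
          by simp
        then have "w \<otimes> x \<ominus> x \<in> J"
          using J_trans[OF J_sym x(2)] v x wN by simp
        then show "x \<in> I w"
          using x by (simp add: I_def)
      qed
      moreover have "z \<in> I w" "z \<notin> I v"
      proof -
        show "z \<in> I w"
          using zD(8) P(2) by blast
        show "z \<notin> I v"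
        proof
          assume "z \<in> I v"
          then have "\<zero> \<ominus> z \<in> J"
            using vz by (simp add: I_def)
          then show False
            using subspace_mem_diff'[OF J_subspace _ subspaceD(2)[OF J_subspace] zD(3)] zD(9) by simp
        qed
      qed
      ultimately have "I v \<subset> I w"
        by blast
      then have "\<mu> (I v) < \<mu> (I w)"
        using mu(2) nidealD(1) nv nI by blast
      then obtain Z where Z: "finite Z" "\<forall>z\<in>Z. (\<exists>P. atom_idem z P) \<and> v \<otimes> z = z"
        "\<forall>y\<in>Z. \<forall>z\<in>Z. y \<noteq> z \<longrightarrow> y \<otimes> z = \<zero>" "(\<Oplus>z\<in>Z. z) = v"
        using less.hyps[of v] v(1) vv vcent by blast
      have ZK: "y \<in> K" "y \<in> carrier A" "y \<in> N" if "y \<in> Z" for y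
        using Z(2) that atom_idemD(1,2,3) by blast+
      have yz: "y \<otimes> z = \<zero>" "z \<otimes> y = \<zero>" "w \<otimes> y = y" if y: "y \<in> Z" for y
      proof -
        have vy: "v \<otimes> y = y"
          using Z(2) y by blast
        show "z \<otimes> y = \<zero>"
          using nuc1[OF zD(2) v(3) ZK(2)[OF y]] vy vz(2) ZK(2)[OF y] by simp
        then show "y \<otimes> z = \<zero>"
          using K_comm[OF zD(1) ZK(1)[OF y]] by simp
        show "w \<otimes> y = y"
          using nuc1[OF wN(1) v(3) ZK(2)[OF y]] vy vw(2) by simp
      qed
      have zZ: "z \<notin> Z"
        using yz(1)[of z] zD(4,10) by auto
      have "(\<Oplus>y\<in>insert z Z. y) = z \<oplus> v"
        using Z(1,4) zZ zD(3) ZK(2) by (subst M.finsum_insert) auto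
      also have "\<dots> = w"
        unfolding v_def using wN zD by (simp add: M.minus_eq M.a_comm[of w] M.a_assoc[symmetric] M.r_neg)
      finally have "(\<Oplus>y\<in>insert z Z. y) = w" .
      moreover have "\<forall>y\<in>insert z Z. \<forall>x\<in>insert z Z. y \<noteq> x \<longrightarrow> y \<otimes> x = \<zero>"
        using Z(3) yz by blast
      moreover have "\<forall>y\<in>insert z Z. (\<exists>P. atom_idem y P) \<and> w \<otimes> y = y"
        using Z(2) yz(3) z wz by blast
      ultimately show ?thesis
        using Z(1) by (intro exI[of _ "insert z Z"]) simp
    qed
  qed
qed

end

section \<open>Peirce components\<close>

context alg begin

text \<open>Expanding the right coefficients in a basis leaves one left coefficient for each basis
  vector, the form in which \<open>bimodule_faithful\<close> is stated.\<close>

lemma mop_normal_form: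
  assumes B: "subspace B" and L: "basis V L" and T: "T \<in> mop B V"
  obtains a where "\<And>l. l \<in> L \<Longrightarrow> a l \<in> B" "\<And>x. x \<in> carrier A \<Longrightarrow> T x = (\<Oplus>l\<in>L. (a l \<otimes> x) \<otimes> l)"
proof -
  have L': "L \<subseteq> carrier A" "comb L = V"
    using L by (auto simp: basis_def indep_def)
  have "\<exists>a. (\<forall>l\<in>L. a l \<in> B) \<and> (\<forall>x\<in>carrier A. T x = (\<Oplus>l\<in>L. (a l \<otimes> x) \<otimes> l))"
    using T
  proof induction
    case (base b v)
    obtain c where c: "c \<in> L \<rightarrow> carrier F" "v = (\<Oplus>l\<in>L. c l \<odot> l)"
      using base(2) L'(2) unfolding comb_def by blast
    have bA: "b \<in> carrier A"
      using base(1) subspaceD(7)[OF B] by blast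
    have cl: "c l \<in> carrier F" "l \<in> carrier A" if "l \<in> L" for l
      using c(1) L'(1) that by auto
    have "(b \<otimes> x) \<otimes> v = (\<Oplus>l\<in>L. ((c l \<odot> b) \<otimes> x) \<otimes> l)" if x: "x \<in> carrier A" for x
    proof -
      have "(b \<otimes> x) \<otimes> v = (\<Oplus>l\<in>L. (b \<otimes> x) \<otimes> (c l \<odot> l))"
        unfolding c(2) using cl bA x by (intro finsum_mult_r) auto
      also have "\<dots> = (\<Oplus>l\<in>L. ((c l \<odot> b) \<otimes> x) \<otimes> l)"
        using cl bA x by (intro M.finsum_cong') (auto simp: smult_mult_l smult_mult_r)
      finally show ?thesis .
    qed
    moreover have "c l \<odot> b \<in> B" if "l \<in> L" for l
      using subspaceD(6)[OF B cl(1)[OF that] base(1)] .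
    ultimately show ?case
      by (intro exI[of _ "\<lambda>l. c l \<odot> b"]) simp
  next
    case (sum S T)
    then obtain a b where a: "\<forall>l\<in>L. a l \<in> B" "\<forall>x\<in>carrier A. S x = (\<Oplus>l\<in>L. (a l \<otimes> x) \<otimes> l)"
      and b: "\<forall>l\<in>L. b l \<in> B" "\<forall>x\<in>carrier A. T x = (\<Oplus>l\<in>L. (b l \<otimes> x) \<otimes> l)"
      by blast
    have "S x \<oplus> T x = (\<Oplus>l\<in>L. ((a l \<oplus> b l) \<otimes> x) \<otimes> l)" if x: "x \<in> carrier A" for x
    proof -
      have c: "a l \<in> carrier A" "b l \<in> carrier A" "l \<in> carrier A" if "l \<in> L" for l
        using a(1) b(1) that L'(1) subspaceD(7)[OF B] by blast+
      have "(\<Oplus>l\<in>L. ((a l \<oplus> b l) \<otimes> x) \<otimes> l) = (\<Oplus>l\<in>L. (a l \<otimes> x) \<otimes> l \<oplus> (b l \<otimes> x) \<otimes> l)"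
        using c x by (intro M.finsum_cong') (auto simp: mult_l_distr)
      also have "\<dots> = S x \<oplus> T x"
        using a(2) b(2) c x M.finsum_addf[of "\<lambda>l. (a l \<otimes> x) \<otimes> l" L "\<lambda>l. (b l \<otimes> x) \<otimes> l"] by simp
      finally show ?thesis ..
    qed
    moreover have "\<forall>l\<in>L. a l \<oplus> b l \<in> B"
      using a(1) b(1) subspaceD(4)[OF B] by blast
    ultimately show ?case
      by (intro exI[of _ "\<lambda>l. a l \<oplus> b l"]) simp
  qed
  then show ?thesis
    using that by blast
qed

definition peirce :: "'a \<Rightarrow> 'a \<Rightarrow> 'a set" where
  "peirce z s = {x \<in> carrier A. z \<otimes> x = x \<and> x \<otimes> s = x}"

text \<open>Taken inside the nucleus, so that it is an associative ring that can act. That it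
  exhausts \<open>z A z\<close> is a consequence of minimality and is proved in
  \<open>corner_eq\<close>.\<close>

definition corner :: "'a \<Rightarrow> 'a set" where
  "corner z = N \<inter> peirce z z"

lemma peirceD: "x \<in> peirce z s \<Longrightarrow> x \<in> carrier A" "x \<in> peirce z s \<Longrightarrow> z \<otimes> x = x" "x \<in> peirce z s \<Longrightarrow> x \<otimes> s = x"
  by (simp_all add: peirce_def)

lemma cornerD: "x \<in> corner z \<Longrightarrow> x \<in> N" "x \<in> corner z \<Longrightarrow> z \<otimes> x = x" "x \<in> corner z \<Longrightarrow> x \<otimes> z = x"
  by (simp_all add: corner_def peirce_def)

lemma cornerI: "x \<in> N \<Longrightarrow> z \<otimes> x = x \<Longrightarrow> x \<otimes> z = x \<Longrightarrow> x \<in> corner z"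
  by (simp add: corner_def peirce_def)

lemma peirce_subspace:
  assumes "z \<in> carrier A" "s \<in> carrier A"
  shows "subspace (peirce z s)"
  unfolding peirce_def
  by (rule subspaceI) (use assms in \<open>auto simp: mult_l_distr mult_r_distr smult_mult_l smult_mult_r\<close>)

lemma corner_subspace: "z \<in> carrier A \<Longrightarrow> subspace (corner z)"
  unfolding corner_def by (intro subspace_inter nuc_subspace peirce_subspace)

lemma corner_mult:
  assumes z: "z \<in> N" and xy: "x \<in> corner z" "y \<in> corner z"
  shows "x \<otimes> y \<in> corner z"
proof (rule cornerI)
  note x = cornerD[OF xy(1)] and y = cornerD[OF xy(2)]
  show "x \<otimes> y \<in> N"
    using x y by simp
  show "z \<otimes> (x \<otimes> y) = x \<otimes> y"
    using nuc1[OF z, of x y] x y by simp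
  show "x \<otimes> y \<otimes> z = x \<otimes> y"
    using nuc3[OF z, of x y] x y by simp
qed

lemma compress_peirce:
  assumes z: "z \<in> N" "z \<otimes> z = z" and s: "s \<in> N" "s \<otimes> s = s" and x: "x \<in> carrier A"
  shows "(z \<otimes> x) \<otimes> s \<in> peirce z s"
proof -
  have "z \<otimes> ((z \<otimes> x) \<otimes> s) = (z \<otimes> x) \<otimes> s"
    using z s x nuc1[OF z(1), of "z \<otimes> x" s] nuc1[OF z(1), of z x] by simp
  moreover have "((z \<otimes> x) \<otimes> s) \<otimes> s = (z \<otimes> x) \<otimes> s"
    using z s x nuc3[OF s(1), of "z \<otimes> x" s] by simp
  ultimately show ?thesis
    using z s x by (simp add: peirce_def)
qed

lemma compress_corner:
  assumes z: "z \<in> N" "z \<otimes> z = z" and x: "x \<in> N"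
  shows "(z \<otimes> x) \<otimes> z \<in> corner z"
  using compress_peirce[OF z z nuc_carr[OF x]] z x by (simp add: corner_def)

lemma compress_id: "x \<in> peirce z s \<Longrightarrow> (z \<otimes> x) \<otimes> s = x"
  by (simp add: peirce_def)

text \<open>For \<open>y = z y z\<close> one has \<open>z (b y c) z = (z b z) y (z c z)\<close>, so
  compression can be shifted from the value to the coefficients.\<close>

lemma mop_compress:
  assumes z: "z \<in> N" "z \<otimes> z = z" and y: "y \<in> corner z" and T: "T \<in> mop N N"
  shows "\<exists>T' \<in> mop (corner z) (corner z). T' y = (z \<otimes> T y) \<otimes> z"
  using T
proof induction
  case (base b c)
  note yD = cornerD[OF y]
  have "(\<lambda>x. (((z \<otimes> b) \<otimes> z) \<otimes> x) \<otimes> ((z \<otimes> c) \<otimes> z)) \<in> mop (corner z) (corner z)"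
    using base z by (intro mop.base compress_corner)
  moreover have "(((z \<otimes> b) \<otimes> z) \<otimes> y) \<otimes> ((z \<otimes> c) \<otimes> z) = (z \<otimes> ((b \<otimes> y) \<otimes> c)) \<otimes> z"
  proof -
    have zbz: "((z \<otimes> b) \<otimes> z) \<otimes> y = z \<otimes> (b \<otimes> y)"
      using base z yD by (simp add: nuc1)
    have "(z \<otimes> (b \<otimes> y)) \<otimes> ((z \<otimes> c) \<otimes> z) = (z \<otimes> (b \<otimes> (y \<otimes> z))) \<otimes> (c \<otimes> z)"
      using base z yD(1) by (simp add: nuc1)
    then show ?thesis
      unfolding zbz using yD base z by (simp add: nuc1)
  qed
  ultimately show ?case
    by (intro bexI[of _ "\<lambda>x. (((z \<otimes> b) \<otimes> z) \<otimes> x) \<otimes> ((z \<otimes> c) \<otimes> z)"])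
next
  case (sum S T)
  then obtain S' T' where S: "S' \<in> mop (corner z) (corner z)" "S' y = (z \<otimes> S y) \<otimes> z"
    and T: "T' \<in> mop (corner z) (corner z)" "T' y = (z \<otimes> T y) \<otimes> z"
    by blast
  have NA: "N \<subseteq> carrier A"
    using nuc_carr by blast
  have "S y \<in> carrier A" "T y \<in> carrier A"
    using mop_closed[OF sum(1) NA NA] mop_closed[OF sum(2) NA NA] cornerD(1)[OF y] by simp_all
  then have "S' y \<oplus> T' y = (z \<otimes> (S y \<oplus> T y)) \<otimes> z"
    using S(2) T(2) z by (simp add: mult_l_distr mult_r_distr)
  then show ?case
    using mop.sum[OF S(1) T(1)] by (intro bexI[of _ "\<lambda>x. S' x \<oplus> T' x"])
qed

end

section \<open>Simplicity of the Peirce components\<close>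

context homog begin

text \<open>The corner represents the whole atom, as every \<open>x \<in> P\<close> is congruent to
  \<open>z x z\<close>. Minimality of \<open>P\<close> and the centrality in
  \<open>atom_data\<close> are transported along this identification.\<close>

lemma corner_simple:
  assumes z: "atom_idem z P"
  shows "simple_mod (corner z) (J \<inter> corner z) z" "central_mod (corner z) (J \<inter> corner z) z"
proof -
  note zD = atom_idemD[OF z]
  note PD = nidealD[OF zD(6)]
  have cP: "x \<in> P" if "x \<in> corner z" for x
    using PD(5)[OF cornerD(1)[OF that] zD(8)] cornerD(2)[OF that] by simp
  have zc: "z \<in> corner z"
    using zD by (intro cornerI) auto
  have NA: "N \<subseteq> carrier A"
    using nuc_carr by blast
  have simp: "\<exists>T\<in>mop (corner z) (corner z). T y \<ominus> z \<in> J \<inter> corner z"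
    if y: "y \<in> corner z" "y \<notin> J \<inter> corner z" for y
  proof -
    note yD = cornerD[OF y(1)]
    \<comment> \<open>The ideal generated by \<open>y\<close> together with \<open>J\<close>. By
      minimality it is \<open>P\<close> and contains \<open>z\<close>, so some operator over
      \<open>N\<close> takes \<open>y\<close> to \<open>z\<close> modulo \<open>J\<close>;
      compressing it gives coefficients in the corner.\<close>
    define Q where "Q = {x \<in> N. \<exists>T\<in>mop N N. x \<ominus> T y \<in> J}"
    have TN: "T y \<in> N" "T y \<in> P" if "T \<in> mop N N" for T
      using mop_preserves[OF that nuc_subspace] mop_preserves[OF that PD(1)] yD(1) cP[OF y(1)] PD(4,5) by auto
    have QI: "x \<in> Q" if "T \<in> mop N N" "x \<in> N" "x \<ominus> T y \<in> J" for T x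
      unfolding Q_def using that by blast
    have zero: "(\<lambda>a. (\<zero> \<otimes> a) \<otimes> \<one>) \<in> mop N N"
      by (intro mop.base) auto
    have JQ: "J \<subseteq> Q"
    proof
      fix x assume x: "x \<in> J"
      have "x \<ominus> (\<zero> \<otimes> y) \<otimes> \<one> \<in> J"
        using x J_nuc[OF x] yD(1) by simp
      then show "x \<in> Q"
        by (rule QI[OF zero J_nuc[OF x]])
    qed
    have mult: "a \<otimes> x \<in> Q \<and> x \<otimes> a \<in> Q" if a: "a \<in> N" and xQ: "x \<in> Q" for a x
    proof -
      obtain T where T: "x \<in> N" "T \<in> mop N N" "x \<ominus> T y \<in> J"
        using xQ unfolding Q_def by blast
      obtain R where R: "R \<in> mop N N" "\<forall>x\<in>carrier A. R x = (a \<otimes> T x) \<otimes> \<one>"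
        using mop_comp[OF mop.base[OF a nuc_one] T(2), of N N] by auto
      obtain R' where R': "R' \<in> mop N N" "\<forall>x\<in>carrier A. R' x = (\<one> \<otimes> T x) \<otimes> a"
        using mop_comp[OF mop.base[OF nuc_one a] T(2), of N N] by auto
      have "R y = a \<otimes> T y" "R' y = T y \<otimes> a"
        using R(2) R'(2) TN[OF T(2)] yD(1) a by simp_all
      then have "a \<otimes> x \<ominus> R y \<in> J" "x \<otimes> a \<ominus> R' y \<in> J"
        using J_mult_diff[OF T(3,1) TN(1)[OF T(2)] a] by simp_all
      then show ?thesis
        unfolding Q_def using R(1) R'(1) T(1) a by blast
    qed
    have "nideal Q"
      unfolding nideal_def
    proof (intro conjI ballI JQ)
      show "subspace Q"
      proof (rule subspaceI)
        show "Q \<subseteq> carrier A"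
          unfolding Q_def using NA by blast
        show "\<zero> \<in> Q"
          using JQ subspaceD(2)[OF J_subspace] by blast
        fix x x' assume "x \<in> Q" "x' \<in> Q"
        then obtain T T' where T: "x \<in> N" "T \<in> mop N N" "x \<ominus> T y \<in> J" "x' \<in> N" "T' \<in> mop N N" "x' \<ominus> T' y \<in> J"
          unfolding Q_def by blast
        have "(x \<oplus> x') \<ominus> (T y \<oplus> T' y) \<in> J"
          using subspaceD(4)[OF J_subspace T(3,6)] T TN by (simp add: add_minus_add)
        then show "x \<oplus> x' \<in> Q"
          by (rule QI[OF mop.sum[OF T(2,5)] nuc_add[OF T(1,4)]])
      next
        fix c x assume c: "c \<in> carrier F" and x: "x \<in> Q"
        have "(c \<odot> \<one>) \<otimes> x \<in> Q"
          using mult[OF nuc_smult[OF c nuc_one] x] by blast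
        then show "c \<odot> x \<in> Q"
          using c x NA unfolding Q_def by (auto simp: smult_mult_l)
      qed
      show "Q \<subseteq> N"
        unfolding Q_def by blast
    qed (use mult in auto)
    moreover have "Q \<subseteq> P"
    proof
      fix x assume "x \<in> Q"
      then obtain T where T: "x \<in> N" "T \<in> mop N N" "x \<ominus> T y \<in> J"
        unfolding Q_def by blast
      then show "x \<in> P"
        using subspace_mem_diff[OF PD(1) _ TN(2)[OF T(2)]] PD(2) nuc_carr by blast
    qed
    moreover have "y \<in> Q"
    proof -
      have 1: "(\<lambda>a. (\<one> \<otimes> a) \<otimes> \<one>) \<in> mop N N"
        by (intro mop.base) auto
      have "y \<ominus> (\<one> \<otimes> y) \<otimes> \<one> \<in> J"
        using yD(1) subspaceD(2)[OF J_subspace] by simp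
      then show ?thesis
        by (rule QI[OF 1 yD(1)])
    qed
    ultimately have "Q = P"
      using zD(5) y unfolding minimal_nideal_def by blast
    then obtain T where T: "T \<in> mop N N" "z \<ominus> T y \<in> J"
      using zD(8) unfolding Q_def by blast
    obtain T' where T': "T' \<in> mop (corner z) (corner z)" "T' y = (z \<otimes> T y) \<otimes> z"
      using mop_compress[OF zD(2,4) y(1) T(1)] by blast
    have d: "T y \<ominus> z \<in> J"
      using J_sym[OF T(2)] TN[OF T(1)] zD(2) by simp
    have "T' y \<ominus> z = (z \<otimes> (T y \<ominus> z)) \<otimes> z"
      unfolding T'(2) using TN[OF T(1)] zD(2,4) by (simp add: mult_minus_l mult_minus_r)
    then have 1: "T' y \<ominus> z \<in> J"
      using J_mult(1)[OF J_mult(2)[OF d zD(2)] zD(2)] by simp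
    have "T' y \<in> corner z"
      unfolding T'(2) using compress_corner[OF zD(2,4)] TN[OF T(1)] by blast
    then have "T' y \<ominus> z \<in> corner z"
      using subspaceD(5)[OF corner_subspace[OF zD(3)]] zc by blast
    then show ?thesis
      using 1 T'(1) by blast
  qed
  show "simple_mod (corner z) (J \<inter> corner z) z"
    unfolding simple_mod_def
  proof (intro conjI ballI)
    show "subspace (corner z)" "subspace (J \<inter> corner z)"
      using corner_subspace[OF zD(3)] subspace_inter[OF J_subspace] by blast+
    show "corner z \<subseteq> N"
      using cornerD(1) by blast
    show "\<And>x y. x \<in> corner z \<Longrightarrow> y \<in> corner z \<Longrightarrow> x \<otimes> y \<in> corner z"
      by (rule corner_mult[OF zD(2)])
    show "z \<in> corner z"
      by (rule zc)
    show "\<And>x. x \<in> corner z \<Longrightarrow> z \<otimes> x = x" "\<And>x. x \<in> corner z \<Longrightarrow> x \<otimes> z = x"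
      by (rule cornerD; assumption)+
    fix x y assume x: "x \<in> corner z" and y: "y \<in> J \<inter> corner z"
    have yJ: "y \<in> J" "y \<in> corner z"
      using y by blast+
    show "x \<otimes> y \<in> J \<inter> corner z" "y \<otimes> x \<in> J \<inter> corner z"
      using J_mult[OF yJ(1) cornerD(1)[OF x]] corner_mult[OF zD(2) x yJ(2)] corner_mult[OF zD(2) yJ(2) x]
      by (simp_all only: IntI)
  next
    show "\<exists>T\<in>mop (corner z) (corner z). T y \<ominus> z \<in> J \<inter> corner z" if "y \<in> corner z - J \<inter> corner z" for y
      using simp that by blast
  qed auto
  show "central_mod (corner z) (J \<inter> corner z) z"
    unfolding central_mod_def
  proof (intro ballI impI)
    fix y assume y: "y \<in> corner z" and comm: "\<forall>x\<in>corner z. y \<otimes> x \<ominus> x \<otimes> y \<in> J \<inter> corner z"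
    note yD = cornerD[OF y]
    obtain u where u: "unit_of u P"
      "\<And>y. y \<in> P \<Longrightarrow> (\<And>x. x \<in> P \<Longrightarrow> y \<otimes> x \<ominus> x \<otimes> y \<in> J) \<Longrightarrow> \<exists>c\<in>carrier F. y \<ominus> c \<odot> u \<in> J"
      using atom_data[OF zD(5)] by metis
    have uP: "u \<in> P" "u \<in> N"
      using u(1) PD(3) unfolding unit_of_def by blast+
    \<comment> \<open>Commuting with the corner modulo \<open>J\<close> implies commuting with all
      of \<open>P\<close>, since \<open>x\<close> may be replaced by \<open>z x z\<close>.\<close>
    have "y \<otimes> x \<ominus> x \<otimes> y \<in> J" if x: "x \<in> P" for x
    proof -
      have xN: "x \<in> N"
        using PD(3)[OF x] .
      let ?c = "(z \<otimes> x) \<otimes> z"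
      have cN: "?c \<in> N" "?c \<in> corner z"
        using compress_corner[OF zD(2,4) xN] zD(2) xN by simp_all
      have "z \<otimes> x \<ominus> x \<in> J" "(z \<otimes> x) \<otimes> z \<ominus> z \<otimes> x \<in> J"
        using zD(7) x PD(4)[OF zD(2) x] unfolding unit_of_def by blast+
      then have d: "x \<ominus> ?c \<in> J"
        using J_sym[OF J_trans[of ?c "z \<otimes> x" x]] xN zD(2) cN by simp
      have 1: "y \<otimes> x \<ominus> y \<otimes> ?c \<in> J" and 2: "x \<otimes> y \<ominus> ?c \<otimes> y \<in> J"
        using J_mult_diff[OF d xN cN(1) yD(1)] by simp_all
      have 3: "y \<otimes> ?c \<ominus> ?c \<otimes> y \<in> J"
        using comm cN(2) by blast
      have "?c \<otimes> y \<ominus> x \<otimes> y \<in> J"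
        using J_sym[OF 2] xN cN yD by simp
      then have "y \<otimes> ?c \<ominus> x \<otimes> y \<in> J"
        using J_trans[OF 3] xN cN(1) yD(1) by simp
      then show ?thesis
        using J_trans[OF 1] xN cN(1) yD(1) by simp
    qed
    then obtain c where c: "c \<in> carrier F" "y \<ominus> c \<odot> u \<in> J"
      using u(2)[OF cP[OF y]] by blast
    have "z \<otimes> u \<ominus> u \<in> J" "z \<otimes> u \<ominus> z \<in> J"
      using zD(7,8) u(1) uP(1) unfolding unit_of_def by blast+
    then have "u \<ominus> z \<in> J"
      using J_trans[OF J_sym[of "z \<otimes> u" u]] uP(2) zD(2) by simp
    then have "c \<odot> (u \<ominus> z) \<in> J"
      using subspaceD(6)[OF J_subspace c(1)] by blast
    then have "c \<odot> u \<ominus> c \<odot> z \<in> J"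
      using c(1) uP(2) zD(2) by (simp add: smult_minus_r)
    then have "y \<ominus> c \<odot> z \<in> J"
      using J_trans[OF c(2)] c(1) yD(1) uP(2) zD(2) by simp
    moreover have "y \<ominus> c \<odot> z \<in> corner z"
      using subspaceD(5,6)[OF corner_subspace[OF zD(3)]] y zc c(1) by blast
    ultimately show "\<exists>c\<in>carrier F. y \<ominus> c \<odot> z \<in> J \<inter> corner z"
      using c(1) by blast
  qed
qed

lemma K_compress:
  assumes z: "z \<in> K" "z \<otimes> z = z" and k: "k \<in> K"
  shows "z \<otimes> k \<in> K \<inter> corner z"
proof -
  have "z \<otimes> (z \<otimes> k) = z \<otimes> k" "(z \<otimes> k) \<otimes> z = z \<otimes> k"
    using nuc1[of z z k] z k K_comm[OF K_mult[OF z(1) k] z(1)] by simp_all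
  then show ?thesis
    using z k by (auto intro: cornerI)
qed

text \<open>\<open>N1 / N2\<close> is a nonzero bimodule over two central simple rings, the corners
  modulo \<open>J\<close>, hence faithful over their tensor product. The parts of \<open>K\<close>
  at \<open>z\<close> and at \<open>s\<close> embed there because \<open>K\<close> meets
  \<open>J\<close> in zero. With the other Peirce components added, the section
  \<open>M / N2\<close> of \<open>A\<close> is faithful over all of \<open>K \<otimes> K\<close>,
  and minimality gives both conclusions.\<close>

lemma section_corner:
  assumes z: "atom_idem z P" and s: "atom_idem s R"
    and N1: "subspace N1" "N1 \<subseteq> peirce z s" and N2: "subspace N2" "N2 \<subseteq> N1" "N1 \<noteq> N2"
    and c1: "\<And>b x. b \<in> corner z \<Longrightarrow> x \<in> N1 \<Longrightarrow> b \<otimes> x \<in> N1" "\<And>c x. c \<in> corner s \<Longrightarrow> x \<in> N1 \<Longrightarrow> x \<otimes> c \<in> N1"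
    and c2: "\<And>b x. b \<in> corner z \<Longrightarrow> x \<in> N2 \<Longrightarrow> b \<otimes> x \<in> N2" "\<And>c x. c \<in> corner s \<Longrightarrow> x \<in> N2 \<Longrightarrow> x \<otimes> c \<in> N2"
    and j: "\<And>b x. b \<in> J \<inter> corner z \<Longrightarrow> x \<in> N1 \<Longrightarrow> b \<otimes> x \<in> N2" "\<And>c x. c \<in> J \<inter> corner s \<Longrightarrow> x \<in> N1 \<Longrightarrow> x \<otimes> c \<in> N2"
  shows "N1 = peirce z s" "N2 = {\<zero>}"
proof -
  note zD = atom_idemD[OF z] and sD = atom_idemD[OF s]
  \<comment> \<open>The preimage of \<open>N1\<close> under the projection to \<open>z A s\<close>;
    it contains all other Peirce components.\<close>
  define M where "M = {a \<in> carrier A. (z \<otimes> a) \<otimes> s \<in> N1}"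
  have cl: "(z \<otimes> a) \<otimes> s \<in> carrier A" if "a \<in> carrier A" for a
    using that zD(3) sD(3) by simp
  have p1: "x \<in> carrier A" "z \<otimes> x = x" "x \<otimes> s = x" if "x \<in> N1" for x
    using N1(2) that peirceD by blast+
  have p2: "x \<in> carrier A" "z \<otimes> x = x" "x \<otimes> s = x" if "x \<in> N2" for x
    using N2(2) that p1 by blast+
  have M: "subspace M"
    unfolding M_def
  proof (rule subspaceI)
    fix x y assume "x \<in> {a \<in> carrier A. (z \<otimes> a) \<otimes> s \<in> N1}" "y \<in> {a \<in> carrier A. (z \<otimes> a) \<otimes> s \<in> N1}"
    then show "x \<oplus> y \<in> {a \<in> carrier A. (z \<otimes> a) \<otimes> s \<in> N1}"
      using subspaceD(4)[OF N1(1)] zD(3) sD(3) by (simp add: mult_l_distr mult_r_distr)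
  next
    fix c x assume "c \<in> carrier F" "x \<in> {a \<in> carrier A. (z \<otimes> a) \<otimes> s \<in> N1}"
    then show "c \<odot> x \<in> {a \<in> carrier A. (z \<otimes> a) \<otimes> s \<in> N1}"
      using subspaceD(6)[OF N1(1)] zD(3) sD(3) by (simp add: smult_mult_l smult_mult_r)
  qed (use zD(3) sD(3) subspaceD(2)[OF N1(1)] in auto)
  have MK: "k \<otimes> x \<in> M" "x \<otimes> k \<in> M" if k: "k \<in> K" and x: "x \<in> M" for k x
  proof -
    have xA: "x \<in> carrier A" "(z \<otimes> x) \<otimes> s \<in> N1"
      using x by (auto simp: M_def)
    have kN: "k \<in> N"
      using k by simp
    have zk: "z \<otimes> k \<in> corner z" "s \<otimes> k \<in> corner s"
      using K_compress k zD(1,4) sD(1,4) by blast+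
    have "(z \<otimes> (k \<otimes> x)) \<otimes> s = ((k \<otimes> z) \<otimes> x) \<otimes> s"
      using kN zD(2) sD(2) xA(1) K_comm[OF zD(1) k] nuc1[OF zD(2), of k x] by simp
    also have "\<dots> = k \<otimes> ((z \<otimes> x) \<otimes> s)"
      using kN zD(2) sD(2) xA(1) by (simp add: nuc1)
    also have "\<dots> = (z \<otimes> k) \<otimes> ((z \<otimes> x) \<otimes> s)"
      using p1(2)[OF xA(2)] K_comm[OF zD(1) k] nuc1[OF kN zD(3) cl[OF xA(1)]] by simp
    finally show "k \<otimes> x \<in> M"
      using c1(1)[OF zk(1) xA(2)] kN xA(1) by (simp add: M_def)
    have "(z \<otimes> (x \<otimes> k)) \<otimes> s = (z \<otimes> x) \<otimes> (k \<otimes> s)"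
      using kN zD(2) sD(2) xA(1) by (simp add: nuc1 nuc2)
    also have "\<dots> = ((z \<otimes> x) \<otimes> s) \<otimes> k"
      using kN zD(2) sD(2) xA(1) K_comm[OF sD(1) k] by (simp add: nuc2)
    also have "\<dots> = ((z \<otimes> x) \<otimes> s) \<otimes> (s \<otimes> k)"
      using p1(3)[OF xA(2)] nuc2[OF sD(2) cl[OF xA(1)], of k] kN by simp
    finally show "x \<otimes> k \<in> M"
      using c1(2)[OF zk(2) xA(2)] kN xA(1) by (simp add: M_def)
  qed
  have N2K: "k \<otimes> x \<in> N2" "x \<otimes> k \<in> N2" if k: "k \<in> K" and x: "x \<in> N2" for k x
  proof -
    have zk: "z \<otimes> k \<in> corner z" "s \<otimes> k \<in> corner s"
      using K_compress k zD(1,4) sD(1,4) by blast+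
    have "k \<otimes> x = (z \<otimes> k) \<otimes> x"
      using p2[OF x] K_comm[OF zD(1) k] nuc1[of k z x] k zD(3) by simp
    then show "k \<otimes> x \<in> N2"
      using c2(1)[OF zk(1) x] by simp
    have "x \<otimes> k = x \<otimes> (s \<otimes> k)"
      using p2[OF x] nuc2[OF sD(2) p2(1)[OF x], of k] k by simp
    then show "x \<otimes> k \<in> N2"
      using c2(2)[OF zk(2) x] by simp
  qed
  have N1M: "x \<in> M" if "x \<in> N1" for x
    using p1[OF that] that by (simp add: M_def)
  have le: "N2 \<subseteq> M"
    using N1M N2(2) by blast
  \<comment> \<open>The parts of \<open>K\<close> at \<open>s\<close> and at \<open>z\<close>. On
    \<open>z A s\<close> an operator over \<open>K\<close> depends only on these, and a basis of
    \<open>V\<close> stays independent modulo \<open>J\<close>, as \<open>bimodule_faithful\<close>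
    demands.\<close>
  define V where "V = K \<inter> corner s"
  define U where "U = K \<inter> corner z"
  have V: "subspace V" and U: "subspace U"
    unfolding V_def U_def using subspace_inter[OF K_subspace corner_subspace] zD(3) sD(3) by blast+
  obtain L where L: "basis V L"
    using basis_exists[OF fd V] .
  have Lf: "finite L" "L \<subseteq> V"
    using L basis_incl[OF L] by (auto simp: basis_def indep_def)
  have restrict: "\<exists>T'\<in>mop U V. \<forall>x\<in>peirce z s. T' x = T x" if "T \<in> mop K K" for T
    using that
  proof induction
    case (base k l)
    have kl: "k \<in> N" "l \<in> N"
      using base by auto
    have zk: "z \<otimes> k \<in> U" "s \<otimes> l \<in> V"
      using K_compress base zD(1,4) sD(1,4) unfolding U_def V_def by blast+
    have "((z \<otimes> k) \<otimes> x) \<otimes> (s \<otimes> l) = (k \<otimes> x) \<otimes> l" if "x \<in> peirce z s" for x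
    proof -
      note x = peirceD[OF that]
      have "(z \<otimes> k) \<otimes> x = k \<otimes> x"
        using x K_comm[OF zD(1) base(1)] nuc1[OF kl(1) zD(3) x(1)] by simp
      moreover have "(k \<otimes> x) \<otimes> (s \<otimes> l) = (k \<otimes> x) \<otimes> l"
        using x nuc2[OF sD(2), of "k \<otimes> x" l] nuc1[OF kl(1) x(1) sD(3)] kl by simp
      ultimately show ?thesis
        by simp
    qed
    then show ?case
      using mop.base[OF zk] by (intro bexI[of _ "\<lambda>x. ((z \<otimes> k) \<otimes> x) \<otimes> (s \<otimes> l)"]) auto
  next
    case (sum S T)
    then obtain S' T' where "S' \<in> mop U V" "\<forall>x\<in>peirce z s. S' x = S x" "T' \<in> mop U V" "\<forall>x\<in>peirce z s. T' x = T x"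
      by blast
    then show ?case
      using mop.sum[of S' U V T'] by (intro bexI[of _ "\<lambda>x. S' x \<oplus> T' x"]) auto
  qed
  have kill: "T x = \<zero>" if T: "T \<in> mop K K" "\<And>x. x \<in> M \<Longrightarrow> T x \<in> N2" and x: "x \<in> peirce z s" for T x
  proof -
    obtain T' where T': "T' \<in> mop U V" "\<forall>x\<in>peirce z s. T' x = T x"
      using restrict[OF T(1)] by blast
    obtain a where a: "\<And>l. l \<in> L \<Longrightarrow> a l \<in> U" "\<And>x. x \<in> carrier A \<Longrightarrow> T' x = (\<Oplus>l\<in>L. (a l \<otimes> x) \<otimes> l)"
      by (rule mop_normal_form[OF U L T'(1)]) blast
    have "\<forall>l\<in>L. a l \<in> J \<inter> corner z"
    proof (rule bimodule_faithful[OF corner_simple[OF z] corner_simple(1)[OF s] N1(1) N2(1)])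
      show "\<not> N1 \<subseteq> N2"
        using N2(2,3) by blast
      show "finite L" "L \<subseteq> corner s"
        using Lf unfolding V_def by blast+
      show "a l \<in> corner z" if "l \<in> L" for l
        using a(1)[OF that] unfolding U_def by blast
      show "(\<Oplus>l\<in>L. (a l \<otimes> x) \<otimes> l) \<in> N2" if x: "x \<in> N1" for x
        using T(2)[OF N1M[OF x]] T'(2) N1(2) x a(2)[OF p1(1)[OF x]] by auto
      fix c assume c: "c \<in> L \<rightarrow> carrier F" and s0: "(\<Oplus>l\<in>L. c l \<odot> l) \<in> J \<inter> corner s"
      have "(\<Oplus>l\<in>L. c l \<odot> l) \<in> K"
        using c Lf(2) subspaceD(6)[OF K_subspace] unfolding V_def by (intro subspace_finsum[OF K_subspace]) blast
      then have "(\<Oplus>l\<in>L. c l \<odot> l) = \<zero>"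
        using K_inter_J s0 by blast
      then show "\<forall>l\<in>L. c l = \<zero>\<^bsub>F\<^esub>"
        using L c unfolding basis_def indep_def by blast
    qed (fact c1 c2 j p1)+
    then have "a l = \<zero>" if "l \<in> L" for l
      using a(1)[OF that] K_inter_J that unfolding U_def by blast
    then have "(\<Oplus>l\<in>L. (a l \<otimes> x) \<otimes> l) = \<zero>"
      using peirceD(1)[OF x] Lf(2) K_carr unfolding V_def by (intro finsum_all_zero) auto
    then show ?thesis
      using T'(2) x a(2)[OF peirceD(1)[OF x]] by simp
  qed
  have min: "M = carrier A \<and> N2 = {\<zero>}"
  proof -
    \<comment> \<open>On the part of \<open>a\<close> outside \<open>z A s\<close> the operator
      takes values in \<open>N2\<close>, hence inside \<open>z A s\<close>; since it commutes with
      the projection to \<open>z A s\<close>, which kills that part, the values are zero. The part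
      inside \<open>z A s\<close> is treated by \<open>kill\<close>.\<close>
    have "T a = \<zero>" if T: "T \<in> mop K K" "\<And>x. x \<in> M \<Longrightarrow> T x \<in> N2" and a: "a \<in> carrier A" for T a
    proof -
      let ?b = "(z \<otimes> a) \<otimes> s"
      have b: "?b \<in> carrier A" "?b \<in> peirce z s"
        using cl[OF a] compress_peirce[OF zD(2,4) sD(2,4) a] .
      have "(z \<otimes> (a \<ominus> ?b)) \<otimes> s = \<zero>"
        using a b peirceD[OF b(2)] zD(3) sD(3) by (simp add: mult_minus_l mult_minus_r)
      then have 1: "a \<ominus> ?b \<in> M" "(z \<otimes> (a \<ominus> ?b)) \<otimes> s = \<zero>"
        using a b subspaceD(2)[OF N1(1)] by (simp_all add: M_def)
      have d: "a \<ominus> ?b \<in> carrier A"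
        using a b by simp
      have "T (a \<ominus> ?b) \<in> N2"
        using T(2)[OF 1(1)] .
      then have "T (a \<ominus> ?b) = (z \<otimes> T (a \<ominus> ?b)) \<otimes> s"
        using p2 by simp
      also have "\<dots> = T ((z \<otimes> (a \<ominus> ?b)) \<otimes> s)"
        using mop_K_bimodule(1)[OF T(1) zD(1) d] mop_K_bimodule(2)[OF T(1) sD(1), of "z \<otimes> (a \<ominus> ?b)"] d zD(3)
        by simp
      also have "\<dots> = \<zero>"
        unfolding 1(2) using mop_zero[OF T(1) K_carr K_carr] .
      finally have "T a \<ominus> T ?b = \<zero>"
        using mop_minus[OF T(1) K_carr K_carr a b(1)] by simp
      then show ?thesis
        using kill[OF T b(2)] mop_closed_K[OF T(1) a] by simp
    qed
    then show ?thesis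
      using minimal_section[OF M MK N2(1) N2K le] by blast
  qed
  then show "N2 = {\<zero>}"
    by blast
  show "N1 = peirce z s"
  proof
    show "peirce z s \<subseteq> N1"
    proof
      fix x assume x: "x \<in> peirce z s"
      then have "x \<in> M"
        using min peirceD(1) by blast
      then show "x \<in> N1"
        using compress_id[OF x] by (simp add: M_def)
    qed
  qed (rule N1(2))
qed

text \<open>The section given by \<open>z N z\<close> and its intersection with \<open>J\<close> is
  nonzero because \<open>z\<close> is not in \<open>J\<close>. Both equations come out together: the
  radical part vanishes, and all of \<open>z A z\<close> is nuclear.\<close>

lemma corner_eq:
  assumes z: "atom_idem z P"
  shows "corner z = peirce z z" "J \<inter> corner z = {\<zero>}"
proof -
  note zD = atom_idemD[OF z]
  note C = simple_modD[OF corner_simple(1)[OF z]]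
  have "z \<in> corner z" "z \<notin> J \<inter> corner z"
    using zD by (auto intro: cornerI)
  then have ne: "corner z \<noteq> J \<inter> corner z"
    by blast
  have le: "corner z \<subseteq> peirce z z"
    unfolding corner_def by blast
  show "corner z = peirce z z" "J \<inter> corner z = {\<zero>}"
    using section_corner[OF z z C(1) le C(7,8) ne C(3) C(3) C(9) C(10) C(10) C(9)] by blast+
qed

text \<open>The radical part of each corner is now zero, so a sub-bimodule of a Peirce component is
  a section with \<open>N2 = {\<zero>}\<close>.\<close>

lemma peirce_simple:
  assumes z: "atom_idem z P" and s: "atom_idem s R"
    and N1: "subspace N1" "N1 \<subseteq> peirce z s" "N1 \<noteq> {\<zero>}"
    and c1: "\<And>b x. b \<in> corner z \<Longrightarrow> x \<in> N1 \<Longrightarrow> b \<otimes> x \<in> N1" "\<And>c x. c \<in> corner s \<Longrightarrow> x \<in> N1 \<Longrightarrow> x \<otimes> c \<in> N1"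
  shows "N1 = peirce z s"
proof -
  have A: "b \<in> carrier A" if "b \<in> corner w" for b w
    using cornerD(1)[OF that] by simp
  have N1A: "x \<in> carrier A" if "x \<in> N1" for x
    using subspaceD(7)[OF N1(1) that] .
  show ?thesis
  proof (rule section_corner(1)[OF z s N1(1,2) subspace_zero _ N1(3) c1])
    show "b \<otimes> x \<in> {\<zero>}" if "b \<in> J \<inter> corner z" "x \<in> N1" for b x
      using that corner_eq(2)[OF z] N1A by auto
    show "x \<otimes> c \<in> {\<zero>}" if "c \<in> J \<inter> corner s" "x \<in> N1" for c x
      using that corner_eq(2)[OF s] N1A by auto
  qed (use subspaceD(2)[OF N1(1)] A in auto)
qed

text \<open>Faithfulness of \<open>A\<close> over \<open>K \<otimes> K\<close>, applied to the
  nonzero tensor of two idempotents of \<open>K\<close>.\<close>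

lemma peirce_nonzero:
  assumes z: "atom_idem z P" and s: "atom_idem s R"
  obtains x where "x \<in> peirce z s" "x \<noteq> \<zero>"
proof -
  note zD = atom_idemD[OF z] and sD = atom_idemD[OF s]
  obtain a where "a \<in> carrier A" "(z \<otimes> a) \<otimes> s \<noteq> \<zero>"
    using bimod_nonzero[OF zD(1,10) sD(1,10)] by blast
  then show ?thesis
    using that compress_peirce[OF zD(2,4) sD(2,4)] by blast
qed

end

section \<open>Bimodules over the division algebra\<close>

context alg begin

text \<open>
  A Casimir element of \<open>E \<otimes> E\<^sup>o\<^sup>p\<close>, for a central division algebra \<open>E\<close>, is found by maximality: an element
  \<open>a\<close> of \<open>E \<otimes> E\<^sup>o\<^sup>p\<close> that annihilates as many basis elements of \<open>E\<close> as possible without being zero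
  is determined by its value at any further basis element.
\<close>

lemma casimir:
  assumes fd: "fin_dim F A" and E: "subspace E" "E \<subseteq> N" "\<And>x y. x \<in> E \<Longrightarrow> y \<in> E \<Longrightarrow> x \<otimes> y \<in> E" "\<one> \<in> E"
    and div: "\<And>y. y \<in> E \<Longrightarrow> y \<noteq> \<zero> \<Longrightarrow> \<exists>v\<in>E. v \<otimes> y = \<one>" and ne: "\<one> \<noteq> \<zero>"
    and cen: "\<And>y. y \<in> E \<Longrightarrow> (\<And>x. x \<in> E \<Longrightarrow> y \<otimes> x = x \<otimes> y) \<Longrightarrow> \<exists>c\<in>carrier F. y = c \<odot> \<one>"
    and sX: "subspace X1" "\<And>b x. b \<in> E \<Longrightarrow> x \<in> X1 \<Longrightarrow> b \<otimes> x \<in> X1" "\<And>b x. b \<in> E \<Longrightarrow> x \<in> X1 \<Longrightarrow> x \<otimes> b \<in> X1"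
      "X1 \<noteq> {\<zero>}"
  obtains u where "u \<in> X1" "u \<noteq> \<zero>" "\<And>y. y \<in> E \<Longrightarrow> y \<otimes> u = u \<otimes> y"
proof -
  have EN: "x \<in> N" "x \<in> carrier A" if "x \<in> E" for x
    using E(2) nuc_carr that by blast+
  have EA: "E \<subseteq> carrier A"
    using EN by blast
  obtain L where L: "basis E L"
    using basis_exists[OF fd E(1)] .
  have Lf: "finite L" "L \<subseteq> E" "comb L = E" "indep L"
    using L basis_incl[OF L] by (auto simp: basis_def indep_def)
  define act where "act = (\<lambda>a x. \<Oplus>l\<in>L. (a l \<otimes> x) \<otimes> l)"
  have sm: "simple_mod E {\<zero>} \<one>"
    unfolding simple_mod_def
  proof (intro conjI ballI subspace_zero E(1,2,4))
    fix y assume y: "y \<in> E - {\<zero>}"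
    then obtain v where v: "v \<in> E" "v \<otimes> y = \<one>"
      using div by blast
    have "(v \<otimes> y) \<otimes> \<one> \<ominus> \<one> \<in> {\<zero>}"
      using v(2) by simp
    then show "\<exists>T\<in>mop E E. T y \<ominus> \<one> \<in> {\<zero>}"
      using mop.base[OF v(1) E(4)] by (intro bexI[of _ "\<lambda>x. (v \<otimes> x) \<otimes> \<one>"])
  qed (use E EN subspaceD(2)[OF E(1)] in auto)
  have cm: "central_mod E {\<zero>} \<one>"
    unfolding central_mod_def
  proof (intro ballI impI)
    fix y assume y: "y \<in> E" and c: "\<forall>x\<in>E. y \<otimes> x \<ominus> x \<otimes> y \<in> {\<zero>}"
    have "y \<otimes> x = x \<otimes> y" if "x \<in> E" for x
      using c that EN[OF y] EN[OF that] minus_eq_zero_iff[of "y \<otimes> x" "x \<otimes> y"] by auto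
    then obtain c where "c \<in> carrier F" "y = c \<odot> \<one>"
      using cen[OF y] by blast
    then show "\<exists>c\<in>carrier F. y \<ominus> c \<odot> \<one> \<in> {\<zero>}"
      by (intro bexI[of _ c]) simp_all
  qed
  \<comment> \<open>An element of \<open>E \<otimes> E^op\<close>, given by its coefficients
    \<open>a\<close> over the basis \<open>L\<close>, is zero if it annihilates some nonzero
    bimodule. Here the radical parts in \<open>bimodule_faithful\<close> are zero.\<close>
  have faithful: "\<forall>l\<in>L. a l = \<zero>"
    if Y: "subspace Y" "\<And>b x. b \<in> E \<Longrightarrow> x \<in> Y \<Longrightarrow> b \<otimes> x \<in> Y" "\<And>b x. b \<in> E \<Longrightarrow> x \<in> Y \<Longrightarrow> x \<otimes> b \<in> Y" "Y \<noteq> {\<zero>}"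
      and a: "\<And>l. l \<in> L \<Longrightarrow> a l \<in> E" and kill: "\<And>x. x \<in> Y \<Longrightarrow> act a x = \<zero>" for Y a
  proof -
    have YA: "x \<in> carrier A" if "x \<in> Y" for x
      using subspaceD(7)[OF Y(1) that] .
    have "\<forall>l\<in>L. a l \<in> {\<zero>}"
    proof (rule bimodule_faithful[OF sm cm sm Y(1) subspace_zero _ Y(2) _ Y(3) _ _ _ _ _ Lf(1,2) _ a])
      show "\<not> Y \<subseteq> {\<zero>}"
        using Y(4) subspaceD(2)[OF Y(1)] by blast
      show "\<forall>l\<in>L. c l = \<zero>\<^bsub>F\<^esub>" if "c \<in> L \<rightarrow> carrier F" "(\<Oplus>l\<in>L. c l \<odot> l) \<in> {\<zero>}" for c
        using Lf(4) that unfolding indep_def by blast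
      show "(\<Oplus>l\<in>L. (a l \<otimes> x) \<otimes> l) \<in> {\<zero>}" if "x \<in> Y" for x
        using kill[OF that] unfolding act_def by simp
    qed (use YA EN in auto)
    then show ?thesis
      by blast
  qed
  have ne': "E \<noteq> {\<zero>}"
    using E(4) ne by blast
  have actmop: "\<exists>T\<in>mop E E. \<forall>x\<in>carrier A. T x = act a x" if a: "\<And>l. l \<in> L \<Longrightarrow> a l \<in> E" for a
    unfolding act_def
    using mop_finsum[of L "\<lambda>l x. (a l \<otimes> x) \<otimes> l" E E \<one>] Lf(1) EA subspaceD(2)[OF E(1)] E(4)
      mop.base[OF a subsetD[OF Lf(2)]] by blast
  \<comment> \<open>Sets of basis vectors annihilated by a common nonzero element of
    \<open>E \<otimes> E^op\<close>; \<open>G\<close> below is one of largest size.\<close>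
  define good where "good = (\<lambda>G. G \<subseteq> L \<and> (\<exists>a. (\<forall>l\<in>L. a l \<in> E) \<and> (\<exists>l\<in>L. a l \<noteq> \<zero>) \<and> (\<forall>g\<in>G. act a g = \<zero>)))"
  have Lne: "L \<noteq> {}"
  proof
    assume "L = {}"
    then have "E = {\<zero>}"
      using Lf(3) by (auto simp: comb_def)
    then show False
      using ne' by blast
  qed
  have good0: "good {}"
    unfolding good_def using Lne E(4) ne by (intro conjI exI[of _ "\<lambda>_. \<one>"]) auto
  have "\<forall>G. good G \<longrightarrow> card G < Suc (card L)"
    unfolding good_def using card_mono[OF Lf(1)] by (auto simp: less_Suc_eq_le)
  then obtain G where G: "good G" "\<And>H. good H \<Longrightarrow> card H \<le> card G"
    using ex_has_greatest_nat[of good "{}" card "Suc (card L)"] good0 by blast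
  obtain a where a: "\<And>l. l \<in> L \<Longrightarrow> a l \<in> E" "\<exists>l\<in>L. a l \<noteq> \<zero>" "\<And>g. g \<in> G \<Longrightarrow> act a g = \<zero>" and GL: "G \<subseteq> L"
    using G(1) unfolding good_def by blast
  obtain T where T: "T \<in> mop E E" "\<And>x. x \<in> carrier A \<Longrightarrow> T x = act a x"
    using actmop[of a] a(1) by blast
  \<comment> \<open>Otherwise the operator of \<open>a\<close> would vanish on \<open>E\<close>, the
    span of \<open>L\<close>, which is itself a nonzero bimodule.\<close>
  have notL: "\<exists>g\<in>L. act a g \<noteq> \<zero>"
  proof (rule ccontr)
    assume "\<not> (\<exists>g\<in>L. act a g \<noteq> \<zero>)"
    then have z: "T g = \<zero>" if "g \<in> L" for g
      using that T(2) Lf(2) EN by auto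
    have "subspace {x \<in> carrier A. T x = \<zero>}"
      by (rule subspaceI) (use mop_add[OF T(1) EA EA] mop_smult[OF T(1) EA EA] mop_zero[OF T(1) EA EA] in auto)
    moreover have "L \<subseteq> {x \<in> carrier A. T x = \<zero>}"
      using z Lf(2) EN by auto
    ultimately have "E \<subseteq> {x \<in> carrier A. T x = \<zero>}"
      using comb_least Lf(3) by blast
    then have aE: "act a x = \<zero>" if "x \<in> E" for x
      using that T(2) by auto
    have "\<forall>l\<in>L. a l = \<zero>"
    proof (rule faithful[of E a, OF E(1) _ _ ne'])
      show "b \<otimes> x \<in> E" "x \<otimes> b \<in> E" if "b \<in> E" "x \<in> E" for b x
        using E(3) that by blast+
    qed (fact a(1) aE)+
    then show False
      using a(2) by blast
  qed
  then obtain g where g: "g \<in> L" "act a g \<noteq> \<zero>"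
    by blast
  have gE: "g \<in> E"
    using g Lf(2) by blast
  have gG: "g \<notin> G"
    using a(3) g(2) by blast
  have ext: "\<not> good (insert g G)"
  proof
    assume "good (insert g G)"
    then have "card (insert g G) \<le> card G"
      by (rule G(2))
    then show False
      using gG finite_subset[OF GL Lf(1)] by simp
  qed
  have TE: "T x \<in> E" if "x \<in> E" for x
    using mop_preserves[OF T(1) E(1) E(3) E(3) that] .
  have "T g \<in> E" "T g \<noteq> \<zero>"
    using TE[OF gE] g(2) T(2)[OF EN(2)[OF gE]] by simp_all
  then obtain v where v: "v \<in> E" "v \<otimes> T g = \<one>"
    using div by blast
  \<comment> \<open>Left multiplication by an inverse normalises the operator: \<open>R\<close>
    sends \<open>g\<close> to \<open>\<one>\<close> and still kills \<open>G\<close>.\<close>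
  obtain R where R: "R \<in> mop E E" "\<And>x. x \<in> carrier A \<Longrightarrow> R x = (v \<otimes> T x) \<otimes> \<one>"
    using mop_comp[OF mop.base[OF v(1) E(4)] T(1) E(2) E(2) E(2) E(2), of E E] E(3) by blast
  have Rg: "R g = \<one>" "\<And>x. x \<in> G \<Longrightarrow> R x = \<zero>"
    using R(2) v EN gE T(2) a(3) GL Lf(2) by (auto simp: subset_iff)
  have RA: "R x \<in> carrier A" if "x \<in> carrier A" for x
    using mop_closed[OF R(1) EA EA that] .
  \<comment> \<open>The operator \<open>x \<mapsto> y R(x) - R(x) y\<close> kills \<open>G\<close>,
    and also \<open>g\<close> because \<open>R g = \<one>\<close>. By maximality of \<open>G\<close>
    its coefficients vanish, so every value of \<open>R\<close> commutes with
    \<open>y\<close>.\<close>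
  have comm: "y \<otimes> R x = R x \<otimes> y" if y: "y \<in> E" and x: "x \<in> carrier A" for y x
  proof -
    note yN = EN[OF y]
    have m1: "\<ominus> \<one> \<in> E"
      using subspaceD(3)[OF E(1) E(4)] .
    obtain R1 where R1: "R1 \<in> mop E E" "\<And>x. x \<in> carrier A \<Longrightarrow> R1 x = (y \<otimes> R x) \<otimes> \<one>"
      using mop_comp[OF mop.base[OF y E(4)] R(1) E(2) E(2) E(2) E(2), of E E] E(3) by blast
    obtain R2 where R2: "R2 \<in> mop E E" "\<And>x. x \<in> carrier A \<Longrightarrow> R2 x = (\<ominus> \<one> \<otimes> R x) \<otimes> y"
      using mop_comp[OF mop.base[OF m1 y] R(1) E(2) E(2) E(2) E(2), of E E] E(3) by blast
    have Q: "(\<lambda>x. R1 x \<oplus> R2 x) \<in> mop E E"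
      by (rule mop.sum[OF R1(1) R2(1)])
    have Qv: "R1 x \<oplus> R2 x = y \<otimes> R x \<ominus> R x \<otimes> y" if "x \<in> carrier A" for x
      using R1(2)[OF that] R2(2)[OF that] RA[OF that] yN by (simp add: mult_neg_l M.minus_eq)
    obtain b where b: "\<And>l. l \<in> L \<Longrightarrow> b l \<in> E" "\<And>x. x \<in> carrier A \<Longrightarrow> R1 x \<oplus> R2 x = (\<Oplus>l\<in>L. (b l \<otimes> x) \<otimes> l)"
      by (rule mop_normal_form[OF E(1) L Q]) blast
    have actb: "act b x = y \<otimes> R x \<ominus> R x \<otimes> y" if "x \<in> carrier A" for x
      unfolding act_def using b(2)[OF that] Qv[OF that] by simp
    have "act b x = \<zero>" if "x \<in> insert g G" for x
      using that Rg yN gE GL Lf(2) EN actb by (auto simp: subset_iff)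
    then have b0: "b l = \<zero>" if "l \<in> L" for l
      using ext g(1) GL b(1) that unfolding good_def by blast
    have "act b x = \<zero>"
      unfolding act_def using b0 x Lf(2) EN by (intro finsum_all_zero) (auto simp: subset_iff)
    then show ?thesis
      using actb[OF x] minus_eq_zero_iff RA[OF x] x yN by simp
  qed
  have X1A: "x \<in> carrier A" if "x \<in> X1" for x
    using subspaceD(7)[OF sX(1) that] .
  \<comment> \<open>The coefficients of \<open>R\<close> are not all zero, as
    \<open>R g = \<one>\<close>; by faithfulness \<open>R\<close> cannot vanish on
    \<open>X1\<close>, and any nonzero value is the element sought.\<close>
  have "\<exists>x\<in>X1. R x \<noteq> \<zero>"
  proof (rule ccontr)
    assume "\<not> (\<exists>x\<in>X1. R x \<noteq> \<zero>)"
    then have Rz: "R x = \<zero>" if "x \<in> X1" for x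
      using that by blast
    obtain b where b: "\<And>l. l \<in> L \<Longrightarrow> b l \<in> E" "\<And>x. x \<in> carrier A \<Longrightarrow> R x = (\<Oplus>l\<in>L. (b l \<otimes> x) \<otimes> l)"
      by (rule mop_normal_form[OF E(1) L R(1)]) blast
    have "\<forall>l\<in>L. b l = \<zero>"
      using Rz b(2) X1A by (intro faithful[OF sX b(1)]) (simp_all add: act_def)
    then have "(\<Oplus>l\<in>L. (b l \<otimes> g) \<otimes> l) = \<zero>"
      using gE Lf(2) EN by (intro finsum_all_zero) (auto simp: subset_iff)
    then show False
      using Rg(1) b(2)[OF EN(2)[OF gE]] ne by simp
  qed
  then obtain x where x: "x \<in> X1" "R x \<noteq> \<zero>"
    by blast
  then show ?thesis
    using that[of "R x"] comm X1A mop_preserves[OF R(1) sX(1,2,3) x(1)] by simp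
qed

end

section \<open>Corners as matrix algebras\<close>

context homog begin

text \<open>Compressing the representatives \<open>g x\<close> to the corner turns a homomorphism
  modulo \<open>J\<close> into a true one: the corner meets \<open>J\<close> in zero, so congruences
  between its elements are equalities.\<close>

lemma atom_matrix:
  assumes z: "atom_idem z P"
  obtains m \<theta> where "m \<ge> 1" "\<And>x. x \<in> carrier (mat_alg m D) \<Longrightarrow> \<theta> x \<in> corner z"
    "\<And>x y. x \<in> carrier (mat_alg m D) \<Longrightarrow> y \<in> carrier (mat_alg m D) \<Longrightarrow> \<theta> (x \<oplus>\<^bsub>mat_alg m D\<^esub> y) = \<theta> x \<oplus> \<theta> y"
    "\<And>x y. x \<in> carrier (mat_alg m D) \<Longrightarrow> y \<in> carrier (mat_alg m D) \<Longrightarrow> \<theta> (x \<otimes>\<^bsub>mat_alg m D\<^esub> y) = \<theta> x \<otimes> \<theta> y"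
    "\<And>c x. c \<in> carrier F \<Longrightarrow> x \<in> carrier (mat_alg m D) \<Longrightarrow> \<theta> (c \<odot>\<^bsub>mat_alg m D\<^esub> x) = c \<odot> \<theta> x"
    "\<theta> \<one>\<^bsub>mat_alg m D\<^esub> = z" "\<And>b. b \<in> corner z \<Longrightarrow> \<exists>x\<in>carrier (mat_alg m D). \<theta> x = b"
proof -
  note zD = atom_idemD[OF z]
  note PD = nidealD[OF zD(6)]
  have one: "\<one>\<^bsub>mat_alg m D\<^esub> \<in> carrier (mat_alg m D)" for m
    using D.mat_one_diag D.mat_diag_closed[OF D.unit_closed] by simp
  obtain u m g where u: "unit_of u P" and m: "m \<ge> 1"
    and g: "\<And>x. x \<in> carrier (mat_alg m D) \<Longrightarrow> g x \<in> P"
    "\<And>x y. x \<in> carrier (mat_alg m D) \<Longrightarrow> y \<in> carrier (mat_alg m D) \<Longrightarrow> g (x \<oplus>\<^bsub>mat_alg m D\<^esub> y) \<ominus> (g x \<oplus> g y) \<in> J"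
    "\<And>x y. x \<in> carrier (mat_alg m D) \<Longrightarrow> y \<in> carrier (mat_alg m D) \<Longrightarrow> g (x \<otimes>\<^bsub>mat_alg m D\<^esub> y) \<ominus> g x \<otimes> g y \<in> J"
    "\<And>c x. c \<in> carrier F \<Longrightarrow> x \<in> carrier (mat_alg m D) \<Longrightarrow> g (c \<odot>\<^bsub>mat_alg m D\<^esub> x) \<ominus> c \<odot> g x \<in> J"
    "g \<one>\<^bsub>mat_alg m D\<^esub> \<ominus> u \<in> J" "\<And>p. p \<in> P \<Longrightarrow> \<exists>x\<in>carrier (mat_alg m D). p \<ominus> g x \<in> J"
    by (rule atom_data[OF zD(5)]) blast
  have gN: "g x \<in> N" if "x \<in> carrier (mat_alg m D)" for x
    using PD(3) g(1) that by blast
  define \<theta> where "\<theta> = (\<lambda>x. (z \<otimes> g x) \<otimes> z)"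
  have th: "\<theta> x \<in> corner z" "\<theta> x \<in> N" if "x \<in> carrier (mat_alg m D)" for x
    unfolding \<theta>_def using compress_corner[OF zD(2,4) gN[OF that]] cornerD(1) by blast+
  have th_g: "\<theta> x \<ominus> g x \<in> J" if x: "x \<in> carrier (mat_alg m D)" for x
  proof -
    have "z \<otimes> g x \<ominus> g x \<in> J" "(z \<otimes> g x) \<otimes> z \<ominus> z \<otimes> g x \<in> J"
      using zD(7) g(1)[OF x] PD(4)[OF zD(2) g(1)[OF x]] unfolding unit_of_def by blast+
    then show ?thesis
      unfolding \<theta>_def using J_trans[of "(z \<otimes> g x) \<otimes> z" "z \<otimes> g x" "g x"] gN[OF x] zD(2) by simp
  qed
  have eq: "x = y" if "x \<in> corner z" "y \<in> corner z" "x \<ominus> y \<in> J" for x y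
  proof -
    have "x \<ominus> y \<in> J \<inter> corner z"
      using that subspaceD(5)[OF corner_subspace[OF zD(3)]] by blast
    then show ?thesis
      using corner_eq(2)[OF z] minus_eq_zero_iff[of x y] cornerD(1) that by simp
  qed
  have th_eq: "\<theta> x = b" if x: "x \<in> carrier (mat_alg m D)" and b: "b \<in> corner z" and d: "g x \<ominus> b \<in> J" for x b
    using eq[OF th(1)[OF x] b] J_trans[OF th_g[OF x] d] th(2)[OF x] gN[OF x] cornerD(1)[OF b] by simp
  have mul: "x \<otimes>\<^bsub>mat_alg m D\<^esub> y \<in> carrier (mat_alg m D)" "x \<oplus>\<^bsub>mat_alg m D\<^esub> y \<in> carrier (mat_alg m D)"
    if "x \<in> carrier (mat_alg m D)" "y \<in> carrier (mat_alg m D)" for x y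
    using D.mat_mult_closed[OF that] that by (auto simp: mat_alg_sel)
  have smu: "c \<odot>\<^bsub>mat_alg m D\<^esub> x \<in> carrier (mat_alg m D)" if "c \<in> carrier F" "x \<in> carrier (mat_alg m D)" for c x
    using that by (auto simp: mat_alg_sel)
  note cs = corner_subspace[OF zD(3)]
  have g_th: "g x \<ominus> \<theta> x \<in> J" if "x \<in> carrier (mat_alg m D)" for x
    using J_sym[OF th_g[OF that]] th(2)[OF that] gN[OF that] by simp
  show ?thesis
  proof (rule that[OF m th(1)])
    fix x y assume x: "x \<in> carrier (mat_alg m D)" and y: "y \<in> carrier (mat_alg m D)"
    note n = gN[OF x] gN[OF y] th(2)[OF x] th(2)[OF y] gN[OF mul(1)[OF x y]] gN[OF mul(2)[OF x y]]
    show "\<theta> (x \<oplus>\<^bsub>mat_alg m D\<^esub> y) = \<theta> x \<oplus> \<theta> y"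
    proof (rule th_eq[OF mul(2)[OF x y] subspaceD(4)[OF cs th(1)[OF x] th(1)[OF y]]])
      have "(g x \<oplus> g y) \<ominus> (\<theta> x \<oplus> \<theta> y) \<in> J"
        using subspaceD(4)[OF J_subspace g_th[OF x] g_th[OF y]] n by (simp add: add_minus_add)
      then show "g (x \<oplus>\<^bsub>mat_alg m D\<^esub> y) \<ominus> (\<theta> x \<oplus> \<theta> y) \<in> J"
        using J_trans[OF g(2)[OF x y]] n by simp
    qed
    show "\<theta> (x \<otimes>\<^bsub>mat_alg m D\<^esub> y) = \<theta> x \<otimes> \<theta> y"
    proof (rule th_eq[OF mul(1)[OF x y] corner_mult[OF zD(2) th(1)[OF x] th(1)[OF y]]])
      have "g x \<otimes> g y \<ominus> g x \<otimes> \<theta> y \<in> J" "g x \<otimes> \<theta> y \<ominus> \<theta> x \<otimes> \<theta> y \<in> J"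
        using J_mult_diff(1)[OF g_th[OF y] n(2,4,1)] J_mult_diff(2)[OF g_th[OF x] n(1,3,4)] by blast+
      then have "g x \<otimes> g y \<ominus> \<theta> x \<otimes> \<theta> y \<in> J"
        using J_trans n by simp
      then show "g (x \<otimes>\<^bsub>mat_alg m D\<^esub> y) \<ominus> \<theta> x \<otimes> \<theta> y \<in> J"
        using J_trans[OF g(3)[OF x y]] n by simp
    qed
  next
    fix c x assume c: "c \<in> carrier F" and x: "x \<in> carrier (mat_alg m D)"
    note n = gN[OF x] th(2)[OF x] gN[OF smu[OF c x]]
    show "\<theta> (c \<odot>\<^bsub>mat_alg m D\<^esub> x) = c \<odot> \<theta> x"
    proof (rule th_eq[OF smu[OF c x] subspaceD(6)[OF cs c th(1)[OF x]]])
      have "c \<odot> g x \<ominus> c \<odot> \<theta> x \<in> J"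
        using subspaceD(6)[OF J_subspace c g_th[OF x]] n c by (simp add: smult_minus_r)
      then show "g (c \<odot>\<^bsub>mat_alg m D\<^esub> x) \<ominus> c \<odot> \<theta> x \<in> J"
        using J_trans[OF g(4)[OF c x]] n c by simp
    qed
  next
    show "\<theta> \<one>\<^bsub>mat_alg m D\<^esub> = z"
    proof (rule th_eq[OF one])
      show "z \<in> corner z"
        using zD by (intro cornerI) auto
      have uN: "u \<in> P" "u \<in> N"
        using u PD(3) unfolding unit_of_def by blast+
      have "z \<otimes> u \<ominus> u \<in> J" "z \<otimes> u \<ominus> z \<in> J"
        using zD(7,8) u uN(1) unfolding unit_of_def by blast+
      then have "u \<ominus> z \<in> J"
        using J_trans[OF J_sym[of "z \<otimes> u" u]] uN(2) zD(2) by simp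
      then show "g \<one>\<^bsub>mat_alg m D\<^esub> \<ominus> z \<in> J"
        using J_trans[OF g(5)] gN[OF one] uN(2) zD(2) by simp
    qed
  next
    fix b assume b: "b \<in> corner z"
    have bN: "b \<in> N"
      using cornerD(1)[OF b] .
    have "b \<in> P"
      using PD(5)[OF bN zD(8)] cornerD(2)[OF b] by simp
    then obtain x where x: "x \<in> carrier (mat_alg m D)" "b \<ominus> g x \<in> J"
      using g(6) by blast
    then have "\<theta> x = b"
      using th_eq[OF x(1) b] J_sym[OF x(2) bN gN[OF x(1)]] by blast
    then show "\<exists>x\<in>carrier (mat_alg m D). \<theta> x = b"
      using x(1) by blast
  qed
qed

end

section \<open>Skew matrix algebras and tensor products\<close>

context module begin

lemma finsum_swap:
  assumes "finite I" "finite J'" "\<And>i j. i \<in> I \<Longrightarrow> j \<in> J' \<Longrightarrow> f i j \<in> carrier M"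
  shows "(\<Oplus>\<^bsub>M\<^esub>i\<in>I. \<Oplus>\<^bsub>M\<^esub>j\<in>J'. f i j) = (\<Oplus>\<^bsub>M\<^esub>j\<in>J'. \<Oplus>\<^bsub>M\<^esub>i\<in>I. f i j)"
  using assms(1,3)
proof (induction I)
  case empty
  then show ?case
    using assms(2) by (simp add: M.add.finprod_one_eqI)
next
  case (insert i I)
  have c: "f k j \<in> carrier M" if "k \<in> insert i I" "j \<in> J'" for k j
    using insert.prems that by blast
  have "(\<Oplus>\<^bsub>M\<^esub>k\<in>insert i I. \<Oplus>\<^bsub>M\<^esub>j\<in>J'. f k j) = (\<Oplus>\<^bsub>M\<^esub>j\<in>J'. f i j) \<oplus>\<^bsub>M\<^esub> (\<Oplus>\<^bsub>M\<^esub>k\<in>I. \<Oplus>\<^bsub>M\<^esub>j\<in>J'. f k j)"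
    using insert.hyps c by (intro M.finsum_insert) (auto intro!: M.finsum_closed)
  also have "\<dots> = (\<Oplus>\<^bsub>M\<^esub>j\<in>J'. f i j) \<oplus>\<^bsub>M\<^esub> (\<Oplus>\<^bsub>M\<^esub>j\<in>J'. \<Oplus>\<^bsub>M\<^esub>k\<in>I. f k j)"
    using insert.IH c by simp
  also have "\<dots> = (\<Oplus>\<^bsub>M\<^esub>j\<in>J'. f i j \<oplus>\<^bsub>M\<^esub> (\<Oplus>\<^bsub>M\<^esub>k\<in>I. f k j))"
    using c by (intro M.finsum_addf[symmetric]) (auto intro!: M.finsum_closed)
  also have "\<dots> = (\<Oplus>\<^bsub>M\<^esub>j\<in>J'. \<Oplus>\<^bsub>M\<^esub>k\<in>insert i I. f k j)"
    using insert.hyps c by (intro M.finsum_cong') (auto intro!: M.finsum_closed M.finsum_insert[symmetric])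
  finally show ?case .
qed

lemma finsum_smult_rdistr:
  assumes "finite I" "\<And>i. i \<in> I \<Longrightarrow> f i \<in> carrier R" "v \<in> carrier M"
  shows "(\<Oplus>i\<in>I. f i) \<odot>\<^bsub>M\<^esub> v = (\<Oplus>\<^bsub>M\<^esub>i\<in>I. f i \<odot>\<^bsub>M\<^esub> v)"
  using assms(1,2)
proof (induction I)
  case empty
  then show ?case
    using assms by simp
next
  case (insert i I)
  have "(\<Oplus>k\<in>insert i I. f k) = f i \<oplus> (\<Oplus>k\<in>I. f k)"
    using insert by (intro R.finsum_insert) auto
  moreover have "(\<Oplus>\<^bsub>M\<^esub>k\<in>insert i I. f k \<odot>\<^bsub>M\<^esub> v) = f i \<odot>\<^bsub>M\<^esub> v \<oplus>\<^bsub>M\<^esub> (\<Oplus>\<^bsub>M\<^esub>k\<in>I. f k \<odot>\<^bsub>M\<^esub> v)"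
    using insert assms(3) by (intro M.finsum_insert) auto
  moreover have "(\<Oplus>k\<in>I. f k) \<in> carrier R"
    using insert by (intro R.finsum_closed) auto
  ultimately show ?case
    using insert assms(3) by (simp add: smult_l_distr)
qed

end

text \<open>The interface between the structure theory and the tensor product: each Peirce component
  of the idempotents \<open>u i i\<close> is a free module of rank one over \<open>D\<close>, with a
  generator \<open>u i j\<close> commuting with \<open>D\<close>. That the structure constants are
  scalars is a consequence and not part of the data.\<close>

locale skew_frame = alg A F + D: alg D F
  for A :: "('f, 'a) module" (structure) and F :: "('f, 'x) ring_scheme" (structure)
    and D :: "('f, 'd) module" +
  fixes n :: nat and u :: "nat \<Rightarrow> nat \<Rightarrow> 'a" and \<phi> :: "'d \<Rightarrow> 'a"
  assumes phi_nuc: "\<And>d. d \<in> carrier D \<Longrightarrow> \<phi> d \<in> N"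
    and phi_add: "\<And>d e. d \<in> carrier D \<Longrightarrow> e \<in> carrier D \<Longrightarrow> \<phi> (d \<oplus>\<^bsub>D\<^esub> e) = \<phi> d \<oplus> \<phi> e"
    and phi_mult: "\<And>d e. d \<in> carrier D \<Longrightarrow> e \<in> carrier D \<Longrightarrow> \<phi> (d \<otimes>\<^bsub>D\<^esub> e) = \<phi> d \<otimes> \<phi> e"
    and phi_smult: "\<And>c d. c \<in> carrier F \<Longrightarrow> d \<in> carrier D \<Longrightarrow> \<phi> (c \<odot>\<^bsub>D\<^esub> d) = c \<odot> \<phi> d"
    and phi_one: "\<phi> \<one>\<^bsub>D\<^esub> = \<one>"
    and u_carr: "\<And>i j. i \<in> {1..n} \<Longrightarrow> j \<in> {1..n} \<Longrightarrow> u i j \<in> carrier A"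
    and u_nuc: "\<And>i. i \<in> {1..n} \<Longrightarrow> u i i \<in> N"
    and u_left: "\<And>i j. i \<in> {1..n} \<Longrightarrow> j \<in> {1..n} \<Longrightarrow> u i i \<otimes> u i j = u i j"
    and u_right: "\<And>i j. i \<in> {1..n} \<Longrightarrow> j \<in> {1..n} \<Longrightarrow> u i j \<otimes> u j j = u i j"
    and u_orth: "\<And>i j. i \<in> {1..n} \<Longrightarrow> j \<in> {1..n} \<Longrightarrow> i \<noteq> j \<Longrightarrow> u i i \<otimes> u j j = \<zero>"
    and u_sum: "(\<Oplus>i\<in>{1..n}. u i i) = \<one>"
    and phi_u: "\<And>d i j. d \<in> carrier D \<Longrightarrow> i \<in> {1..n} \<Longrightarrow> j \<in> {1..n} \<Longrightarrow> \<phi> d \<otimes> u i j = u i j \<otimes> \<phi> d"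
    and u_inj: "\<And>d i j. d \<in> carrier D \<Longrightarrow> i \<in> {1..n} \<Longrightarrow> j \<in> {1..n} \<Longrightarrow> \<phi> d \<otimes> u i j = \<zero> \<Longrightarrow> d = \<zero>\<^bsub>D\<^esub>"
    and u_span: "\<And>x i j. i \<in> {1..n} \<Longrightarrow> j \<in> {1..n} \<Longrightarrow> x \<in> peirce (u i i) (u j j) \<Longrightarrow> \<exists>d\<in>carrier D. x = \<phi> d \<otimes> u i j"
    and D_central: "\<And>d. d \<in> carrier D \<Longrightarrow> (\<And>e. e \<in> carrier D \<Longrightarrow> d \<otimes>\<^bsub>D\<^esub> e = e \<otimes>\<^bsub>D\<^esub> d)
      \<Longrightarrow> \<exists>c\<in>carrier F. d = c \<odot>\<^bsub>D\<^esub> \<one>\<^bsub>D\<^esub>"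
begin

lemma phi_carr [simp]: "d \<in> carrier D \<Longrightarrow> \<phi> d \<in> carrier A"
  using phi_nuc by simp

lemma phi_minus: "d \<in> carrier D \<Longrightarrow> e \<in> carrier D \<Longrightarrow> \<phi> (d \<ominus>\<^bsub>D\<^esub> e) = \<phi> d \<ominus> \<phi> e"
proof -
  assume d: "d \<in> carrier D" "e \<in> carrier D"
  have "\<phi> (d \<ominus>\<^bsub>D\<^esub> e) \<oplus> \<phi> e = \<phi> d"
    using phi_add[of "d \<ominus>\<^bsub>D\<^esub> e" e] d D.minus_add_cancel[OF d] by simp
  then have "(\<phi> (d \<ominus>\<^bsub>D\<^esub> e) \<oplus> \<phi> e) \<ominus> \<phi> e = \<phi> d \<ominus> \<phi> e"
    by simp
  then show ?thesis
    using d by (simp add: M.minus_eq M.a_assoc M.r_neg)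
qed

lemma u_prod_peirce:
  assumes "i \<in> {1..n}" "k \<in> {1..n}" "j \<in> {1..n}"
  shows "u i k \<otimes> u k j \<in> peirce (u i i) (u j j)"
  using nuc1[OF u_nuc[OF assms(1)] u_carr[OF assms(1,2)] u_carr[OF assms(2,3)]]
    nuc3[OF u_nuc[OF assms(3)] u_carr[OF assms(1,2)] u_carr[OF assms(2,3)]]
    u_left[OF assms(1,2)] u_right[OF assms(2,3)] u_carr[OF assms(1,2)] u_carr[OF assms(2,3)]
  by (simp add: peirce_def)

text \<open>The product is \<open>\<phi> d \<otimes> u i j\<close> for some \<open>d\<close>.
  Elements of \<open>\<phi>(D)\<close> pass through both factors, so \<open>d e\<close> and
  \<open>e d\<close> have the same effect on \<open>u i j\<close>; hence \<open>d\<close> is central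
  in \<open>D\<close> and a scalar.\<close>

lemma u_prod:
  assumes ikj: "i \<in> {1..n}" "k \<in> {1..n}" "j \<in> {1..n}"
  shows "\<exists>c\<in>carrier F. u i k \<otimes> u k j = c \<odot> u i j"
proof -
  note a = u_carr[OF ikj(1,2)] and b = u_carr[OF ikj(2,3)] and w = u_carr[OF ikj(1,3)]
  obtain d where d: "d \<in> carrier D" "u i k \<otimes> u k j = \<phi> d \<otimes> u i j"
    using u_span[OF ikj(1,3) u_prod_peirce[OF ikj]] by blast
  have "d \<otimes>\<^bsub>D\<^esub> e = e \<otimes>\<^bsub>D\<^esub> d" if e: "e \<in> carrier D" for e
  proof -
    note pe = phi_nuc[OF e] and pd = phi_nuc[OF d(1)]
    have "(\<phi> e \<otimes> \<phi> d) \<otimes> u i j = \<phi> e \<otimes> (u i k \<otimes> u k j)"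
      unfolding d(2) using nuc1[OF pe _ w] pd by simp
    also have "\<dots> = (u i k \<otimes> \<phi> e) \<otimes> u k j"
      using nuc1[OF pe a b] phi_u[OF e ikj(1,2)] by simp
    also have "\<dots> = u i k \<otimes> (u k j \<otimes> \<phi> e)"
      using nuc2[OF pe a b] phi_u[OF e ikj(2,3)] by simp
    also have "\<dots> = (\<phi> d \<otimes> u i j) \<otimes> \<phi> e"
      unfolding d(2)[symmetric] using nuc3[OF pe a b] by simp
    also have "\<dots> = (\<phi> d \<otimes> \<phi> e) \<otimes> u i j"
      using nuc1[OF pd w, of "\<phi> e"] nuc1[OF pd _ w, of "\<phi> e"] phi_u[OF e ikj(1,3)] pe by simp
    finally have "\<phi> (e \<otimes>\<^bsub>D\<^esub> d) \<otimes> u i j = \<phi> (d \<otimes>\<^bsub>D\<^esub> e) \<otimes> u i j"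
      using d e by (simp add: phi_mult)
    then have "\<phi> (e \<otimes>\<^bsub>D\<^esub> d \<ominus>\<^bsub>D\<^esub> d \<otimes>\<^bsub>D\<^esub> e) \<otimes> u i j = \<zero>"
      using d e w by (simp add: phi_minus mult_minus_l)
    then have "e \<otimes>\<^bsub>D\<^esub> d \<ominus>\<^bsub>D\<^esub> d \<otimes>\<^bsub>D\<^esub> e = \<zero>\<^bsub>D\<^esub>"
      using u_inj[OF _ ikj(1,3)] d e by simp
    then show ?thesis
      using D.minus_eq_zero_iff d e by simp
  qed
  then obtain c where c: "c \<in> carrier F" "d = c \<odot>\<^bsub>D\<^esub> \<one>\<^bsub>D\<^esub>"
    using D_central[OF d(1)] by blast
  then have "u i k \<otimes> u k j = c \<odot> u i j"
    using d(2) w by (simp add: phi_smult phi_one smult_mult_l)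
  then show ?thesis
    using c(1) by blast
qed

text \<open>The value 1 is prescribed when neighbouring indices agree, which makes the family
  reduced by construction. It is the correct value there because \<open>u i i\<close> and
  \<open>u j j\<close> act as units on \<open>u i j\<close>.\<close>

definition c :: "nat \<Rightarrow> nat \<Rightarrow> nat \<Rightarrow> 'f" where
  "c i k j = (if i = k \<or> k = j then \<one>\<^bsub>F\<^esub> else SOME r. r \<in> carrier F \<and> u i k \<otimes> u k j = r \<odot> u i j)"

lemma c_props:
  assumes ikj: "i \<in> {1..n}" "k \<in> {1..n}" "j \<in> {1..n}"
  shows "c i k j \<in> carrier F" "u i k \<otimes> u k j = c i k j \<odot> u i j"
proof -
  have "c i k j \<in> carrier F \<and> u i k \<otimes> u k j = c i k j \<odot> u i j"
  proof (cases "i = k \<or> k = j")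
    case True
    then show ?thesis
      using u_left u_right u_carr ikj by (auto simp: c_def)
  next
    case False
    then have "c i k j = (SOME r. r \<in> carrier F \<and> u i k \<otimes> u k j = r \<odot> u i j)"
      by (simp add: c_def)
    then show ?thesis
      using someI_ex[of "\<lambda>r. r \<in> carrier F \<and> u i k \<otimes> u k j = r \<odot> u i j"] u_prod[OF ikj] by auto
  qed
  then show "c i k j \<in> carrier F" "u i k \<otimes> u k j = c i k j \<odot> u i j"
    by auto
qed

lemma c_reduced: "reduced_skew_set F n c"
  unfolding reduced_skew_set_def using c_props(1) by (auto simp: c_def)

abbreviation "Sk \<equiv> skew_mat_alg F n c"

lemma Sk_sel:
  "carrier Sk = ({1..n} \<times> {1..n} \<rightarrow>\<^sub>E carrier F)"
  "x \<otimes>\<^bsub>Sk\<^esub> y = (\<lambda>(i, j)\<in>{1..n} \<times> {1..n}. \<Oplus>\<^bsub>F\<^esub>k \<in> {1..n}. c i k j \<otimes>\<^bsub>F\<^esub> (x (i, k) \<otimes>\<^bsub>F\<^esub> y (k, j)))"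
  "\<one>\<^bsub>Sk\<^esub> = (\<lambda>(i, j)\<in>{1..n} \<times> {1..n}. if i = j then \<one>\<^bsub>F\<^esub> else \<zero>\<^bsub>F\<^esub>)"
  "\<zero>\<^bsub>Sk\<^esub> = (\<lambda>p\<in>{1..n} \<times> {1..n}. \<zero>\<^bsub>F\<^esub>)"
  "x \<oplus>\<^bsub>Sk\<^esub> y = (\<lambda>p\<in>{1..n} \<times> {1..n}. x p \<oplus>\<^bsub>F\<^esub> y p)"
  "a \<odot>\<^bsub>Sk\<^esub> x = (\<lambda>p\<in>{1..n} \<times> {1..n}. a \<otimes>\<^bsub>F\<^esub> x p)"
  by (simp_all add: skew_mat_alg_def Let_def)

lemma Sk_val: "x \<in> carrier Sk \<Longrightarrow> p \<in> {1..n} \<times> {1..n} \<Longrightarrow> x p \<in> carrier F"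
  unfolding Sk_sel by (rule PiE_mem)

lemma Sk_ext: "x \<in> carrier Sk \<Longrightarrow> y \<in> carrier Sk \<Longrightarrow> (\<And>p. p \<in> {1..n} \<times> {1..n} \<Longrightarrow> x p = y p) \<Longrightarrow> x = y"
  unfolding Sk_sel by (rule PiE_ext)

lemma Sk_closed:
  "x \<in> carrier Sk \<Longrightarrow> y \<in> carrier Sk \<Longrightarrow> x \<oplus>\<^bsub>Sk\<^esub> y \<in> carrier Sk" "\<zero>\<^bsub>Sk\<^esub> \<in> carrier Sk" "\<one>\<^bsub>Sk\<^esub> \<in> carrier Sk"
  "a \<in> carrier F \<Longrightarrow> x \<in> carrier Sk \<Longrightarrow> a \<odot>\<^bsub>Sk\<^esub> x \<in> carrier Sk"
  using Sk_val[of x] Sk_val[of y] unfolding Sk_sel by auto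

lemma Sk_mult_closed:
  assumes "x \<in> carrier Sk" "y \<in> carrier Sk"
  shows "x \<otimes>\<^bsub>Sk\<^esub> y \<in> carrier Sk"
proof -
  have "(\<Oplus>\<^bsub>F\<^esub>k \<in> {1..n}. c i k j \<otimes>\<^bsub>F\<^esub> (x (i, k) \<otimes>\<^bsub>F\<^esub> y (k, j))) \<in> carrier F"
    if "i \<in> {1..n}" "j \<in> {1..n}" for i j
    using that c_props(1) Sk_val[OF assms(1)] Sk_val[OF assms(2)] by (intro R.finsum_closed) auto
  then show ?thesis
    unfolding Sk_sel by (intro restrict_PiE_iff[THEN iffD2] ballI) auto
qed

lemma Sk_at:
  assumes "p \<in> {1..n} \<times> {1..n}"
  shows "(x \<oplus>\<^bsub>Sk\<^esub> y) p = x p \<oplus>\<^bsub>F\<^esub> y p" "\<zero>\<^bsub>Sk\<^esub> p = \<zero>\<^bsub>F\<^esub>" "(a \<odot>\<^bsub>Sk\<^esub> x) p = a \<otimes>\<^bsub>F\<^esub> x p"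
  using assms by (simp_all add: Sk_sel)

lemma Sk_module: "module F Sk"
proof (rule moduleI)
  show "cring F"
    by (rule R.cring_axioms)
  show "abelian_group Sk"
  proof (rule abelian_groupI)
    fix x assume x: "x \<in> carrier Sk"
    have n: "(\<ominus>\<^bsub>F\<^esub> \<one>\<^bsub>F\<^esub>) \<odot>\<^bsub>Sk\<^esub> x \<in> carrier Sk"
      using x by (intro Sk_closed) auto
    have "((\<ominus>\<^bsub>F\<^esub> \<one>\<^bsub>F\<^esub>) \<odot>\<^bsub>Sk\<^esub> x) \<oplus>\<^bsub>Sk\<^esub> x = \<zero>\<^bsub>Sk\<^esub>"
      using Sk_val[OF x] by (intro Sk_ext Sk_closed n x) (simp_all add: Sk_at R.l_minus R.l_neg)
    then show "\<exists>y\<in>carrier Sk. y \<oplus>\<^bsub>Sk\<^esub> x = \<zero>\<^bsub>Sk\<^esub>"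
      using n by blast
    show "\<zero>\<^bsub>Sk\<^esub> \<oplus>\<^bsub>Sk\<^esub> x = x"
      using Sk_val[OF x] by (intro Sk_ext Sk_closed x) (simp_all add: Sk_at)
  next
    fix x y assume xy: "x \<in> carrier Sk" "y \<in> carrier Sk"
    show "x \<oplus>\<^bsub>Sk\<^esub> y = y \<oplus>\<^bsub>Sk\<^esub> x"
      using Sk_val[OF xy(1)] Sk_val[OF xy(2)] by (intro Sk_ext Sk_closed xy) (simp_all add: Sk_at R.a_comm)
  next
    fix x y z assume xy: "x \<in> carrier Sk" "y \<in> carrier Sk" "z \<in> carrier Sk"
    show "(x \<oplus>\<^bsub>Sk\<^esub> y) \<oplus>\<^bsub>Sk\<^esub> z = x \<oplus>\<^bsub>Sk\<^esub> (y \<oplus>\<^bsub>Sk\<^esub> z)"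
      using Sk_val[OF xy(1)] Sk_val[OF xy(2)] Sk_val[OF xy(3)]
      by (intro Sk_ext Sk_closed xy) (simp_all add: Sk_at R.a_assoc)
  qed (use Sk_closed in blast)+
next
  fix a b x assume ab: "a \<in> carrier F" "b \<in> carrier F" and x: "x \<in> carrier Sk"
  show "(a \<oplus>\<^bsub>F\<^esub> b) \<odot>\<^bsub>Sk\<^esub> x = a \<odot>\<^bsub>Sk\<^esub> x \<oplus>\<^bsub>Sk\<^esub> b \<odot>\<^bsub>Sk\<^esub> x"
    using Sk_val[OF x] ab by (intro Sk_ext Sk_closed R.a_closed x) (simp_all add: Sk_at R.l_distr)
  show "(a \<otimes>\<^bsub>F\<^esub> b) \<odot>\<^bsub>Sk\<^esub> x = a \<odot>\<^bsub>Sk\<^esub> (b \<odot>\<^bsub>Sk\<^esub> x)"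
    using Sk_val[OF x] ab by (intro Sk_ext Sk_closed R.m_closed x) (simp_all add: Sk_at R.m_assoc)
next
  fix a x y assume a: "a \<in> carrier F" and xy: "x \<in> carrier Sk" "y \<in> carrier Sk"
  show "a \<odot>\<^bsub>Sk\<^esub> (x \<oplus>\<^bsub>Sk\<^esub> y) = a \<odot>\<^bsub>Sk\<^esub> x \<oplus>\<^bsub>Sk\<^esub> a \<odot>\<^bsub>Sk\<^esub> y"
    using Sk_val[OF xy(1)] Sk_val[OF xy(2)] a by (intro Sk_ext Sk_closed xy) (simp_all add: Sk_at R.r_distr)
next
  fix x assume x: "x \<in> carrier Sk"
  show "\<one>\<^bsub>F\<^esub> \<odot>\<^bsub>Sk\<^esub> x = x"
    using Sk_val[OF x] by (intro Sk_ext Sk_closed x) (simp_all add: Sk_at)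
qed (use Sk_closed in blast)

text \<open>The homomorphism from the skew matrix algebra with \<open>e_ij \<mapsto> u i j\<close>.
  The sum is nested because products are evaluated row by row.\<close>

definition hs :: "(nat \<times> nat \<Rightarrow> 'f) \<Rightarrow> 'a" where
  "hs x = (\<Oplus>i\<in>{1..n}. \<Oplus>j\<in>{1..n}. x (i, j) \<odot> u i j)"

lemma hs_term: "x \<in> carrier Sk \<Longrightarrow> i \<in> {1..n} \<Longrightarrow> j \<in> {1..n} \<Longrightarrow> x (i, j) \<odot> u i j \<in> carrier A"
  using Sk_val u_carr by simp

lemma hs_row: "x \<in> carrier Sk \<Longrightarrow> i \<in> {1..n} \<Longrightarrow> (\<Oplus>j\<in>{1..n}. x (i, j) \<odot> u i j) \<in> carrier A"
  using hs_term by (intro M.finsum_closed) auto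

lemma hs_closed: "x \<in> carrier Sk \<Longrightarrow> hs x \<in> carrier A"
  unfolding hs_def using hs_row by (intro M.finsum_closed) auto

lemma hs_add:
  assumes x: "x \<in> carrier Sk" and y: "y \<in> carrier Sk"
  shows "hs (x \<oplus>\<^bsub>Sk\<^esub> y) = hs x \<oplus> hs y"
proof -
  have "hs (x \<oplus>\<^bsub>Sk\<^esub> y) = (\<Oplus>i\<in>{1..n}. \<Oplus>j\<in>{1..n}. x (i, j) \<odot> u i j \<oplus> y (i, j) \<odot> u i j)"
    unfolding hs_def using hs_term[OF x] hs_term[OF y] Sk_val[OF x] Sk_val[OF y] u_carr
    by (intro M.finsum_cong' refl funcsetI M.finsum_closed) (auto simp: Sk_at smult_l_distr)
  also have "\<dots> = (\<Oplus>i\<in>{1..n}. (\<Oplus>j\<in>{1..n}. x (i, j) \<odot> u i j) \<oplus> (\<Oplus>j\<in>{1..n}. y (i, j) \<odot> u i j))"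
    using hs_term[OF x] hs_term[OF y] hs_row[OF x] hs_row[OF y] by (intro M.finsum_cong' refl M.finsum_addf) auto
  also have "\<dots> = hs x \<oplus> hs y"
    unfolding hs_def using hs_row[OF x] hs_row[OF y] by (intro M.finsum_addf) auto
  finally show ?thesis .
qed

lemma hs_smult:
  assumes a: "a \<in> carrier F" and x: "x \<in> carrier Sk"
  shows "hs (a \<odot>\<^bsub>Sk\<^esub> x) = a \<odot> hs x"
proof -
  have "hs (a \<odot>\<^bsub>Sk\<^esub> x) = (\<Oplus>i\<in>{1..n}. \<Oplus>j\<in>{1..n}. a \<odot> (x (i, j) \<odot> u i j))"
    unfolding hs_def using hs_term[OF x] Sk_val[OF x] u_carr a
    by (intro M.finsum_cong' refl funcsetI M.finsum_closed) (auto simp: Sk_at smult_assoc1)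
  also have "\<dots> = (\<Oplus>i\<in>{1..n}. a \<odot> (\<Oplus>j\<in>{1..n}. x (i, j) \<odot> u i j))"
    using hs_term[OF x] hs_row[OF x] a by (intro M.finsum_cong' refl finsum_smult_ldistr[symmetric]) auto
  also have "\<dots> = a \<odot> hs x"
    unfolding hs_def using hs_row[OF x] a by (intro finsum_smult_ldistr[symmetric]) auto
  finally show ?thesis .
qed

lemma u_mult_zero:
  assumes "i \<in> {1..n}" "j \<in> {1..n}" "k \<in> {1..n}" "l \<in> {1..n}" "j \<noteq> k"
  shows "u i j \<otimes> u k l = \<zero>"
proof -
  note a = u_carr[OF assms(1,2)] and b = u_carr[OF assms(3,4)]
  have "u i j \<otimes> u k l = (u i j \<otimes> u j j) \<otimes> (u k k \<otimes> u k l)"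
    using u_left u_right assms by simp
  also have "\<dots> = u i j \<otimes> (u j j \<otimes> (u k k \<otimes> u k l))"
    using nuc2[OF u_nuc[OF assms(2)] a] u_nuc[OF assms(3)] b by simp
  also have "u j j \<otimes> (u k k \<otimes> u k l) = (u j j \<otimes> u k k) \<otimes> u k l"
    using nuc1[OF u_nuc[OF assms(2)] _ b] u_nuc[OF assms(3)] by simp
  finally show ?thesis
    using u_orth assms a b by simp
qed

lemma hs_mult:
  assumes x: "x \<in> carrier Sk" and y: "y \<in> carrier Sk"
  shows "hs (x \<otimes>\<^bsub>Sk\<^esub> y) = hs x \<otimes> hs y"
proof -
  have F: "x (i, j) \<in> carrier F" "y (i, j) \<in> carrier F" if "i \<in> {1..n}" "j \<in> {1..n}" for i j
    using Sk_val[OF x] Sk_val[OF y] that by auto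
  \<comment> \<open>Only row \<open>j\<close> of \<open>y\<close> survives, since
    \<open>u i j \<otimes> u k l\<close> vanishes for \<open>j \<noteq> k\<close>.\<close>
  have uy: "u i j \<otimes> hs y = (\<Oplus>l\<in>{1..n}. (y (j, l) \<otimes>\<^bsub>F\<^esub> c i j l) \<odot> u i l)" if i: "i \<in> {1..n}" and j: "j \<in> {1..n}" for i j
  proof -
    note a = u_carr[OF i j]
    have "u i j \<otimes> hs y = (\<Oplus>k\<in>{1..n}. u i j \<otimes> (\<Oplus>l\<in>{1..n}. y (k, l) \<odot> u k l))"
      unfolding hs_def using hs_row[OF y] a by (intro finsum_mult_r) auto
    also have "\<dots> = u i j \<otimes> (\<Oplus>l\<in>{1..n}. y (j, l) \<odot> u j l)"
    proof (rule finsum_single)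
      fix k assume k: "k \<in> {1..n}" "k \<noteq> j"
      have "u i j \<otimes> (\<Oplus>l\<in>{1..n}. y (k, l) \<odot> u k l) = (\<Oplus>l\<in>{1..n}. u i j \<otimes> (y (k, l) \<odot> u k l))"
        using hs_term[OF y k(1)] a by (intro finsum_mult_r) auto
      also have "\<dots> = \<zero>"
        using u_mult_zero[OF i j k(1)] k F[OF k(1)] u_carr[OF k(1)] a
        by (intro finsum_all_zero) (simp add: smult_mult_r)
      finally show "u i j \<otimes> (\<Oplus>l\<in>{1..n}. y (k, l) \<odot> u k l) = \<zero>" .
    qed (use j a hs_row[OF y j] in auto)
    also have "\<dots> = (\<Oplus>l\<in>{1..n}. u i j \<otimes> (y (j, l) \<odot> u j l))"
      using hs_term[OF y j] a by (intro finsum_mult_r) auto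
    also have "\<dots> = (\<Oplus>l\<in>{1..n}. (y (j, l) \<otimes>\<^bsub>F\<^esub> c i j l) \<odot> u i l)"
      using F[OF j] u_carr[OF j] u_carr[OF i] a c_props[OF i j]
      by (intro M.finsum_cong' refl) (auto simp: smult_mult_r smult_assoc1)
    finally show ?thesis .
  qed
  have t: "(x (i, j) \<otimes>\<^bsub>F\<^esub> (y (j, l) \<otimes>\<^bsub>F\<^esub> c i j l)) \<odot> u i l \<in> carrier A"
    if "i \<in> {1..n}" "j \<in> {1..n}" "l \<in> {1..n}" for i j l
    using F that u_carr c_props(1) by simp
  have "hs x \<otimes> hs y = (\<Oplus>i\<in>{1..n}. (\<Oplus>j\<in>{1..n}. x (i, j) \<odot> u i j) \<otimes> hs y)"
    unfolding hs_def[of x] using hs_row[OF x] hs_closed[OF y] by (intro finsum_mult_l) auto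
  also have "\<dots> = (\<Oplus>i\<in>{1..n}. \<Oplus>j\<in>{1..n}. \<Oplus>l\<in>{1..n}. (x (i, j) \<otimes>\<^bsub>F\<^esub> (y (j, l) \<otimes>\<^bsub>F\<^esub> c i j l)) \<odot> u i l)"
  proof (intro M.finsum_cong' refl)
    fix i assume i: "i \<in> {1..n}"
    have "(\<Oplus>j\<in>{1..n}. x (i, j) \<odot> u i j) \<otimes> hs y = (\<Oplus>j\<in>{1..n}. (x (i, j) \<odot> u i j) \<otimes> hs y)"
      using hs_term[OF x i] hs_closed[OF y] by (intro finsum_mult_l) auto
    also have "\<dots> = (\<Oplus>j\<in>{1..n}. \<Oplus>l\<in>{1..n}. (x (i, j) \<otimes>\<^bsub>F\<^esub> (y (j, l) \<otimes>\<^bsub>F\<^esub> c i j l)) \<odot> u i l)"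
    proof (intro M.finsum_cong' refl)
      fix j assume j: "j \<in> {1..n}"
      have "(x (i, j) \<odot> u i j) \<otimes> hs y = x (i, j) \<odot> (\<Oplus>l\<in>{1..n}. (y (j, l) \<otimes>\<^bsub>F\<^esub> c i j l) \<odot> u i l)"
        using uy[OF i j] F[OF i j] u_carr[OF i j] hs_closed[OF y] by (simp add: smult_mult_l)
      also have "\<dots> = (\<Oplus>l\<in>{1..n}. x (i, j) \<odot> ((y (j, l) \<otimes>\<^bsub>F\<^esub> c i j l) \<odot> u i l))"
        using F i j u_carr[OF i] c_props(1)[OF i j] by (intro finsum_smult_ldistr) auto
      also have "\<dots> = (\<Oplus>l\<in>{1..n}. (x (i, j) \<otimes>\<^bsub>F\<^esub> (y (j, l) \<otimes>\<^bsub>F\<^esub> c i j l)) \<odot> u i l)"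
        using F i j u_carr[OF i] c_props(1)[OF i j] by (intro M.finsum_cong' refl) (auto simp: smult_assoc1)
      finally show "(x (i, j) \<odot> u i j) \<otimes> hs y = (\<Oplus>l\<in>{1..n}. (x (i, j) \<otimes>\<^bsub>F\<^esub> (y (j, l) \<otimes>\<^bsub>F\<^esub> c i j l)) \<odot> u i l)" .
    qed (use t[OF i] in \<open>auto intro!: M.finsum_closed\<close>)
    finally show "(\<Oplus>j\<in>{1..n}. x (i, j) \<odot> u i j) \<otimes> hs y =
      (\<Oplus>j\<in>{1..n}. \<Oplus>l\<in>{1..n}. (x (i, j) \<otimes>\<^bsub>F\<^esub> (y (j, l) \<otimes>\<^bsub>F\<^esub> c i j l)) \<odot> u i l)" .
  qed (use t in \<open>auto intro!: M.finsum_closed\<close>)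
  also have "\<dots> = (\<Oplus>i\<in>{1..n}. \<Oplus>l\<in>{1..n}. \<Oplus>j\<in>{1..n}. (x (i, j) \<otimes>\<^bsub>F\<^esub> (y (j, l) \<otimes>\<^bsub>F\<^esub> c i j l)) \<odot> u i l)"
    using t by (intro M.finsum_cong' refl finsum_swap) (auto intro!: M.finsum_closed)
  also have "\<dots> = hs (x \<otimes>\<^bsub>Sk\<^esub> y)"
    unfolding hs_def
  proof (intro M.finsum_cong' refl)
    fix i l assume il: "i \<in> {1..n}" "l \<in> {1..n}"
    have "(x \<otimes>\<^bsub>Sk\<^esub> y) (i, l) = (\<Oplus>\<^bsub>F\<^esub>j\<in>{1..n}. c i j l \<otimes>\<^bsub>F\<^esub> (x (i, j) \<otimes>\<^bsub>F\<^esub> y (j, l)))"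
      using il by (simp add: Sk_sel)
    also have "\<dots> = (\<Oplus>\<^bsub>F\<^esub>j\<in>{1..n}. x (i, j) \<otimes>\<^bsub>F\<^esub> (y (j, l) \<otimes>\<^bsub>F\<^esub> c i j l))"
      using F il c_props(1) by (intro R.finsum_cong' refl) (auto simp: R.m_ac)
    finally have e: "(x \<otimes>\<^bsub>Sk\<^esub> y) (i, l) = (\<Oplus>\<^bsub>F\<^esub>j\<in>{1..n}. x (i, j) \<otimes>\<^bsub>F\<^esub> (y (j, l) \<otimes>\<^bsub>F\<^esub> c i j l))" .
    show "(\<Oplus>j\<in>{1..n}. (x (i, j) \<otimes>\<^bsub>F\<^esub> (y (j, l) \<otimes>\<^bsub>F\<^esub> c i j l)) \<odot> u i l) = (x \<otimes>\<^bsub>Sk\<^esub> y) (i, l) \<odot> u i l"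
      unfolding e using F il c_props(1) u_carr by (intro finsum_smult_rdistr[symmetric]) auto
  qed (use hs_term[OF Sk_mult_closed[OF x y]] hs_row[OF Sk_mult_closed[OF x y]] in auto)
  finally show ?thesis ..
qed

lemma hs_one: "hs \<one>\<^bsub>Sk\<^esub> = \<one>"
proof -
  have "hs \<one>\<^bsub>Sk\<^esub> = (\<Oplus>i\<in>{1..n}. u i i)"
    unfolding hs_def
  proof (intro M.finsum_cong' refl)
    fix i assume i: "i \<in> {1..n}"
    have "(\<Oplus>j\<in>{1..n}. \<one>\<^bsub>Sk\<^esub> (i, j) \<odot> u i j) = \<one>\<^bsub>Sk\<^esub> (i, i) \<odot> u i i"
      using i u_carr[OF i] by (intro finsum_single) (auto simp: Sk_sel)
    then show "(\<Oplus>j\<in>{1..n}. \<one>\<^bsub>Sk\<^esub> (i, j) \<odot> u i j) = u i i"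
      using i u_carr[OF i i] by (simp add: Sk_sel)
  qed (use u_carr in auto)
  then show ?thesis
    using u_sum by simp
qed

lemma phi_hs:
  assumes d: "d \<in> carrier D" and x: "x \<in> carrier Sk"
  shows "\<phi> d \<otimes> hs x = hs x \<otimes> \<phi> d"
proof -
  note p = phi_carr[OF d]
  have "\<phi> d \<otimes> hs x = (\<Oplus>i\<in>{1..n}. \<phi> d \<otimes> (\<Oplus>j\<in>{1..n}. x (i, j) \<odot> u i j))"
    unfolding hs_def using hs_row[OF x] p by (intro finsum_mult_r) auto
  also have "\<dots> = (\<Oplus>i\<in>{1..n}. (\<Oplus>j\<in>{1..n}. x (i, j) \<odot> u i j) \<otimes> \<phi> d)"
  proof (intro M.finsum_cong' refl)
    fix i assume i: "i \<in> {1..n}"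
    have "\<phi> d \<otimes> (\<Oplus>j\<in>{1..n}. x (i, j) \<odot> u i j) = (\<Oplus>j\<in>{1..n}. \<phi> d \<otimes> (x (i, j) \<odot> u i j))"
      using hs_term[OF x i] p by (intro finsum_mult_r) auto
    also have "\<dots> = (\<Oplus>j\<in>{1..n}. (x (i, j) \<odot> u i j) \<otimes> \<phi> d)"
      using p u_carr[OF i] Sk_val[OF x] i phi_u[OF d i]
      by (intro M.finsum_cong' refl) (auto simp: smult_mult_l smult_mult_r)
    also have "\<dots> = (\<Oplus>j\<in>{1..n}. x (i, j) \<odot> u i j) \<otimes> \<phi> d"
      using hs_term[OF x i] p by (intro finsum_mult_l[symmetric]) auto
    finally show "\<phi> d \<otimes> (\<Oplus>j\<in>{1..n}. x (i, j) \<odot> u i j) = (\<Oplus>j\<in>{1..n}. x (i, j) \<odot> u i j) \<otimes> \<phi> d" .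
  qed (use hs_row[OF x] p in auto)
  also have "\<dots> = hs x \<otimes> \<phi> d"
    unfolding hs_def using hs_row[OF x] p by (intro finsum_mult_l[symmetric]) auto
  finally show ?thesis .
qed

definition \<beta> :: "'d \<times> (nat \<times> nat \<Rightarrow> 'f) \<Rightarrow> 'a" where
  "\<beta> p = \<phi> (fst p) \<otimes> hs (snd p)"

sublocale B: bilinear_map F D Sk A \<beta>
proof (intro bilinear_map.intro bilinear_map_axioms.intro two_modules.intro)
  show "field F" "module F D" "module F A"
    by (rule field_F D.module_axioms module_axioms)+
  show "module F Sk"
    by (rule Sk_module)
qed (use phi_add hs_add hs_closed phi_smult hs_smult in
    \<open>auto simp: \<beta>_def mult_l_distr mult_r_distr smult_mult_l smult_mult_r\<close>)

text \<open>The factors can be interchanged because \<open>\<phi>(D)\<close> is nuclear and commutes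
  with the image of \<open>hs\<close>.\<close>

lemma beta_mult:
  assumes "p \<in> carrier D \<times> carrier Sk" "r \<in> carrier D \<times> carrier Sk"
  shows "\<beta> (fst p \<otimes>\<^bsub>D\<^esub> fst r, snd p \<otimes>\<^bsub>Sk\<^esub> snd r) = \<beta> p \<otimes> \<beta> r"
proof -
  have d: "fst p \<in> carrier D" "fst r \<in> carrier D" "snd p \<in> carrier Sk" "snd r \<in> carrier Sk"
    using assms by auto
  note q = phi_nuc[OF d(1)] phi_nuc[OF d(2)] hs_closed[OF d(3)] hs_closed[OF d(4)]
  let ?a = "\<phi> (fst p)" and ?b = "\<phi> (fst r)" and ?x = "hs (snd p)" and ?y = "hs (snd r)"
  have "(?a \<otimes> ?x) \<otimes> (?b \<otimes> ?y) = ?a \<otimes> ((?x \<otimes> ?b) \<otimes> ?y)"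
    using q by (simp add: nuc1 nuc2)
  also have "(?x \<otimes> ?b) \<otimes> ?y = ?b \<otimes> (?x \<otimes> ?y)"
    using q phi_hs[OF d(2,3), symmetric] by (simp add: nuc1)
  also have "?a \<otimes> (?b \<otimes> (?x \<otimes> ?y)) = (?a \<otimes> ?b) \<otimes> (?x \<otimes> ?y)"
    using q by (simp add: nuc1)
  finally show ?thesis
    using d by (simp add: \<beta>_def phi_mult hs_mult)
qed

end

section \<open>Congruence modulo the tensor relations\<close>

context two_modules begin

text \<open>Membership of both sides is included, so that chains of congruences carry their own side
  conditions.\<close>

definition tcong :: "('a \<times> 'b \<Rightarrow> 'f) \<Rightarrow> ('a \<times> 'b \<Rightarrow> 'f) \<Rightarrow> bool" where
  "tcong f g \<longleftrightarrow> f \<in> carrier T \<and> g \<in> carrier T \<and> f \<ominus>\<^bsub>T\<^esub> g \<in> I"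

lemma I_add: "f \<in> I \<Longrightarrow> g \<in> I \<Longrightarrow> f \<oplus>\<^bsub>T\<^esub> g \<in> I" and I_neg: "f \<in> I \<Longrightarrow> \<ominus>\<^bsub>T\<^esub> f \<in> I"
  and I_smult: "a \<in> carrier F \<Longrightarrow> f \<in> I \<Longrightarrow> a \<odot>\<^bsub>T\<^esub> f \<in> I"
  using T.submoduleE[OF tensor_ideal_submodule] by blast+

lemma tcong_refl: "f \<in> carrier T \<Longrightarrow> tcong f f"
  using I_zero by (simp add: tcong_def a_minus_def T.r_neg)

lemma tcong_trans:
  assumes "tcong f g" "tcong g h"
  shows "tcong f h"
proof -
  have c: "f \<in> carrier T" "g \<in> carrier T" "h \<in> carrier T"
    using assms by (auto simp: tcong_def)
  have "(f \<ominus>\<^bsub>T\<^esub> g) \<oplus>\<^bsub>T\<^esub> (g \<ominus>\<^bsub>T\<^esub> h) \<in> I"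
    using assms I_add by (simp add: tcong_def)
  moreover have "(f \<ominus>\<^bsub>T\<^esub> g) \<oplus>\<^bsub>T\<^esub> (g \<ominus>\<^bsub>T\<^esub> h) = f \<ominus>\<^bsub>T\<^esub> h"
    using c by (simp add: a_minus_def T.a_assoc) (simp add: T.a_assoc[symmetric] T.l_neg)
  ultimately show ?thesis
    using c by (simp add: tcong_def)
qed

lemma tcong_sym:
  assumes "tcong f g"
  shows "tcong g f"
proof -
  have c: "f \<in> carrier T" "g \<in> carrier T"
    using assms by (auto simp: tcong_def)
  have "\<ominus>\<^bsub>T\<^esub> (f \<ominus>\<^bsub>T\<^esub> g) = g \<ominus>\<^bsub>T\<^esub> f"
    using c by (simp add: a_minus_def T.minus_add T.a_comm)
  moreover have "\<ominus>\<^bsub>T\<^esub> (f \<ominus>\<^bsub>T\<^esub> g) \<in> I"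
    using assms I_neg by (simp add: tcong_def)
  ultimately show ?thesis
    using c by (simp add: tcong_def)
qed

lemma tcong_add:
  assumes "tcong f g" "tcong f' g'"
  shows "tcong (f \<oplus>\<^bsub>T\<^esub> f') (g \<oplus>\<^bsub>T\<^esub> g')"
proof -
  have c: "f \<in> carrier T" "g \<in> carrier T" "f' \<in> carrier T" "g' \<in> carrier T"
    using assms by (auto simp: tcong_def)
  have "(f \<oplus>\<^bsub>T\<^esub> f') \<ominus>\<^bsub>T\<^esub> (g \<oplus>\<^bsub>T\<^esub> g') = (f \<ominus>\<^bsub>T\<^esub> g) \<oplus>\<^bsub>T\<^esub> (f' \<ominus>\<^bsub>T\<^esub> g')"
    using c by (simp add: a_minus_def T.minus_add T.a_ac)
  then show ?thesis
    using c assms I_add by (auto simp: tcong_def)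
qed

lemma tcong_gen_add_l:
  assumes "a \<in> carrier A" "a' \<in> carrier A" "b \<in> carrier B"
  shows "tcong (free_gen F (a \<oplus>\<^bsub>A\<^esub> a') b) (free_gen F a b \<oplus>\<^bsub>T\<^esub> free_gen F a' b)"
proof -
  have "free_gen F (a \<oplus>\<^bsub>A\<^esub> a') b \<ominus>\<^bsub>T\<^esub> (free_gen F a b \<oplus>\<^bsub>T\<^esub> free_gen F a' b) \<in> tensor_relations F A B"
    unfolding tensor_relations_def Let_def using assms by blast
  then show ?thesis
    using assms tensor_relations_ideal free_gen_mem T_add by (auto simp: tcong_def)
qed

lemma tcong_gen_add_r:
  assumes "a \<in> carrier A" "b \<in> carrier B" "b' \<in> carrier B"
  shows "tcong (free_gen F a (b \<oplus>\<^bsub>B\<^esub> b')) (free_gen F a b \<oplus>\<^bsub>T\<^esub> free_gen F a b')"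
proof -
  have "free_gen F a (b \<oplus>\<^bsub>B\<^esub> b') \<ominus>\<^bsub>T\<^esub> (free_gen F a b \<oplus>\<^bsub>T\<^esub> free_gen F a b') \<in> tensor_relations F A B"
    unfolding tensor_relations_def Let_def using assms by blast
  then show ?thesis
    using assms tensor_relations_ideal free_gen_mem T_add by (auto simp: tcong_def)
qed

lemma tcong_gen_smult_l:
  assumes "c \<in> carrier F" "a \<in> carrier A" "b \<in> carrier B"
  shows "tcong (free_gen F (c \<odot>\<^bsub>A\<^esub> a) b) (c \<odot>\<^bsub>T\<^esub> free_gen F a b)"
proof -
  have "free_gen F (c \<odot>\<^bsub>A\<^esub> a) b \<ominus>\<^bsub>T\<^esub> (c \<odot>\<^bsub>T\<^esub> free_gen F a b) \<in> tensor_relations F A B"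
    unfolding tensor_relations_def Let_def using assms by blast
  then show ?thesis
    using assms tensor_relations_ideal free_gen_mem T_smult by (auto simp: tcong_def)
qed

lemma tcong_gen_smult_r:
  assumes "c \<in> carrier F" "a \<in> carrier A" "b \<in> carrier B"
  shows "tcong (free_gen F a (c \<odot>\<^bsub>B\<^esub> b)) (c \<odot>\<^bsub>T\<^esub> free_gen F a b)"
proof -
  have "free_gen F a (c \<odot>\<^bsub>B\<^esub> b) \<ominus>\<^bsub>T\<^esub> (c \<odot>\<^bsub>T\<^esub> free_gen F a b) \<in> tensor_relations F A B"
    unfolding tensor_relations_def Let_def using assms by blast
  then show ?thesis
    using assms tensor_relations_ideal free_gen_mem T_smult by (auto simp: tcong_def)
qed

lemma tcong_gen_zero_l: "b \<in> carrier B \<Longrightarrow> tcong (free_gen F \<zero>\<^bsub>A\<^esub> b) \<zero>\<^bsub>T\<^esub>"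
  using tcong_gen_smult_l[of "\<zero>\<^bsub>F\<^esub>" "\<zero>\<^bsub>A\<^esub>" b] free_gen_mem[of "\<zero>\<^bsub>A\<^esub>" b] by simp

lemma tcong_gen_zero_r: "a \<in> carrier A \<Longrightarrow> tcong (free_gen F a \<zero>\<^bsub>B\<^esub>) \<zero>\<^bsub>T\<^esub>"
  using tcong_gen_smult_r[of "\<zero>\<^bsub>F\<^esub>" a "\<zero>\<^bsub>B\<^esub>"] free_gen_mem[of a "\<zero>\<^bsub>B\<^esub>"] by simp

lemma tcong_finsum:
  assumes "finite Q" "\<And>p. p \<in> Q \<Longrightarrow> tcong (f p) (g p)"
  shows "tcong (\<Oplus>\<^bsub>T\<^esub>p\<in>Q. f p) (\<Oplus>\<^bsub>T\<^esub>p\<in>Q. g p)"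
  using assms
proof (induction Q)
  case empty
  then show ?case
    using tcong_refl T_zero by simp
next
  case (insert p Q)
  have c: "f \<in> Q \<rightarrow> carrier T" "g \<in> Q \<rightarrow> carrier T" "f p \<in> carrier T" "g p \<in> carrier T"
    using insert.prems by (auto simp: tcong_def)
  then show ?case
    using insert tcong_add by simp
qed

text \<open>Induction on the size of the support, removing one generator at a time.\<close>

lemma free_alg_induct:
  assumes f: "f \<in> carrier T" and H: "\<zero>\<^bsub>T\<^esub> \<in> H" "\<And>g h. g \<in> H \<Longrightarrow> h \<in> H \<Longrightarrow> g \<oplus>\<^bsub>T\<^esub> h \<in> H"
    "\<And>c a b. c \<in> carrier F \<Longrightarrow> a \<in> carrier A \<Longrightarrow> b \<in> carrier B \<Longrightarrow> c \<odot>\<^bsub>T\<^esub> free_gen F a b \<in> H"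
  shows "f \<in> H"
  using f
proof (induction "card {p. f p \<noteq> \<zero>\<^bsub>F\<^esub>}" arbitrary: f)
  case 0
  then have "{p. f p \<noteq> \<zero>\<^bsub>F\<^esub>} = {}"
    using T_support(1) card_0_eq by metis
  then have "f = \<zero>\<^bsub>T\<^esub>"
    unfolding T_sel by auto
  then show ?case
    using H(1) by simp
next
  case (Suc n)
  then have "{p. f p \<noteq> \<zero>\<^bsub>F\<^esub>} \<noteq> {}"
    by (metis card.empty nat.distinct(1))
  then obtain p where p: "f p \<noteq> \<zero>\<^bsub>F\<^esub>"
    by blast
  have pAB: "p \<in> carrier A \<times> carrier B"
    using p T_support(2)[OF Suc.prems] by blast
  define g where "g = f(p := \<zero>\<^bsub>F\<^esub>)"
  have sg: "{q. g q \<noteq> \<zero>\<^bsub>F\<^esub>} = {q. f q \<noteq> \<zero>\<^bsub>F\<^esub>} - {p}"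
    by (auto simp: g_def)
  have "g \<in> carrier T"
  proof (rule T_memI)
    show "g q \<in> carrier F" for q
      using T_val[OF Suc.prems] by (simp add: g_def)
    show "\<And>q. g q \<noteq> \<zero>\<^bsub>F\<^esub> \<Longrightarrow> q \<in> {q. f q \<noteq> \<zero>\<^bsub>F\<^esub>}"
      using sg by blast
  qed (use T_support[OF Suc.prems] in auto)
  moreover have "n = card {q. g q \<noteq> \<zero>\<^bsub>F\<^esub>}"
    unfolding sg using Suc.hyps(2) p T_support(1)[OF Suc.prems] by (subst card_Diff_singleton) auto
  ultimately have "g \<in> H"
    using Suc.hyps(1) by blast
  moreover have "f p \<odot>\<^bsub>T\<^esub> free_gen F (fst p) (snd p) \<in> H"
    using pAB T_val[OF Suc.prems] by (intro H(3)) auto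
  moreover have "f = g \<oplus>\<^bsub>T\<^esub> f p \<odot>\<^bsub>T\<^esub> free_gen F (fst p) (snd p)"
    unfolding T_sel g_def free_gen_def using T_val[OF Suc.prems] by (intro ext) auto
  ultimately show ?case
    using H(2) by metis
qed

end

section \<open>Normal forms in the tensor product; kernel and image of the evaluation\<close>

context skew_frame begin

abbreviation "Tn \<equiv> {1..n} \<times> {1..n}"

definition eu :: "nat \<times> nat \<Rightarrow> nat \<times> nat \<Rightarrow> 'f" where
  "eu p = (\<lambda>r\<in>Tn. if r = p then \<one>\<^bsub>F\<^esub> else \<zero>\<^bsub>F\<^esub>)"

lemma eu_closed: "eu p \<in> carrier Sk"
  unfolding Sk_sel eu_def by auto

lemma hs_eu:
  assumes "i \<in> {1..n}" "j \<in> {1..n}"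
  shows "hs (eu (i, j)) = u i j"
proof -
  have "hs (eu (i, j)) = (\<Oplus>l\<in>{1..n}. eu (i, j) (i, l) \<odot> u i l)"
    unfolding hs_def
  proof (rule finsum_single)
    fix k assume k: "k \<in> {1..n}" "k \<noteq> i"
    show "(\<Oplus>l\<in>{1..n}. eu (i, j) (k, l) \<odot> u k l) = \<zero>"
      using k u_carr[OF k(1)] by (intro finsum_all_zero) (simp add: eu_def)
  qed (use assms hs_row[OF eu_closed] in auto)
  also have "\<dots> = eu (i, j) (i, j) \<odot> u i j"
    using assms u_carr[OF assms(1)] by (intro finsum_single) (auto simp: eu_def)
  finally show ?thesis
    using assms u_carr[OF assms] by (simp add: eu_def)
qed

text \<open>Scalars are moved across the tensor sign: \<open>a \<otimes> x\<close> is the sum of the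
  \<open>x_p a \<otimes> e_p\<close>, with all coefficients collected in \<open>D\<close>.\<close>

lemma gen_normal_form:
  assumes a: "a \<in> carrier D" and x: "x \<in> carrier Sk"
  shows "B.tcong (free_gen F a x) (\<Oplus>\<^bsub>B.T\<^esub>p\<in>Tn. free_gen F (x p \<odot>\<^bsub>D\<^esub> a) (eu p))"
proof -
  \<comment> \<open>Truncations of \<open>x\<close> to a set of positions, for an induction over
    that set.\<close>
  define xs where "xs = (\<lambda>Q. \<lambda>p\<in>Tn. if p \<in> Q then x p else \<zero>\<^bsub>F\<^esub>)"
  have xs: "xs Q \<in> carrier Sk" for Q
    unfolding xs_def Sk_sel using Sk_val[OF x] by auto
  have t: "free_gen F (x p \<odot>\<^bsub>D\<^esub> a) (eu p) \<in> carrier B.T" if "p \<in> Tn" for p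
    using that a Sk_val[OF x that] eu_closed by (intro B.free_gen_mem) auto
  have "B.tcong (free_gen F a (xs Q)) (\<Oplus>\<^bsub>B.T\<^esub>p\<in>Q. free_gen F (x p \<odot>\<^bsub>D\<^esub> a) (eu p))"
    if "finite Q" "Q \<subseteq> Tn" for Q
    using that
  proof (induction Q)
    case empty
    have "xs {} = \<zero>\<^bsub>Sk\<^esub>"
      by (simp add: xs_def Sk_sel)
    then show ?case
      using B.tcong_gen_zero_r[OF a] by simp
  next
    case (insert p Q)
    have p: "p \<in> Tn"
      using insert.prems by blast
    have xp: "x p \<in> carrier F"
      using Sk_val[OF x p] .
    have e: "xs (insert p Q) = xs Q \<oplus>\<^bsub>Sk\<^esub> x p \<odot>\<^bsub>Sk\<^esub> eu p"
    proof (rule Sk_ext[OF xs])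
      show "xs Q \<oplus>\<^bsub>Sk\<^esub> x p \<odot>\<^bsub>Sk\<^esub> eu p \<in> carrier Sk"
        using xs eu_closed xp by (intro Sk_closed)
      fix r assume r: "r \<in> Tn"
      show "xs (insert p Q) r = (xs Q \<oplus>\<^bsub>Sk\<^esub> x p \<odot>\<^bsub>Sk\<^esub> eu p) r"
        unfolding Sk_at[OF r] xs_def eu_def using r insert.hyps(2) Sk_val[OF x r] xp
        by (cases "r = p") auto
    qed
    have "B.tcong (free_gen F a (x p \<odot>\<^bsub>Sk\<^esub> eu p)) (free_gen F (x p \<odot>\<^bsub>D\<^esub> a) (eu p))"
      using B.tcong_trans[OF B.tcong_gen_smult_r[OF xp a eu_closed] B.tcong_sym[OF B.tcong_gen_smult_l[OF xp a eu_closed]]] .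
    then have "B.tcong (free_gen F a (xs Q) \<oplus>\<^bsub>B.T\<^esub> free_gen F a (x p \<odot>\<^bsub>Sk\<^esub> eu p))
        ((\<Oplus>\<^bsub>B.T\<^esub>p\<in>Q. free_gen F (x p \<odot>\<^bsub>D\<^esub> a) (eu p)) \<oplus>\<^bsub>B.T\<^esub> free_gen F (x p \<odot>\<^bsub>D\<^esub> a) (eu p))"
      using insert B.tcong_add by simp
    then have "B.tcong (free_gen F a (xs (insert p Q)))
        ((\<Oplus>\<^bsub>B.T\<^esub>p\<in>Q. free_gen F (x p \<odot>\<^bsub>D\<^esub> a) (eu p)) \<oplus>\<^bsub>B.T\<^esub> free_gen F (x p \<odot>\<^bsub>D\<^esub> a) (eu p))"
      unfolding e using B.tcong_trans[OF B.tcong_gen_add_r[OF a xs Sk_closed(4)[OF xp eu_closed]]] by blast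
    moreover have "(\<Oplus>\<^bsub>B.T\<^esub>p\<in>insert p Q. free_gen F (x p \<odot>\<^bsub>D\<^esub> a) (eu p)) =
        (\<Oplus>\<^bsub>B.T\<^esub>p\<in>Q. free_gen F (x p \<odot>\<^bsub>D\<^esub> a) (eu p)) \<oplus>\<^bsub>B.T\<^esub> free_gen F (x p \<odot>\<^bsub>D\<^esub> a) (eu p)"
    proof -
      have c: "(\<lambda>p. free_gen F (x p \<odot>\<^bsub>D\<^esub> a) (eu p)) \<in> Q \<rightarrow> carrier B.T"
        using t insert.prems by blast
      show ?thesis
        using B.T.finsum_insert[OF insert.hyps c t[OF p]] B.T.a_comm[OF t[OF p] B.T.finsum_closed[OF c]]
        by simp
    qed
    ultimately show ?case
      by simp
  qed
  from this[of Tn] have "B.tcong (free_gen F a (xs Tn)) (\<Oplus>\<^bsub>B.T\<^esub>p\<in>Tn. free_gen F (x p \<odot>\<^bsub>D\<^esub> a) (eu p))"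
    by blast
  moreover have "xs Tn = x"
    using xs x by (intro Sk_ext) (auto simp: xs_def)
  ultimately show ?thesis
    by simp
qed

lemma free_normal_form:
  assumes "f \<in> carrier B.T"
  obtains d where "\<And>p. p \<in> Tn \<Longrightarrow> d p \<in> carrier D" "B.tcong f (\<Oplus>\<^bsub>B.T\<^esub>p\<in>Tn. free_gen F (d p) (eu p))"
proof -
  define H where "H = {f. \<exists>d. (\<forall>p\<in>Tn. d p \<in> carrier D) \<and> B.tcong f (\<Oplus>\<^bsub>B.T\<^esub>p\<in>Tn. free_gen F (d p) (eu p))}"
  have "f \<in> H"
    using assms
  proof (rule B.free_alg_induct)
    have "B.tcong (\<Oplus>\<^bsub>B.T\<^esub>p\<in>Tn. free_gen F \<zero>\<^bsub>D\<^esub> (eu p)) (\<Oplus>\<^bsub>B.T\<^esub>p\<in>Tn. \<zero>\<^bsub>B.T\<^esub>)"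
      using B.tcong_gen_zero_l[OF eu_closed] by (intro B.tcong_finsum) auto
    then show "\<zero>\<^bsub>B.T\<^esub> \<in> H"
      unfolding H_def using B.tcong_sym by (intro CollectI exI[of _ "\<lambda>_. \<zero>\<^bsub>D\<^esub>"]) auto
  next
    fix g h assume "g \<in> H" "h \<in> H"
    then obtain d e where d: "\<forall>p\<in>Tn. d p \<in> carrier D" "B.tcong g (\<Oplus>\<^bsub>B.T\<^esub>p\<in>Tn. free_gen F (d p) (eu p))"
      and e: "\<forall>p\<in>Tn. e p \<in> carrier D" "B.tcong h (\<Oplus>\<^bsub>B.T\<^esub>p\<in>Tn. free_gen F (e p) (eu p))"
      unfolding H_def by blast
    have m: "free_gen F (d p) (eu p) \<in> carrier B.T" "free_gen F (e p) (eu p) \<in> carrier B.T" if "p \<in> Tn" for p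
      using d(1) e(1) that eu_closed B.free_gen_mem by blast+
    have "B.tcong (\<Oplus>\<^bsub>B.T\<^esub>p\<in>Tn. free_gen F (d p \<oplus>\<^bsub>D\<^esub> e p) (eu p))
        (\<Oplus>\<^bsub>B.T\<^esub>p\<in>Tn. free_gen F (d p) (eu p) \<oplus>\<^bsub>B.T\<^esub> free_gen F (e p) (eu p))"
      using d(1) e(1) eu_closed by (intro B.tcong_finsum B.tcong_gen_add_l) auto
    also have "(\<Oplus>\<^bsub>B.T\<^esub>p\<in>Tn. free_gen F (d p) (eu p) \<oplus>\<^bsub>B.T\<^esub> free_gen F (e p) (eu p)) =
        (\<Oplus>\<^bsub>B.T\<^esub>p\<in>Tn. free_gen F (d p) (eu p)) \<oplus>\<^bsub>B.T\<^esub> (\<Oplus>\<^bsub>B.T\<^esub>p\<in>Tn. free_gen F (e p) (eu p))"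
      using m by (intro B.T.finsum_addf) auto
    finally have "B.tcong (g \<oplus>\<^bsub>B.T\<^esub> h) (\<Oplus>\<^bsub>B.T\<^esub>p\<in>Tn. free_gen F (d p \<oplus>\<^bsub>D\<^esub> e p) (eu p))"
      using B.tcong_trans[OF B.tcong_add[OF d(2) e(2)] B.tcong_sym] by blast
    then show "g \<oplus>\<^bsub>B.T\<^esub> h \<in> H"
      unfolding H_def using d(1) e(1) by (intro CollectI exI[of _ "\<lambda>p. d p \<oplus>\<^bsub>D\<^esub> e p"]) auto
  next
    fix r a x assume r: "r \<in> carrier F" and a: "a \<in> carrier D" and x: "x \<in> carrier Sk"
    have "B.tcong (r \<odot>\<^bsub>B.T\<^esub> free_gen F a x) (free_gen F (r \<odot>\<^bsub>D\<^esub> a) x)"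
      using B.tcong_sym[OF B.tcong_gen_smult_l[OF r a x]] .
    then have "B.tcong (r \<odot>\<^bsub>B.T\<^esub> free_gen F a x) (\<Oplus>\<^bsub>B.T\<^esub>p\<in>Tn. free_gen F (x p \<odot>\<^bsub>D\<^esub> (r \<odot>\<^bsub>D\<^esub> a)) (eu p))"
      using B.tcong_trans gen_normal_form[OF D.smult_closed[OF r a] x] by blast
    then show "r \<odot>\<^bsub>B.T\<^esub> free_gen F a x \<in> H"
      unfolding H_def using a r Sk_val[OF x]
      by (intro CollectI exI[of _ "\<lambda>p. x p \<odot>\<^bsub>D\<^esub> (r \<odot>\<^bsub>D\<^esub> a)"]) auto
  qed
  then obtain d where d: "\<forall>p\<in>Tn. d p \<in> carrier D" "B.tcong f (\<Oplus>\<^bsub>B.T\<^esub>p\<in>Tn. free_gen F (d p) (eu p))"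
    unfolding H_def mem_Collect_eq by (elim exE conjE)
  show ?thesis
    by (rule that[OF bspec[OF d(1)] d(2)])
qed

lemma ev_finsum:
  assumes "finite Q" "\<And>p. p \<in> Q \<Longrightarrow> f p \<in> carrier B.T"
  shows "B.ev (\<Oplus>\<^bsub>B.T\<^esub>p\<in>Q. f p) = (\<Oplus>p\<in>Q. B.ev (f p))"
  using assms
proof (induction Q)
  case empty
  then show ?case
    using B.ev_zero by simp
next
  case (insert p Q)
  have c: "f \<in> Q \<rightarrow> carrier B.T" "f p \<in> carrier B.T" "(\<lambda>p. B.ev (f p)) \<in> Q \<rightarrow> carrier A" "B.ev (f p) \<in> carrier A"
    using insert.prems B.ev_closed by auto
  then show ?case
    using insert B.ev_add[of "f p" "\<Oplus>\<^bsub>B.T\<^esub>p\<in>Q. f p"] by simp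
qed

lemma ev_eu: "d \<in> carrier D \<Longrightarrow> i \<in> {1..n} \<Longrightarrow> j \<in> {1..n} \<Longrightarrow> B.ev (free_gen F d (eu (i, j))) = \<phi> d \<otimes> u i j"
  using B.ev_gen[of d "eu (i, j)"] eu_closed hs_eu by (simp add: \<beta>_def)

text \<open>In normal form the evaluation is the sum of the \<open>\<phi>(d_ij) u_ij\<close>.
  Multiplying by \<open>u i i\<close> and \<open>u j j\<close> isolates one term, and
  \<open>u_inj\<close> makes its coefficient zero. Together with \<open>ev_ideal\<close>, the kernel
  is exactly the tensor ideal.\<close>

lemma ev_ker:
  assumes f: "f \<in> carrier B.T" and z: "B.ev f = \<zero>"
  shows "f \<in> B.I"
proof -
  obtain d where d: "\<And>p. p \<in> Tn \<Longrightarrow> d p \<in> carrier D" and fd: "B.tcong f (\<Oplus>\<^bsub>B.T\<^esub>p\<in>Tn. free_gen F (d p) (eu p))"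
    by (rule free_normal_form[OF f]) blast
  define g where "g = (\<Oplus>\<^bsub>B.T\<^esub>p\<in>Tn. free_gen F (d p) (eu p))"
  have gT: "g \<in> carrier B.T" and "f \<ominus>\<^bsub>B.T\<^esub> g \<in> B.I"
    using fd unfolding B.tcong_def g_def by auto
  then have "B.ev f \<ominus> B.ev g = \<zero>"
    using B.ev_ideal B.ev_minus[OF f gT] by metis
  then have gz: "B.ev g = \<zero>"
    using z B.ev_closed[OF gT] minus_eq_zero_iff[of \<zero> "B.ev g"] by simp
  have m: "free_gen F (d p) (eu p) \<in> carrier B.T" if "p \<in> Tn" for p
    using d that eu_closed B.free_gen_mem by blast
  have t: "\<phi> (d (i, j)) \<otimes> u i j \<in> carrier A" if "i \<in> {1..n}" "j \<in> {1..n}" for i j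
    using d that u_carr by simp
  have evg: "B.ev g = (\<Oplus>p\<in>Tn. \<phi> (d p) \<otimes> u (fst p) (snd p))"
    unfolding g_def using m d t
    by (subst ev_finsum) (auto intro!: M.finsum_cong' simp: ev_eu)
  have dz: "d (i, j) = \<zero>\<^bsub>D\<^esub>" if ij: "i \<in> {1..n}" "j \<in> {1..n}" for i j
  proof -
    have "(u i i \<otimes> B.ev g) \<otimes> u j j = (\<Oplus>p\<in>Tn. (u i i \<otimes> (\<phi> (d p) \<otimes> u (fst p) (snd p))) \<otimes> u j j)"
      unfolding evg using t ij u_carr by (subst finsum_mult_r, force, force, subst finsum_mult_l) auto
    also have "\<dots> = (u i i \<otimes> (\<phi> (d (i, j)) \<otimes> u (fst (i, j)) (snd (i, j)))) \<otimes> u j j"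
    proof (rule finsum_single)
      fix p assume p: "p \<in> Tn" "p \<noteq> (i, j)"
      obtain k l where kl: "p = (k, l)" "k \<in> {1..n}" "l \<in> {1..n}"
        using p by auto
      note dp = phi_nuc[OF d[OF p(1)]] and w = u_carr[OF kl(2,3)]
      have "u i i \<otimes> (\<phi> (d p) \<otimes> u k l) = \<phi> (d p) \<otimes> (u i i \<otimes> u k l)"
        using nuc2[OF dp u_carr[OF ij(1,1)] w] phi_u[OF d[OF p(1)] ij(1,1)] nuc1[OF dp u_carr[OF ij(1,1)] w] by simp
      then have "(u i i \<otimes> (\<phi> (d p) \<otimes> u k l)) \<otimes> u j j = \<phi> (d p) \<otimes> (u i i \<otimes> (u k l \<otimes> u j j))"
        using dp u_nuc[OF ij(1)] w u_carr[OF ij(2,2)] by (simp add: nuc1)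
      also have "\<dots> = \<zero>"
      proof (cases "k = i")
        case True
        then have "u k l \<otimes> u j j = \<zero>"
          using u_mult_zero[OF kl(2,3) ij(2,2)] p kl(1) by auto
        then show ?thesis
          using dp u_carr[OF ij(1,1)] by simp
      next
        case False
        then have "u i i \<otimes> u k l = \<zero>"
          using u_mult_zero[OF ij(1,1) kl(2,3)] by auto
        then have "\<zero> \<otimes> u j j = u i i \<otimes> (u k l \<otimes> u j j)"
          using nuc1[OF u_nuc[OF ij(1)] w u_carr[OF ij(2,2)]] by simp
        then show ?thesis
          using dp u_carr[OF ij(2,2)] by (simp flip: \<open>\<zero> \<otimes> u j j = _\<close>)
      qed
      finally show "(u i i \<otimes> (\<phi> (d p) \<otimes> u (fst p) (snd p))) \<otimes> u j j = \<zero>"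
        by (simp add: kl(1))
    qed (use ij t[OF ij] u_carr in auto)
    also have "\<dots> = \<phi> (d (i, j)) \<otimes> u i j"
    proof -
      have dij: "d (i, j) \<in> carrier D"
        using d ij by simp
      note dp = phi_nuc[OF dij] and w = u_carr[OF ij]
      have "u i i \<otimes> (\<phi> (d (i, j)) \<otimes> u i j) = \<phi> (d (i, j)) \<otimes> (u i i \<otimes> u i j)"
        using nuc2[OF dp u_carr[OF ij(1,1)] w] phi_u[OF dij ij(1,1)] nuc1[OF dp u_carr[OF ij(1,1)] w] by simp
      then show ?thesis
        using u_left[OF ij] u_right[OF ij] nuc1[OF dp w u_carr[OF ij(2,2)]] by simp
    qed
    finally have "\<phi> (d (i, j)) \<otimes> u i j = \<zero>"
      using gz u_carr[OF ij(1,1)] u_carr[OF ij(2,2)] by simp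
    then show ?thesis
      using u_inj ij d by simp
  qed
  have "B.tcong g (\<Oplus>\<^bsub>B.T\<^esub>p\<in>Tn. \<zero>\<^bsub>B.T\<^esub>)"
    unfolding g_def using dz B.tcong_gen_zero_l[OF eu_closed] by (intro B.tcong_finsum) auto
  then have "B.tcong f \<zero>\<^bsub>B.T\<^esub>"
    using B.tcong_trans[OF fd] by (simp add: g_def)
  then have "f \<ominus>\<^bsub>B.T\<^esub> \<zero>\<^bsub>B.T\<^esub> \<in> B.I"
    by (simp add: B.tcong_def)
  moreover have "f \<ominus>\<^bsub>B.T\<^esub> \<zero>\<^bsub>B.T\<^esub> = f"
    using f B.T.r_zero[of f] B.T.minus_equality[of "\<zero>\<^bsub>B.T\<^esub>" "\<zero>\<^bsub>B.T\<^esub>"] B.T_zero by (simp add: a_minus_def)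
  ultimately show ?thesis
    by simp
qed

text \<open>The Peirce decomposition of \<open>a\<close> for the idempotents \<open>u i i\<close>,
  each component being of the form \<open>\<phi> d \<otimes> u i j\<close> by
  \<open>u_span\<close>.\<close>

lemma ev_surj:
  assumes a: "a \<in> carrier A"
  obtains f where "f \<in> carrier B.T" "B.ev f = a"
proof -
  define H where "H = B.ev ` carrier B.T"
  have H: "subspace H"
  proof (rule subspaceI)
    show "H \<subseteq> carrier A"
      unfolding H_def using B.ev_closed by blast
    show "\<zero> \<in> H"
      unfolding H_def by (rule image_eqI[of _ _ "\<zero>\<^bsub>B.T\<^esub>"]) (use B.ev_zero B.T_zero in simp_all)
    fix x y assume "x \<in> H" "y \<in> H"
    then obtain f g where fg: "f \<in> carrier B.T" "x = B.ev f" "g \<in> carrier B.T" "y = B.ev g"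
      unfolding H_def by blast
    have "x \<oplus> y = B.ev (f \<oplus>\<^bsub>B.T\<^esub> g)"
      unfolding fg(2,4) by (rule B.ev_add[OF fg(1,3), symmetric])
    then show "x \<oplus> y \<in> H"
      unfolding H_def using B.T_add[OF fg(1,3)] by (rule image_eqI)
  next
    fix r x assume r: "r \<in> carrier F" and "x \<in> H"
    then obtain f where f: "f \<in> carrier B.T" "x = B.ev f"
      unfolding H_def by blast
    have "r \<odot> x = B.ev (r \<odot>\<^bsub>B.T\<^esub> f)"
      unfolding f(2) by (rule B.ev_smult[OF r f(1), symmetric])
    then show "r \<odot> x \<in> H"
      unfolding H_def using B.T_smult[OF r f(1)] by (rule image_eqI)
  qed
  have comp: "(u i i \<otimes> a) \<otimes> u j j \<in> H" if ij: "i \<in> {1..n}" "j \<in> {1..n}" for i j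
  proof -
    have "(u i i \<otimes> a) \<otimes> u j j \<in> peirce (u i i) (u j j)"
      using compress_peirce[OF u_nuc[OF ij(1)] _ u_nuc[OF ij(2)] _ a] u_left ij by simp
    then obtain d where d: "d \<in> carrier D" "(u i i \<otimes> a) \<otimes> u j j = \<phi> d \<otimes> u i j"
      using u_span ij by blast
    have "(u i i \<otimes> a) \<otimes> u j j = B.ev (free_gen F d (eu (i, j)))"
      unfolding d(2) by (rule ev_eu[OF d(1) ij, symmetric])
    then show ?thesis
      unfolding H_def using B.free_gen_mem[OF d(1) eu_closed] by (rule image_eqI)
  qed
  have c: "u i i \<otimes> a \<in> carrier A" "u i i \<in> carrier A" if "i \<in> {1..n}" for i
    using u_carr that a by simp_all
  have "a = (\<Oplus>i\<in>{1..n}. u i i) \<otimes> a"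
    using a u_sum by simp
  also have "\<dots> = (\<Oplus>i\<in>{1..n}. u i i \<otimes> a)"
    using c a by (intro finsum_mult_l) auto
  finally have e: "a = (\<Oplus>i\<in>{1..n}. u i i \<otimes> a)" .
  have "u i i \<otimes> a \<in> H" if i: "i \<in> {1..n}" for i
  proof -
    have "u i i \<otimes> a = (u i i \<otimes> a) \<otimes> (\<Oplus>j\<in>{1..n}. u j j)"
      using c[OF i] u_sum by simp
    also have "\<dots> = (\<Oplus>j\<in>{1..n}. (u i i \<otimes> a) \<otimes> u j j)"
      using c c[OF i] by (intro finsum_mult_r) auto
    also have "\<dots> \<in> H"
      using comp[OF i] by (rule subspace_finsum[OF H])
    finally show ?thesis .
  qed
  then have "(\<Oplus>i\<in>{1..n}. u i i \<otimes> a) \<in> H"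
    by (rule subspace_finsum[OF H])
  then have "a \<in> H"
    by (simp only: e[symmetric])
  then show ?thesis
    using that unfolding H_def by blast
qed

end

lemma free_alg_mult:
  "(f \<otimes>\<^bsub>free_alg F A B\<^esub> g) p = (\<Oplus>\<^bsub>F\<^esub>q \<in> {((a, b), (a', b')). f (a, b) \<noteq> \<zero>\<^bsub>F\<^esub> \<and> g (a', b') \<noteq> \<zero>\<^bsub>F\<^esub> \<and>
    p = (a \<otimes>\<^bsub>A\<^esub> a', b \<otimes>\<^bsub>B\<^esub> b')}. f (fst q) \<otimes>\<^bsub>F\<^esub> g (snd q))"
  by (simp add: free_alg_def)

lemma free_alg_one: "\<one>\<^bsub>free_alg F A B\<^esub> = free_gen F \<one>\<^bsub>A\<^esub> \<one>\<^bsub>B\<^esub>"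
  by (simp add: free_alg_def free_gen_def)

section \<open>Multiplicativity of the evaluation and the isomorphism\<close>

context skew_frame begin

lemma T_mult_val:
  "(f \<otimes>\<^bsub>B.T\<^esub> g) p = (\<Oplus>\<^bsub>F\<^esub>r \<in> {r \<in> {p. f p \<noteq> \<zero>\<^bsub>F\<^esub>} \<times> {p. g p \<noteq> \<zero>\<^bsub>F\<^esub>}.
    (fst (fst r) \<otimes>\<^bsub>D\<^esub> fst (snd r), snd (fst r) \<otimes>\<^bsub>Sk\<^esub> snd (snd r)) = p}. f (fst r) \<otimes>\<^bsub>F\<^esub> g (snd r))"
proof -
  have "{((a, b), (a', b')). f (a, b) \<noteq> \<zero>\<^bsub>F\<^esub> \<and> g (a', b') \<noteq> \<zero>\<^bsub>F\<^esub> \<and> p = (a \<otimes>\<^bsub>D\<^esub> a', b \<otimes>\<^bsub>Sk\<^esub> b')} =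
    {r \<in> {p. f p \<noteq> \<zero>\<^bsub>F\<^esub>} \<times> {p. g p \<noteq> \<zero>\<^bsub>F\<^esub>}.
      (fst (fst r) \<otimes>\<^bsub>D\<^esub> fst (snd r), snd (fst r) \<otimes>\<^bsub>Sk\<^esub> snd (snd r)) = p}"
    by auto
  then show ?thesis
    unfolding free_alg_mult by (rule arg_cong)
qed

lemma ev_mult:
  assumes f: "f \<in> carrier B.T" and g: "g \<in> carrier B.T"
  shows "f \<otimes>\<^bsub>B.T\<^esub> g \<in> carrier B.T" "B.ev (f \<otimes>\<^bsub>B.T\<^esub> g) = B.ev f \<otimes> B.ev g"
proof -
  define Sf where "Sf = {p. f p \<noteq> \<zero>\<^bsub>F\<^esub>}"
  define Sg where "Sg = {p. g p \<noteq> \<zero>\<^bsub>F\<^esub>}"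
  define \<pi> where "\<pi> = (\<lambda>r. (fst (fst r) \<otimes>\<^bsub>D\<^esub> fst (snd r), snd (fst r) \<otimes>\<^bsub>Sk\<^esub> snd (snd r)))"
  define Q where "Q = (\<lambda>p. {r \<in> Sf \<times> Sg. \<pi> r = p})"
  define w where "w = (\<lambda>r. f (fst r) \<otimes>\<^bsub>F\<^esub> g (snd r))"
  have fin: "finite Sf" "finite Sg" and sub: "Sf \<subseteq> carrier D \<times> carrier Sk" "Sg \<subseteq> carrier D \<times> carrier Sk"
    unfolding Sf_def Sg_def using B.T_support f g by blast+
  have val: "(f \<otimes>\<^bsub>B.T\<^esub> g) p = (\<Oplus>\<^bsub>F\<^esub>r\<in>Q p. w r)" for p
    unfolding T_mult_val Q_def Sf_def Sg_def \<pi>_def w_def ..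
  have wF: "w r \<in> carrier F" for r
    unfolding w_def using B.T_val f g by simp
  have Qfin: "finite (Q p)" for p
    unfolding Q_def using fin by simp
  define S where "S = \<pi> ` (Sf \<times> Sg)"
  have Sfin: "finite S" "S \<subseteq> carrier D \<times> carrier Sk"
  proof -
    show "finite S"
      unfolding S_def using fin by simp
    show "S \<subseteq> carrier D \<times> carrier Sk"
    proof
      fix p assume "p \<in> S"
      then obtain r where r: "fst r \<in> Sf" "snd r \<in> Sg" "p = \<pi> r"
        unfolding S_def by auto
      then have "fst r \<in> carrier D \<times> carrier Sk" "snd r \<in> carrier D \<times> carrier Sk"
        using sub by blast+
      then show "p \<in> carrier D \<times> carrier Sk"
        unfolding r(3) \<pi>_def using Sk_mult_closed by (auto simp: mem_Times_iff)
    qed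
  qed
  have supp: "p \<in> S" if "(f \<otimes>\<^bsub>B.T\<^esub> g) p \<noteq> \<zero>\<^bsub>F\<^esub>" for p
  proof (rule ccontr)
    assume "p \<notin> S"
    then have "Q p = {}"
      unfolding Q_def S_def by blast
    then show False
      using that val by simp
  qed
  show T: "f \<otimes>\<^bsub>B.T\<^esub> g \<in> carrier B.T"
  proof (rule B.T_memI[OF _ supp Sfin])
    show "(f \<otimes>\<^bsub>B.T\<^esub> g) p \<in> carrier F" for p
      unfolding val using wF by (intro R.finsum_closed) auto
  qed
  have piS: "\<pi> r \<in> carrier D \<times> carrier Sk" if "r \<in> Sf \<times> Sg" for r
    using Sfin(2) that unfolding S_def by blast
  have bc: "w r \<odot> \<beta> (\<pi> r) \<in> carrier A" if "r \<in> Sf \<times> Sg" for r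
    using wF B.beta_closed'[OF piS[OF that]] by simp
  have "B.ev (f \<otimes>\<^bsub>B.T\<^esub> g) = (\<Oplus>p\<in>S. (f \<otimes>\<^bsub>B.T\<^esub> g) p \<odot> \<beta> p)"
    using supp by (intro B.ev_superset T Sfin) auto
  also have "\<dots> = (\<Oplus>p\<in>S. \<Oplus>r\<in>Q p. w r \<odot> \<beta> (\<pi> r))"
  proof (intro M.finsum_cong' refl)
    fix p assume p: "p \<in> S"
    have "(f \<otimes>\<^bsub>B.T\<^esub> g) p \<odot> \<beta> p = (\<Oplus>r\<in>Q p. w r \<odot> \<beta> p)"
      unfolding val using Qfin wF B.beta_closed' p Sfin(2) by (intro finsum_smult_rdistr) auto
    also have "\<dots> = (\<Oplus>r\<in>Q p. w r \<odot> \<beta> (\<pi> r))"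
      using bc by (intro M.finsum_cong' refl) (auto simp: Q_def)
    finally show "(f \<otimes>\<^bsub>B.T\<^esub> g) p \<odot> \<beta> p = (\<Oplus>r\<in>Q p. w r \<odot> \<beta> (\<pi> r))" .
  next
    show "(\<lambda>p. \<Oplus>r\<in>Q p. w r \<odot> \<beta> (\<pi> r)) \<in> S \<rightarrow> carrier A"
      using bc by (intro funcsetI M.finsum_closed) (auto simp: Q_def)
  qed
  also have "\<dots> = (\<Oplus>r\<in>(\<Union>p\<in>S. Q p). w r \<odot> \<beta> (\<pi> r))"
  proof (rule M.add.finprod_UN_disjoint[symmetric])
    show "pairwise (\<lambda>i j. disjnt (Q i) (Q j)) S"
      by (auto simp: pairwise_def disjnt_def Q_def)
    show "w r \<odot> \<beta> (\<pi> r) \<in> carrier A" if "p \<in> S" "r \<in> Q p" for p r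
      using bc that unfolding Q_def by blast
  qed (use Sfin Qfin in auto)
  \<comment> \<open>The whole of \<open>Sf \<times> Sg\<close>, cut into slices so that the sum
    becomes an iterated one.\<close>
  also have "(\<Union>p\<in>S. Q p) = (\<Union>p\<in>Sf. {p} \<times> Sg)"
    unfolding S_def Q_def by auto
  also have "(\<Oplus>r\<in>(\<Union>p\<in>Sf. {p} \<times> Sg). w r \<odot> \<beta> (\<pi> r)) = (\<Oplus>p\<in>Sf. \<Oplus>r\<in>{p} \<times> Sg. w r \<odot> \<beta> (\<pi> r))"
  proof (rule M.add.finprod_UN_disjoint)
    show "pairwise (\<lambda>i j. disjnt ({i} \<times> Sg) ({j} \<times> Sg)) Sf"
      by (auto simp: pairwise_def disjnt_def)
    show "w r \<odot> \<beta> (\<pi> r) \<in> carrier A" if "p \<in> Sf" "r \<in> {p} \<times> Sg" for p r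
      using bc that by auto
  qed (use fin in auto)
  also have "\<dots> = (\<Oplus>p\<in>Sf. (f p \<odot> \<beta> p) \<otimes> B.ev g)"
  proof (intro M.finsum_cong' refl)
    fix p assume p: "p \<in> Sf"
    have bp: "\<beta> p \<in> carrier A" "f p \<in> carrier F"
      using B.beta_closed' sub(1) p B.T_val[OF f] by blast+
    have bs: "\<beta> s \<in> carrier A" "g s \<in> carrier F" if "s \<in> Sg" for s
      using B.beta_closed' sub(2) that B.T_val[OF g] by blast+
    have "(\<Oplus>r\<in>{p} \<times> Sg. w r \<odot> \<beta> (\<pi> r)) = (\<Oplus>s\<in>Sg. w (p, s) \<odot> \<beta> (\<pi> (p, s)))"
    proof -
      have "{p} \<times> Sg = Pair p ` Sg"
        by auto
      moreover have "inj_on (Pair p) Sg"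
        by (auto simp: inj_on_def)
      moreover have "(\<lambda>r. w r \<odot> \<beta> (\<pi> r)) \<in> Pair p ` Sg \<rightarrow> carrier A"
        using bc p by auto
      ultimately show ?thesis
        using M.finsum_reindex[of "\<lambda>r. w r \<odot> \<beta> (\<pi> r)" "Pair p" Sg] by simp
    qed
    also have "\<dots> = (\<Oplus>s\<in>Sg. (f p \<odot> \<beta> p) \<otimes> (g s \<odot> \<beta> s))"
    proof (intro M.finsum_cong' refl)
      fix s assume s: "s \<in> Sg"
      have "\<beta> (\<pi> (p, s)) = \<beta> p \<otimes> \<beta> s"
        using beta_mult[of p s] sub p s by (auto simp: \<pi>_def)
      then show "w (p, s) \<odot> \<beta> (\<pi> (p, s)) = (f p \<odot> \<beta> p) \<otimes> (g s \<odot> \<beta> s)"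
        using bp bs[OF s]
        by (simp add: w_def smult_mult_l smult_mult_r R.m_comm[of "f p"] flip: smult_assoc1)
    qed (use bp bs in auto)
    also have "\<dots> = (f p \<odot> \<beta> p) \<otimes> B.ev g"
      unfolding free_eval_def Sg_def[symmetric] using bp bs by (intro finsum_mult_r[symmetric]) auto
    finally show "(\<Oplus>r\<in>{p} \<times> Sg. w r \<odot> \<beta> (\<pi> r)) = (f p \<odot> \<beta> p) \<otimes> B.ev g" .
  next
    show "(\<lambda>p. (f p \<odot> \<beta> p) \<otimes> B.ev g) \<in> Sf \<rightarrow> carrier A"
      using B.beta_closed' sub(1) B.T_val[OF f] B.ev_closed[OF g] by (intro funcsetI mult_closed smult_closed) blast+
  qed
  also have "\<dots> = B.ev f \<otimes> B.ev g"
  proof -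
    have "(\<lambda>p. f p \<odot> \<beta> p) \<in> Sf \<rightarrow> carrier A"
      using B.beta_closed' sub(1) B.T_val[OF f] by (intro funcsetI smult_closed) blast+
    then show ?thesis
      unfolding free_eval_def[of F A \<beta> f] Sf_def[symmetric]
      using B.ev_closed[OF g] by (intro finsum_mult_l[symmetric])
  qed
  finally show "B.ev (f \<otimes>\<^bsub>B.T\<^esub> g) = B.ev f \<otimes> B.ev g" .
qed

text \<open>The inverse of the isomorphism induced by \<open>ev\<close>: cosets of the tensor ideal
  are the fibres of \<open>ev\<close>. Multiplicativity of \<open>ev\<close> then shows that the
  union defining a product of cosets is a single fibre.\<close>

definition fibre :: "'a \<Rightarrow> ('d \<times> (nat \<times> nat \<Rightarrow> 'f) \<Rightarrow> 'f) set" where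
  "fibre a = {f \<in> carrier B.T. B.ev f = a}"

lemma fibreD: "f \<in> fibre a \<Longrightarrow> f \<in> carrier B.T" "f \<in> fibre a \<Longrightarrow> B.ev f = a"
  by (simp_all add: fibre_def)

lemma coset_fibre:
  assumes f: "f \<in> carrier B.T"
  shows "B.I +>\<^bsub>B.T\<^esub> f = fibre (B.ev f)"
proof (intro subset_antisym subsetI)
  fix g assume "g \<in> B.I +>\<^bsub>B.T\<^esub> f"
  then obtain i where i: "i \<in> B.I" "g = i \<oplus>\<^bsub>B.T\<^esub> f"
    unfolding a_r_coset_def' by blast
  show "g \<in> fibre (B.ev f)"
    unfolding fibre_def i(2) using B.ev_add[OF B.I_carr[OF i(1)] f] B.ev_ideal[OF i(1)] B.ev_closed[OF f]
      B.T_add[OF B.I_carr[OF i(1)] f] by simp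
next
  fix g assume g: "g \<in> fibre (B.ev f)"
  note gD = fibreD[OF g]
  have "B.ev (g \<ominus>\<^bsub>B.T\<^esub> f) = \<zero>"
    using B.ev_minus[OF gD(1) f] gD(2) B.ev_closed[OF f] by simp
  then have "g \<ominus>\<^bsub>B.T\<^esub> f \<in> B.I"
    using ev_ker gD(1) f B.T.minus_closed by blast
  moreover have "g = (g \<ominus>\<^bsub>B.T\<^esub> f) \<oplus>\<^bsub>B.T\<^esub> f"
    using gD(1) f by (simp add: a_minus_def B.T.a_assoc B.T.l_neg)
  ultimately show "g \<in> B.I +>\<^bsub>B.T\<^esub> f"
    unfolding a_r_coset_def' by blast
qed

lemma fibre_nonempty:
  assumes "a \<in> carrier A"
  obtains f where "f \<in> fibre a" "f \<in> carrier B.T" "B.ev f = a" "B.I +>\<^bsub>B.T\<^esub> f = fibre a"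
proof -
  obtain f where "f \<in> carrier B.T" "B.ev f = a"
    using ev_surj[OF assms] by blast
  then show ?thesis
    using that[of f] coset_fibre[of f] by (simp add: fibre_def)
qed

lemma isomorphism: "alg_isomorphic F A (tensor_alg F D Sk)"
proof -
  let ?W = "tensor_alg F D Sk"
  have sel: "carrier ?W = (\<Union>f\<in>carrier B.T. {B.I +>\<^bsub>B.T\<^esub> f})" "\<one>\<^bsub>?W\<^esub> = B.I +>\<^bsub>B.T\<^esub> \<one>\<^bsub>B.T\<^esub>"
    "U \<otimes>\<^bsub>?W\<^esub> V = (\<Union>f\<in>U. \<Union>g\<in>V. B.I +>\<^bsub>B.T\<^esub> (f \<otimes>\<^bsub>B.T\<^esub> g))"
    "U \<oplus>\<^bsub>?W\<^esub> V = (\<Union>f\<in>U. \<Union>g\<in>V. {f \<oplus>\<^bsub>B.T\<^esub> g})"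
    "r \<odot>\<^bsub>?W\<^esub> U = (\<Union>f\<in>U. B.I +>\<^bsub>B.T\<^esub> (r \<odot>\<^bsub>B.T\<^esub> f))" for U V r
    by (simp_all add: tensor_alg_def quot_def A_RCOSETS_def' rcoset_mult_def set_add_def')
  have "fibre \<in> ring_iso A ?W"
  proof (rule ring_iso_memI)
    fix a b assume a: "a \<in> carrier A" and b: "b \<in> carrier A"
    obtain f where f: "f \<in> fibre a" "f \<in> carrier B.T" "B.ev f = a" "B.I +>\<^bsub>B.T\<^esub> f = fibre a"
      by (rule fibre_nonempty[OF a])
    obtain g where g: "g \<in> fibre b" "g \<in> carrier B.T" "B.ev g = b" "B.I +>\<^bsub>B.T\<^esub> g = fibre b"
      by (rule fibre_nonempty[OF b])
    show "fibre a \<in> carrier ?W"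
      unfolding sel using f(2,4) by blast
    have "B.I +>\<^bsub>B.T\<^esub> (f' \<otimes>\<^bsub>B.T\<^esub> g') = fibre (a \<otimes> b)" if "f' \<in> fibre a" "g' \<in> fibre b" for f' g'
      using coset_fibre[OF ev_mult(1)] ev_mult(2) fibreD that by metis
    then have "(\<Union>f\<in>fibre a. \<Union>g\<in>fibre b. B.I +>\<^bsub>B.T\<^esub> (f \<otimes>\<^bsub>B.T\<^esub> g)) = (\<Union>f\<in>fibre a. \<Union>g\<in>fibre b. fibre (a \<otimes> b))"
      by simp
    then show "fibre (a \<otimes> b) = fibre a \<otimes>\<^bsub>?W\<^esub> fibre b"
      unfolding sel using f(1) g(1) by auto
    show "fibre (a \<oplus> b) = fibre a \<oplus>\<^bsub>?W\<^esub> fibre b"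
      unfolding sel
    proof (intro subset_antisym subsetI)
      fix h assume h: "h \<in> fibre (a \<oplus> b)"
      note hD = fibreD[OF h]
      have k: "h \<ominus>\<^bsub>B.T\<^esub> f \<in> carrier B.T"
        using hD(1) f(2) by (rule B.T.minus_closed)
      have "B.ev (h \<ominus>\<^bsub>B.T\<^esub> f) = b"
        using B.ev_minus[OF hD(1) f(2)] hD(2) f(3) a b by (simp add: M.minus_eq M.a_comm[of a] M.a_assoc M.r_neg)
      then have "h \<ominus>\<^bsub>B.T\<^esub> f \<in> fibre b"
        using k by (simp add: fibre_def)
      moreover have "h = f \<oplus>\<^bsub>B.T\<^esub> (h \<ominus>\<^bsub>B.T\<^esub> f)"
        using hD(1) f(2) by (simp add: a_minus_def B.T.a_comm[of f] B.T.a_assoc B.T.l_neg)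
      ultimately show "h \<in> (\<Union>f\<in>fibre a. \<Union>g\<in>fibre b. {f \<oplus>\<^bsub>B.T\<^esub> g})"
        using f(1) by blast
    next
      fix h assume "h \<in> (\<Union>f\<in>fibre a. \<Union>g\<in>fibre b. {f \<oplus>\<^bsub>B.T\<^esub> g})"
      then obtain f' g' where fg: "f' \<in> fibre a" "g' \<in> fibre b" and h: "h = f' \<oplus>\<^bsub>B.T\<^esub> g'"
        by blast
      have "B.ev h = a \<oplus> b"
        unfolding h B.ev_add[OF fibreD(1)[OF fg(1)] fibreD(1)[OF fg(2)]] fibreD(2)[OF fg(1)] fibreD(2)[OF fg(2)] ..
      moreover have "h \<in> carrier B.T"
        unfolding h using fibreD(1)[OF fg(1)] fibreD(1)[OF fg(2)] by (rule B.T.a_closed)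
      ultimately show "h \<in> fibre (a \<oplus> b)"
        unfolding fibre_def by (intro CollectI conjI)
    qed
  next
    have "B.ev (free_gen F \<one>\<^bsub>D\<^esub> \<one>\<^bsub>Sk\<^esub>) = \<one>"
      using B.ev_gen[OF D.unit_closed Sk_closed(3)] by (simp add: \<beta>_def phi_one hs_one)
    then show "fibre \<one> = \<one>\<^bsub>?W\<^esub>"
      unfolding sel free_alg_one using coset_fibre[OF B.free_gen_mem[OF D.unit_closed Sk_closed(3)]] by simp
  next
    show "bij_betw fibre (carrier A) (carrier ?W)"
    proof (rule bij_betwI')
      fix a b assume a: "a \<in> carrier A" and b: "b \<in> carrier A"
      show "fibre a = fibre b \<longleftrightarrow> a = b"
      proof
        assume e: "fibre a = fibre b"
        obtain f where f: "f \<in> fibre a"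
          by (rule fibre_nonempty[OF a])
        then have "B.ev f = b"
          unfolding e by (rule fibreD(2))
        then show "a = b"
          using fibreD(2)[OF f] by simp
      qed simp
    next
      fix a assume a: "a \<in> carrier A"
      obtain f where "f \<in> carrier B.T" "B.I +>\<^bsub>B.T\<^esub> f = fibre a"
        by (rule fibre_nonempty[OF a])
      then show "fibre a \<in> carrier ?W"
        unfolding sel by blast
    next
      fix Y assume "Y \<in> carrier ?W"
      then obtain f where f: "f \<in> carrier B.T" "Y = B.I +>\<^bsub>B.T\<^esub> f"
        unfolding sel by blast
      then have "Y = fibre (B.ev f)"
        using coset_fibre[OF f(1)] by simp
      then show "\<exists>a\<in>carrier A. Y = fibre a"
        using B.ev_closed[OF f(1)] by (intro bexI)
    qed
  qed
  moreover have "fibre (r \<odot> a) = r \<odot>\<^bsub>?W\<^esub> fibre a" if r: "r \<in> carrier F" and a: "a \<in> carrier A" for r a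
  proof -
    obtain f where f: "f \<in> fibre a"
      by (rule fibre_nonempty[OF a])
    have "B.I +>\<^bsub>B.T\<^esub> (r \<odot>\<^bsub>B.T\<^esub> g) = fibre (r \<odot> a)" if "g \<in> fibre a" for g
      using coset_fibre[OF B.T_smult[OF r fibreD(1)[OF that]]] B.ev_smult[OF r fibreD(1)[OF that]] fibreD(2)[OF that]
      by simp
    then have "(\<Union>f\<in>fibre a. B.I +>\<^bsub>B.T\<^esub> (r \<odot>\<^bsub>B.T\<^esub> f)) = (\<Union>f\<in>fibre a. fibre (r \<odot> a))"
      by simp
    then show ?thesis
      unfolding sel using f by auto
  qed
  ultimately show ?thesis
    unfolding alg_isomorphic_def by blast
qed

end

section \<open>Homogeneous algebras\<close>

context homog begin

lemma one_nonzero: "\<one> \<noteq> \<zero>"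
  using cent by (simp add: central_def)

lemma D_inverse:
  assumes "d \<in> carrier D" "d \<noteq> \<zero>\<^bsub>D\<^esub>"
  obtains e where "e \<in> carrier D" "e \<otimes>\<^bsub>D\<^esub> d = \<one>\<^bsub>D\<^esub>"
proof -
  have "d \<in> Units D"
    using common_div assms by (simp add: common_division_algebra_def central_division_algebra_def)
  then show ?thesis
    using that unfolding Units_def by blast
qed

text \<open>\<open>central\<close> refers to the nonassociative centre; as \<open>D\<close> is
  associative, its nucleus is everything and commuting suffices.\<close>

lemma D_center:
  assumes d: "d \<in> carrier D" and comm: "\<And>e. e \<in> carrier D \<Longrightarrow> d \<otimes>\<^bsub>D\<^esub> e = e \<otimes>\<^bsub>D\<^esub> d"
  shows "\<exists>c\<in>carrier F. d = c \<odot>\<^bsub>D\<^esub> \<one>\<^bsub>D\<^esub>"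
proof -
  interpret Dr: ring D
    by (rule D_ring)
  have "d \<in> nucleus D"
    unfolding D.nucleus_iff using d Dr.m_assoc by simp
  then have "d \<in> alg_center D"
    unfolding alg_center_def using comm by blast
  moreover have "central F D"
    using common_div by (simp add: common_division_algebra_def central_division_algebra_def)
  ultimately show ?thesis
    unfolding central_def by blast
qed

end

text \<open>All choices made at once: the atomic idempotents, and for each of them a matrix size and
  a homomorphism from matrices over \<open>D\<close> onto its corner. Injectivity on
  \<open>D\<close> is derived in \<open>phi_inj\<close>.\<close>

locale matrix_frame = homog A F K D
  for A :: "('f, 'a) module" (structure) and F :: "('f, 'x) ring_scheme" (structure) and K
    and D :: "('f, 'd) module" +
  fixes Z :: "'a set" and P :: "'a \<Rightarrow> 'a set" and m :: "'a \<Rightarrow> nat" and \<theta> :: "'a \<Rightarrow> (nat \<times> nat \<Rightarrow> 'd) \<Rightarrow> 'a"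
  assumes Z_fin: "finite Z" and Z_atom: "\<And>z. z \<in> Z \<Longrightarrow> atom_idem z (P z)"
    and Z_orth: "\<And>y z. y \<in> Z \<Longrightarrow> z \<in> Z \<Longrightarrow> y \<noteq> z \<Longrightarrow> y \<otimes> z = \<zero>" and Z_sum: "(\<Oplus>z\<in>Z. z) = \<one>"
    and m_pos: "\<And>z. z \<in> Z \<Longrightarrow> m z \<ge> 1"
    and th_corner: "\<And>z x. z \<in> Z \<Longrightarrow> x \<in> carrier (mat_alg (m z) D) \<Longrightarrow> \<theta> z x \<in> corner z"
    and th_add: "\<And>z x y. z \<in> Z \<Longrightarrow> x \<in> carrier (mat_alg (m z) D) \<Longrightarrow> y \<in> carrier (mat_alg (m z) D)
      \<Longrightarrow> \<theta> z (x \<oplus>\<^bsub>mat_alg (m z) D\<^esub> y) = \<theta> z x \<oplus> \<theta> z y"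
    and th_mult: "\<And>z x y. z \<in> Z \<Longrightarrow> x \<in> carrier (mat_alg (m z) D) \<Longrightarrow> y \<in> carrier (mat_alg (m z) D)
      \<Longrightarrow> \<theta> z (x \<otimes>\<^bsub>mat_alg (m z) D\<^esub> y) = \<theta> z x \<otimes> \<theta> z y"
    and th_smult: "\<And>z c x. z \<in> Z \<Longrightarrow> c \<in> carrier F \<Longrightarrow> x \<in> carrier (mat_alg (m z) D)
      \<Longrightarrow> \<theta> z (c \<odot>\<^bsub>mat_alg (m z) D\<^esub> x) = c \<odot> \<theta> z x"
    and th_one: "\<And>z. z \<in> Z \<Longrightarrow> \<theta> z \<one>\<^bsub>mat_alg (m z) D\<^esub> = z"
    and th_surj: "\<And>z b. z \<in> Z \<Longrightarrow> b \<in> corner z \<Longrightarrow> \<exists>x\<in>carrier (mat_alg (m z) D). \<theta> z x = b"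
begin

lemmas ZD = atom_idemD(2,3,4)[OF Z_atom]

definition dg :: "'a \<Rightarrow> 'd \<Rightarrow> 'a" where
  "dg z d = \<theta> z (mat_diag (m z) D (m z) d)"

definition eps :: "'a \<Rightarrow> nat \<Rightarrow> nat \<Rightarrow> 'a" where
  "eps z i j = \<theta> z (mat_unit (m z) D i j \<one>\<^bsub>D\<^esub>)"

definition \<phi> :: "'d \<Rightarrow> 'a" where
  "\<phi> d = (\<Oplus>z\<in>Z. dg z d)"

lemma dg_corner: "z \<in> Z \<Longrightarrow> d \<in> carrier D \<Longrightarrow> dg z d \<in> corner z"
  unfolding dg_def by (intro th_corner D.mat_diag_closed)

lemma dg_nuc: "z \<in> Z \<Longrightarrow> d \<in> carrier D \<Longrightarrow> dg z d \<in> N"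
  using dg_corner cornerD(1) by blast

lemma dg_carr: "z \<in> Z \<Longrightarrow> d \<in> carrier D \<Longrightarrow> dg z d \<in> carrier A"
  using dg_nuc nuc_carr by blast

lemma phi_nuc: "d \<in> carrier D \<Longrightarrow> \<phi> d \<in> N"
  unfolding \<phi>_def using dg_nuc by (intro subspace_finsum[OF nuc_subspace])

text \<open>Of the summands \<open>dg y d\<close> only the one at \<open>z\<close> sees
  \<open>x = z x\<close>, because distinct idempotents are orthogonal. So on a Peirce component
  \<open>\<phi> d\<close> acts through a single diagonal matrix.\<close>

lemma phi_left:
  assumes d: "d \<in> carrier D" and z: "z \<in> Z" and x: "x \<in> carrier A" "z \<otimes> x = x"
  shows "\<phi> d \<otimes> x = dg z d \<otimes> x"
proof -
  have "\<phi> d \<otimes> x = (\<Oplus>y\<in>Z. dg y d \<otimes> x)"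
    unfolding \<phi>_def using dg_carr d x by (intro finsum_mult_l) auto
  also have "\<dots> = dg z d \<otimes> x"
  proof (rule finsum_single[OF Z_fin z])
    fix y assume y: "y \<in> Z" "y \<noteq> z"
    note c = cornerD[OF dg_corner[OF y(1) d]]
    have "dg y d \<otimes> x = (dg y d \<otimes> y) \<otimes> (z \<otimes> x)"
      using c x by simp
    also have "\<dots> = dg y d \<otimes> ((y \<otimes> z) \<otimes> x)"
      using nuc1[OF c(1) ZD(2)[OF y(1)], of "z \<otimes> x"] nuc1[OF ZD(1)[OF y(1)] ZD(2)[OF z] x(1)] x ZD(2)[OF z] by simp
    also have "\<dots> = \<zero>"
      using Z_orth[OF y(1) z y(2)] x c(1) by simp
    finally show "dg y d \<otimes> x = \<zero>" .
  qed (use dg_carr[OF z d] x in simp)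
  finally show ?thesis .
qed

lemma phi_right:
  assumes d: "d \<in> carrier D" and z: "z \<in> Z" and x: "x \<in> carrier A" "x \<otimes> z = x"
  shows "x \<otimes> \<phi> d = x \<otimes> dg z d"
proof -
  have "x \<otimes> \<phi> d = (\<Oplus>y\<in>Z. x \<otimes> dg y d)"
    unfolding \<phi>_def using dg_carr d x by (intro finsum_mult_r) auto
  also have "\<dots> = x \<otimes> dg z d"
  proof (rule finsum_single[OF Z_fin z])
    fix y assume y: "y \<in> Z" "y \<noteq> z"
    note c = cornerD[OF dg_corner[OF y(1) d]]
    have "x \<otimes> dg y d = (x \<otimes> z) \<otimes> (y \<otimes> dg y d)"
      using c x by simp
    also have "\<dots> = x \<otimes> ((z \<otimes> y) \<otimes> dg y d)"
      using nuc2[OF ZD(1)[OF z] x(1), of "y \<otimes> dg y d"] nuc1[OF ZD(1)[OF z] ZD(2)[OF y(1)], of "dg y d"] c ZD(2)[OF y(1)] by simp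
    also have "\<dots> = \<zero>"
      using Z_orth[OF z y(1)] y x c(1) by simp
    finally show "x \<otimes> dg y d = \<zero>" .
  qed (use dg_carr[OF z d] x in simp)
  finally show ?thesis .
qed

lemma phi_add: "d \<in> carrier D \<Longrightarrow> e \<in> carrier D \<Longrightarrow> \<phi> (d \<oplus>\<^bsub>D\<^esub> e) = \<phi> d \<oplus> \<phi> e"
proof -
  assume d: "d \<in> carrier D" "e \<in> carrier D"
  have "\<phi> (d \<oplus>\<^bsub>D\<^esub> e) = (\<Oplus>z\<in>Z. dg z d \<oplus> dg z e)"
    unfolding \<phi>_def
  proof (intro M.finsum_cong' refl)
    fix z assume z: "z \<in> Z"
    show "dg z (d \<oplus>\<^bsub>D\<^esub> e) = dg z d \<oplus> dg z e"
      unfolding dg_def D.mat_diag_add[OF d] using z d by (intro th_add D.mat_diag_closed)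
  qed (use dg_carr d in auto)
  also have "\<dots> = \<phi> d \<oplus> \<phi> e"
    unfolding \<phi>_def using dg_carr d by (intro M.finsum_addf) auto
  finally show ?thesis .
qed

lemma phi_smult: "c \<in> carrier F \<Longrightarrow> d \<in> carrier D \<Longrightarrow> \<phi> (c \<odot>\<^bsub>D\<^esub> d) = c \<odot> \<phi> d"
proof -
  assume c: "c \<in> carrier F" and d: "d \<in> carrier D"
  have "\<phi> (c \<odot>\<^bsub>D\<^esub> d) = (\<Oplus>z\<in>Z. c \<odot> dg z d)"
    unfolding \<phi>_def
  proof (intro M.finsum_cong' refl)
    fix z assume z: "z \<in> Z"
    show "dg z (c \<odot>\<^bsub>D\<^esub> d) = c \<odot> dg z d"
      unfolding dg_def D.mat_diag_smult[OF c d] using z c d by (intro th_smult D.mat_diag_closed)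
  qed (use dg_carr c d in auto)
  also have "\<dots> = c \<odot> \<phi> d"
    unfolding \<phi>_def using dg_carr c d Z_fin by (intro finsum_smult_ldistr[symmetric]) auto
  finally show ?thesis .
qed

lemma phi_mult: "d \<in> carrier D \<Longrightarrow> e \<in> carrier D \<Longrightarrow> \<phi> (d \<otimes>\<^bsub>D\<^esub> e) = \<phi> d \<otimes> \<phi> e"
proof -
  assume d: "d \<in> carrier D" "e \<in> carrier D"
  have "\<phi> (d \<otimes>\<^bsub>D\<^esub> e) = (\<Oplus>z\<in>Z. \<phi> d \<otimes> dg z e)"
    unfolding \<phi>_def[of "d \<otimes>\<^bsub>D\<^esub> e"]
  proof (intro M.finsum_cong' refl)
    fix z assume z: "z \<in> Z"
    have "dg z (d \<otimes>\<^bsub>D\<^esub> e) = dg z d \<otimes> dg z e"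
      unfolding dg_def D.mat_diag_mult[OF d, symmetric] using z d by (intro th_mult D.mat_diag_closed)
    also have "\<dots> = \<phi> d \<otimes> dg z e"
      using phi_left[OF d(1) z dg_carr[OF z d(2)] cornerD(2)[OF dg_corner[OF z d(2)]]] by simp
    finally show "dg z (d \<otimes>\<^bsub>D\<^esub> e) = \<phi> d \<otimes> dg z e" .
  qed (use dg_carr d phi_nuc in auto)
  also have "\<dots> = \<phi> d \<otimes> \<phi> e"
    unfolding \<phi>_def[of e] using dg_carr d phi_nuc by (intro finsum_mult_r[symmetric]) auto
  finally show ?thesis .
qed

lemma phi_one: "\<phi> \<one>\<^bsub>D\<^esub> = \<one>"
proof -
  have "\<phi> \<one>\<^bsub>D\<^esub> = (\<Oplus>z\<in>Z. z)"
    unfolding \<phi>_def dg_def using th_one ZD(2) D.mat_one_diag by (intro M.finsum_cong' refl) auto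
  then show ?thesis
    using Z_sum by simp
qed

text \<open>A unital homomorphism from a division ring into a nonzero algebra is injective.\<close>

lemma phi_inj:
  assumes d: "d \<in> carrier D" "\<phi> d = \<zero>"
  shows "d = \<zero>\<^bsub>D\<^esub>"
proof (rule ccontr)
  assume "d \<noteq> \<zero>\<^bsub>D\<^esub>"
  then obtain e where e: "e \<in> carrier D" "e \<otimes>\<^bsub>D\<^esub> d = \<one>\<^bsub>D\<^esub>"
    using D_inverse d by blast
  then have "\<one> = \<phi> e \<otimes> \<phi> d"
    using phi_mult[OF e(1) d(1)] phi_one by simp
  then show False
    using one_nonzero d phi_nuc[OF e(1)] by simp
qed

lemma eps_corner: "z \<in> Z \<Longrightarrow> eps z i j \<in> corner z"
  unfolding eps_def by (intro th_corner D.mat_unit_closed D.unit_closed)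

lemma eps_nuc: "z \<in> Z \<Longrightarrow> eps z i j \<in> N"
  using eps_corner cornerD(1) by blast

lemma eps_carr: "z \<in> Z \<Longrightarrow> eps z i j \<in> carrier A"
  using eps_nuc nuc_carr by blast

lemma th_zero: "z \<in> Z \<Longrightarrow> \<theta> z \<zero>\<^bsub>mat_alg (m z) D\<^esub> = \<zero>"
proof -
  assume z: "z \<in> Z"
  let ?o = "\<zero>\<^bsub>mat_alg (m z) D\<^esub>"
  have o: "?o \<in> carrier (mat_alg (m z) D)"
    by (auto simp: mat_alg_sel)
  have "\<zero>\<^bsub>F\<^esub> \<odot>\<^bsub>mat_alg (m z) D\<^esub> ?o = ?o"
    unfolding mat_alg_sel by (rule restrict_ext) auto
  then have "\<theta> z ?o = \<zero>\<^bsub>F\<^esub> \<odot> \<theta> z ?o"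
    using th_smult[OF z R.zero_closed o] by simp
  also have "\<dots> = \<zero>"
    using cornerD(1)[OF th_corner[OF z o]] by simp
  finally show ?thesis .
qed

lemma eps_mult:
  assumes z: "z \<in> Z" and i: "i \<in> {1..m z}" "j \<in> {1..m z}" "k \<in> {1..m z}" "l \<in> {1..m z}"
  shows "eps z i j \<otimes> eps z k l = (if j = k then eps z i l else \<zero>)"
  unfolding eps_def using z th_zero[OF z]
    th_mult[OF z D.mat_unit_closed[OF D.unit_closed] D.mat_unit_closed[OF D.unit_closed], symmetric]
    D.mat_unit_mult[OF D.unit_closed D.unit_closed i]
  by simp

lemma eps_sum:
  assumes z: "z \<in> Z"
  shows "(\<Oplus>i\<in>{1..m z}. eps z i i) = z"
proof -
  have "(\<Oplus>i\<in>{1..r}. eps z i i) = \<theta> z (mat_diag (m z) D r \<one>\<^bsub>D\<^esub>)" if "r \<le> m z" for r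
    using that
  proof (induction r)
    case 0
    then show ?case
      using th_zero[OF z] by (simp add: D.mat_diag_zero)
  next
    case (Suc r)
    have "{1..Suc r} = insert (Suc r) {1..r}"
      by auto
    then have "(\<Oplus>i\<in>{1..Suc r}. eps z i i) = eps z (Suc r) (Suc r) \<oplus> (\<Oplus>i\<in>{1..r}. eps z i i)"
      using eps_carr[OF z] by (simp add: M.finsum_insert)
    also have "\<dots> = \<theta> z (mat_diag (m z) D r \<one>\<^bsub>D\<^esub>) \<oplus> eps z (Suc r) (Suc r)"
      using Suc eps_carr[OF z] cornerD(1)[OF th_corner[OF z D.mat_diag_closed[OF D.unit_closed]]] by (simp add: M.a_comm)
    also have "\<dots> = \<theta> z (mat_diag (m z) D (Suc r) \<one>\<^bsub>D\<^esub>)"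
      using Suc.prems D.mat_diag_Suc[OF D.unit_closed, of r "m z"]
        th_add[OF z D.mat_diag_closed[OF D.unit_closed] D.mat_unit_closed[OF D.unit_closed]]
      by (simp add: eps_def)
    finally show ?case .
  qed
  from this[of "m z"] show ?thesis
    using th_one[OF z] D.mat_one_diag by simp
qed

lemma phi_eps:
  assumes z: "z \<in> Z" and i: "i \<in> {1..m z}" "j \<in> {1..m z}" and d: "d \<in> carrier D"
  shows "\<phi> d \<otimes> eps z i j = eps z i j \<otimes> \<phi> d" "\<phi> d \<otimes> eps z i j = \<theta> z (mat_unit (m z) D i j d)"
proof -
  have "\<phi> d \<otimes> eps z i j = dg z d \<otimes> eps z i j"
    using phi_left[OF d z eps_carr[OF z] cornerD(2)[OF eps_corner[OF z]]] .
  also have "\<dots> = \<theta> z (mat_unit (m z) D i j d)"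
    unfolding dg_def eps_def
    using th_mult[OF z D.mat_diag_closed[OF d] D.mat_unit_closed[OF D.unit_closed], symmetric]
      D.mat_diag_unit(1)[OF d D.unit_closed i] d by simp
  finally show e: "\<phi> d \<otimes> eps z i j = \<theta> z (mat_unit (m z) D i j d)" .
  have "eps z i j \<otimes> \<phi> d = eps z i j \<otimes> dg z d"
    using phi_right[OF d z eps_carr[OF z] cornerD(3)[OF eps_corner[OF z]]] .
  also have "\<dots> = \<theta> z (mat_unit (m z) D i j d)"
    unfolding dg_def eps_def
    using th_mult[OF z D.mat_unit_closed[OF D.unit_closed] D.mat_diag_closed[OF d], symmetric]
      D.mat_diag_unit(2)[OF d D.unit_closed i] d by simp
  finally show "\<phi> d \<otimes> eps z i j = eps z i j \<otimes> \<phi> d"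
    using e by simp
qed

lemma one_index: "z \<in> Z \<Longrightarrow> 1 \<in> {1..m z}"
  using m_pos by simp

text \<open>The matrix identity \<open>E_1i X E_k1 = X_ik E_11\<close>, by which the coefficients of
  an element of the corner appear as elements of \<open>\<phi>(D)\<close>.\<close>

lemma corner_block:
  assumes z: "z \<in> Z" and b: "b \<in> corner z" and i: "i \<in> {1..m z}" "k \<in> {1..m z}"
  shows "\<exists>d\<in>carrier D. (eps z 1 i \<otimes> b) \<otimes> eps z k 1 = \<phi> d \<otimes> eps z 1 1"
proof -
  let ?M = "mat_alg (m z) D"
  note o = one_index[OF z]
  obtain x where x: "x \<in> carrier ?M" "\<theta> z x = b"
    using th_surj[OF z b] by blast
  note e1 = D.mat_unit_closed[OF D.unit_closed, of "m z" 1 i] and ek = D.mat_unit_closed[OF D.unit_closed, of "m z" k 1]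
  have c: "mat_unit (m z) D 1 i \<one>\<^bsub>D\<^esub> \<otimes>\<^bsub>?M\<^esub> x \<in> carrier ?M"
    using D.mat_mult_closed[OF e1 x(1)] .
  have "(mat_unit (m z) D 1 i \<one>\<^bsub>D\<^esub> \<otimes>\<^bsub>?M\<^esub> x) \<otimes>\<^bsub>?M\<^esub> mat_unit (m z) D k 1 \<one>\<^bsub>D\<^esub> = mat_unit (m z) D 1 1 (x (i, k))"
  proof (rule D.mat_ext[OF D.mat_mult_closed[OF c ek]])
    show "mat_unit (m z) D 1 1 (x (i, k)) \<in> carrier ?M"
      using D.mat_val[OF x(1) i] by (rule D.mat_unit_closed)
    fix p r assume pr: "p \<in> {1..m z}" "r \<in> {1..m z}"
    show "((mat_unit (m z) D 1 i \<one>\<^bsub>D\<^esub> \<otimes>\<^bsub>?M\<^esub> x) \<otimes>\<^bsub>?M\<^esub> mat_unit (m z) D k 1 \<one>\<^bsub>D\<^esub>) (p, r) = mat_unit (m z) D 1 1 (x (i, k)) (p, r)"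
      unfolding D.mat_unit_mult_r[OF c D.unit_closed i(2) o pr] D.mat_unit_mult_l[OF x(1) D.unit_closed o i(1) pr(1) i(2)]
      using D.mat_val[OF x(1) i] pr by (simp add: D.mat_unit_val)
  qed
  then have "(eps z 1 i \<otimes> b) \<otimes> eps z k 1 = \<phi> (x (i, k)) \<otimes> eps z 1 1"
    unfolding eps_def x(2)[symmetric] th_mult[OF z e1 x(1), symmetric] th_mult[OF z c ek, symmetric]
    using phi_eps(2)[OF z o o D.mat_val[OF x(1) i]] by (simp add: eps_def)
  then show ?thesis
    using D.mat_val[OF x(1) i] by blast
qed

lemma eps_l:
  assumes "z \<in> Z" "i \<in> {1..m z}" "j \<in> {1..m z}" "k \<in> {1..m z}" "l \<in> {1..m z}" "a \<in> carrier A"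
  shows "eps z i j \<otimes> (eps z k l \<otimes> a) = (if j = k then eps z i l \<otimes> a else \<zero>)"
  using nuc1[OF eps_nuc eps_carr assms(6), OF assms(1) assms(1), of i j k l] eps_mult[OF assms(1-5)] assms(6) by auto

lemma eps_r:
  assumes "z \<in> Z" "i \<in> {1..m z}" "j \<in> {1..m z}" "k \<in> {1..m z}" "l \<in> {1..m z}" "a \<in> carrier A"
  shows "(a \<otimes> eps z i j) \<otimes> eps z k l = (if j = k then a \<otimes> eps z i l else \<zero>)"
  using nuc2[OF eps_nuc assms(6) eps_carr, OF assms(1) assms(1), of i j k l] eps_mult[OF assms(1-5)] assms(6) by auto

lemma eps_assoc:
  assumes "z \<in> Z" "s \<in> Z" "a \<in> carrier A"
  shows "(eps z i j \<otimes> a) \<otimes> eps s k l = eps z i j \<otimes> (a \<otimes> eps s k l)"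
  using nuc1[OF eps_nuc assms(3) eps_carr] assms by simp

text \<open>Row \<open>k\<close> is moved to row 1 and back, using \<open>E_kk = E_k1 E_1k\<close>
  and that the \<open>E_kk\<close> add up to \<open>z\<close>.\<close>

lemma left_expand:
  assumes z: "z \<in> Z" and a: "a \<in> carrier A" "z \<otimes> a = a"
  shows "a = (\<Oplus>k\<in>{1..m z}. eps z k 1 \<otimes> (eps z 1 k \<otimes> a))"
proof -
  have "a = (\<Oplus>k\<in>{1..m z}. eps z k k) \<otimes> a"
    using eps_sum[OF z] a by simp
  also have "\<dots> = (\<Oplus>k\<in>{1..m z}. eps z k k \<otimes> a)"
    using eps_carr[OF z] a by (intro finsum_mult_l) auto
  also have "\<dots> = (\<Oplus>k\<in>{1..m z}. eps z k 1 \<otimes> (eps z 1 k \<otimes> a))"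
  proof (intro M.finsum_cong' refl)
    fix k assume k: "k \<in> {1..m z}"
    show "eps z k k \<otimes> a = eps z k 1 \<otimes> (eps z 1 k \<otimes> a)"
      using eps_l[OF z k one_index[OF z] one_index[OF z] k a(1)] by simp
  qed (use eps_carr[OF z] a in auto)
  finally show ?thesis .
qed

lemma right_expand:
  assumes z: "z \<in> Z" and a: "a \<in> carrier A" "a \<otimes> z = a"
  shows "a = (\<Oplus>k\<in>{1..m z}. (a \<otimes> eps z k 1) \<otimes> eps z 1 k)"
proof -
  have "a = a \<otimes> (\<Oplus>k\<in>{1..m z}. eps z k k)"
    using eps_sum[OF z] a by simp
  also have "\<dots> = (\<Oplus>k\<in>{1..m z}. a \<otimes> eps z k k)"
    using eps_carr[OF z] a by (intro finsum_mult_r) auto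
  also have "\<dots> = (\<Oplus>k\<in>{1..m z}. (a \<otimes> eps z k 1) \<otimes> eps z 1 k)"
  proof (intro M.finsum_cong' refl)
    fix k assume k: "k \<in> {1..m z}"
    show "a \<otimes> eps z k k = (a \<otimes> eps z k 1) \<otimes> eps z 1 k"
      using eps_r[OF z k one_index[OF z] one_index[OF z] k a(1)] by simp
  qed (use eps_carr[OF z] a in auto)
  finally show ?thesis .
qed

text \<open>Position (1,1) is the reference corner, available because \<open>m z \<ge> 1\<close>;
  \<open>entry\<close> moves the coefficient at any position there. This is the Morita reduction
  from bimodules over matrix algebras to bimodules over \<open>D\<close>.\<close>

definition block :: "'a \<Rightarrow> 'a \<Rightarrow> 'a set" where
  "block z s = peirce (eps z 1 1) (eps s 1 1)"

definition entry :: "'a \<Rightarrow> nat \<Rightarrow> 'a \<Rightarrow> nat \<Rightarrow> 'a \<Rightarrow> 'a" where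
  "entry z i s j a = (eps z 1 i \<otimes> a) \<otimes> eps s j 1"

lemma block_subspace: "z \<in> Z \<Longrightarrow> s \<in> Z \<Longrightarrow> subspace (block z s)"
  unfolding block_def by (intro peirce_subspace eps_carr)

lemma block_carr: "x \<in> block z s \<Longrightarrow> x \<in> carrier A"
  unfolding block_def by (rule peirceD(1))

lemma entry_block:
  assumes z: "z \<in> Z" "s \<in> Z" and ij: "i \<in> {1..m z}" "j \<in> {1..m s}" and a: "a \<in> carrier A"
  shows "entry z i s j a \<in> block z s"
proof -
  have c: "eps z 1 i \<otimes> a \<in> carrier A" "a \<otimes> eps s j 1 \<in> carrier A"
    using eps_carr z a by simp_all
  show ?thesis
    unfolding block_def peirce_def entry_def
    using c eps_carr[OF z(1)] eps_carr[OF z(2)] eps_r[OF z(2) ij(2) one_index[OF z(2)] one_index[OF z(2)] one_index[OF z(2)] c(1)]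
      eps_l[OF z(1) one_index[OF z(1)] one_index[OF z(1)] one_index[OF z(1)] ij(1) c(2)]
    by (simp add: eps_assoc[OF z a])
qed

lemma entry_zero:
  assumes z: "z \<in> Z" "s \<in> Z" and a: "a \<in> peirce z s"
    and ent: "\<And>i j. i \<in> {1..m z} \<Longrightarrow> j \<in> {1..m s} \<Longrightarrow> entry z i s j a = \<zero>"
  shows "a = \<zero>"
proof -
  note aD = peirceD[OF a]
  have "eps z 1 i \<otimes> a = \<zero>" if i: "i \<in> {1..m z}" for i
  proof -
    have c: "eps z 1 i \<otimes> a \<in> carrier A"
      using eps_carr[OF z(1)] aD(1) by simp
    have "(eps z 1 i \<otimes> a) \<otimes> s = eps z 1 i \<otimes> a"
      using nuc1[OF eps_nuc[OF z(1)] aD(1) ZD(2)[OF z(2)], of 1 i] aD(3) by simp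
    then have "eps z 1 i \<otimes> a = (\<Oplus>k\<in>{1..m s}. entry z i s k a \<otimes> eps s 1 k)"
      unfolding entry_def by (rule right_expand[OF z(2) c])
    also have "\<dots> = \<zero>"
      using ent[OF i] eps_carr[OF z(2)] by (intro finsum_all_zero) auto
    finally show ?thesis .
  qed
  then have "(\<Oplus>k\<in>{1..m z}. eps z k 1 \<otimes> (eps z 1 k \<otimes> a)) = \<zero>"
    using eps_carr[OF z(1)] by (intro finsum_all_zero) auto
  then show ?thesis
    using left_expand[OF z(1) aD(1,2)] by simp
qed

lemma block_nonzero:
  assumes z: "z \<in> Z" "s \<in> Z"
  shows "block z s \<noteq> {\<zero>}"
proof
  assume b: "block z s = {\<zero>}"
  obtain a where a: "a \<in> peirce z s" "a \<noteq> \<zero>"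
    using peirce_nonzero[OF Z_atom[OF z(1)] Z_atom[OF z(2)]] .
  have "entry z i s j a = \<zero>" if "i \<in> {1..m z}" "j \<in> {1..m s}" for i j
    using entry_block[OF z that peirceD(1)[OF a(1)]] b by simp
  then show False
    using entry_zero[OF z a(1)] a(2) by blast
qed

lemma eps_idem: "z \<in> Z \<Longrightarrow> i \<in> {1..m z} \<Longrightarrow> eps z i i \<otimes> eps z i i = eps z i i"
  by (simp add: eps_mult)

lemma z_eps: "z \<in> Z \<Longrightarrow> z \<otimes> eps z i j = eps z i j" "z \<in> Z \<Longrightarrow> eps z i j \<otimes> z = eps z i j"
  using cornerD(2,3)[OF eps_corner] by blast+

lemma block_peirce:
  assumes z: "z \<in> Z" "s \<in> Z" and x: "x \<in> block z s"
  shows "x \<in> peirce z s"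
proof -
  note xD = peirceD[OF x[unfolded block_def]]
  have "z \<otimes> x = x"
    using nuc1[OF ZD(1)[OF z(1)] eps_carr[OF z(1)] xD(1), of 1 1] z_eps(1)[OF z(1)] xD(2) by simp
  moreover have "x \<otimes> s = x"
    using nuc3[OF ZD(1)[OF z(2)] xD(1) eps_carr[OF z(2)], of 1 1] z_eps(2)[OF z(2)] xD(3) by simp
  ultimately show ?thesis
    using xD(1) by (simp add: peirce_def)
qed

lemma entry_of_block:
  assumes z: "z \<in> Z" "s \<in> Z" and x: "x \<in> block z s" and ij: "i \<in> {1..m z}" "j \<in> {1..m s}"
  shows "entry z i s j x = (if i = 1 \<and> j = 1 then x else \<zero>)"
proof -
  note xD = peirceD[OF x[unfolded block_def]]
  note o = one_index[OF z(1)] one_index[OF z(2)]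
  have "eps z 1 i \<otimes> x = (if i = 1 then x else \<zero>)"
    using eps_l[OF z(1) o(1) ij(1) o(1) o(1) xD(1)] xD(2) by simp
  moreover have "x \<otimes> eps s j 1 = (if j = 1 then x else \<zero>)"
    using eps_r[OF z(2) o(2) o(2) ij(2) o(2) xD(1)] xD(3) by auto
  ultimately show ?thesis
    unfolding entry_def using eps_carr[OF z(2)] xD(3) by simp
qed

text \<open>The rule for matrix multiplication, with the coefficients of \<open>b\<close> read off
  by \<open>corner_block\<close>.\<close>

lemma entry_left:
  assumes z: "z \<in> Z" "s \<in> Z" and a: "a \<in> peirce z s" and b: "b \<in> corner z" and ij: "i \<in> {1..m z}" "j \<in> {1..m s}"
  shows "\<exists>d. (\<forall>k\<in>{1..m z}. d k \<in> carrier D) \<and> entry z i s j (b \<otimes> a) = (\<Oplus>k\<in>{1..m z}. \<phi> (d k) \<otimes> entry z k s j a)"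
proof -
  note aD = peirceD[OF a] and bD = cornerD[OF b]
  note o = one_index[OF z(1)]
  have bA: "b \<in> carrier A"
    using bD(1) by simp
  have c1: "eps z 1 i \<otimes> b \<in> N" "eps z 1 i \<otimes> b \<in> carrier A"
    using eps_nuc[OF z(1)] bD(1) by (auto simp: eps_carr[OF z(1)])
  have ea: "eps z p r \<otimes> a \<in> carrier A" for p r
    using eps_carr[OF z(1)] aD(1) by simp
  obtain d where d: "\<And>k. k \<in> {1..m z} \<Longrightarrow> d k \<in> carrier D \<and> (eps z 1 i \<otimes> b) \<otimes> eps z k 1 = \<phi> (d k) \<otimes> eps z 1 1"
    using corner_block[OF z(1) b ij(1)] by metis
  have "eps z 1 i \<otimes> (b \<otimes> a) = (eps z 1 i \<otimes> b) \<otimes> a"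
    using nuc1[OF eps_nuc[OF z(1)] bA aD(1)] by simp
  also have "\<dots> = (eps z 1 i \<otimes> b) \<otimes> (\<Oplus>k\<in>{1..m z}. eps z k 1 \<otimes> (eps z 1 k \<otimes> a))"
    using left_expand[OF z(1) aD(1,2)] by simp
  also have "\<dots> = (\<Oplus>k\<in>{1..m z}. (eps z 1 i \<otimes> b) \<otimes> (eps z k 1 \<otimes> (eps z 1 k \<otimes> a)))"
    using c1 ea eps_carr[OF z(1)] by (intro finsum_mult_r) auto
  also have "\<dots> = (\<Oplus>k\<in>{1..m z}. \<phi> (d k) \<otimes> (eps z 1 k \<otimes> a))"
  proof (intro M.finsum_cong' refl)
    fix k assume k: "k \<in> {1..m z}"
    have "(eps z 1 i \<otimes> b) \<otimes> (eps z k 1 \<otimes> (eps z 1 k \<otimes> a)) = ((eps z 1 i \<otimes> b) \<otimes> eps z k 1) \<otimes> (eps z 1 k \<otimes> a)"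
      using nuc1[OF c1(1) eps_carr[OF z(1)] ea] by simp
    also have "\<dots> = (\<phi> (d k) \<otimes> eps z 1 1) \<otimes> (eps z 1 k \<otimes> a)"
      using d[OF k] by simp
    also have "\<dots> = \<phi> (d k) \<otimes> (eps z 1 1 \<otimes> (eps z 1 k \<otimes> a))"
      using nuc1[OF phi_nuc eps_carr[OF z(1)] ea] d[OF k] by simp
    also have "eps z 1 1 \<otimes> (eps z 1 k \<otimes> a) = eps z 1 k \<otimes> a"
      using eps_l[OF z(1) o o o k aD(1)] by simp
    finally show "(eps z 1 i \<otimes> b) \<otimes> (eps z k 1 \<otimes> (eps z 1 k \<otimes> a)) = \<phi> (d k) \<otimes> (eps z 1 k \<otimes> a)" .
  next
    show "(\<lambda>k. \<phi> (d k) \<otimes> (eps z 1 k \<otimes> a)) \<in> {1..m z} \<rightarrow> carrier A"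
      using ea phi_nuc d by simp
  qed
  finally have "entry z i s j (b \<otimes> a) = (\<Oplus>k\<in>{1..m z}. \<phi> (d k) \<otimes> (eps z 1 k \<otimes> a)) \<otimes> eps s j 1"
    unfolding entry_def by simp
  also have "\<dots> = (\<Oplus>k\<in>{1..m z}. (\<phi> (d k) \<otimes> (eps z 1 k \<otimes> a)) \<otimes> eps s j 1)"
    using ea phi_nuc d eps_carr[OF z(2)] by (intro finsum_mult_l) auto
  also have "\<dots> = (\<Oplus>k\<in>{1..m z}. \<phi> (d k) \<otimes> entry z k s j a)"
  proof (intro M.finsum_cong' refl)
    fix k assume k: "k \<in> {1..m z}"
    show "(\<phi> (d k) \<otimes> (eps z 1 k \<otimes> a)) \<otimes> eps s j 1 = \<phi> (d k) \<otimes> entry z k s j a"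
      unfolding entry_def using nuc1[OF phi_nuc ea eps_carr[OF z(2)]] d[OF k] by simp
  next
    show "(\<lambda>k. \<phi> (d k) \<otimes> entry z k s j a) \<in> {1..m z} \<rightarrow> carrier A"
      using ea phi_nuc d eps_carr[OF z(2)] by (simp add: entry_def)
  qed
  finally show ?thesis
    using d by blast
qed

lemma entry_right:
  assumes z: "z \<in> Z" "s \<in> Z" and a: "a \<in> peirce z s" and b: "b \<in> corner s" and ij: "i \<in> {1..m z}" "j \<in> {1..m s}"
  shows "\<exists>d. (\<forall>k\<in>{1..m s}. d k \<in> carrier D) \<and> entry z i s j (a \<otimes> b) = (\<Oplus>k\<in>{1..m s}. entry z i s k a \<otimes> \<phi> (d k))"
proof -
  note aD = peirceD[OF a] and bD = cornerD[OF b]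
  note o = one_index[OF z(2)]
  have bA: "b \<in> carrier A"
    using bD(1) by simp
  have c1: "b \<otimes> eps s j 1 \<in> N" "b \<otimes> eps s j 1 \<in> carrier A"
    using eps_nuc[OF z(2)] bD(1) by (auto simp: eps_carr[OF z(2)])
  have ea: "a \<otimes> eps s p r \<in> carrier A" for p r
    using eps_carr[OF z(2)] aD(1) by simp
  have "\<exists>d\<in>carrier D. eps s 1 k \<otimes> (b \<otimes> eps s j 1) = eps s 1 1 \<otimes> \<phi> d" if k: "k \<in> {1..m s}" for k
    using corner_block[OF z(2) b k ij(2)] eps_assoc[OF z(2) z(2) bA] phi_eps(1)[OF z(2) o o] by simp
  then obtain d where d: "\<And>k. k \<in> {1..m s} \<Longrightarrow> d k \<in> carrier D \<and> eps s 1 k \<otimes> (b \<otimes> eps s j 1) = eps s 1 1 \<otimes> \<phi> (d k)"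
    by metis
  have "(a \<otimes> b) \<otimes> eps s j 1 = a \<otimes> (b \<otimes> eps s j 1)"
    using nuc3[OF eps_nuc[OF z(2)] aD(1) bA] by simp
  also have "\<dots> = (\<Oplus>k\<in>{1..m s}. (a \<otimes> eps s k 1) \<otimes> eps s 1 k) \<otimes> (b \<otimes> eps s j 1)"
    using right_expand[OF z(2) aD(1,3)] by simp
  also have "\<dots> = (\<Oplus>k\<in>{1..m s}. ((a \<otimes> eps s k 1) \<otimes> eps s 1 k) \<otimes> (b \<otimes> eps s j 1))"
    using c1 ea eps_carr[OF z(2)] by (intro finsum_mult_l) auto
  also have "\<dots> = (\<Oplus>k\<in>{1..m s}. (a \<otimes> eps s k 1) \<otimes> \<phi> (d k))"
  proof (intro M.finsum_cong' refl)
    fix k assume k: "k \<in> {1..m s}"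
    have "((a \<otimes> eps s k 1) \<otimes> eps s 1 k) \<otimes> (b \<otimes> eps s j 1) = (a \<otimes> eps s k 1) \<otimes> (eps s 1 k \<otimes> (b \<otimes> eps s j 1))"
      using nuc2[OF eps_nuc[OF z(2)] ea c1(2)] by simp
    also have "\<dots> = (a \<otimes> eps s k 1) \<otimes> (eps s 1 1 \<otimes> \<phi> (d k))"
      using d[OF k] by simp
    also have "\<dots> = ((a \<otimes> eps s k 1) \<otimes> eps s 1 1) \<otimes> \<phi> (d k)"
      using nuc2[OF eps_nuc[OF z(2)] ea nuc_carr[OF phi_nuc]] d[OF k] by simp
    also have "(a \<otimes> eps s k 1) \<otimes> eps s 1 1 = a \<otimes> eps s k 1"
      using eps_r[OF z(2) k o o o aD(1)] by simp
    finally show "((a \<otimes> eps s k 1) \<otimes> eps s 1 k) \<otimes> (b \<otimes> eps s j 1) = (a \<otimes> eps s k 1) \<otimes> \<phi> (d k)" .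
  next
    show "(\<lambda>k. (a \<otimes> eps s k 1) \<otimes> \<phi> (d k)) \<in> {1..m s} \<rightarrow> carrier A"
      using ea phi_nuc d by simp
  qed
  finally have "entry z i s j (a \<otimes> b) = eps z 1 i \<otimes> (\<Oplus>k\<in>{1..m s}. (a \<otimes> eps s k 1) \<otimes> \<phi> (d k))"
    unfolding entry_def eps_assoc[OF z mult_closed[OF aD(1) bA]] by simp
  also have "\<dots> = (\<Oplus>k\<in>{1..m s}. eps z 1 i \<otimes> ((a \<otimes> eps s k 1) \<otimes> \<phi> (d k)))"
    using ea phi_nuc d eps_carr[OF z(1)] by (intro finsum_mult_r) auto
  also have "\<dots> = (\<Oplus>k\<in>{1..m s}. entry z i s k a \<otimes> \<phi> (d k))"
  proof (intro M.finsum_cong' refl)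
    fix k assume k: "k \<in> {1..m s}"
    show "eps z 1 i \<otimes> ((a \<otimes> eps s k 1) \<otimes> \<phi> (d k)) = entry z i s k a \<otimes> \<phi> (d k)"
      unfolding entry_def eps_assoc[OF z aD(1)] using nuc1[OF eps_nuc[OF z(1)] ea nuc_carr[OF phi_nuc]] d[OF k] by simp
  next
    show "(\<lambda>k. entry z i s k a \<otimes> \<phi> (d k)) \<in> {1..m s} \<rightarrow> carrier A"
      using aD(1) phi_nuc d eps_carr[OF z(2)] eps_carr[OF z(1)] by (simp add: entry_def)
  qed
  finally show ?thesis
    using d by blast
qed

text \<open>The elements of \<open>z A s\<close> all of whose entries lie in \<open>M\<close> form a
  sub-bimodule. It contains \<open>M\<close>, so it is nonzero and by \<open>peirce_simple\<close>
  everything; the (1,1) entries of the block then show that \<open>M\<close> is the whole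
  block.\<close>

lemma block_simple:
  assumes z: "z \<in> Z" "s \<in> Z" and M: "subspace M" "M \<subseteq> block z s" "M \<noteq> {\<zero>}"
    and left: "\<And>d x. d \<in> carrier D \<Longrightarrow> x \<in> M \<Longrightarrow> \<phi> d \<otimes> x \<in> M"
    and right: "\<And>d x. d \<in> carrier D \<Longrightarrow> x \<in> M \<Longrightarrow> x \<otimes> \<phi> d \<in> M"
  shows "M = block z s"
proof -
  note o = one_index[OF z(1)] one_index[OF z(2)]
  define Q where "Q = {a \<in> peirce z s. \<forall>i\<in>{1..m z}. \<forall>j\<in>{1..m s}. entry z i s j a \<in> M}"
  note Ps = peirce_subspace[OF ZD(2)[OF z(1)] ZD(2)[OF z(2)]]
  note M0 = subspaceD(2)[OF M(1)]
  have QP: "a \<in> peirce z s" if "a \<in> Q" for a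
    using that by (simp add: Q_def)
  have Qent: "entry z i s j a \<in> M" if "a \<in> Q" "i \<in> {1..m z}" "j \<in> {1..m s}" for a i j
    using that by (simp add: Q_def)
  have QI: "a \<in> Q" if "a \<in> peirce z s" "\<And>i j. i \<in> {1..m z} \<Longrightarrow> j \<in> {1..m s} \<Longrightarrow> entry z i s j a \<in> M" for a
    using that by (simp add: Q_def)
  note ez = eps_carr[OF z(1)] and es = eps_carr[OF z(2)]
  have "subspace Q"
  proof (rule subspaceI)
    show "Q \<subseteq> carrier A"
      using QP peirceD(1) by blast
    show "\<zero> \<in> Q"
      using subspaceD(2)[OF Ps] M0 ez es by (intro QI) (simp_all add: entry_def)
    show "x \<oplus> y \<in> Q" if xy: "x \<in> Q" "y \<in> Q" for x y
    proof (rule QI)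
      note c = peirceD(1)[OF QP[OF xy(1)]] peirceD(1)[OF QP[OF xy(2)]]
      show "x \<oplus> y \<in> peirce z s"
        using subspaceD(4)[OF Ps] QP xy by simp
      fix i j assume ij: "i \<in> {1..m z}" "j \<in> {1..m s}"
      have "entry z i s j (x \<oplus> y) = entry z i s j x \<oplus> entry z i s j y"
        using c ez es by (simp add: entry_def mult_l_distr mult_r_distr)
      then show "entry z i s j (x \<oplus> y) \<in> M"
        using subspaceD(4)[OF M(1) Qent[OF xy(1) ij] Qent[OF xy(2) ij]] by simp
    qed
    show "c \<odot> x \<in> Q" if c: "c \<in> carrier F" and x: "x \<in> Q" for c x
    proof (rule QI)
      note xc = peirceD(1)[OF QP[OF x]]
      show "c \<odot> x \<in> peirce z s"
        using subspaceD(6)[OF Ps c] QP x by simp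
      fix i j assume ij: "i \<in> {1..m z}" "j \<in> {1..m s}"
      have "entry z i s j (c \<odot> x) = c \<odot> entry z i s j x"
        using xc c ez es by (simp add: entry_def smult_mult_l smult_mult_r)
      then show "entry z i s j (c \<odot> x) \<in> M"
        using subspaceD(6)[OF M(1) c Qent[OF x ij]] by simp
    qed
  qed
  moreover have MQ: "x \<in> Q" if x: "x \<in> M" for x
  proof (rule QI)
    have xb: "x \<in> block z s"
      using M(2) x by blast
    then show "x \<in> peirce z s"
      by (rule block_peirce[OF z])
    fix i j assume "i \<in> {1..m z}" "j \<in> {1..m s}"
    then show "entry z i s j x \<in> M"
      using entry_of_block[OF z xb] x M0 by simp
  qed
  then have "Q \<noteq> {\<zero>}"
    using M(3) M0 by blast
  ultimately have Q: "Q = peirce z s"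
  proof (intro peirce_simple[OF Z_atom[OF z(1)] Z_atom[OF z(2)]])
    show "Q \<subseteq> peirce z s"
      using QP by blast
    show "b \<otimes> a \<in> Q" if b: "b \<in> corner z" and a: "a \<in> Q" for b a
    proof (rule QI)
      note aD = peirceD[OF QP[OF a]] and bD = cornerD[OF b]
      have "b \<in> carrier A"
        using bD(1) by simp
      then show "b \<otimes> a \<in> peirce z s"
        using nuc1[OF bD(1) aD(1) ZD(2)[OF z(2)]] nuc1[OF ZD(1)[OF z(1)] nuc_carr[OF bD(1)] aD(1)] aD bD
        by (simp add: peirce_def)
      fix i j assume ij: "i \<in> {1..m z}" "j \<in> {1..m s}"
      obtain d where d: "\<forall>k\<in>{1..m z}. d k \<in> carrier D"
          "entry z i s j (b \<otimes> a) = (\<Oplus>k\<in>{1..m z}. \<phi> (d k) \<otimes> entry z k s j a)"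
        using entry_left[OF z QP[OF a] b ij] by blast
      show "entry z i s j (b \<otimes> a) \<in> M"
        unfolding d(2)
      proof (rule subspace_finsum[OF M(1)])
        fix k assume k: "k \<in> {1..m z}"
        show "\<phi> (d k) \<otimes> entry z k s j a \<in> M"
          using left[OF bspec[OF d(1) k] Qent[OF a k ij(2)]] .
      qed
    qed
    show "a \<otimes> b \<in> Q" if b: "b \<in> corner s" and a: "a \<in> Q" for b a
    proof (rule QI)
      note aD = peirceD[OF QP[OF a]] and bD = cornerD[OF b]
      have "b \<in> carrier A"
        using bD(1) by simp
      then show "a \<otimes> b \<in> peirce z s"
        using nuc3[OF bD(1) ZD(2)[OF z(1)] aD(1)] nuc3[OF ZD(1)[OF z(2)] aD(1) nuc_carr[OF bD(1)]] aD bD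
        by (simp add: peirce_def)
      fix i j assume ij: "i \<in> {1..m z}" "j \<in> {1..m s}"
      obtain d where d: "\<forall>k\<in>{1..m s}. d k \<in> carrier D"
          "entry z i s j (a \<otimes> b) = (\<Oplus>k\<in>{1..m s}. entry z i s k a \<otimes> \<phi> (d k))"
        using entry_right[OF z QP[OF a] b ij] by blast
      show "entry z i s j (a \<otimes> b) \<in> M"
        unfolding d(2)
      proof (rule subspace_finsum[OF M(1)])
        fix k assume k: "k \<in> {1..m s}"
        show "entry z i s k a \<otimes> \<phi> (d k) \<in> M"
          using right[OF bspec[OF d(1) k] Qent[OF a ij(1) k]] .
      qed
    qed
  qed
  have "x \<in> M" if x: "x \<in> block z s" for x
  proof -
    have "x \<in> Q"
      unfolding Q by (rule block_peirce[OF z x])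
    from Qent[OF this o] show ?thesis
      unfolding entry_of_block[OF z x o] by simp
  qed
  then show ?thesis
    using M(2) by blast
qed

lemma phi_eq:
  assumes d: "d \<in> carrier D" "e \<in> carrier D" "\<phi> d = \<phi> e"
  shows "d = e"
proof -
  have m: "d \<ominus>\<^bsub>D\<^esub> e \<in> carrier D"
    using d by simp
  have "(d \<ominus>\<^bsub>D\<^esub> e) \<oplus>\<^bsub>D\<^esub> e = d"
    using d by (simp add: D.M.minus_eq D.M.a_assoc D.M.l_neg)
  then have "\<phi> (d \<ominus>\<^bsub>D\<^esub> e) \<oplus> \<phi> e = \<zero> \<oplus> \<phi> e"
    using phi_add[OF m d(2)] d phi_nuc by simp
  then have "\<phi> (d \<ominus>\<^bsub>D\<^esub> e) = \<zero>"
    using m d phi_nuc M.add.r_cancel by simp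
  then show ?thesis
    using phi_inj[OF m] D.minus_eq_zero_iff d by simp
qed

lemma phi_inverse:
  assumes "d \<in> carrier D" "d \<noteq> \<zero>\<^bsub>D\<^esub>"
  obtains e where "e \<in> carrier D" "\<phi> e \<otimes> \<phi> d = \<one>"
proof -
  obtain e where e: "e \<in> carrier D" "e \<otimes>\<^bsub>D\<^esub> d = \<one>\<^bsub>D\<^esub>"
    using D_inverse assms by blast
  then show ?thesis
    using that[of e] phi_mult[OF e(1) assms(1)] phi_one by simp
qed

lemma phi_eps_l:
  "\<lbrakk>z \<in> Z; i \<in> {1..m z}; j \<in> {1..m z}; d \<in> carrier D; a \<in> carrier A\<rbrakk>
    \<Longrightarrow> \<phi> d \<otimes> (eps z i j \<otimes> a) = eps z i j \<otimes> (\<phi> d \<otimes> a)"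
  using nuc1[OF phi_nuc eps_carr, of d z a i j] nuc1[OF eps_nuc nuc_carr[OF phi_nuc], of z d a i j] phi_eps(1) by simp

lemma phi_eps_r:
  "\<lbrakk>z \<in> Z; i \<in> {1..m z}; j \<in> {1..m z}; d \<in> carrier D; a \<in> carrier A\<rbrakk>
    \<Longrightarrow> (a \<otimes> eps z i j) \<otimes> \<phi> d = (a \<otimes> \<phi> d) \<otimes> eps z i j"
  using nuc3[OF phi_nuc _ eps_carr, of d a z i j] nuc3[OF eps_nuc _ nuc_carr[OF phi_nuc], of z a d i j] phi_eps(1)[of z i j d] by simp

lemma phi_block:
  assumes z: "z \<in> Z" "s \<in> Z" and d: "d \<in> carrier D" and x: "x \<in> block z s"
  shows "\<phi> d \<otimes> x \<in> block z s" "x \<otimes> \<phi> d \<in> block z s"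
proof -
  note xD = peirceD[OF x[unfolded block_def]]
  note o = one_index[OF z(1)] one_index[OF z(2)]
  have dA: "\<phi> d \<in> carrier A"
    using phi_nuc[OF d] by simp
  show "\<phi> d \<otimes> x \<in> block z s"
    unfolding block_def peirce_def
    using phi_eps_l[OF z(1) o(1) o(1) d xD(1)] nuc1[OF phi_nuc[OF d] xD(1) eps_carr[OF z(2)], of 1 1] xD dA by simp
  show "x \<otimes> \<phi> d \<in> block z s"
    unfolding block_def peirce_def
    using phi_eps_r[OF z(2) o(2) o(2) d xD(1)] nuc3[OF phi_nuc[OF d] eps_carr[OF z(1)] xD(1), of 1 1] xD dA by simp
qed

lemma phi_image_subspace: "subspace (\<phi> ` carrier D)"
proof (rule subspaceI)
  show "\<phi> ` carrier D \<subseteq> carrier A"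
    using phi_nuc by auto
  have "\<zero> = \<phi> \<zero>\<^bsub>D\<^esub>"
    using phi_smult[OF R.zero_closed D.unit_closed] phi_nuc[OF D.unit_closed] D.unit_closed by simp
  then show "\<zero> \<in> \<phi> ` carrier D"
    by (rule image_eqI) simp
  fix x y assume "x \<in> \<phi> ` carrier D" "y \<in> \<phi> ` carrier D"
  then obtain d e where "d \<in> carrier D" "e \<in> carrier D" "x = \<phi> d" "y = \<phi> e"
    by blast
  then show "x \<oplus> y \<in> \<phi> ` carrier D"
    using phi_add[of d e] by (intro image_eqI[of _ _ "d \<oplus>\<^bsub>D\<^esub> e"]) auto
next
  fix c x assume c: "c \<in> carrier F" and "x \<in> \<phi> ` carrier D"
  then obtain d where "d \<in> carrier D" "x = \<phi> d"
    by blast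
  then show "c \<odot> x \<in> \<phi> ` carrier D"
    using c phi_smult[of c d] by (intro image_eqI[of _ _ "c \<odot>\<^bsub>D\<^esub> d"]) auto
qed

text \<open>\<open>\<phi>(D)\<close> is a central division algebra inside the nucleus, finite
  dimensional as a subspace of \<open>A\<close>, and the block is a nonzero bimodule over it;
  \<open>casimir\<close> applies.\<close>

lemma block_generator:
  assumes z: "z \<in> Z" "s \<in> Z"
  shows "\<exists>w\<in>block z s. w \<noteq> \<zero> \<and> (\<forall>d\<in>carrier D. \<phi> d \<otimes> w = w \<otimes> \<phi> d)"
proof -
  let ?E = "\<phi> ` carrier D"
  have div: "\<exists>v\<in>?E. v \<otimes> y = \<one>" if y: "y \<in> ?E" "y \<noteq> \<zero>" for y
  proof -
    obtain d where d: "d \<in> carrier D" "y = \<phi> d"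
      using y(1) by blast
    then have "d \<noteq> \<zero>\<^bsub>D\<^esub>"
      using y(2) phi_smult[OF R.zero_closed D.unit_closed] phi_nuc[OF D.unit_closed] D.unit_closed by auto
    then obtain e where "e \<in> carrier D" "\<phi> e \<otimes> \<phi> d = \<one>"
      using phi_inverse[OF d(1)] by blast
    then show ?thesis
      using d(2) by blast
  qed
  have cen: "\<exists>c\<in>carrier F. y = c \<odot> \<one>" if y: "y \<in> ?E" and comm: "\<And>x. x \<in> ?E \<Longrightarrow> y \<otimes> x = x \<otimes> y" for y
  proof -
    obtain d where d: "d \<in> carrier D" "y = \<phi> d"
      using y by blast
    have "d \<otimes>\<^bsub>D\<^esub> e = e \<otimes>\<^bsub>D\<^esub> d" if e: "e \<in> carrier D" for e
    proof (rule phi_eq)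
      show "\<phi> (d \<otimes>\<^bsub>D\<^esub> e) = \<phi> (e \<otimes>\<^bsub>D\<^esub> d)"
        using comm[of "\<phi> e"] phi_mult[OF d(1) e] phi_mult[OF e d(1)] e d(2) by simp
    qed (use d(1) e in \<open>simp_all add: D.mult_closed\<close>)
    then obtain c where "c \<in> carrier F" "d = c \<odot>\<^bsub>D\<^esub> \<one>\<^bsub>D\<^esub>"
      using D_center[OF d(1)] by blast
    then show ?thesis
      using d(2) phi_smult[OF _ D.unit_closed] phi_one by auto
  qed
  have mult: "x \<otimes> y \<in> ?E" if xy: "x \<in> ?E" "y \<in> ?E" for x y
  proof -
    obtain d e where de: "d \<in> carrier D" "e \<in> carrier D" "x = \<phi> d" "y = \<phi> e"
      using xy by blast
    then have "x \<otimes> y = \<phi> (d \<otimes>\<^bsub>D\<^esub> e)"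
      using phi_mult by simp
    then show ?thesis
      using D.mult_closed[OF de(1,2)] by blast
  qed
  have one: "\<one> \<in> ?E"
    using phi_one[symmetric] D.unit_closed by (rule image_eqI)
  have EN: "?E \<subseteq> N"
    using phi_nuc by blast
  have l: "b \<otimes> x \<in> block z s" if b: "b \<in> ?E" and x: "x \<in> block z s" for b x
  proof -
    obtain d where "d \<in> carrier D" "b = \<phi> d"
      using b by blast
    then show ?thesis
      using phi_block(1)[OF z _ x] by simp
  qed
  have r: "x \<otimes> b \<in> block z s" if b: "b \<in> ?E" and x: "x \<in> block z s" for b x
  proof -
    obtain d where "d \<in> carrier D" "b = \<phi> d"
      using b by blast
    then show ?thesis
      using phi_block(2)[OF z _ x] by simp
  qed
  show ?thesis
  proof (rule casimir[OF fd phi_image_subspace EN mult one div one_nonzero cen block_subspace[OF z] l r block_nonzero[OF z]])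
    fix w assume w: "w \<in> block z s" "w \<noteq> \<zero>" "\<And>y. y \<in> ?E \<Longrightarrow> y \<otimes> w = w \<otimes> y"
    have "\<forall>d\<in>carrier D. \<phi> d \<otimes> w = w \<otimes> \<phi> d"
      using w(3)[OF imageI] by (intro ballI)
    then show ?thesis
      using w(1,2) by blast
  qed
qed

text \<open>Because \<open>w\<close> commutes with \<open>\<phi>(D)\<close>, the subspace
  \<open>\<phi>(D) w\<close> is stable under multiplication by \<open>\<phi>(D)\<close> from both
  sides. It is nonzero and hence fills the simple block.\<close>

lemma block_span:
  assumes z: "z \<in> Z" "s \<in> Z" and w: "w \<in> block z s" "w \<noteq> \<zero>"
    and comm: "\<And>d. d \<in> carrier D \<Longrightarrow> \<phi> d \<otimes> w = w \<otimes> \<phi> d" and x: "x \<in> block z s"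
  shows "\<exists>d\<in>carrier D. x = \<phi> d \<otimes> w"
proof -
  define M where "M = (\<lambda>y. y \<otimes> w) ` (\<phi> ` carrier D)"
  note wA = block_carr[OF w(1)]
  note Es = phi_image_subspace
  have EA: "y \<in> carrier A" if "y \<in> \<phi> ` carrier D" for y
    using subspaceD(7)[OF Es that] .
  have MI: "\<phi> d \<otimes> w \<in> M" if "d \<in> carrier D" for d
    using that unfolding M_def by blast
  have ME: "\<exists>d\<in>carrier D. x = \<phi> d \<otimes> w" if "x \<in> M" for x
    using that unfolding M_def by blast
  have "M = block z s"
  proof (rule block_simple[OF z])
    show "subspace M"
    proof (rule subspaceI)
      show "M \<subseteq> carrier A"
        using wA EA unfolding M_def by auto
      have "\<zero> = \<zero> \<otimes> w"
        using wA by simp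
      then show "\<zero> \<in> M"
        unfolding M_def using subspaceD(2)[OF Es] by (rule image_eqI)
      fix x y assume "x \<in> M" "y \<in> M"
      then obtain a b where ab: "a \<in> \<phi> ` carrier D" "b \<in> \<phi> ` carrier D" "x = a \<otimes> w" "y = b \<otimes> w"
        unfolding M_def by blast
      then have "x \<oplus> y = (a \<oplus> b) \<otimes> w"
        using EA wA by (simp add: mult_l_distr)
      then show "x \<oplus> y \<in> M"
        unfolding M_def using subspaceD(4)[OF Es ab(1,2)] by (rule image_eqI)
    next
      fix c x assume c: "c \<in> carrier F" and "x \<in> M"
      then obtain a where a: "a \<in> \<phi> ` carrier D" "x = a \<otimes> w"
        unfolding M_def by blast
      then have "c \<odot> x = (c \<odot> a) \<otimes> w"
        using EA wA c by (simp add: smult_mult_l)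
      then show "c \<odot> x \<in> M"
        unfolding M_def using subspaceD(6)[OF Es c a(1)] by (rule image_eqI)
    qed
    show "M \<subseteq> block z s"
    proof
      fix x assume "x \<in> M"
      then obtain d where "d \<in> carrier D" "x = \<phi> d \<otimes> w"
        using ME by blast
      then show "x \<in> block z s"
        using phi_block(1)[OF z _ w(1)] by simp
    qed
    show "M \<noteq> {\<zero>}"
      using MI[OF D.unit_closed] phi_one wA w(2) by auto
    fix d x assume d: "d \<in> carrier D" and "x \<in> M"
    then obtain e where e: "e \<in> carrier D" "x = \<phi> e \<otimes> w"
      using ME by blast
    note c = phi_nuc[OF d] phi_nuc[OF e(1)]
    have "\<phi> d \<otimes> x = \<phi> (d \<otimes>\<^bsub>D\<^esub> e) \<otimes> w"
      using nuc1[OF c(1) nuc_carr[OF c(2)] wA] e(2) phi_mult[OF d e(1)] by simp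
    then show "\<phi> d \<otimes> x \<in> M"
      using MI[OF D.mult_closed[OF d e(1)]] by simp
    have "x \<otimes> \<phi> d = \<phi> (e \<otimes>\<^bsub>D\<^esub> d) \<otimes> w"
      using nuc1[OF c(2) nuc_carr[OF c(1)] wA] nuc1[OF c(2) wA nuc_carr[OF c(1)]] e(2) phi_mult[OF e(1) d] comm[OF d]
      by simp
    then show "x \<otimes> \<phi> d \<in> M"
      using MI[OF D.mult_closed[OF e(1) d]] by simp
  qed
  then show ?thesis
    using ME x by blast
qed

text \<open>On the diagonal the generator is the matrix unit itself and not an arbitrary commuting
  element, so that the diagonal \<open>U p p\<close> are idempotents with sum
  \<open>\<one>\<close>.\<close>

definition gen :: "'a \<Rightarrow> 'a \<Rightarrow> 'a" where
  "gen z s = (if z = s then eps z 1 1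
     else SOME w. w \<in> block z s \<and> w \<noteq> \<zero> \<and> (\<forall>d\<in>carrier D. \<phi> d \<otimes> w = w \<otimes> \<phi> d))"

lemma gen:
  assumes z: "z \<in> Z" "s \<in> Z"
  shows "gen z s \<in> block z s" "gen z s \<noteq> \<zero>" "\<And>d. d \<in> carrier D \<Longrightarrow> \<phi> d \<otimes> gen z s = gen z s \<otimes> \<phi> d"
proof -
  note o = one_index[OF z(1)]
  have "gen z s \<in> block z s \<and> gen z s \<noteq> \<zero> \<and> (\<forall>d\<in>carrier D. \<phi> d \<otimes> gen z s = gen z s \<otimes> \<phi> d)"
  proof (cases "z = s")
    case True
    have b: "eps z 1 1 \<in> block z z"
      unfolding block_def peirce_def using eps_carr[OF z(1)] eps_idem[OF z(1) o] by simp
    have "eps z 1 1 \<noteq> \<zero>"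
    proof
      assume e: "eps z 1 1 = \<zero>"
      have "block z z \<subseteq> {\<zero>}"
      proof
        fix x assume x: "x \<in> block z z"
        from peirceD(1,2)[OF x[unfolded block_def]] show "x \<in> {\<zero>}"
          unfolding e by simp
      qed
      moreover have "{\<zero>} \<subseteq> block z z"
        using b unfolding e by simp
      ultimately show False
        using block_nonzero[OF z(1) z(1)] by simp
    qed
    moreover have "\<phi> d \<otimes> eps z 1 1 = eps z 1 1 \<otimes> \<phi> d" if "d \<in> carrier D" for d
      using phi_eps(1)[OF z(1) o o that] .
    ultimately show ?thesis
      using True b unfolding gen_def by simp
  next
    case False
    have "\<exists>w. w \<in> block z s \<and> w \<noteq> \<zero> \<and> (\<forall>d\<in>carrier D. \<phi> d \<otimes> w = w \<otimes> \<phi> d)"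
      using block_generator[OF z] by blast
    from someI_ex[OF this] show ?thesis
      using False by (simp add: gen_def)
  qed
  then show "gen z s \<in> block z s" "gen z s \<noteq> \<zero>" "\<And>d. d \<in> carrier D \<Longrightarrow> \<phi> d \<otimes> gen z s = gen z s \<otimes> \<phi> d"
    by blast+
qed

lemma gen_carr: "z \<in> Z \<Longrightarrow> s \<in> Z \<Longrightarrow> gen z s \<in> carrier A"
  using gen(1) block_carr by blast

text \<open>The generator of the block, moved from the reference position (1,1) to row
  \<open>snd p\<close> and column \<open>snd r\<close>.\<close>

definition U :: "'a \<times> nat \<Rightarrow> 'a \<times> nat \<Rightarrow> 'a" where
  "U p r = (eps (fst p) (snd p) 1 \<otimes> gen (fst p) (fst r)) \<otimes> eps (fst r) 1 (snd r)"

definition Ix :: "('a \<times> nat) set" where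
  "Ix = (SIGMA z:Z. {1..m z})"

lemma Ix: "p \<in> Ix \<Longrightarrow> fst p \<in> Z" "p \<in> Ix \<Longrightarrow> snd p \<in> {1..m (fst p)}"
  by (auto simp: Ix_def)

abbreviation E :: "'a \<times> nat \<Rightarrow> 'a" where
  "E p \<equiv> eps (fst p) (snd p) (snd p)"

lemma U_carr: "p \<in> Ix \<Longrightarrow> r \<in> Ix \<Longrightarrow> U p r \<in> carrier A"
  unfolding U_def by (intro mult_closed eps_carr gen_carr Ix(1))

lemma U_diag: "p \<in> Ix \<Longrightarrow> U p p = E p"
proof -
  assume p: "p \<in> Ix"
  note z = Ix(1)[OF p] and i = Ix(2)[OF p]
  note o = one_index[OF z]
  have "gen (fst p) (fst p) = eps (fst p) 1 1"
    by (simp add: gen_def)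
  then show ?thesis
    unfolding U_def using eps_mult[OF z i o o o] eps_mult[OF z i o o i] by simp
qed

lemma U_peirce:
  assumes p: "p \<in> Ix" and r: "r \<in> Ix"
  shows "E p \<otimes> U p r = U p r" "U p r \<otimes> E r = U p r"
proof -
  note z = Ix(1)[OF p] Ix(1)[OF r] and i = Ix(2)[OF p] Ix(2)[OF r]
  note o = one_index[OF z(1)] one_index[OF z(2)]
  note g = gen_carr[OF z]
  have c: "eps (fst p) (snd p) 1 \<otimes> gen (fst p) (fst r) \<in> carrier A" "gen (fst p) (fst r) \<otimes> eps (fst r) 1 (snd r) \<in> carrier A"
    using g eps_carr z by auto
  show "E p \<otimes> U p r = U p r"
    unfolding U_def eps_assoc[OF z g] using eps_l[OF z(1) i(1) i(1) i(1) o(1) c(2)] by simp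
  show "U p r \<otimes> E r = U p r"
    unfolding U_def using eps_r[OF z(2) o(2) i(2) i(2) i(2) c(1)] by simp
qed

lemma U_orth:
  assumes p: "p \<in> Ix" and r: "r \<in> Ix" and ne: "p \<noteq> r"
  shows "E p \<otimes> E r = \<zero>"
proof -
  note z = Ix(1)[OF p] Ix(1)[OF r] and i = Ix(2)[OF p] Ix(2)[OF r]
  show ?thesis
  proof (cases "fst p = fst r")
    case True
    then have "snd p \<noteq> snd r"
      using ne by (simp add: prod_eq_iff)
    then show ?thesis
      using eps_mult[OF z(1) i(1) i(1), of "snd r" "snd r"] i(2) True by simp
  next
    case False
    have "E p \<otimes> E r = (E p \<otimes> fst p) \<otimes> (fst r \<otimes> E r)"
      using z_eps z by simp
    also have "\<dots> = E p \<otimes> ((fst p \<otimes> fst r) \<otimes> E r)"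
      using nuc2[OF ZD(1)[OF z(1)] eps_carr[OF z(1)], of "fst r \<otimes> E r" "snd p" "snd p"]
        nuc1[OF ZD(1)[OF z(1)] ZD(2)[OF z(2)] eps_carr[OF z(2)]] ZD(2)[OF z(2)] eps_carr[OF z(2)]
      by simp
    also have "\<dots> = \<zero>"
      using Z_orth[OF z False] eps_carr z by simp
    finally show ?thesis .
  qed
qed

text \<open>\<open>\<phi> d\<close> commutes with the matrix units and with the generator. In the
  second form it stands next to the generator, where \<open>block_span\<close> can be read
  back.\<close>

lemma phi_U:
  assumes d: "d \<in> carrier D" and p: "p \<in> Ix" and r: "r \<in> Ix"
  shows "\<phi> d \<otimes> U p r = U p r \<otimes> \<phi> d" "\<phi> d \<otimes> U p r = eps (fst p) (snd p) 1 \<otimes> ((\<phi> d \<otimes> gen (fst p) (fst r)) \<otimes> eps (fst r) 1 (snd r))"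
proof -
  note z = Ix(1)[OF p] Ix(1)[OF r] and i = Ix(2)[OF p] Ix(2)[OF r]
  note o = one_index[OF z(1)] one_index[OF z(2)]
  note g = gen_carr[OF z] and e = phi_nuc[OF d] nuc_carr[OF phi_nuc[OF d]]
  have c: "eps (fst p) (snd p) 1 \<otimes> gen (fst p) (fst r) \<in> carrier A" "gen (fst p) (fst r) \<otimes> eps (fst r) 1 (snd r) \<in> carrier A"
    using g eps_carr z by auto
  have "\<phi> d \<otimes> U p r = eps (fst p) (snd p) 1 \<otimes> (\<phi> d \<otimes> (gen (fst p) (fst r) \<otimes> eps (fst r) 1 (snd r)))"
    unfolding U_def eps_assoc[OF z g] by (rule phi_eps_l[OF z(1) i(1) o(1) d c(2)])
  also have "\<phi> d \<otimes> (gen (fst p) (fst r) \<otimes> eps (fst r) 1 (snd r)) = (\<phi> d \<otimes> gen (fst p) (fst r)) \<otimes> eps (fst r) 1 (snd r)"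
    using nuc1[OF e(1) g eps_carr[OF z(2)]] by simp
  finally show 1: "\<phi> d \<otimes> U p r = eps (fst p) (snd p) 1 \<otimes> ((\<phi> d \<otimes> gen (fst p) (fst r)) \<otimes> eps (fst r) 1 (snd r))" .
  have "U p r \<otimes> \<phi> d = ((eps (fst p) (snd p) 1 \<otimes> gen (fst p) (fst r)) \<otimes> \<phi> d) \<otimes> eps (fst r) 1 (snd r)"
    unfolding U_def by (rule phi_eps_r[OF z(2) o(2) i(2) d c(1)])
  also have "(eps (fst p) (snd p) 1 \<otimes> gen (fst p) (fst r)) \<otimes> \<phi> d = eps (fst p) (snd p) 1 \<otimes> (\<phi> d \<otimes> gen (fst p) (fst r))"
    using nuc1[OF eps_nuc[OF z(1)] g e(2)] gen(3)[OF z d] by simp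
  also have "(eps (fst p) (snd p) 1 \<otimes> (\<phi> d \<otimes> gen (fst p) (fst r))) \<otimes> eps (fst r) 1 (snd r) = \<phi> d \<otimes> U p r"
    unfolding 1 using e g by (intro eps_assoc[OF z] mult_closed)
  finally show "\<phi> d \<otimes> U p r = U p r \<otimes> \<phi> d"
    by simp
qed

text \<open>Multiplying by the opposite matrix units on both sides moves \<open>U p r\<close> back
  to the generator.\<close>

lemma U_nonzero:
  assumes p: "p \<in> Ix" and r: "r \<in> Ix"
  shows "U p r \<noteq> \<zero>"
proof
  assume U: "U p r = \<zero>"
  note z = Ix(1)[OF p] Ix(1)[OF r] and i = Ix(2)[OF p] Ix(2)[OF r]
  note o = one_index[OF z(1)] one_index[OF z(2)]
  note g = gen_carr[OF z]
  note gD = peirceD[OF gen(1)[OF z, unfolded block_def]]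
  have c: "eps (fst p) (snd p) 1 \<otimes> gen (fst p) (fst r) \<in> carrier A" "gen (fst p) (fst r) \<otimes> eps (fst r) 1 (snd r) \<in> carrier A"
    using g eps_carr z by auto
  have "gen (fst p) (fst r) \<otimes> eps (fst r) 1 (snd r) = eps (fst p) 1 1 \<otimes> (gen (fst p) (fst r) \<otimes> eps (fst r) 1 (snd r))"
    using eps_assoc[OF z g, of 1 1 1 "snd r"] gD by simp
  also have "\<dots> = eps (fst p) 1 (snd p) \<otimes> U p r"
    unfolding U_def eps_assoc[OF z g] using eps_l[OF z(1) o(1) i(1) i(1) o(1) c(2)] by simp
  also have "\<dots> = \<zero>"
    using U eps_carr[OF z(1)] by simp
  finally have "(gen (fst p) (fst r) \<otimes> eps (fst r) 1 (snd r)) \<otimes> eps (fst r) (snd r) 1 = \<zero>"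
    using eps_carr[OF z(2)] by simp
  then show False
    using eps_r[OF z(2) o(2) i(2) i(2) o(2) g] gD(3) gen(2)[OF z] by simp
qed

lemma U_inj:
  assumes d: "d \<in> carrier D" and p: "p \<in> Ix" and r: "r \<in> Ix" and 0: "\<phi> d \<otimes> U p r = \<zero>"
  shows "d = \<zero>\<^bsub>D\<^esub>"
proof (rule ccontr)
  assume "d \<noteq> \<zero>\<^bsub>D\<^esub>"
  then obtain e where e: "e \<in> carrier D" "\<phi> e \<otimes> \<phi> d = \<one>"
    using phi_inverse[OF d] by blast
  have "U p r = (\<phi> e \<otimes> \<phi> d) \<otimes> U p r"
    using e U_carr[OF p r] by simp
  also have "\<dots> = \<phi> e \<otimes> (\<phi> d \<otimes> U p r)"
    using nuc1[OF phi_nuc[OF e(1)] nuc_carr[OF phi_nuc[OF d]] U_carr[OF p r]] .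
  also have "\<dots> = \<zero>"
    using 0 phi_nuc[OF e(1)] by simp
  finally show False
    using U_nonzero[OF p r] by simp
qed

text \<open>At the reference position \<open>x\<close> becomes \<open>\<phi> d\<close> times the
  generator; moving back gives the same multiple of \<open>U p r\<close>.\<close>

lemma U_span:
  assumes p: "p \<in> Ix" and r: "r \<in> Ix" and x: "x \<in> peirce (E p) (E r)"
  shows "\<exists>d\<in>carrier D. x = \<phi> d \<otimes> U p r"
proof -
  note z = Ix(1)[OF p] Ix(1)[OF r] and i = Ix(2)[OF p] Ix(2)[OF r]
  note o = one_index[OF z(1)] one_index[OF z(2)]
  note xD = peirceD[OF x]
  have "entry (fst p) (snd p) (fst r) (snd r) x \<in> block (fst p) (fst r)"
    by (rule entry_block[OF z i xD(1)])
  then obtain d where d: "d \<in> carrier D" "entry (fst p) (snd p) (fst r) (snd r) x = \<phi> d \<otimes> gen (fst p) (fst r)"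
    using block_span[OF z gen[OF z]] by blast
  have c: "eps (fst p) 1 (snd p) \<otimes> x \<in> carrier A"
    using eps_carr[OF z(1)] xD(1) by simp
  have "entry (fst p) (snd p) (fst r) (snd r) x \<otimes> eps (fst r) 1 (snd r) = (eps (fst p) 1 (snd p) \<otimes> x) \<otimes> E r"
    unfolding entry_def using eps_r[OF z(2) i(2) o(2) o(2) i(2) c] by simp
  also have "\<dots> = eps (fst p) 1 (snd p) \<otimes> x"
    using eps_assoc[OF z xD(1)] xD(3) by simp
  finally have "\<phi> d \<otimes> U p r = eps (fst p) (snd p) 1 \<otimes> (eps (fst p) 1 (snd p) \<otimes> x)"
    unfolding phi_U(2)[OF d(1) p r] d(2) by simp
  also have "\<dots> = x"
    using eps_l[OF z(1) i(1) o(1) o(1) i(1) xD(1)] xD(2) by simp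
  finally show ?thesis
    using d(1) by (intro bexI) simp_all
qed

lemma U_sum: "(\<Oplus>p\<in>Ix. E p) = \<one>"
proof -
  have Ix': "Ix = (\<Union>z\<in>Z. Pair z ` {1..m z})"
    by (auto simp: Ix_def)
  have "(\<Oplus>p\<in>Ix. E p) = (\<Oplus>z\<in>Z. \<Oplus>p\<in>Pair z ` {1..m z}. E p)"
    unfolding Ix'
  proof (rule M.add.finprod_UN_disjoint)
    show "finite Z"
      by (rule Z_fin)
    show "E p \<in> carrier A" if "z \<in> Z" "p \<in> Pair z ` {1..m z}" for z p
      using that eps_carr by auto
  qed (auto simp: pairwise_def disjnt_def)
  also have "\<dots> = (\<Oplus>z\<in>Z. z)"
  proof (intro M.finsum_cong' refl)
    fix z assume z: "z \<in> Z"
    have "E \<in> Pair z ` {1..m z} \<rightarrow> carrier A"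
      by (rule funcsetI) (use eps_carr[OF z] in auto)
    then have "(\<Oplus>p\<in>Pair z ` {1..m z}. E p) = (\<Oplus>i\<in>{1..m z}. eps z i i)"
      using M.finsum_reindex[of E "Pair z" "{1..m z}"] by (simp add: inj_on_def)
    then show "(\<Oplus>p\<in>Pair z ` {1..m z}. E p) = z"
      using eps_sum[OF z] by simp
  qed (use ZD in auto)
  finally show ?thesis
    using Z_sum by simp
qed

text \<open>The pairs of an atom and a row are enumerated from 1 to \<open>n\<close>, so
  \<open>n\<close> is the sum of the matrix sizes. There is at least one pair since
  \<open>\<one> \<noteq> \<zero>\<close>.\<close>

lemma frame:
  obtains n u where "n \<ge> 1" "skew_frame A F D n u \<phi>"
proof -
  have fin: "finite Ix"
    unfolding Ix_def using Z_fin by blast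
  have "Ix \<noteq> {}"
    using U_sum one_nonzero by auto
  then have n: "card Ix \<ge> 1"
    using fin by (simp add: Suc_le_eq card_gt_0_iff)
  obtain b where b: "bij_betw b {1..card Ix} Ix"
    using ex_bij_betw_nat_finite_1[OF fin] by blast
  have bI: "b i \<in> Ix" if "i \<in> {1..card Ix}" for i
    using b that bij_betwE by blast
  have "skew_frame A F D (card Ix) (\<lambda>i j. U (b i) (b j)) \<phi>"
  proof (intro skew_frame.intro skew_frame_axioms.intro)
    show "alg A F" "alg D F"
      by unfold_locales
    show "(\<Oplus>i\<in>{1..card Ix}. U (b i) (b i)) = \<one>"
    proof -
      have "(\<Oplus>i\<in>{1..card Ix}. U (b i) (b i)) = (\<Oplus>i\<in>{1..card Ix}. E (b i))"
        using bI U_diag eps_carr Ix(1) by (intro M.finsum_cong' refl) auto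
      also have "\<dots> = (\<Oplus>p\<in>b ` {1..card Ix}. E p)"
        using b eps_carr bI Ix(1) by (intro M.finsum_reindex[symmetric]) (auto simp: bij_betw_def)
      also have "\<dots> = \<one>"
        using b U_sum by (simp add: bij_betw_def)
      finally show ?thesis .
    qed
    show "U (b i) (b i) \<otimes> U (b j) (b j) = \<zero>" if ij: "i \<in> {1..card Ix}" "j \<in> {1..card Ix}" "i \<noteq> j" for i j
    proof -
      have "b i \<noteq> b j"
        using inj_onD[OF bij_betw_imp_inj_on[OF b] _ ij(1,2)] ij(3) by blast
      then show ?thesis
        unfolding U_diag[OF bI[OF ij(1)]] U_diag[OF bI[OF ij(2)]] by (rule U_orth[OF bI[OF ij(1)] bI[OF ij(2)]])
    qed
    show "d = \<zero>\<^bsub>D\<^esub>" if "d \<in> carrier D" "i \<in> {1..card Ix}" "j \<in> {1..card Ix}" "\<phi> d \<otimes> U (b i) (b j) = \<zero>" for d i j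
      using U_inj[OF that(1) bI[OF that(2)] bI[OF that(3)] that(4)] .
    show "\<exists>d\<in>carrier D. x = \<phi> d \<otimes> U (b i) (b j)"
      if "i \<in> {1..card Ix}" "j \<in> {1..card Ix}" "x \<in> peirce (U (b i) (b i)) (U (b j) (b j))" for x i j
      using U_span[OF bI[OF that(1)] bI[OF that(2)]] that(3)
      unfolding U_diag[OF bI[OF that(1)]] U_diag[OF bI[OF that(2)]] by blast
    show "\<exists>c\<in>carrier F. d = c \<odot>\<^bsub>D\<^esub> \<one>\<^bsub>D\<^esub>"
      if "d \<in> carrier D" "\<And>e. e \<in> carrier D \<Longrightarrow> d \<otimes>\<^bsub>D\<^esub> e = e \<otimes>\<^bsub>D\<^esub> d" for d
      using D_center[OF that] .
    show "U (b i) (b i) \<in> N" if "i \<in> {1..card Ix}" for i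
      unfolding U_diag[OF bI[OF that]] by (rule eps_nuc[OF Ix(1)[OF bI[OF that]]])
    show "\<phi> d \<otimes> U (b i) (b j) = U (b i) (b j) \<otimes> \<phi> d"
      if "d \<in> carrier D" "i \<in> {1..card Ix}" "j \<in> {1..card Ix}" for d i j
      using phi_U(1)[OF that(1) bI[OF that(2)] bI[OF that(3)]] .
    show "U (b i) (b j) \<in> carrier A" "U (b i) (b i) \<otimes> U (b i) (b j) = U (b i) (b j)"
      "U (b i) (b j) \<otimes> U (b j) (b j) = U (b i) (b j)" if ij: "i \<in> {1..card Ix}" "j \<in> {1..card Ix}" for i j
      unfolding U_diag[OF bI[OF ij(1)]] U_diag[OF bI[OF ij(2)]]
      by (rule U_carr[OF bI[OF ij(1)] bI[OF ij(2)]] U_peirce[OF bI[OF ij(1)] bI[OF ij(2)]])+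
  qed (fact phi_nuc phi_add phi_mult phi_smult phi_one)+
  then show ?thesis
    using that n by blast
qed

end

theorem proposition18p2:
  fixes F :: "('f, 'x) ring_scheme"
    and A :: "('f, 'a) module"
    and D :: "('f, 'd) module"
  assumes "field F"
    and "semiassociative F A"
    and "homogeneous F A"
    and "common_division_algebra F A D"
  shows "\<exists>n c. n \<ge> 1 \<and> reduced_skew_set F n c \<and>
    alg_isomorphic F A (tensor_alg F D (skew_mat_alg F n c))"
proof -
  obtain K where K: "subalg F A K" "K \<subseteq> nucleus A" "etale F (A\<lparr>carrier := K\<rparr>)"
      "minimally_faithful (tensor_alg F (A\<lparr>carrier := K\<rparr>) (A\<lparr>carrier := K\<rparr>)) (bimod F A)"
    using assms(2) unfolding semiassociative_def by blast
  interpret homog A F K D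
  proof (intro homog.intro homog_axioms.intro semiassoc.intro semiassoc_axioms.intro alg.intro)
    show "unital_algebra F A" "fin_dim F A" "central F A"
      using assms(2) by (simp_all add: semiassociative_def)
  qed (fact assms K)+
  note one_J = subspaceD(2)[OF J_subspace]
  \<comment> \<open>The decomposition is applied to the idempotent \<open>\<one>\<close>, which is
    central on the nose.\<close>
  have "\<exists>Z. finite Z \<and> (\<forall>z\<in>Z. (\<exists>P. atom_idem z P) \<and> \<one>\<^bsub>A\<^esub> \<otimes>\<^bsub>A\<^esub> z = z) \<and>
      (\<forall>y\<in>Z. \<forall>z\<in>Z. y \<noteq> z \<longrightarrow> y \<otimes>\<^bsub>A\<^esub> z = \<zero>\<^bsub>A\<^esub>) \<and> (\<Oplus>\<^bsub>A\<^esub>z\<in>Z. z) = \<one>\<^bsub>A\<^esub>"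
    by (rule idempotent_decomposition) (use one_J in \<open>simp_all add: M.minus_eq M.r_neg\<close>)
  then obtain Z P where Z: "finite Z" "\<And>z. z \<in> Z \<Longrightarrow> atom_idem z (P z)"
      "\<And>y z. y \<in> Z \<Longrightarrow> z \<in> Z \<Longrightarrow> y \<noteq> z \<Longrightarrow> y \<otimes>\<^bsub>A\<^esub> z = \<zero>\<^bsub>A\<^esub>" "(\<Oplus>\<^bsub>A\<^esub>z\<in>Z. z) = \<one>\<^bsub>A\<^esub>"
    by metis
  \<comment> \<open>Collected in one predicate, so that the matrix sizes and the maps can be chosen
    for all \<open>z\<close> simultaneously.\<close>
  define Q where "Q = (\<lambda>z m \<theta>. m \<ge> 1 \<and> (\<forall>x\<in>carrier (mat_alg m D). \<theta> x \<in> corner z) \<and>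
      (\<forall>x\<in>carrier (mat_alg m D). \<forall>y\<in>carrier (mat_alg m D). \<theta> (x \<oplus>\<^bsub>mat_alg m D\<^esub> y) = \<theta> x \<oplus>\<^bsub>A\<^esub> \<theta> y) \<and>
      (\<forall>x\<in>carrier (mat_alg m D). \<forall>y\<in>carrier (mat_alg m D). \<theta> (x \<otimes>\<^bsub>mat_alg m D\<^esub> y) = \<theta> x \<otimes>\<^bsub>A\<^esub> \<theta> y) \<and>
      (\<forall>c\<in>carrier F. \<forall>x\<in>carrier (mat_alg m D). \<theta> (c \<odot>\<^bsub>mat_alg m D\<^esub> x) = c \<odot>\<^bsub>A\<^esub> \<theta> x) \<and>
      \<theta> \<one>\<^bsub>mat_alg m D\<^esub> = z \<and> (\<forall>b\<in>corner z. \<exists>x\<in>carrier (mat_alg m D). \<theta> x = b))"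
  have "\<exists>m \<theta>. Q z m \<theta>" if z: "z \<in> Z" for z
  proof (rule atom_matrix[OF Z(2)[OF z]])
    fix m \<theta> assume h: "m \<ge> 1" "\<And>x. x \<in> carrier (mat_alg m D) \<Longrightarrow> \<theta> x \<in> corner z"
      "\<And>x y. x \<in> carrier (mat_alg m D) \<Longrightarrow> y \<in> carrier (mat_alg m D) \<Longrightarrow> \<theta> (x \<oplus>\<^bsub>mat_alg m D\<^esub> y) = \<theta> x \<oplus>\<^bsub>A\<^esub> \<theta> y"
      "\<And>x y. x \<in> carrier (mat_alg m D) \<Longrightarrow> y \<in> carrier (mat_alg m D) \<Longrightarrow> \<theta> (x \<otimes>\<^bsub>mat_alg m D\<^esub> y) = \<theta> x \<otimes>\<^bsub>A\<^esub> \<theta> y"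
      "\<And>c x. c \<in> carrier F \<Longrightarrow> x \<in> carrier (mat_alg m D) \<Longrightarrow> \<theta> (c \<odot>\<^bsub>mat_alg m D\<^esub> x) = c \<odot>\<^bsub>A\<^esub> \<theta> x"
      "\<theta> \<one>\<^bsub>mat_alg m D\<^esub> = z" "\<And>b. b \<in> corner z \<Longrightarrow> \<exists>x\<in>carrier (mat_alg m D). \<theta> x = b"
    show ?thesis
      unfolding Q_def by (intro exI[of _ m] exI[of _ \<theta>] conjI ballI h)
  qed
  then obtain m where "\<forall>z\<in>Z. \<exists>\<theta>. Q z (m z) \<theta>"
    using bchoice[of Z "\<lambda>z m. \<exists>\<theta>. Q z m \<theta>"] by blast
  then obtain \<theta> where "\<forall>z\<in>Z. Q z (m z) (\<theta> z)"
    using bchoice[of Z "\<lambda>z. Q z (m z)"] by blast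
  note mt = this[unfolded Q_def, rule_format]
  interpret matrix_frame A F K D Z P m \<theta>
    by unfold_locales (use Z mt in \<open>blast+\<close>)
  obtain n u where n: "n \<ge> 1" and "skew_frame A F D n u \<phi>"
    by (rule frame)
  then interpret sf: skew_frame A F D n u \<phi>
    by simp
  show ?thesis
    using n sf.c_reduced sf.isomorphism by blast
qed

end
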